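(* Let $0<p\le1$ and $\omega,\nu\in\mathcal{D}$. Then there exists $N=N(\omega,\nu,p)\in\mathbb{N}$ (depending only on $\omega,\nu,p$) such that the following holds for every $f\in A^1_{\nu_{\log}}$. The small Hankel operator $h^\nu_f:A^p_\omega\to A^1_\nu$ is bounded if and only if $$\sup_{z\in\mathbb{D}}\left|f^{(n)}(z)\right|(1-|z|)^n\frac{\widehat{\nu}(z)(1-|z|)}{\left(\widehat{\omega}(z)(1-|z|)\right)^{\frac1p}}\log\frac{e}{1-|z|}<\infty$$ for some (equivalently for all) $n\ge N$. Moreover, $$\|h^\nu_f\|_{A^p_\omega\to A^1_\nu}\asymp\sup_{z\in\mathbb{D}}\left|f^{(n)}(z)\right|(1-|z|)^n\frac{\widehat{\nu}(z)(1-|z|)}{\left(\widehat{\omega}(z)(1-|z|)\right)^{\frac1p}}\log\frac{e}{1-|z|}+\sum_{j=0}^{n-1}|f^{(j)}(0)|$$ for each fixed $n\ge N$.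
   Context: $\mathbb{D}$ is the open unit disc in $\mathbb{C}$, $\mathcal{H}(\mathbb{D})$ the space of analytic functions on $\mathbb{D}$, $H^\infty$ the bounded ones, and $dA=\frac{dx\,dy}{\pi}$ normalized area measure. A radial weight is a non-negative $\omega\in L^1(\mathbb{D},dA)$ with $\omega(z)=\omega(|z|)$. Write $\widehat{\omega}(z)=\int_{|z|}^1\omega(s)\,ds$; all radial weights are assumed to satisfy $\widehat{\omega}(z)>0$ for all $z\in\mathbb{D}$. For $0<p<\infty$, $\|f\|_{L^p_\omega}^p=\int_{\mathbb{D}}|f|^p\omega\,dA$ and $A^p_\omega=L^p_\omega\cap\mathcal{H}(\mathbb{D})$. A radial weight $\omega$ belongs to $\widehat{\mathcal{D}}$ if there is $C\ge1$ with $\widehat{\omega}(r)\le C\,\widehat{\omega}(\frac{1+r}{2})$ for all $0\le r<1$; it belongs to $\check{\mathcal{D}}$ if there are $K>1$ and $C>1$ with $\widehat{\omega}(r)\ge C\,\widehat{\omega}(1-\frac{1-r}{K})$ for all $0\le r<1$. Set $\mathcal{D}=\widehat{\mathcal{D}}\cap\check{\mathcal{D}}$. For a radial weight $\nu$, $A^1_{\nu_{\log}}$ is the set of $f\in\mathcal{H}(\mathbb{D})$ with $\int_{\mathbb{D}}|f(z)|\left(\log\frac{e}{1-|z|}\right)\nu(z)\,dA(z)<\infty$. $B^\nu_z$ denotes the reproducing kernel of the Hilbert space $A^2_\nu$ at $z\in\mathbb{D}$, with inner product $\int_{\mathbb{D}}f\overline{g}\,\nu\,dA$. The small Hankel operator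 is $$h_f^\nu(g)(z)=\int_{\mathbb{D}}f(\zeta)\overline{g(\zeta)B^\nu_z(\zeta)}\,\nu(\zeta)\,dA(\zeta),\quad z\in\mathbb{D},$$ which is defined for $g\in H^\infty$ when $f\in A^1_{\nu_{\log}}$. Since $H^\infty$ is dense in $A^p_\omega$, $h^\nu_f:A^p_\omega\to A^1_\nu$ is called bounded if $\|h^\nu_f(g)\|_{L^1_\nu}\le C\|g\|_{L^p_\omega}$ for all $g\in H^\infty$ and some $C>0$; the least such $C$ is $\|h^\nu_f\|_{A^p_\omega\to A^1_\nu}$. $a\asymp b$ means $C^{-1}a\le b\le Ca$ with a constant $C>0$ independent of $f$ (it may depend on $\omega,\nu,p,n$). *)

theory Defs
  imports "HOL-Complex_Analysis.Complex_Analysis"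
begin

abbreviation unit_disc :: "complex set" where
  "unit_disc \<equiv> ball 0 1"

definition area :: "complex measure" where
  "area = density (lebesgue_on unit_disc) (\<lambda>_. ennreal (1 / pi))"

text \<open>
  Functions on the disc are total functions on the complex plane; only their values on
  \<^const>\<open>unit_disc\<close> matter in everything below.
\<close>

definition tail :: "(complex \<Rightarrow> real) \<Rightarrow> real \<Rightarrow> real" where
  "tail \<omega> r = (LINT s:{r..<1}|lebesgue. \<omega> (of_real s))"

text \<open>
  Area-integrability of a radial function makes every tail from \<open>r > 0\<close> finite, whereas the tail
  from \<open>0\<close> may diverge; the Bochner integral is then \<open>0\<close> and the positivity condition below fails.
  Such weights lie outside \<open>D_hat\<close> in any case, because the doubling inequality at \<open>r = 0\<close>
  forces the tail from \<open>0\<close> to be finite.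
\<close>

definition radial_weight :: "(complex \<Rightarrow> real) \<Rightarrow> bool" where
  "radial_weight \<omega> \<longleftrightarrow>
     (\<forall>z\<in>unit_disc. 0 \<le> \<omega> z \<and> \<omega> z = \<omega> (of_real (cmod z))) \<and>
     integrable area \<omega> \<and>
     (\<forall>z\<in>unit_disc. 0 < tail \<omega> (cmod z))"

definition D_hat :: "(complex \<Rightarrow> real) set" where
  "D_hat = {\<omega>. radial_weight \<omega> \<and>
     (\<exists>C\<ge>1. \<forall>r\<in>{0..<1}. tail \<omega> r \<le> C * tail \<omega> ((1 + r) / 2))}"

definition D_check :: "(complex \<Rightarrow> real) set" where
  "D_check = {\<omega>. radial_weight \<omega> \<and>
     (\<exists>K>1. \<exists>C>1. \<forall>r\<in>{0..<1}. tail \<omega> r \<ge> C * tail \<omega> (1 - (1 - r) / K))}"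

definition D_class :: "(complex \<Rightarrow> real) set" where
  "D_class = D_hat \<inter> D_check"

definition Lp :: "real \<Rightarrow> (complex \<Rightarrow> real) \<Rightarrow> (complex \<Rightarrow> complex) set" where
  "Lp p \<omega> = {f \<in> borel_measurable area. integrable area (\<lambda>z. cmod (f z) powr p * \<omega> z)}"

definition Lp_norm :: "real \<Rightarrow> (complex \<Rightarrow> real) \<Rightarrow> (complex \<Rightarrow> complex) \<Rightarrow> real" where
  "Lp_norm p \<omega> f = (LINT z|area. cmod (f z) powr p * \<omega> z) powr (1 / p)"

definition bergman :: "real \<Rightarrow> (complex \<Rightarrow> real) \<Rightarrow> (complex \<Rightarrow> complex) set" where
  "bergman p \<omega> = {f \<in> Lp p \<omega>. f holomorphic_on unit_disc}"

definition H_infinity :: "(complex \<Rightarrow> complex) set" where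
  "H_infinity = {g. g holomorphic_on unit_disc \<and> bounded (g ` unit_disc)}"

definition log_weight :: "(complex \<Rightarrow> real) \<Rightarrow> complex \<Rightarrow> real" where
  "log_weight \<nu> z = ln (exp 1 / (1 - cmod z)) * \<nu> z"

definition reproduces_at :: "(complex \<Rightarrow> real) \<Rightarrow> complex \<Rightarrow> (complex \<Rightarrow> complex) \<Rightarrow> bool" where
  "reproduces_at \<nu> z B \<longleftrightarrow> B \<in> bergman 2 \<nu> \<and>
     (\<forall>f\<in>bergman 2 \<nu>. f z = (LINT \<zeta>|area. f \<zeta> * cnj (B \<zeta>) * of_real (\<nu> \<zeta>)))"

text \<open>
  For a radial weight the reproducing kernel exists and is unique on the disc.  It is not unique as
  a function on the whole plane, hence the use of \<open>SOME\<close>.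
\<close>

definition bergman_kernel :: "(complex \<Rightarrow> real) \<Rightarrow> complex \<Rightarrow> complex \<Rightarrow> complex" where
  "bergman_kernel \<nu> z = (SOME B. reproduces_at \<nu> z B)"

definition small_hankel ::
  "(complex \<Rightarrow> real) \<Rightarrow> (complex \<Rightarrow> complex) \<Rightarrow> (complex \<Rightarrow> complex) \<Rightarrow> complex \<Rightarrow> complex" where
  "small_hankel \<nu> f g z =
     (LINT \<zeta>|area. f \<zeta> * cnj (g \<zeta> * bergman_kernel \<nu> z \<zeta>) * of_real (\<nu> \<zeta>))"

text \<open>
  Membership in \<open>Lp 1 \<nu>\<close> is required separately because the real-valued \<^const>\<open>Lp_norm\<close> is \<open>0\<close>,
  not infinite, on functions that are not integrable.
\<close>

definition hankel_bound ::
  "real \<Rightarrow> (complex \<Rightarrow> real) \<Rightarrow> (complex \<Rightarrow> real) \<Rightarrow> (complex \<Rightarrow> complex) \<Rightarrow> real \<Rightarrow> bool" where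
  "hankel_bound p \<omega> \<nu> f C \<longleftrightarrow>
     (\<forall>g\<in>H_infinity. small_hankel \<nu> f g \<in> Lp 1 \<nu> \<and>
        Lp_norm 1 \<nu> (small_hankel \<nu> f g) \<le> C * Lp_norm p \<omega> g)"

definition hankel_bounded ::
  "real \<Rightarrow> (complex \<Rightarrow> real) \<Rightarrow> (complex \<Rightarrow> real) \<Rightarrow> (complex \<Rightarrow> complex) \<Rightarrow> bool" where
  "hankel_bounded p \<omega> \<nu> f \<longleftrightarrow> (\<exists>C>0. hankel_bound p \<omega> \<nu> f C)"

text \<open>The operator norm is infinite if the operator is unbounded (infimum of the empty set).\<close>

definition hankel_norm ::
  "real \<Rightarrow> (complex \<Rightarrow> real) \<Rightarrow> (complex \<Rightarrow> real) \<Rightarrow> (complex \<Rightarrow> complex) \<Rightarrow> ennreal" where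
  "hankel_norm p \<omega> \<nu> f = Inf {ennreal C | C. C > 0 \<and> hankel_bound p \<omega> \<nu> f C}"

definition symbol_sup ::
  "real \<Rightarrow> (complex \<Rightarrow> real) \<Rightarrow> (complex \<Rightarrow> real) \<Rightarrow> nat \<Rightarrow> (complex \<Rightarrow> complex) \<Rightarrow> ennreal" where
  "symbol_sup p \<omega> \<nu> n f =
     (SUP z\<in>unit_disc. ennreal
        (cmod ((deriv ^^ n) f z) * (1 - cmod z) ^ n *
         (tail \<nu> (cmod z) * (1 - cmod z) / (tail \<omega> (cmod z) * (1 - cmod z)) powr (1 / p)) *
         ln (exp 1 / (1 - cmod z))))"

definition comparable_on :: "'a set \<Rightarrow> ('a \<Rightarrow> ennreal) \<Rightarrow> ('a \<Rightarrow> ennreal) \<Rightarrow> bool" where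
  "comparable_on F a b \<longleftrightarrow>
     (\<exists>C::real. C > 0 \<and> (\<forall>f\<in>F. ennreal (1 / C) * a f \<le> b f \<and> b f \<le> ennreal C * a f))"

end

theory Submission
  imports Defs "HOL-Computational_Algebra.Fundamental_Theorem_Algebra"
begin

text \<open>
  A radial weight is an integral over circles, so monomials are orthogonal, the reproducing kernel is the power series
  of the reciprocal moments, and pairings against analytic functions are sums over Taylor coefficients.

  Sufficiency: \<open>n\<close> applications of \<open>f \<mapsto> (z f)'\<close> replace \<open>f\<close> in the pairing by a function controlled by \<open>f\<^sup>(\<^sup>n\<^sup>)\<close>
  and the weight \<open>\<nu>\<close> by an iterated tail of size \<open>(1 - r)\<^sup>n\<^sup>-\<^sup>1\<close> times the tail of \<open>\<nu>\<close>.  The kernel has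
  \<open>L\<^sup>1\<close>-norm of order \<open>log (e / (1 - \<bar>\<zeta>\<bar>))\<close>, so Fubini leaves an integral of \<open>\<bar>g\<bar>\<close> that a Carleson embedding
  bounds by the norm of \<open>g\<close>, the case \<open>p \<le> 1\<close> following from point evaluation.

  Necessity: apply the operator to \<open>g = z\<^sup>n (1 - cnj a z)\<^sup>-\<^sup>n\<^sup>-\<^sup>1 / log (e / (1 - cnj a z))\<close> and pair the result with the
  logarithm in the denominator, which lies in the Bloch space, the dual of \<open>A\<^sup>1\<close>.  This gives the pairing of \<open>f\<close> with
  \<open>z\<^sup>n (1 - cnj a z)\<^sup>-\<^sup>n\<^sup>-\<^sup>1\<close>, whose coefficients are those of \<open>f\<^sup>(\<^sup>n\<^sup>)\<close> times moments; a convolution with a kernel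
  whose circle mean is at most a constant over the tail of \<open>\<nu>\<close> removes the moments.
\<close>

subsection \<open>Polar coordinates\<close>

text \<open>The order \<open>n\<close> must be large for two independent reasons. The test quotients
  have a norm of the right size only if \<open>n * p\<close> exceeds the exponent from which the
  integral of the density against \<open>(1 - a s)^(-c)\<close> is governed by the part near
  \<open>s = a\<close>. And the weight in front of the \<open>n\<close>-th derivative must be almost
  decreasing in \<open>|z|\<close>, so \<open>(1 - r)^n\<close> has to beat the power
  \<open>-1/p\<close> of the tail of \<omega>; otherwise lower derivatives could not be recovered by
  integration. Upper doubling supplies such power bounds. Lower doubling enters where the mean of
  the kernel is recovered from that of its derivative, and where the density is replaced by
  \<open>T r / (1 - r)\<close>. No asymptotics of the kernel are used, only a lower bound for the
  moments \<open>m_k\<close>, their monotonicity and \<open>k (m_k - m_(k+1)) \<le> C m_k\<close>.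
  For general \<open>p\<close> the function \<open>|g|^p\<close> is not the modulus of a holomorphic
  function, so zeros of polynomials are removed before means over circles are compared. A weight is
  only Lebesgue measurable; the analysis therefore runs on a Borel representative of its radial
  profile and is carried over to area measure at the end.\<close>

definition circ :: "real \<Rightarrow> complex" where "circ t = cis (2 * pi * t)"

text \<open>One measure space in two roles: the parameter of the circle through \<open>circ\<close>,
  where it is a probability measure, and the range of the radius.\<close>

abbreviation unit_interval :: "real measure" ("\<U>") where
  "\<U> \<equiv> restrict_space lborel {0..<1}"

lemma norm_circ [simp]: "cmod (circ t) = 1"
  by (simp add: circ_def)

lemma circ_measurable [measurable]: "circ \<in> borel_measurable borel"
  unfolding circ_def by (intro borel_measurable_continuous_onI continuous_intros)

lemma circ_add: "circ (s + t) = circ s * circ t"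
  by (simp add: circ_def cis_mult ring_distribs)

lemma circ_periodic: "circ (t + 1) = circ t"
  by (simp add: circ_add) (simp add: circ_def)

lemma emeasure_U [simp]: "emeasure \<U> {0..<1} = 1"
  by (simp add: emeasure_restrict_space)

interpretation U: finite_measure \<U>
  by (rule finite_measureI) simp

lemma circ_polar: "\<exists>s\<in>{0..<1}. z = of_real (cmod z) * circ s"
proof -
  define s0 where "s0 = Arg z / (2 * pi)"
  have z: "z = of_real (cmod z) * circ s0"
    by (simp add: circ_def s0_def) (metis rcis_cmod_Arg rcis_def)
  have s0: "-1/2 < s0" "s0 \<le> 1/2"
    using Arg_bounded[of z] by (auto simp: s0_def field_simps)
  show ?thesis
  proof (cases "s0 < 0")
    case True
    with z s0 show ?thesis by (intro bexI[of _ "s0 + 1"]) (auto simp: circ_periodic)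
  next
    case False
    with z s0 show ?thesis by (intro bexI[of _ s0]) auto
  qed
qed

text \<open>Behaviour of measure under orthogonal maps is a statement about \<open>real^2\<close>;
  this identification carries it to \<open>complex\<close>.\<close>

lemma vec_complex_lborel:
  "distr lborel borel (\<lambda>v::real^2. Complex (v $ 1) (v $ 2)) = lborel"
proof (rule lborel_eqI [symmetric])
  fix l u :: complex
  assume le: "\<And>b. b \<in> Basis \<Longrightarrow> l \<bullet> b \<le> u \<bullet> b"
  let ?f = "\<lambda>v::real^2. Complex (v $ 1) (v $ 2)"
  have m: "?f \<in> borel_measurable borel"
    by (auto intro!: borel_measurable_continuous_onI continuous_intros simp: Complex_eq)
  have eq: "?f -` box l u = box (vector [Re l, Im l]) (vector [Re u, Im u])"
    by (auto simp: box_def Basis_complex_def Basis_vec_def inner_axis forall_2 complex_inner_1 split: if_splits)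
  have B: "(Basis :: (real^2) set) = {axis 1 1, axis 2 1}"
    by (auto simp: Basis_vec_def) (metis exhaust_2)
  have "Re l \<le> Re u" "Im l \<le> Im u"
    using le[of 1] le[of \<i>] by (auto simp: Basis_complex_def)
  then have "emeasure lborel (box (vector [Re l, Im l]) (vector [Re u, Im u] :: real^2)) =
      ennreal ((Re u - Re l) * (Im u - Im l))"
    by (subst emeasure_lborel_box)
       (auto simp: B inner_axis axis_eq_axis exhaust_2)
  then show "emeasure (distr lborel borel ?f) (box l u) = ennreal (\<Prod>b\<in>Basis. (u - l) \<bullet> b)"
    using m by (simp add: emeasure_distr eq Basis_complex_def)
qed simp

text \<open>Checked on boxes: in the coordinates of \<open>real^2\<close> the preimage of a box is
  its image under multiplication by \<open>inverse w\<close>, an orthogonal map, whose determinant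
  has absolute value 1.\<close>

lemma lborel_rotation:
  assumes "cmod w = 1"
  shows "distr lborel borel (\<lambda>z. w * z) = lborel"
proof (rule lborel_eqI [symmetric])
  fix l u :: complex
  assume le: "\<And>b. b \<in> Basis \<Longrightarrow> l \<bullet> b \<le> u \<bullet> b"
  let ?f = "\<lambda>v::real^2. Complex (v $ 1) (v $ 2)"
  let ?R = "\<lambda>v::real^2. vector [Re (inverse w * ?f v), Im (inverse w * ?f v)] :: real^2"
  have m: "?f \<in> borel_measurable borel"
    by (auto intro!: borel_measurable_continuous_onI continuous_intros simp: Complex_eq)
  have w0: "w \<noteq> 0" using assms by auto
  have fR: "?f (?R v) = inverse w * ?f v" for v by (auto simp: complex_eq_iff)
  have finj: "v = v'" if "?f v = ?f v'" for v v' using that by (auto simp: vec_eq_iff forall_2)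
  have nrm: "norm v = cmod (?f v)" for v :: "real^2"
    by (simp add: norm_vec_def L2_set_def sum_2 cmod_def)
  have lin: "linear ?R"
    by (rule linearI) (auto simp: vec_eq_iff forall_2 algebra_simps add_divide_distrib)
  have "norm (?R v) = norm v" for v
    unfolding nrm fR by (simp add: norm_mult norm_inverse assms)
  with lin have orth: "orthogonal_transformation ?R"
    unfolding orthogonal_transformation by blast
  have pre: "?f -` ((\<lambda>z. w * z) -` box l u) = ?R ` (?f -` box l u)"
  proof (intro equalityI subsetI)
    fix v assume "v \<in> ?f -` ((\<lambda>z. w * z) -` box l u)"
    then have "w * ?f v \<in> box l u" by simp
    define v' where "v' = (vector [Re (w * ?f v), Im (w * ?f v)] :: real^2)"
    have v': "?f v' = w * ?f v" by (simp add: v'_def complex_eq_iff)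
    have "?f (?R v') = inverse w * ?f v'" by (rule fR)
    also have "\<dots> = inverse w * (w * ?f v)" by (simp only: v')
    also have "\<dots> = ?f v" by (simp only: mult.assoc[symmetric] left_inverse[OF w0] mult_1_left)
    finally have "?f (?R v') = ?f v" .
    then have "?R v' = v" by (rule finj)
    moreover have "v' \<in> ?f -` box l u" using v' \<open>w * ?f v \<in> box l u\<close> by simp
    ultimately show "v \<in> ?R ` (?f -` box l u)" by (rule image_eqI[OF sym])
  next
    fix v assume "v \<in> ?R ` (?f -` box l u)"
    then obtain v' where v': "v = ?R v'" "?f v' \<in> box l u" by auto
    have "w * ?f v = w * (inverse w * ?f v')" by (simp only: v'(1) fR)
    also have "\<dots> = ?f v'" by (simp only: mult.assoc[symmetric] right_inverse[OF w0] mult_1_left)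
    finally have "w * ?f v = ?f v'" .
    then show "v \<in> ?f -` ((\<lambda>z. w * z) -` box l u)" using v' by simp
  qed
  have eq: "?f -` box l u = box (vector [Re l, Im l]) (vector [Re u, Im u])"
    by (auto simp: box_def Basis_complex_def Basis_vec_def inner_axis forall_2 complex_inner_1 split: if_splits)
  have lm: "?f -` box l u \<in> lmeasurable" unfolding eq by simp
  have wb: "(\<lambda>z. w * z) -` box l u \<in> sets borel"
    by (rule measurable_sets_borel[of "\<lambda>z. w * z" borel]) simp_all
  have pb: "?R ` (?f -` box l u) \<in> sets borel"
    unfolding pre[symmetric]
    by (rule measurable_sets_borel[OF m wb])
  have "emeasure (distr lborel borel (\<lambda>z. w * z)) (box l u) = emeasure lborel ((\<lambda>z. w * z) -` box l u)"
    by (subst emeasure_distr) auto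
  also have "\<dots> = emeasure lborel (?f -` ((\<lambda>z. w * z) -` box l u))"
    by (subst vec_complex_lborel[symmetric], subst emeasure_distr) (use m wb in simp_all)
  also have "\<dots> = emeasure lebesgue (?R ` (?f -` box l u))"
    unfolding pre using pb by simp
  also have "\<dots> = ennreal (measure lebesgue (?R ` (?f -` box l u)))"
    using measurable_linear_image[OF lin lm] by (simp add: emeasure_eq_measure2)
  also have "measure lebesgue (?R ` (?f -` box l u)) = measure lebesgue (?f -` box l u)"
    using measure_linear_image[OF lin lm] orthogonal_transformation_det[OF orth] by simp
  also have "ennreal \<dots> = emeasure lebesgue (?f -` box l u)"
    using lm by (simp add: emeasure_eq_measure2)
  also have "\<dots> = emeasure lborel (?f -` box l u)" unfolding eq by simp
  also have "\<dots> = emeasure (distr lborel borel ?f) (box l u)"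
    using m by (subst emeasure_distr) auto
  also have "\<dots> = emeasure lborel (box l u)" by (simp add: vec_complex_lborel)
  also have "\<dots> = ennreal (\<Prod>b\<in>Basis. (u - l) \<bullet> b)" using le by (rule emeasure_lborel_box)
  finally show "emeasure (distr lborel borel (\<lambda>z. w * z)) (box l u) = ennreal (\<Prod>b\<in>Basis. (u - l) \<bullet> b)" .
qed simp

text \<open>Translation turns the period \<open>{0..<1}\<close> into \<open>{s..<1+s}\<close>; the
  piece beyond 1 is moved back by periodicity.\<close>

lemma nn_integral_circ_shift:
  assumes [measurable]: "F \<in> borel_measurable borel" and s: "s \<in> {0..<1}"
  shows "(\<integral>\<^sup>+t. F (circ (s + t)) \<partial>\<U>) = (\<integral>\<^sup>+t. F (circ t) \<partial>\<U>)"
proof -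
  define h where "h t = F (circ t)" for t
  have hm[measurable]: "h \<in> borel_measurable borel" unfolding h_def by measurable
  have per: "h (1 + t) = h t" for t using circ_periodic[of t] by (simp add: h_def add.commute)
  have shift: "(\<integral>\<^sup>+t. g t \<partial>lborel) = (\<integral>\<^sup>+t. g (c + t) \<partial>lborel)" if "g \<in> borel_measurable borel" for g :: "real \<Rightarrow> ennreal" and c
    using nn_integral_real_affine[OF that, of 1 c] by simp
  have "(\<integral>\<^sup>+t. F (circ (s + t)) \<partial>\<U>) = (\<integral>\<^sup>+t. h (s + t) * indicator {0..<1} t \<partial>lborel)"
    by (simp add: nn_integral_restrict_space h_def)
  also have "\<dots> = (\<integral>\<^sup>+t. h (s + t) * indicator {s..<1+s} (s + t) \<partial>lborel)"
    by (intro nn_integral_cong) (auto simp: indicator_def)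
  also have "\<dots> = (\<integral>\<^sup>+t. h t * indicator {s..<1+s} t \<partial>lborel)"
    by (rule shift[symmetric]) measurable
  also have "\<dots> = (\<integral>\<^sup>+t. h t * indicator {s..<1} t + h t * indicator {1..<1+s} t \<partial>lborel)"
    using s by (intro nn_integral_cong) (auto simp: indicator_def)
  also have "\<dots> = (\<integral>\<^sup>+t. h t * indicator {s..<1} t \<partial>lborel) + (\<integral>\<^sup>+t. h t * indicator {1..<1+s} t \<partial>lborel)"
    by (rule nn_integral_add) auto
  also have "(\<integral>\<^sup>+t. h t * indicator {1..<1+s} t \<partial>lborel) = (\<integral>\<^sup>+t. h (1 + t) * indicator {1..<1+s} (1 + t) \<partial>lborel)"
    by (rule shift) measurable
  also have "\<dots> = (\<integral>\<^sup>+t. h t * indicator {0..<s} t \<partial>lborel)"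
    by (intro nn_integral_cong) (auto simp: indicator_def per)
  also have "(\<integral>\<^sup>+t. h t * indicator {s..<1} t \<partial>lborel) + (\<integral>\<^sup>+t. h t * indicator {0..<s} t \<partial>lborel)
     = (\<integral>\<^sup>+t. h t * indicator {s..<1} t + h t * indicator {0..<s} t \<partial>lborel)"
    by (rule nn_integral_add[symmetric]) auto
  also have "\<dots> = (\<integral>\<^sup>+t. h t * indicator {0..<1} t \<partial>lborel)"
    using s by (intro nn_integral_cong) (auto simp: indicator_def)
  finally show ?thesis by (simp add: nn_integral_restrict_space h_def)
qed

text \<open>Finite measures on the line are determined by the rays \<open>{x<..}\<close>. For
  \<open>0 \<le> x < 1\<close> both sides give such a ray the area \<open>pi - pi * x^2\<close> of
  an annulus.\<close>

lemma distr_cmod: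
  "distr (density lborel (indicator unit_disc)) borel cmod =
     density lborel (\<lambda>r. ennreal (2 * pi * r) * indicator {0..<1} r)" (is "?M = ?N")
proof (rule measure_eqI_lessThan)
  have M: "emeasure ?M {x<..} = emeasure lborel (unit_disc \<inter> {z. x < cmod z})" for x
  proof -
    have "{z. x < cmod z} \<in> sets lborel" by (auto intro!: borel_open open_Collect_less continuous_intros)
    then have [measurable]: "cmod -` {x<..} \<in> sets borel" by (simp add: vimage_def)
    have [measurable]: "unit_disc \<in> sets borel" by simp
    have "emeasure ?M {x<..} = emeasure (density lborel (indicator unit_disc)) (cmod -` {x<..})"
      by (subst emeasure_distr) auto
    also have "\<dots> = (\<integral>\<^sup>+z. indicator unit_disc z * indicator (cmod -` {x<..}) z \<partial>lborel)"
      by (rule emeasure_density) measurable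
    also have "\<dots> = (\<integral>\<^sup>+z. indicator (unit_disc \<inter> {z. x < cmod z}) z \<partial>lborel)"
      by (intro nn_integral_cong) (auto simp: indicator_def)
    also have "\<dots> = emeasure lborel (unit_disc \<inter> {z. x < cmod z})"
      by (rule nn_integral_indicator) (use \<open>{z. x < cmod z} \<in> sets lborel\<close> in auto)
    finally show ?thesis .
  qed
  have eb: "emeasure lborel (ball (0::complex) r) = ennreal (pi * r\<^sup>2)" if "r \<ge> 0" for r
    using emeasure_ball[OF that, of "0::complex"] by (simp add: unit_ball_vol_2)
  have ecb: "emeasure lborel (cball (0::complex) r) = ennreal (pi * r\<^sup>2)" if "r \<ge> 0" for r
    using emeasure_cball[OF that, of "0::complex"] by (simp add: unit_ball_vol_2)
  have Mx: "emeasure ?M {x<..} = (if x < 0 then ennreal pi else if x < 1 then ennreal (pi - pi * x\<^sup>2) else 0)" for x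
  proof -
    consider "x < 0" | "0 \<le> x" "x < 1" | "x \<ge> 1" by linarith
    then show ?thesis
    proof cases
      case 1
      then have "unit_disc \<inter> {z. x < cmod z} = unit_disc" by (auto intro: less_le_trans)
      then show ?thesis using 1 by (simp only: M) (simp add: eb)
    next
      case 2
      have "unit_disc \<inter> {z. x < cmod z} = unit_disc - cball 0 x" by auto
      moreover have "emeasure lborel (unit_disc - cball (0::complex) x) = emeasure lborel unit_disc - emeasure lborel (cball (0::complex) x)"
        using 2 by (intro emeasure_Diff) (auto simp: ecb)
      ultimately show ?thesis using 2 by (simp only: M) (simp add: eb ecb ennreal_minus)
    next
      case 3
      then have "unit_disc \<inter> {z. x < cmod z} = {}" by auto
      then show ?thesis using 3 by (simp only: M) simp
    qed
  qed
  have I: "(\<integral>\<^sup>+r. ennreal (2 * pi * r) * indicator {x..1} r \<partial>lborel) = ennreal (pi - pi * x\<^sup>2)" if "0 \<le> x" "x \<le> 1" for x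
    by (subst nn_integral_FTC_Icc[of "\<lambda>r. 2 * pi * r" x 1 "\<lambda>r. pi * r\<^sup>2"])
       (use that in \<open>auto intro!: derivative_eq_intros\<close>)
  have Nx: "emeasure ?N {x<..} = (if x < 0 then ennreal pi else if x < 1 then ennreal (pi - pi * x\<^sup>2) else 0)" for x
  proof -
    have "emeasure ?N {x<..} = (\<integral>\<^sup>+r. ennreal (2 * pi * r) * indicator {0..<1} r * indicator {x<..} r \<partial>lborel)"
      by (subst emeasure_density) auto
    also have "\<dots> = (if x < 0 then ennreal pi else if x < 1 then ennreal (pi - pi * x\<^sup>2) else 0)"
    proof -
      have ae: "AE r in lborel. r \<noteq> x \<and> r \<noteq> (1::real)" by (simp add: AE_lborel_singleton)
      consider "x < 0" | "0 \<le> x" "x < 1" | "x \<ge> 1" by linarith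
      then show ?thesis
      proof cases
        case 1
        then have "(\<integral>\<^sup>+r. ennreal (2 * pi * r) * indicator {0..<1} r * indicator {x<..} r \<partial>lborel) =
          (\<integral>\<^sup>+r. ennreal (2 * pi * r) * indicator {0..1} r \<partial>lborel)"
          by (intro nn_integral_cong_AE eventually_mono[OF ae]) (auto simp: indicator_def)
        then show ?thesis using 1 by (simp add: I)
      next
        case 2
        then have "(\<integral>\<^sup>+r. ennreal (2 * pi * r) * indicator {0..<1} r * indicator {x<..} r \<partial>lborel) =
          (\<integral>\<^sup>+r. ennreal (2 * pi * r) * indicator {x..1} r \<partial>lborel)"
          by (intro nn_integral_cong_AE eventually_mono[OF ae]) (auto simp: indicator_def)
        then show ?thesis using 2 by (simp add: I)
      next
        case 3
        then have "(\<integral>\<^sup>+r. ennreal (2 * pi * r) * indicator {0..<1} r * indicator {x<..} r \<partial>lborel) =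
          (\<integral>\<^sup>+(r::real). 0 \<partial>lborel)"
          by (intro nn_integral_cong) (auto simp: indicator_def)
        then show ?thesis using 3 by simp
      qed
    qed
    finally show ?thesis .
  qed
  show "emeasure ?M {x<..} < \<infinity>" for x by (simp add: Mx)
  show "emeasure ?M {x<..} = emeasure ?N {x<..}" for x by (simp only: Mx Nx)
qed auto

text \<open>No change of variables is made: averaging the integral over all rotations and exchanging
  the order leaves a function of \<open>cmod z\<close> alone, whose integral is read off from
  \<open>distr_cmod\<close>.\<close>

lemma nn_integral_polar:
  assumes [measurable]: "F \<in> borel_measurable borel"
  shows "(\<integral>\<^sup>+z. F z * indicator unit_disc z \<partial>lborel) =
    (\<integral>\<^sup>+r. ennreal (2 * pi * r) * (\<integral>\<^sup>+t. F (of_real r * circ t) \<partial>\<U>) \<partial>\<U>)"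
proof -
  have [measurable]: "unit_disc \<in> sets borel" by simp
  define F1 where "F1 z = F z * indicator unit_disc z" for z :: complex
  have [measurable]: "F1 \<in> borel_measurable borel" unfolding F1_def by measurable
  have rot: "(\<integral>\<^sup>+z. F1 z \<partial>lborel) = (\<integral>\<^sup>+z. F1 (circ t * z) \<partial>lborel)" for t
    by (subst lborel_rotation[of "circ t", symmetric]) (simp_all add: nn_integral_distr)
  have [measurable]: "(\<lambda>p. circ (fst p) * snd p) \<in> \<U> \<Otimes>\<^sub>M lborel \<rightarrow>\<^sub>M borel" 
    by (intro borel_measurable_times measurable_compose[OF measurable_fst] measurable_compose[OF measurable_snd])
       (auto intro: measurable_restrict_space1)
  interpret pair_sigma_finite \<U> "lborel :: complex measure" ..
  have inner: "(\<integral>\<^sup>+t. F1 (circ t * z) \<partial>\<U>) = (\<integral>\<^sup>+t. F1 (of_real (cmod z) * circ t) \<partial>\<U>)" for z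
  proof -
    obtain s where s: "s \<in> {0..<1}" "z = of_real (cmod z) * circ s" using circ_polar by blast
    have "(\<integral>\<^sup>+t. F1 (circ t * z) \<partial>\<U>) = (\<integral>\<^sup>+t. F1 (of_real (cmod z) * circ (s + t)) \<partial>\<U>)"
      by (subst s(2)) (simp add: circ_add mult_ac)
    also have "\<dots> = (\<integral>\<^sup>+t. F1 (of_real (cmod z) * circ t) \<partial>\<U>)"
      using s(1) by (intro nn_integral_circ_shift[of "\<lambda>w. F1 (of_real (cmod z) * w)"]) measurable
    finally show ?thesis .
  qed
  define \<Phi> where "\<Phi> r = (\<integral>\<^sup>+t. F (of_real r * circ t) \<partial>\<U>)" for r :: real
  have [measurable]: "\<Phi> \<in> borel_measurable borel" unfolding \<Phi>_def
    by (intro U.borel_measurable_nn_integral)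
       (auto simp: split_beta' intro!: measurable_compose[OF _ assms] borel_measurable_times measurable_compose[OF measurable_fst] measurable_compose[OF measurable_snd] measurable_restrict_space1)
  have "(\<integral>\<^sup>+z. F1 z \<partial>lborel) = (\<integral>\<^sup>+t. (\<integral>\<^sup>+z. F1 (circ t * z) \<partial>lborel) \<partial>\<U>)"
    by (simp add: rot[symmetric] nn_integral_const)
  also have "\<dots> = (\<integral>\<^sup>+z. (\<integral>\<^sup>+t. F1 (circ t * z) \<partial>\<U>) \<partial>lborel)"
    by (intro Fubini'[symmetric]) (simp add: split_beta')
  also have "\<dots> = (\<integral>\<^sup>+z. \<Phi> (cmod z) * indicator unit_disc z \<partial>lborel)"
    unfolding inner by (intro nn_integral_cong) (auto simp: F1_def \<Phi>_def norm_mult indicator_def)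
  also have "\<dots> = (\<integral>\<^sup>+z. \<Phi> (cmod z) \<partial>density lborel (indicator unit_disc))"
    by (subst nn_integral_density) (auto simp: mult.commute)
  also have "\<dots> = (\<integral>\<^sup>+r. \<Phi> r \<partial>distr (density lborel (indicator unit_disc)) borel cmod)"
    by (subst nn_integral_distr) auto
  also have "\<dots> = (\<integral>\<^sup>+r. ennreal (2 * pi * r) * indicator {0..<1} r * \<Phi> r \<partial>lborel)"
    unfolding distr_cmod by (subst nn_integral_density) auto
  also have "\<dots> = (\<integral>\<^sup>+r. ennreal (2 * pi * r) * \<Phi> r \<partial>\<U>)"
    by (simp add: nn_integral_restrict_space mult_ac)
  finally show ?thesis by (simp add: F1_def \<Phi>_def)
qed

subsection \<open>Radial weights as measures on the disc\<close>

abbreviation disc_borel :: "complex measure" ("\<D>") where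
  "\<D> \<equiv> restrict_space borel unit_disc"

text \<open>This is \<open>w(|z|) dA\<close>; the factor \<open>2 * r\<close> is the normalised area
  element in polar coordinates. The profile takes values in \<open>ennreal\<close> because the
  iterated tails used later may be infinite at the origin.\<close>

definition disc_measure :: "(real \<Rightarrow> ennreal) \<Rightarrow> complex measure" where
  "disc_measure w = distr (density \<U> (\<lambda>r. ennreal (2 * r) * w r) \<Otimes>\<^sub>M \<U>) \<D> (\<lambda>(r, t). of_real r * circ t)"

lemma polar_map_measurable [measurable]:
  "(\<lambda>(r, t). complex_of_real r * circ t) \<in> \<U> \<Otimes>\<^sub>M \<U> \<rightarrow>\<^sub>M \<D>"
proof (rule measurable_restrict_space2)
  show "(\<lambda>(r, t). complex_of_real r * circ t) \<in> space (\<U> \<Otimes>\<^sub>M \<U>) \<rightarrow> unit_disc"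
    by (auto simp: space_pair_measure norm_mult)
  have [measurable]: "(\<lambda>r. r) \<in> \<U> \<rightarrow>\<^sub>M borel" by (rule measurable_restrict_space1) simp
  have "circ \<in> \<U> \<rightarrow>\<^sub>M borel" "complex_of_real \<in> \<U> \<rightarrow>\<^sub>M borel"
    by (auto intro!: measurable_restrict_space1)
  then show "(\<lambda>(r, t). complex_of_real r * circ t) \<in> \<U> \<Otimes>\<^sub>M \<U> \<rightarrow>\<^sub>M borel"
    by (simp add: split_beta') 
qed

lemma sets_density_U [measurable_cong]: "sets (density \<U> f) = sets \<U>" by simp

lemma borel_measurable_U [measurable (raw)]: "f \<in> borel_measurable borel \<Longrightarrow> f \<in> borel_measurable \<U>"
  by (rule measurable_restrict_space1) simp

lemma sets_disc_measure [simp, measurable_cong]: "sets (disc_measure w) = sets \<D>"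
  and space_disc_measure [simp]: "space (disc_measure w) = unit_disc"
  by (auto simp: disc_measure_def space_restrict_space)

lemma nn_integral_disc_measure:
  assumes [measurable]: "F \<in> borel_measurable \<D>" "w \<in> borel_measurable borel"
  shows "(\<integral>\<^sup>+z. F z \<partial>disc_measure w) =
    (\<integral>\<^sup>+r. ennreal (2 * r) * w r * (\<integral>\<^sup>+t. F (of_real r * circ t) \<partial>\<U>) \<partial>\<U>)"
proof -
  have m: "(\<lambda>p. F (complex_of_real (fst p) * circ (snd p))) \<in> borel_measurable (\<U> \<Otimes>\<^sub>M \<U>)"
    using measurable_compose[OF polar_map_measurable assms(1)] by (simp add: split_beta')
  have "(\<integral>\<^sup>+z. F z \<partial>disc_measure w) =
      (\<integral>\<^sup>+p. F (of_real (fst p) * circ (snd p)) \<partial>(density \<U> (\<lambda>r. ennreal (2 * r) * w r) \<Otimes>\<^sub>M \<U>))"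
    unfolding disc_measure_def by (subst nn_integral_distr) (auto simp: split_beta')
  also have "\<dots> = (\<integral>\<^sup>+r. (\<integral>\<^sup>+t. F (of_real r * circ t) \<partial>\<U>) \<partial>density \<U> (\<lambda>r. ennreal (2 * r) * w r))"
    using m by (subst U.nn_integral_fst[symmetric]) auto
  also have "\<dots> = (\<integral>\<^sup>+r. ennreal (2 * r) * w r * (\<integral>\<^sup>+t. F (of_real r * circ t) \<partial>\<U>) \<partial>\<U>)"
    using m U.borel_measurable_nn_integral_fst[OF m] by (subst nn_integral_density) auto
  finally show ?thesis .
qed

lemma integral_disc_measure:
  fixes \<phi> :: "complex \<Rightarrow> 'b::{banach, second_countable_topology}"
  assumes [measurable]: "w \<in> borel_measurable borel" and fin: "(\<integral>\<^sup>+r. ennreal (2 * r) * w r \<partial>\<U>) < \<infinity>"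
    and int: "integrable (disc_measure w) \<phi>"
  shows "integral\<^sup>L (disc_measure w) \<phi> =
    (\<integral>r. (\<integral>t. \<phi> (of_real r * circ t) \<partial>\<U>) \<partial>density \<U> (\<lambda>r. ennreal (2 * r) * w r))"
proof -
  let ?R = "density \<U> (\<lambda>r. ennreal (2 * r) * w r)"
  have "emeasure ?R (space \<U>) = (\<integral>\<^sup>+r. ennreal (2 * r) * w r * indicator (space \<U>) r \<partial>\<U>)"
    by (rule emeasure_density[OF _ sets.top]) measurable
  also have "\<dots> = (\<integral>\<^sup>+r. ennreal (2 * r) * w r \<partial>\<U>)"
    by (intro nn_integral_cong) (simp del: space_restrict_space)
  finally have e: "emeasure ?R (space \<U>) = (\<integral>\<^sup>+r. ennreal (2 * r) * w r \<partial>\<U>)" .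
  have "emeasure ?R (space ?R) \<noteq> \<infinity>"
    unfolding space_density e using fin by simp
  then interpret R: finite_measure ?R by (rule finite_measureI)
  interpret pair_sigma_finite ?R \<U> ..
  have m: "\<phi> \<in> borel_measurable \<D>" using int by (auto dest: borel_measurable_integrable)
  have int2: "integrable (?R \<Otimes>\<^sub>M \<U>) (\<lambda>p. \<phi> (of_real (fst p) * circ (snd p)))"
    using int m unfolding disc_measure_def by (subst (asm) integrable_distr_eq) (auto simp: split_beta')
  have "integral\<^sup>L (disc_measure w) \<phi> = (\<integral>p. \<phi> (of_real (fst p) * circ (snd p)) \<partial>(?R \<Otimes>\<^sub>M \<U>))"
    unfolding disc_measure_def using m by (subst integral_distr) (auto simp: split_beta')
  also have "\<dots> = (\<integral>r. (\<integral>t. \<phi> (of_real r * circ t) \<partial>\<U>) \<partial>?R)"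
    using integral_fst'[OF int2] by simp
  finally show ?thesis .
qed

lemma finite_disc_measure:
  assumes [measurable]: "w \<in> borel_measurable borel" and fin: "(\<integral>\<^sup>+r. ennreal (2 * r) * w r \<partial>\<U>) < \<infinity>"
  shows "finite_measure (disc_measure w)"
proof (rule finite_measureI)
  have "emeasure (disc_measure w) (space (disc_measure w)) = (\<integral>\<^sup>+z. 1 \<partial>disc_measure w)" by simp
  also have "\<dots> = (\<integral>\<^sup>+r. ennreal (2 * r) * w r \<partial>\<U>)"
    by (subst nn_integral_disc_measure) auto
  finally show "emeasure (disc_measure w) (space (disc_measure w)) \<noteq> \<infinity>" using fin by simp
qed

lemma borel_measurable_area: "f \<in> borel_measurable \<D> \<Longrightarrow> f \<in> borel_measurable area"
  unfolding area_def measurable_def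
  by (auto simp: sets_restrict_space space_restrict_space)

lemma space_area [simp]: "space area = unit_disc" by (simp add: area_def)

lemma ident_measurable_area: "(\<lambda>z. z) \<in> area \<rightarrow>\<^sub>M \<D>"
proof (rule measurable_restrict_space2)
  show "(\<lambda>z. z) \<in> borel_measurable area"
    by (intro borel_measurable_area measurable_restrict_space1) simp
qed simp

lemma radial_weightD:
  assumes "radial_weight \<omega>"
  shows "z \<in> unit_disc \<Longrightarrow> 0 \<le> \<omega> z" "z \<in> unit_disc \<Longrightarrow> \<omega> z = \<omega> (of_real (cmod z))"
    "integrable area \<omega>" "z \<in> unit_disc \<Longrightarrow> 0 < tail \<omega> (cmod z)"
  using assms unfolding radial_weight_def by blast+

text \<open>A Borel function that agrees with the weight almost everywhere on the radius agrees with
  it almost everywhere on the disc, because null sets of radii pull back to null sets under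
  \<open>cmod\<close>.\<close>

lemma radial_weight_borel:
  assumes \<omega>: "radial_weight \<omega>"
  obtains w :: "real \<Rightarrow> real" where "w \<in> borel_measurable borel" "\<And>s. 0 \<le> w s"
    "AE z in area. \<omega> z = w (cmod z)"
    "\<And>r. 0 \<le> r \<Longrightarrow> r < 1 \<Longrightarrow> ennreal (tail \<omega> r) = (\<integral>\<^sup>+s. ennreal (w s) * indicator {r..} s \<partial>\<U>)"
proof -
  \<comment> \<open>A profile that is not integrable would have Bochner integral 0, against the
    positivity of the tail at the origin.\<close>
  have int: "set_integrable lebesgue {0..<1} (\<lambda>s. \<omega> (of_real s))"
  proof (rule ccontr)
    assume "\<not> ?thesis"
    then have "tail \<omega> 0 = 0"
      unfolding tail_def set_lebesgue_integral_def set_integrable_def by (rule not_integrable_integral_eq)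
    moreover have "0 < tail \<omega> (cmod 0)" by (rule radial_weightD(4)[OF \<omega>]) simp
    ultimately show False by simp
  qed
  then have "(\<lambda>s. indicator {0..<1} s *\<^sub>R \<omega> (of_real s)) \<in> borel_measurable lebesgue"
    unfolding set_integrable_def by auto
  then obtain g where g [measurable]: "g \<in> borel_measurable lborel"
    and gae: "AE s in lborel. indicator {0..<1} s *\<^sub>R \<omega> (of_real s) = g s"
    by (rule bexE[OF completion_ex_borel_measurable_real])
  \<comment> \<open>The maximum makes the representative non-negative everywhere and changes nothing
    where \<open>g\<close> agrees with the weight.\<close>
  define w where "w s = max 0 (g s)" for s
  have wm [measurable]: "w \<in> borel_measurable borel" using g unfolding w_def by auto
  have nn: "0 \<le> \<omega> z" if "z \<in> unit_disc" for z using radial_weightD(1)[OF \<omega> that] .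
  have rad: "\<omega> z = \<omega> (of_real (cmod z))" if "z \<in> unit_disc" for z using radial_weightD(2)[OF \<omega> that] .
  have indm: "indicator unit_disc \<in> borel_measurable (lborel :: complex measure)"
    by (intro borel_measurable_indicator) simp
  have wae: "AE s in lborel. s \<in> {0..<1} \<longrightarrow> \<omega> (of_real s) = w s"
    using gae
  proof eventually_elim
    case (elim s)
    show ?case
    proof
      assume s: "s \<in> {0..<1}"
      then have "0 \<le> \<omega> (of_real s)" by (intro nn) simp
      then show "\<omega> (of_real s) = w s" using elim s by (simp add: w_def)
    qed
  qed
  then have "AE s in density lborel (\<lambda>r. ennreal (2 * pi * r) * indicator {0..<1} r). s \<in> {0..<1} \<longrightarrow> \<omega> (of_real s) = w s"
    by (subst AE_density) (auto elim!: eventually_mono)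
  then have "AE s in distr (density lborel (indicator unit_disc)) borel cmod. s \<in> {0..<1} \<longrightarrow> \<omega> (of_real s) = w s"
    unfolding distr_cmod .
  then have "AE z in density lborel (indicator unit_disc). cmod z \<in> {0..<1} \<longrightarrow> \<omega> (of_real (cmod z)) = w (cmod z)"
    by (rule AE_distrD[rotated]) auto
  then have "AE z in lborel. z \<in> unit_disc \<longrightarrow> \<omega> z = w (cmod z)"
    unfolding AE_density[OF indm]
  proof (rule eventually_mono)
    fix z assume *: "0 < (indicator unit_disc z :: ennreal) \<longrightarrow> cmod z \<in> {0..<1} \<longrightarrow> \<omega> (of_real (cmod z)) = w (cmod z)"
    show "z \<in> unit_disc \<longrightarrow> \<omega> z = w (cmod z)"
    proof
      assume z: "z \<in> unit_disc"
      with * have "\<omega> (of_real (cmod z)) = w (cmod z)" by simp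
      with rad[OF z] show "\<omega> z = w (cmod z)" by (rule trans)
    qed
  qed
  then have "AE z in lebesgue_on unit_disc. \<omega> z = w (cmod z)"
    by (subst AE_restrict_space_iff) (auto simp: AE_completion)
  then have ae: "AE z in area. \<omega> z = w (cmod z)"
    unfolding area_def by (subst AE_density) (auto elim!: eventually_mono)
  have T: "ennreal (tail \<omega> r) = (\<integral>\<^sup>+s. ennreal (w s) * indicator {r..} s \<partial>\<U>)" if r: "0 \<le> r" "r < 1" for r
  proof -
    have i: "integrable lebesgue (\<lambda>s. indicator {r..<1} s *\<^sub>R \<omega> (of_real s))"
      using set_integrable_subset[OF int, of "{r..<1}"] r by (auto simp: set_integrable_def)
    have "ennreal (tail \<omega> r) = (\<integral>\<^sup>+s. ennreal (indicator {r..<1} s *\<^sub>R \<omega> (of_real s)) \<partial>lebesgue)"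
      unfolding tail_def set_lebesgue_integral_def
      using r by (intro nn_integral_eq_integral[symmetric] i) (auto simp: indicator_def intro!: AE_I2 nn)
    also have "\<dots> = (\<integral>\<^sup>+s. ennreal (w s) * indicator {r..<1} s \<partial>lebesgue)"
      by (intro nn_integral_cong_AE AE_completion eventually_mono[OF wae]) (use r in \<open>auto simp: indicator_def\<close>)
    also have "\<dots> = (\<integral>\<^sup>+s. ennreal (w s) * indicator {r..<1} s \<partial>lborel)"
      by (rule nn_integral_completion)
    also have "\<dots> = (\<integral>\<^sup>+s. ennreal (w s) * indicator {r..} s \<partial>\<U>)"
      using r by (simp add: nn_integral_restrict_space) (intro nn_integral_cong, auto simp: indicator_def)
    finally show ?thesis .
  qed
  show ?thesis by (rule that[OF wm _ ae T]) (auto simp: w_def)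
qed

text \<open>The bridge from the weighted area measure to \<open>disc_measure\<close>: only Borel
  subsets of the disc are measured, so the completion inside \<open>area\<close> disappears and
  polar coordinates apply.\<close>

lemma distr_area_radial:
  assumes \<omega>: "radial_weight \<omega>" and [measurable]: "w \<in> borel_measurable borel" and nn: "\<And>s. 0 \<le> w s"
    and ae: "AE z in area. \<omega> z = w (cmod z)"
  shows "distr (density area (\<lambda>z. ennreal (\<omega> z))) \<D> (\<lambda>z. z) = disc_measure (\<lambda>s. ennreal (w s))"
proof (rule measure_eqI)
  note idm [measurable] = ident_measurable_area
  have \<omega>m [measurable]: "\<omega> \<in> borel_measurable area"
    using radial_weightD(3)[OF \<omega>] by (rule borel_measurable_integrable)
  have \<omega>m2 [measurable]: "(\<lambda>z. w (cmod z)) \<in> borel_measurable area"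
    by (rule borel_measurable_area) (rule measurable_restrict_space1, measurable)
  fix A assume "A \<in> sets (distr (density area (\<lambda>z. ennreal (\<omega> z))) \<D> (\<lambda>z. z))"
  then have A: "A \<in> sets \<D>" by simp
  then have A': "A \<in> sets borel" "A \<subseteq> unit_disc" by (auto simp: sets_restrict_space)
  have Aa: "A \<in> sets area" using measurable_sets[OF idm A] A'(2) by (simp add: Int_absorb2)
  have [measurable]: "A \<in> sets borel" by fact
  have "emeasure (distr (density area (\<lambda>z. ennreal (\<omega> z))) \<D> (\<lambda>z. z)) A = emeasure (density area (\<lambda>z. ennreal (\<omega> z))) A"
    using A A'(2) by (subst emeasure_distr) (auto simp: Int_absorb2)
  also have "\<dots> = (\<integral>\<^sup>+z. ennreal (\<omega> z) * indicator A z \<partial>area)"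
    using Aa by (subst emeasure_density) auto
  also have "\<dots> = (\<integral>\<^sup>+z. ennreal (w (cmod z)) * indicator A z \<partial>area)"
    by (intro nn_integral_cong_AE eventually_mono[OF ae]) auto
  also have "\<dots> = (\<integral>\<^sup>+z. ennreal (1 / pi) * (ennreal (w (cmod z)) * indicator A z) \<partial>lebesgue_on unit_disc)"
    using \<omega>m2 Aa unfolding area_def by (subst nn_integral_density) (auto)
  also have "\<dots> = (\<integral>\<^sup>+z. ennreal (1 / pi) * (ennreal (w (cmod z)) * indicator A z) * indicator unit_disc z \<partial>lebesgue)"
    by (subst nn_integral_restrict_space) auto
  also have "\<dots> = (\<integral>\<^sup>+z. (ennreal (1 / pi) * (ennreal (w (cmod z)) * indicator A z)) * indicator unit_disc z \<partial>lborel)"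
    by (rule nn_integral_completion)
  also have "\<dots> = (\<integral>\<^sup>+r. ennreal (2 * pi * r) * (\<integral>\<^sup>+t. ennreal (1 / pi) * (ennreal (w (cmod (of_real r * circ t))) * indicator A (of_real r * circ t)) \<partial>\<U>) \<partial>\<U>)"
    by (rule nn_integral_polar) measurable
  also have "\<dots> = (\<integral>\<^sup>+r. ennreal (2 * r) * ennreal (w r) * (\<integral>\<^sup>+t. indicator A (of_real r * circ t) \<partial>\<U>) \<partial>\<U>)"
  proof (rule nn_integral_cong)
    fix r :: real assume "r \<in> space \<U>"
    then have r: "0 \<le> r" by simp
    have [measurable]: "(\<lambda>t. complex_of_real r * circ t) \<in> \<U> \<rightarrow>\<^sub>M borel" by (rule borel_measurable_U) measurable
    have "(\<integral>\<^sup>+t. ennreal (1 / pi) * (ennreal (w (cmod (of_real r * circ t))) * indicator A (of_real r * circ t)) \<partial>\<U>)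
      = (\<integral>\<^sup>+t. (ennreal (1 / pi) * ennreal (w r)) * indicator A (of_real r * circ t) \<partial>\<U>)"
      using r by (simp add: norm_mult mult_ac)
    also have "\<dots> = ennreal (1 / pi) * ennreal (w r) * (\<integral>\<^sup>+t. indicator A (of_real r * circ t) \<partial>\<U>)"
      by (rule nn_integral_cmult) measurable
    finally show "ennreal (2 * pi * r) * (\<integral>\<^sup>+t. ennreal (1 / pi) * (ennreal (w (cmod (of_real r * circ t))) * indicator A (of_real r * circ t)) \<partial>\<U>) 
      = ennreal (2 * r) * ennreal (w r) * (\<integral>\<^sup>+t. indicator A (of_real r * circ t) \<partial>\<U>)"
      using r nn by (simp add: mult.assoc[symmetric] ennreal_mult[symmetric])
  qed
  also have "\<dots> = (\<integral>\<^sup>+z. indicator A z \<partial>disc_measure (\<lambda>s. ennreal (w s)))"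
    using A by (subst nn_integral_disc_measure) auto
  also have "\<dots> = emeasure (disc_measure (\<lambda>s. ennreal (w s))) A"
    using A by simp
  finally show "emeasure (distr (density area (\<lambda>z. ennreal (\<omega> z))) \<D> (\<lambda>z. z)) A = emeasure (disc_measure (\<lambda>s. ennreal (w s))) A" .
qed simp

lemma area_radial_integral:
  fixes \<phi> :: "complex \<Rightarrow> 'b::{banach, second_countable_topology}"
  assumes \<omega>: "radial_weight \<omega>" and w: "w \<in> borel_measurable borel" "\<And>s. 0 \<le> w s"
    and ae: "AE z in area. \<omega> z = w (cmod z)" and \<phi>: "\<phi> \<in> borel_measurable \<D>"
  shows "integrable area (\<lambda>z. \<omega> z *\<^sub>R \<phi> z) \<longleftrightarrow> integrable (disc_measure (\<lambda>s. ennreal (w s))) \<phi>"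
    and "(LINT z|area. \<omega> z *\<^sub>R \<phi> z) = integral\<^sup>L (disc_measure (\<lambda>s. ennreal (w s))) \<phi>"
proof -
  note idm [measurable] = ident_measurable_area
  have \<omega>m [measurable]: "\<omega> \<in> borel_measurable area"
    using radial_weightD(3)[OF \<omega>] by (rule borel_measurable_integrable)
  have [measurable]: "\<phi> \<in> borel_measurable area" using \<phi> by (rule borel_measurable_area)
  have nn: "AE z in area. 0 \<le> \<omega> z" using radial_weightD(1)[OF \<omega>] by (intro AE_I2) simp
  show "integrable area (\<lambda>z. \<omega> z *\<^sub>R \<phi> z) \<longleftrightarrow> integrable (disc_measure (\<lambda>s. ennreal (w s))) \<phi>"
    unfolding distr_area_radial[OF \<omega> w ae, symmetric] using \<phi> nn
    by (subst integrable_distr_eq) (auto simp: integrable_density)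
  show "(LINT z|area. \<omega> z *\<^sub>R \<phi> z) = integral\<^sup>L (disc_measure (\<lambda>s. ennreal (w s))) \<phi>"
    unfolding distr_area_radial[OF \<omega> w ae, symmetric] using \<phi> nn
    by (subst integral_distr) (auto simp: integral_density)
qed

section \<open>Orthogonality and Parseval's identity on the circle\<close>

lemma cis_integral: "(\<integral>t. cis (2 * pi * (of_int m * t)) \<partial>\<U>) = (if m = 0 then 1 else 0)"
proof (cases "m = 0")
  case True
  then show ?thesis by (simp add: measure_restrict_space measure_def emeasure_restrict_space)
next
  case False
  define a where "a = 2 * of_real pi * of_int m * \<i>"
  have a0: "a \<noteq> 0" using False by (simp add: a_def)
  define F where "F t = exp (of_real t * a) / a" for t :: real
  have cisa: "cis (2 * pi * (of_int m * t)) = exp (of_real t * a)" for t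
    by (simp add: cis_conv_exp a_def mult_ac)
  have F: "(F has_vector_derivative cis (2 * pi * (of_int m * t))) (at t within {0..1})" for t
    unfolding F_def cisa
    by (rule has_vector_derivative_real_field[of "\<lambda>z. exp (z * a) / a"])
       (use a0 in \<open>auto intro!: derivative_eq_intros\<close>)
  have [measurable]: "(\<lambda>t. cis (2 * pi * (of_int m * t))) \<in> borel_measurable borel"
    by (intro borel_measurable_continuous_onI continuous_intros)
  have "(\<integral>t. cis (2 * pi * (of_int m * t)) \<partial>\<U>) = (\<integral>t. indicator {0..<1} t *\<^sub>R cis (2 * pi * (of_int m * t)) \<partial>lborel)"
    by (subst integral_restrict_space) (auto simp: set_lebesgue_integral_def)
  also have "\<dots> = (\<integral>t. indicator {0..1} t *\<^sub>R cis (2 * pi * (of_int m * t)) \<partial>lborel)"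
  proof (rule integral_cong_AE)
    have "AE t in lborel. t \<noteq> (1::real)" by (simp add: AE_lborel_singleton)
    then show "AE t in lborel. indicator {0..<1} t *\<^sub>R cis (2 * pi * (of_int m * t)) = indicator {0..1} t *\<^sub>R cis (2 * pi * (of_int m * t))"
      by eventually_elim (auto simp: indicator_def)
  qed (measurable, measurable)
  also have "\<dots> = F 1 - F 0"
    by (rule integral_FTC_Icc) (auto intro!: F continuous_intros)
  also have "\<dots> = 0"
    using cisa[of 1] cis_multiple_2pi[of "of_int m"] by (simp add: F_def mult_ac)
  finally show ?thesis using False by simp
qed

lemma circ_power: "circ t ^ k = cis (2 * pi * (real k * t))"
  unfolding circ_def Complex.DeMoivre by (simp add: mult_ac)

lemma borel_measurable_cnj [measurable (raw)]:
  "f \<in> borel_measurable M \<Longrightarrow> (\<lambda>x. cnj (f x)) \<in> borel_measurable M"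
  by (rule measurable_compose[of _ _ borel]) (auto intro!: borel_measurable_continuous_onI continuous_intros)

lemma circ_orthogonal: "(\<integral>t. circ t ^ j * cnj (circ t) ^ k \<partial>\<U>) = (if j = k then 1 else 0)"
proof -
  have "circ t ^ j * cnj (circ t) ^ k = cis (2 * pi * (of_int (int j - int k) * t))" for t
    unfolding complex_cnj_power[symmetric] circ_power by (simp add: cis_cnj cis_mult algebra_simps)
  then show ?thesis by (simp only: cis_integral) auto
qed

lemma circ_measurable_U [measurable]: "circ \<in> borel_measurable \<U>"
  by (rule borel_measurable_U) measurable

text \<open>Summable coefficients and factors bounded by 1 dominate the series by a multiple of
  \<phi>, so sum and integral may be exchanged. It serves circle averages and integrals over the
  disc alike.\<close>

lemma integral_bounded_series:
  fixes e :: "nat \<Rightarrow> 'a \<Rightarrow> complex"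
  assumes a: "summable (\<lambda>k. norm (a k :: complex))" and \<phi>: "integrable M \<phi>"
    and e [measurable]: "\<And>k. e k \<in> borel_measurable M" and e1: "\<And>k x. x \<in> space M \<Longrightarrow> norm (e k x) \<le> 1"
  shows "integrable M (\<lambda>x. (\<Sum>k. a k * e k x) * \<phi> x)"
    and "(\<lambda>k. a k * (\<integral>x. e k x * \<phi> x \<partial>M)) sums (\<integral>x. (\<Sum>k. a k * e k x) * \<phi> x \<partial>M)"
proof -
  define f where "f k x = a k * (e k x * \<phi> x)" for k x
  have \<phi>m [measurable]: "\<phi> \<in> borel_measurable M" using \<phi> by auto
  have ie: "integrable M (\<lambda>x. e k x * \<phi> x)" for k
  proof (rule Bochner_Integration.integrable_bound[OF \<phi>])
    show "AE x in M. norm (e k x * \<phi> x) \<le> norm (\<phi> x)"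
      using e1 by (auto simp: norm_mult intro!: AE_I2 mult_left_le_one_le)
  qed measurable
  then have f_int: "integrable M (f k)" for k unfolding f_def by (rule integrable_mult_right)
  have sae: "summable (\<lambda>k. norm (a k * e k x))" if "x \<in> space M" for x
    by (rule summable_comparison_test'[OF a, of 0]) (auto simp: norm_mult intro!: mult_left_le e1 that)
  have sf: "summable (\<lambda>k. norm (f k x))" if "x \<in> space M" for x
    using summable_mult2[OF sae[OF that], of "norm (\<phi> x)"] by (simp add: f_def norm_mult mult_ac)
  have AEs: "AE x in M. summable (\<lambda>k. norm (f k x))" using sf by (rule AE_I2)
  have b: "norm (\<integral>x. norm (f k x) \<partial>M) \<le> norm (a k) * (\<integral>x. norm (\<phi> x) \<partial>M)" for k
  proof -
    have "(\<integral>x. norm (f k x) \<partial>M) \<le> (\<integral>x. norm (a k) * norm (\<phi> x) \<partial>M)"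
      using f_int[of k] \<phi> e1
      by (intro integral_mono integrable_norm integrable_mult_right f_int) (auto simp: f_def norm_mult intro!: mult_left_mono mult_left_le_one_le)
    then show ?thesis by (simp add: integral_nonneg_AE)
  qed
  have "summable (\<lambda>k. \<integral>x. norm (f k x) \<partial>M)"
    by (rule summable_comparison_test'[OF summable_mult2[OF a], of 0]) (use b in auto)
  note I = integrable_suminf[OF f_int AEs this] sums_integral[OF f_int AEs this]
  have eq: "(\<Sum>k. f k x) = (\<Sum>k. a k * e k x) * \<phi> x" if "x \<in> space M" for x
    using suminf_mult2[OF summable_norm_cancel[OF sae[OF that]], of "\<phi> x"] by (simp add: f_def mult_ac)
  show "integrable M (\<lambda>x. (\<Sum>k. a k * e k x) * \<phi> x)"
    using I(1) eq by (simp cong: Bochner_Integration.integrable_cong)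
  have "(\<integral>x. (\<Sum>k. f k x) \<partial>M) = (\<integral>x. (\<Sum>k. a k * e k x) * \<phi> x \<partial>M)"
    using eq by (intro Bochner_Integration.integral_cong) auto
  with I(2) show "(\<lambda>k. a k * (\<integral>x. e k x * \<phi> x \<partial>M)) sums (\<integral>x. (\<Sum>k. a k * e k x) * \<phi> x \<partial>M)"
    by (simp add: f_def)
qed

lemma circle_series_integrable:
  assumes b: "summable (\<lambda>k. norm (b k :: complex))"
  shows "integrable \<U> (\<lambda>t. \<Sum>k. b k * cnj (circ t) ^ k)"
  using integral_bounded_series(1)[OF b, of \<U> "\<lambda>_. 1" "\<lambda>k t. cnj (circ t) ^ k"]
  by (simp add: norm_power)

lemma circle_series_coeff:
  assumes b: "summable (\<lambda>k. norm (b k :: complex))"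
  shows "(\<integral>t. circ t ^ j * (\<Sum>k. b k * cnj (circ t) ^ k) \<partial>\<U>) = b j"
proof -
  have "(\<lambda>k. b k * (\<integral>t. cnj (circ t) ^ k * circ t ^ j \<partial>\<U>)) sums (\<integral>t. (\<Sum>k. b k * cnj (circ t) ^ k) * circ t ^ j \<partial>\<U>)"
    by (intro integral_bounded_series b U.integrable_const_bound[of _ 1]) (auto simp: norm_power)
  moreover have "(\<lambda>k. b k * (\<integral>t. cnj (circ t) ^ k * circ t ^ j \<partial>\<U>)) = (\<lambda>k. if k = j then b j else 0)"
    using circ_orthogonal by (auto simp: mult.commute fun_eq_iff)
  ultimately have "(\<lambda>k. if k = j then b j else 0) sums (\<integral>t. (\<Sum>k. b k * cnj (circ t) ^ k) * circ t ^ j \<partial>\<U>)"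
    by simp
  then have "(\<integral>t. (\<Sum>k. b k * cnj (circ t) ^ k) * circ t ^ j \<partial>\<U>) = b j"
    using sums_single[of j "\<lambda>_. b j"] by (rule sums_unique2)
  then show ?thesis by (simp add: mult.commute)
qed

text \<open>Parseval in bilinear form: the conjugation sits on the powers and not on the
  coefficients, so the average multiplies two coefficient sequences termwise. This is how moments
  are later cancelled by the kernel.\<close>

lemma circle_parseval:
  assumes a: "summable (\<lambda>k. norm (a k :: complex))" and b: "summable (\<lambda>k. norm (b k :: complex))"
  shows "(\<lambda>k. a k * b k) sums (\<integral>t. (\<Sum>k. a k * circ t ^ k) * (\<Sum>k. b k * cnj (circ t) ^ k) \<partial>\<U>)"
  using integral_bounded_series(2)[OF a circle_series_integrable[OF b], of "\<lambda>k t. circ t ^ k"]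
  by (simp add: circle_series_coeff[OF b] norm_power)

subsection \<open>Power series on the disc\<close>

definition taylor :: "(complex \<Rightarrow> complex) \<Rightarrow> nat \<Rightarrow> complex" where
  "taylor f k = (deriv ^^ k) f 0 / fact k"

lemma taylor_sums:
  assumes "f holomorphic_on unit_disc" "z \<in> unit_disc"
  shows "(\<lambda>k. taylor f k * z ^ k) sums f z"
  using holomorphic_power_series[of f 0 1 z] assms by (simp add: taylor_def)

lemma power_series_summable_norm:
  fixes a :: "nat \<Rightarrow> complex"
  assumes "\<And>z. z \<in> unit_disc \<Longrightarrow> (\<lambda>k. a k * z ^ k) sums f z" "w \<in> unit_disc"
  shows "summable (\<lambda>k. norm (a k * w ^ k))"
proof -
  obtain r where r: "cmod w < r" "r < 1" using assms(2) dense[of "cmod w" 1] by auto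
  have "summable (\<lambda>k. a k * of_real r ^ k)"
    using assms(1)[of "of_real r"] r norm_ge_zero[of w] by (intro sums_summable) auto
  then show ?thesis by (rule powser_insidea) (use r in auto)
qed

lemma taylor_summable:
  assumes "f holomorphic_on unit_disc" "z \<in> unit_disc"
  shows "summable (\<lambda>k. norm (taylor f k * z ^ k))"
  using power_series_summable_norm[OF taylor_sums[OF assms(1)] assms(2)] .

lemma power_series_circle_coeff:
  fixes a :: "nat \<Rightarrow> complex"
  assumes f: "\<And>z. z \<in> unit_disc \<Longrightarrow> (\<lambda>k. a k * z ^ k) sums f z" and r: "0 \<le> r" "r < 1"
  shows "(\<integral>t. f (of_real r * circ t) * cnj (circ t) ^ j \<partial>\<U>) = a j * of_real r ^ j"
proof -
  have s: "summable (\<lambda>k. norm (a k * of_real r ^ k))"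
    by (rule power_series_summable_norm[OF f]) (use r in auto)
  have eq: "(\<Sum>k. (a k * of_real r ^ k) * circ t ^ k) = f (of_real r * circ t)" for t
    using f[of "of_real r * circ t"] r by (auto simp: sums_iff norm_mult power_mult_distrib mult.assoc)
  have "(\<lambda>k. (a k * of_real r ^ k) * (\<integral>t. circ t ^ k * cnj (circ t) ^ j \<partial>\<U>)) sums
      (\<integral>t. (\<Sum>k. (a k * of_real r ^ k) * circ t ^ k) * cnj (circ t) ^ j \<partial>\<U>)"
    by (intro integral_bounded_series s U.integrable_const_bound[of _ 1]) (auto simp: norm_power)
  moreover have "(\<lambda>k. (a k * of_real r ^ k) * (\<integral>t. circ t ^ k * cnj (circ t) ^ j \<partial>\<U>)) = (\<lambda>k. if k = j then a j * of_real r ^ j else 0)"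
    by (auto simp: circ_orthogonal fun_eq_iff)
  ultimately show ?thesis
    using sums_unique2[OF _ sums_single[of j "\<lambda>_. a j * of_real r ^ j"]] by (simp add: eq)
qed

text \<open>The coefficients are recovered from averages over the circle of radius 1/2, hence the
  expansion is unique.\<close>

lemma power_series_taylor:
  assumes f: "\<And>z. z \<in> unit_disc \<Longrightarrow> (\<lambda>k. a k * z ^ k) sums f z"
  shows "f holomorphic_on unit_disc" "taylor f = a"
proof -
  show h: "f holomorphic_on unit_disc"
    by (rule power_series_holomorphic[of _ _ a]) (use f in auto)
  show "taylor f = a"
  proof
    fix j
    have "taylor f j * of_real (1/2) ^ j = a j * of_real (1/2) ^ j"
      using power_series_circle_coeff[OF taylor_sums[OF h], of "1/2" j] power_series_circle_coeff[OF f, of "1/2" j] by simp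
    then show "taylor f j = a j" by simp
  qed
qed

subsection \<open>Means over circles\<close>

lemma circle_measurable:
  assumes "u \<in> borel_measurable \<D>" "0 \<le> r" "r < 1"
  shows "(\<lambda>t. u (complex_of_real r * circ t)) \<in> borel_measurable \<U>"
  by (rule measurable_compose[OF _ assms(1)], rule measurable_restrict_space2)
     (use assms(2,3) in \<open>auto simp: norm_mult\<close>)

lemma continuous_on_measurable_D:
  "continuous_on unit_disc f \<Longrightarrow> f \<in> borel_measurable \<D>"
  by (rule borel_measurable_continuous_on_restrict)

lemma holomorphic_measurable_D: "f holomorphic_on unit_disc \<Longrightarrow> f \<in> borel_measurable \<D>"
  by (intro continuous_on_measurable_D holomorphic_on_imp_continuous_on)

lemma continuous_circle_bounded:
  fixes u :: "complex \<Rightarrow> 'b::real_normed_vector"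
  assumes "continuous_on unit_disc u" "0 \<le> r" "r < 1"
  obtains B where "\<And>z. cmod z \<le> r \<Longrightarrow> norm (u z) \<le> B"
proof -
  have "compact (u ` cball 0 r)"
    by (intro compact_continuous_image continuous_on_subset[OF assms(1)]) (use assms in auto)
  then obtain B where "\<forall>x\<in>u ` cball 0 r. norm x \<le> B"
    using compact_imp_bounded bounded_iff by blast
  then show ?thesis using that[of B] by auto
qed

lemma circle_integrable:
  fixes u :: "complex \<Rightarrow> 'b::{banach, second_countable_topology}"
  assumes u: "continuous_on unit_disc u" and r: "0 \<le> r" "r < 1"
  shows "integrable \<U> (\<lambda>t. u (of_real r * circ t))"
proof -
  obtain B where B: "\<And>z. cmod z \<le> r \<Longrightarrow> norm (u z) \<le> B"
    using continuous_circle_bounded[OF assms] by auto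
  show ?thesis
    using circle_measurable[OF continuous_on_measurable_D[OF u] r] r
    by (intro U.integrable_const_bound[of _ B]) (auto intro!: B simp: norm_mult)
qed

definition circ_mean :: "(complex \<Rightarrow> real) \<Rightarrow> real \<Rightarrow> real" where
  "circ_mean u r = (\<integral>t. u (of_real r * circ t) \<partial>\<U>)"

lemma circ_mean_nn:
  assumes u: "continuous_on unit_disc u" "\<And>z. 0 \<le> u z" and r: "0 \<le> r" "r < 1"
  shows "(\<integral>\<^sup>+t. ennreal (u (of_real r * circ t)) \<partial>\<U>) = ennreal (circ_mean u r)"
  unfolding circ_mean_def using circle_integrable[OF u(1) r] u(2)
  by (intro nn_integral_eq_integral) auto

lemma circ_mean_nonneg: "(\<And>z. 0 \<le> u z) \<Longrightarrow> 0 \<le> circ_mean u r"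
  unfolding circ_mean_def by (simp add: integral_nonneg_AE)

lemma circ_mean_shift:
  assumes u: "continuous_on unit_disc u" "\<And>z. 0 \<le> u z" and z: "z \<in> unit_disc"
  shows "(\<integral>t. u (z * circ t) \<partial>\<U>) = circ_mean u (cmod z)" "integrable \<U> (\<lambda>t. u (z * circ t))"
proof -
  obtain s where s: "s \<in> {0..<1}" "z = of_real (cmod z) * circ s" using circ_polar by blast
  \<comment> \<open>Extension by zero gives a Borel function on the plane, as
    \<open>nn_integral_circ_shift\<close> requires.\<close>
  define v where "v y = (if y \<in> unit_disc then u y else 0)" for y
  have vm [measurable]: "v \<in> borel_measurable borel"
  proof -
    have "v = (\<lambda>y. indicator unit_disc y *\<^sub>R u y)" by (auto simp: v_def indicator_def)
    then show ?thesis
      using continuous_on_measurable_D[OF u(1)] by (subst (asm) borel_measurable_restrict_space_iff) auto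
  qed
  have v: "v (z * circ t) = u (z * circ t)" "v (of_real (cmod z) * circ t) = u (of_real (cmod z) * circ t)" for t
    using z by (auto simp: v_def norm_mult)
  have "(\<integral>\<^sup>+t. ennreal (u (z * circ t)) \<partial>\<U>) = (\<integral>\<^sup>+t. ennreal (v (of_real (cmod z) * circ (s + t))) \<partial>\<U>)"
    by (subst v(1)[symmetric], subst s(2)) (simp add: circ_add mult_ac)
  also have "\<dots> = (\<integral>\<^sup>+t. ennreal (v (of_real (cmod z) * circ t)) \<partial>\<U>)"
    using s(1) by (intro nn_integral_circ_shift[of "\<lambda>w. ennreal (v (of_real (cmod z) * w))"]) measurable
  also have "\<dots> = ennreal (circ_mean u (cmod z))"
    unfolding v using u z by (intro circ_mean_nn) auto
  finally have e: "(\<integral>\<^sup>+t. ennreal (u (z * circ t)) \<partial>\<U>) = ennreal (circ_mean u (cmod z))" .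
  have m: "(\<lambda>t. u (z * circ t)) \<in> borel_measurable \<U>"
    unfolding v(1)[symmetric] by measurable
  show "integrable \<U> (\<lambda>t. u (z * circ t))"
    by (rule integrableI_nonneg) (use m u(2) e in auto)
  show "(\<integral>t. u (z * circ t) \<partial>\<U>) = circ_mean u (cmod z)"
    using m u(2) e circ_mean_nonneg[of u "cmod z"] by (subst integral_eq_nn_integral) auto
qed

lemma taylor_deriv: "taylor (deriv f) k = of_nat (Suc k) * taylor f (Suc k)"
  by (simp add: taylor_def funpow_swap1[of deriv] field_simps del: of_nat_Suc)

text \<open>The circle mean of \<open>\<bar>H\<bar>\<close> at one radius is the value of a holomorphic function
  that is dominated by the circle means of \<open>\<bar>H\<bar>\<close> at all radii: integrate against a fixed unimodular function.\<close>

lemma circ_mean_dual: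
  assumes H: "H holomorphic_on unit_disc" and r: "0 \<le> r" "r < 1"
  obtains F where "F holomorphic_on unit_disc" "F (of_real r) = of_real (circ_mean (\<lambda>z. cmod (H z)) r)"
    "\<And>z. z \<in> unit_disc \<Longrightarrow> cmod (F z) \<le> circ_mean (\<lambda>z. cmod (H z)) (cmod z)"
    "\<And>z. z \<in> unit_disc \<Longrightarrow> cmod (deriv F z) \<le> circ_mean (\<lambda>z. cmod (deriv H z)) (cmod z)"
proof -
  \<comment> \<open>The conjugate sign of \<open>H\<close> on the chosen circle, so that
    \<open>H * \<kappa>\<close> is the modulus of \<open>H\<close> there; it is 0 where
    \<open>H\<close> vanishes.\<close>
  define \<kappa> where "\<kappa> t = cnj (sgn (H (of_real r * circ t)))" for t
  have Hm: "(\<lambda>t. H (of_real r * circ t)) \<in> borel_measurable \<U>"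
    by (rule circle_measurable[OF holomorphic_measurable_D[OF H]]) (use r in auto)
  have \<kappa>m [measurable]: "\<kappa> \<in> borel_measurable \<U>"
    unfolding \<kappa>_def sgn_div_norm using Hm by measurable
  have \<kappa>1: "norm (\<kappa> t) \<le> 1" for t by (simp add: \<kappa>_def norm_sgn)
  have series: "(\<lambda>k. (taylor G k * (\<integral>t. circ t ^ k * \<eta> t \<partial>\<U>)) * z ^ k) sums (\<integral>t. G (z * circ t) * \<eta> t \<partial>\<U>)"
    if G: "G holomorphic_on unit_disc" and z: "z \<in> unit_disc" and \<eta>: "\<And>t. norm (\<eta> t) \<le> 1" "\<eta> \<in> borel_measurable \<U>" for G z \<eta>
  proof -
    have \<eta>int: "integrable \<U> \<eta>"
      by (rule U.integrable_const_bound[of _ 1]) (use \<eta> in auto)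
    have eq: "(\<Sum>k. (taylor G k * z ^ k) * circ t ^ k) = G (z * circ t)" for t
      using taylor_sums[OF G, of "z * circ t"] z by (auto simp: sums_iff norm_mult power_mult_distrib mult.assoc)
    have "(\<lambda>k. (taylor G k * z ^ k) * (\<integral>t. circ t ^ k * \<eta> t \<partial>\<U>)) sums (\<integral>t. (\<Sum>k. (taylor G k * z ^ k) * circ t ^ k) * \<eta> t \<partial>\<U>)"
      by (intro integral_bounded_series taylor_summable G z \<eta>int) (auto simp: norm_power)
    then show ?thesis unfolding eq by (simp add: mult_ac)
  qed
  have bound: "norm (\<integral>t. G (z * circ t) * \<eta> t \<partial>\<U>) \<le> circ_mean (\<lambda>z. cmod (G z)) (cmod z)"
    if G: "G holomorphic_on unit_disc" and z: "z \<in> unit_disc" and \<eta>: "\<And>t. norm (\<eta> t) \<le> 1" for G z \<eta>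
  proof -
    have cG: "continuous_on unit_disc (\<lambda>z. cmod (G z))"
      by (intro continuous_intros holomorphic_on_imp_continuous_on G)
    note sh = circ_mean_shift[OF cG _ z]
    have "norm (\<integral>t. G (z * circ t) * \<eta> t \<partial>\<U>) \<le> (\<integral>t. norm (G (z * circ t) * \<eta> t) \<partial>\<U>)"
      by (rule integral_norm_bound)
    also have "\<dots> \<le> (\<integral>t. cmod (G (z * circ t)) \<partial>\<U>)"
      using sh(2) by (intro Bochner_Integration.integral_mono_AE') (auto simp: norm_mult intro!: mult_left_le \<eta>)
    also have "\<dots> = circ_mean (\<lambda>z. cmod (G z)) (cmod z)" using sh(1) by simp
    finally show ?thesis .
  qed
  define F where "F z = (\<integral>t. H (z * circ t) * \<kappa> t \<partial>\<U>)" for z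
  have Fs: "(\<lambda>k. (taylor H k * (\<integral>t. circ t ^ k * \<kappa> t \<partial>\<U>)) * z ^ k) sums F z" if z: "z \<in> unit_disc" for z
    unfolding F_def by (rule series[OF H z \<kappa>1 \<kappa>m])
  have F: "F holomorphic_on unit_disc" "taylor F = (\<lambda>k. taylor H k * (\<integral>t. circ t ^ k * \<kappa> t \<partial>\<U>))"
    using power_series_taylor[of "\<lambda>k. taylor H k * (\<integral>t. circ t ^ k * \<kappa> t \<partial>\<U>)" F] Fs by blast+
  have dH: "deriv H holomorphic_on unit_disc" by (rule holomorphic_deriv[OF H open_ball])
  have dF: "deriv F holomorphic_on unit_disc" by (rule holomorphic_deriv[OF F(1) open_ball])
  \<comment> \<open>Differentiation under the integral brings out a factor \<open>circ t\<close>; it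
    is unimodular and is absorbed into \<open>\<kappa>\<close>.\<close>
  have \<kappa>2: "norm (circ t * \<kappa> t) \<le> 1" for t using \<kappa>1[of t] by (simp add: norm_mult)
  have dFeq: "deriv F z = (\<integral>t. deriv H (z * circ t) * (circ t * \<kappa> t) \<partial>\<U>)" if z: "z \<in> unit_disc" for z
  proof -
    have "taylor (deriv F) k = taylor (deriv H) k * (\<integral>t. circ t ^ k * (circ t * \<kappa> t) \<partial>\<U>)" for k
    proof -
      have "taylor F (Suc k) = taylor H (Suc k) * (\<integral>t. circ t ^ k * (circ t * \<kappa> t) \<partial>\<U>)"
        unfolding F(2) by (simp only: power_Suc2 mult.assoc)
      then show ?thesis by (simp only: taylor_deriv mult.assoc)
    qed
    then have "(\<lambda>k. taylor (deriv F) k * z ^ k) sums (\<integral>t. deriv H (z * circ t) * (circ t * \<kappa> t) \<partial>\<U>)"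
      using series[OF dH z \<kappa>2] by simp
    with taylor_sums[OF dF z] show ?thesis by (rule sums_unique2)
  qed
  have "H (of_real r * circ t) * \<kappa> t = of_real (cmod (H (of_real r * circ t)))" for t
  proof (cases "H (of_real r * circ t) = 0")
    case False
    then show ?thesis
      using complex_norm_square[of "H (of_real r * circ t)"]
      by (simp add: \<kappa>_def sgn_div_norm scaleR_conv_of_real field_simps power2_eq_square)
  qed simp
  then have Fr: "F (of_real r) = of_real (circ_mean (\<lambda>z. cmod (H z)) r)" by (simp add: F_def circ_mean_def)
  show ?thesis
  proof (rule that[of F])
    show "cmod (deriv F z) \<le> circ_mean (\<lambda>z. cmod (deriv H z)) (cmod z)" if "z \<in> unit_disc" for z
      unfolding dFeq[OF that] by (rule bound[OF dH that \<kappa>2])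
    show "cmod (F z) \<le> circ_mean (\<lambda>z. cmod (H z)) (cmod z)" if "z \<in> unit_disc" for z
      unfolding F_def by (rule bound[OF H that \<kappa>1])
  qed (fact F(1) Fr)+
qed

text \<open>The maximum modulus principle for the dual function \<open>F\<close> on the disc of
  radius \<open>r'\<close> takes the place of subharmonicity of the modulus of
  \<open>H\<close>.\<close>

lemma circ_mean_norm_mono:
  assumes H: "H holomorphic_on unit_disc" and r: "0 \<le> r" "r \<le> r'" "r' < 1"
  shows "circ_mean (\<lambda>z. cmod (H z)) r \<le> circ_mean (\<lambda>z. cmod (H z)) r'"
proof (cases "r = r'")
  case False
  have "r < 1" using r by simp
  then obtain F where F: "F holomorphic_on unit_disc" "F (of_real r) = of_real (circ_mean (\<lambda>z. cmod (H z)) r)"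
    "\<And>z. z \<in> unit_disc \<Longrightarrow> cmod (F z) \<le> circ_mean (\<lambda>z. cmod (H z)) (cmod z)"
    using circ_mean_dual[OF H r(1)] by metis
  have "norm (F (of_real r)) \<le> circ_mean (\<lambda>z. cmod (H z)) r'"
  proof (rule maximum_modulus_frontier[of F "ball 0 r'"])
    show "F holomorphic_on interior (ball 0 r')"
      by (rule holomorphic_on_subset[OF F(1)]) (use r in auto)
    show "continuous_on (closure (ball 0 r')) F"
      using r False by (intro continuous_on_subset[OF holomorphic_on_imp_continuous_on[OF F(1)]]) auto
    show "cmod (F z) \<le> circ_mean (\<lambda>z. cmod (H z)) r'" if "z \<in> frontier (ball 0 r')" for z
      using F(3)[of z] that r False by (simp add: frontier_ball)
  qed (use r False in auto)
  then show ?thesis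
    unfolding F(2) using circ_mean_nonneg[of "\<lambda>z. cmod (H z)" r] by simp
qed simp

text \<open>Cauchy's formula, obtained from Parseval against the geometric series in
  \<open>q = z / r\<close>; its kernel is at most \<open>1 / (1 - norm q)\<close> in
  modulus.\<close>

lemma norm_le_circ_mean:
  assumes H: "H holomorphic_on unit_disc" and z: "cmod z < r" "r < 1"
  shows "cmod (H z) * (1 - cmod z / r) \<le> circ_mean (\<lambda>z. cmod (H z)) r"
proof -
  have r0: "0 < r" using z norm_ge_zero[of z] by linarith
  define q where "q = z / of_real r"
  have q1: "norm q < 1" using z r0 by (simp add: q_def norm_divide)
  have sH: "summable (\<lambda>k. norm (taylor H k * of_real r ^ k))"
    by (rule taylor_summable[OF H]) (use r0 z in auto)
  have sq: "summable (\<lambda>k. norm (q ^ k))"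
    using q1 by (simp add: norm_power summable_geometric)
  have e1: "(\<Sum>k. (taylor H k * of_real r ^ k) * circ t ^ k) = H (of_real r * circ t)" for t
    using taylor_sums[OF H, of "of_real r * circ t"] z r0 by (auto simp: sums_iff norm_mult power_mult_distrib mult.assoc)
  have e2: "(\<Sum>k. q ^ k * cnj (circ t) ^ k) = 1 / (1 - q * cnj (circ t))" for t
    using q1 suminf_geometric[of "q * cnj (circ t)"] by (simp add: norm_mult power_mult_distrib)
  have "(\<lambda>k. (taylor H k * of_real r ^ k) * q ^ k) sums (\<integral>t. H (of_real r * circ t) * (1 / (1 - q * cnj (circ t))) \<partial>\<U>)"
    using circle_parseval[OF sH sq] by (simp only: e1 e2)
  moreover have "(\<lambda>k. (taylor H k * of_real r ^ k) * q ^ k) sums H z"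
    using taylor_sums[OF H, of z] z r0 by (simp add: q_def power_divide)
  ultimately have Hz: "H z = (\<integral>t. H (of_real r * circ t) * (1 / (1 - q * cnj (circ t))) \<partial>\<U>)"
    by (rule sums_unique2[rotated])
  have cH: "continuous_on unit_disc (\<lambda>z. cmod (H z))"
    by (intro continuous_intros holomorphic_on_imp_continuous_on H)
  have i: "integrable \<U> (\<lambda>t. cmod (H (of_real r * circ t)))"
    by (rule circle_integrable[OF cH]) (use r0 z in auto)
  have "cmod (H z) \<le> (\<integral>t. norm (H (of_real r * circ t) * (1 / (1 - q * cnj (circ t)))) \<partial>\<U>)"
    unfolding Hz by (rule integral_norm_bound)
  also have "\<dots> \<le> (\<integral>t. cmod (H (of_real r * circ t)) * (1 / (1 - norm q)) \<partial>\<U>)"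
  proof (rule Bochner_Integration.integral_mono_AE')
    have "1 - norm q \<le> norm (1 - q * cnj (circ t))" for t
      using norm_triangle_ineq2[of 1 "q * cnj (circ t)"] by (simp add: norm_mult)
    then have "1 / norm (1 - q * cnj (circ t)) \<le> 1 / (1 - norm q)" for t
      using q1 by (intro frac_le) auto
    then show "AE t in \<U>. norm (H (of_real r * circ t) * (1 / (1 - q * cnj (circ t)))) \<le> cmod (H (of_real r * circ t)) * (1 / (1 - norm q))"
      by (intro AE_I2) (simp only: norm_mult norm_divide norm_one, intro mult_left_mono, auto)
  qed (use i q1 in auto)
  also have "\<dots> = circ_mean (\<lambda>z. cmod (H z)) r / (1 - norm q)"
    by (simp add: circ_mean_def)
  finally show ?thesis using q1 r0 by (simp add: field_simps q_def norm_divide)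
qed

subsection \<open>Means of powers\<close>

lemma blaschke_factor_bound:
  assumes "cmod a < 1" "cmod z \<le> 1"
  shows "cmod (z - a) \<le> cmod (1 - cnj a * z)"
    and "cmod z = 1 \<Longrightarrow> cmod (z - a) = cmod (1 - cnj a * z)"
proof -
  have e: "(cmod (1 - cnj a * z))\<^sup>2 - (cmod (z - a))\<^sup>2 = (1 - (cmod a)\<^sup>2) * (1 - (cmod z)\<^sup>2)"
    unfolding cmod_power2 by (simp add: power2_eq_square algebra_simps)
  have "(cmod a)\<^sup>2 \<le> 1" "(cmod z)\<^sup>2 \<le> 1" using assms by (simp_all add: power_le_one)
  then have "0 \<le> (1 - (cmod a)\<^sup>2) * (1 - (cmod z)\<^sup>2)" by simp
  with e have "(cmod (z - a))\<^sup>2 \<le> (cmod (1 - cnj a * z))\<^sup>2" by linarith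
  then show "cmod (z - a) \<le> cmod (1 - cnj a * z)" by (rule power2_le_imp_le) simp
  show "cmod (z - a) = cmod (1 - cnj a * z)" if "cmod z = 1"
  proof -
    have "(cmod (z - a))\<^sup>2 = (cmod (1 - cnj a * z))\<^sup>2"
      using e unfolding that by simp
    then show ?thesis by (rule power2_eq_imp_eq) simp_all
  qed
qed

text \<open>Each zero in the disc is traded for the corresponding Blaschke denominator.\<close>

lemma poly_zero_free_majorant:
  fixes P :: "complex poly"
  assumes "P \<noteq> 0"
  shows "\<exists>Q. (\<forall>z. cmod z < 1 \<longrightarrow> poly Q z \<noteq> 0) \<and>
    (\<forall>z. cmod z \<le> 1 \<longrightarrow> cmod (poly P z) \<le> cmod (poly Q z)) \<and>
    (\<forall>z. cmod z = 1 \<longrightarrow> cmod (poly P z) = cmod (poly Q z))"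
  using assms
proof (induction "degree P" arbitrary: P rule: less_induct)
  case less
  show ?case
  proof (cases "degree P = 0")
    case True
    then obtain c where "P = [:c:]" by (rule degree_eq_zeroE)
    with less.prems show ?thesis by (intro exI[of _ P]) auto
  next
    case False
    then obtain a where "poly P a = 0"
      using Fundamental_Theorem_Algebra.fundamental_theorem_of_algebra[of P] constant_degree[of P] by auto
    then obtain P' where P': "P = [:-a, 1:] * P'" unfolding poly_eq_0_iff_dvd by (rule dvdE)
    with less.prems have n0: "P' \<noteq> 0" by auto
    have "degree P = Suc (degree P')" unfolding P' using n0 by (subst degree_mult_eq) auto
    then obtain Q' where Q': "\<And>z. cmod z < 1 \<Longrightarrow> poly Q' z \<noteq> 0"
      "\<And>z. cmod z \<le> 1 \<Longrightarrow> cmod (poly P' z) \<le> cmod (poly Q' z)"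
      "\<And>z. cmod z = 1 \<Longrightarrow> cmod (poly P' z) = cmod (poly Q' z)"
      using less.hyps[of P'] n0 by auto
    have lin: "poly [:-a, 1:] z = z - a" "poly [:1, - cnj a:] z = 1 - cnj a * z" for z by simp_all
    show ?thesis
    proof (cases "cmod a < 1")
      case True
      have nz: "1 - cnj a * z \<noteq> 0" if "cmod z < 1" for z
      proof
        assume "1 - cnj a * z = 0"
        then have "cmod (cnj a * z) = 1" by (metis eq_iff_diff_eq_0 norm_one)
        moreover have "cmod a * cmod z < 1"
          using mult_left_le[of "cmod z" "cmod a"] True that by simp
        ultimately show False by (simp add: norm_mult)
      qed
      show ?thesis
      proof (intro exI[of _ "[:1, - cnj a:] * Q'"] conjI allI impI)
        fix z assume "cmod z < 1"
        then show "poly ([:1, - cnj a:] * Q') z \<noteq> 0" using nz[of z] Q'(1)[of z] unfolding poly_mult lin by simp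
      next
        fix z assume "cmod z \<le> 1"
        then have "cmod (z - a) * cmod (poly P' z) \<le> cmod (1 - cnj a * z) * cmod (poly Q' z)"
          using blaschke_factor_bound(1)[OF True] Q'(2) by (intro mult_mono) auto
        then show "cmod (poly P z) \<le> cmod (poly ([:1, - cnj a:] * Q') z)"
          unfolding P' poly_mult norm_mult lin by simp
      next
        fix z assume "cmod z = 1"
        then have "cmod (z - a) * cmod (poly P' z) = cmod (1 - cnj a * z) * cmod (poly Q' z)"
          using blaschke_factor_bound(2)[OF True, of z] Q'(3) by simp
        then show "cmod (poly P z) = cmod (poly ([:1, - cnj a:] * Q') z)"
          unfolding P' poly_mult norm_mult lin by simp
      qed
    next
      case False
      \<comment> \<open>Zeros on or outside the unit circle stay as they are: their factors do not
        vanish in the open disc.\<close>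
      have nz: "z - a \<noteq> 0" if "cmod z < 1" for z using False that by auto
      show ?thesis
      proof (intro exI[of _ "[:-a, 1:] * Q'"] conjI allI impI)
        fix z assume "cmod z < 1"
        then show "poly ([:-a, 1:] * Q') z \<noteq> 0" using nz[of z] Q'(1)[of z] unfolding poly_mult lin by simp
      next
        fix z assume "cmod z \<le> 1"
        then show "cmod (poly P z) \<le> cmod (poly ([:-a, 1:] * Q') z)"
          using Q'(2)[of z] unfolding P' poly_mult norm_mult by (simp add: mult_left_mono)
      next
        fix z assume "cmod z = 1"
        then show "cmod (poly P z) = cmod (poly ([:-a, 1:] * Q') z)"
          using Q'(3)[of z] unfolding P' poly_mult norm_mult by simp
      qed
    qed
  qed
qed

lemma poly_bounded_cball:
  fixes P :: "complex poly"
  obtains B where "\<And>z. cmod z \<le> 1 \<Longrightarrow> cmod (poly P z) \<le> B"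
proof -
  have "compact (poly P ` cball 0 1)"
    by (intro compact_continuous_image continuous_intros) auto
  then obtain B where "\<forall>x\<in>poly P ` cball 0 1. norm x \<le> B"
    using compact_imp_bounded bounded_iff by blast
  then show ?thesis using that[of B] by auto
qed

lemma poly_circle_measurable [measurable]:
  "(\<lambda>t. poly P (of_real r * circ t)) \<in> borel_measurable \<U>" for P :: "complex poly"
  by (rule borel_measurable_U, rule measurable_compose[of _ _ borel])
     (auto intro!: borel_measurable_continuous_onI continuous_intros)

lemma poly_unit_circle_measurable [measurable]:
  "(\<lambda>t. poly P (circ t)) \<in> borel_measurable \<U>" for P :: "complex poly"
  using poly_circle_measurable[of P 1] by simp

text \<open>A zero-free majorant \<open>Q\<close> has a holomorphic logarithm, so
  \<open>cmod (poly Q z) powr p\<close> is the modulus of the holomorphic function \<open>H\<close>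
  and the case of exponent 1 applies. Nothing is lost on the unit circle, where \<open>P\<close> and
  \<open>Q\<close> have equal modulus. Since \<open>H\<close> lives on the open disc only, the
  circle of radius 1 is reached as a limit of the radii \<open>\<rho> n\<close>.\<close>

lemma poly_circ_mean_bounds:
  fixes P :: "complex poly"
  assumes p: "0 < p"
  shows "0 \<le> r \<Longrightarrow> r < 1 \<Longrightarrow>
      circ_mean (\<lambda>z. cmod (poly P z) powr p) r \<le> circ_mean (\<lambda>z. cmod (poly P z) powr p) 1"
    and "cmod z < 1 \<Longrightarrow>
      cmod (poly P z) powr p * (1 - cmod z) \<le> circ_mean (\<lambda>z. cmod (poly P z) powr p) 1"
proof -
  have "(0 \<le> r \<longrightarrow> r < 1 \<longrightarrow>
      circ_mean (\<lambda>z. cmod (poly P z) powr p) r \<le> circ_mean (\<lambda>z. cmod (poly P z) powr p) 1) \<and>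
     (cmod z < 1 \<longrightarrow> cmod (poly P z) powr p * (1 - cmod z) \<le> circ_mean (\<lambda>z. cmod (poly P z) powr p) 1)"
  proof (cases "P = 0")
    case True
    then show ?thesis by (simp add: circ_mean_def)
  next
    case False
    obtain Q where Q: "\<And>z. cmod z < 1 \<Longrightarrow> poly Q z \<noteq> 0"
      "\<And>z. cmod z \<le> 1 \<Longrightarrow> cmod (poly P z) \<le> cmod (poly Q z)"
      "\<And>z. cmod z = 1 \<Longrightarrow> cmod (poly P z) = cmod (poly Q z)"
      using poly_zero_free_majorant[OF False] by blast
    have hQ: "poly Q holomorphic_on unit_disc" by (intro holomorphic_intros)
    obtain L where L: "L holomorphic_on unit_disc" "\<And>z. z \<in> unit_disc \<Longrightarrow> poly Q z = exp (L z)"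
      using contractible_imp_holomorphic_log[OF hQ convex_imp_contractible[OF convex_ball]] Q(1) by (metis mem_ball_0)
    define H where "H z = exp (of_real p * L z)" for z
    have H: "H holomorphic_on unit_disc" unfolding H_def by (intro holomorphic_intros L)
    have nH: "cmod (H z) = cmod (poly Q z) powr p" if "cmod z < 1" for z
      using L(2)[of z] that by (simp add: H_def powr_def)
    obtain B where B: "\<And>z. cmod z \<le> 1 \<Longrightarrow> cmod (poly Q z) \<le> B" using poly_bounded_cball by blast
    obtain B' where B': "\<And>z. cmod z \<le> 1 \<Longrightarrow> cmod (poly P z) \<le> B'" using poly_bounded_cball by blast
    define I where "I s = circ_mean (\<lambda>z. cmod (poly Q z) powr p) s" for s
    have IH: "circ_mean (\<lambda>z. cmod (H z)) s = I s" if "0 \<le> s" "s < 1" for s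
      unfolding circ_mean_def I_def using that by (intro Bochner_Integration.integral_cong) (auto simp: nH norm_mult)
    define \<rho> where "\<rho> n = 1 - inverse (real (Suc n))" for n
    have \<rho>: "0 \<le> \<rho> n" "\<rho> n < 1" for n by (auto simp: \<rho>_def field_simps)
    have \<rho>l: "\<rho> \<longlonglongrightarrow> 1"
      unfolding \<rho>_def using tendsto_diff[OF tendsto_const LIMSEQ_inverse_real_of_nat, of 1] by simp
    have Il: "(\<lambda>n. I (\<rho> n)) \<longlonglongrightarrow> I 1"
      unfolding I_def circ_mean_def
    proof (rule integral_dominated_convergence[where w = "\<lambda>_. B powr p"])
      show "AE t in \<U>. (\<lambda>n. cmod (poly Q (of_real (\<rho> n) * circ t)) powr p) \<longlonglongrightarrow> cmod (poly Q (of_real 1 * circ t)) powr p"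
        using p by (intro AE_I2 tendsto_powr' tendsto_norm isCont_tendsto_compose[OF poly_isCont] tendsto_mult tendsto_const tendsto_of_real \<rho>l) auto
      show "AE t in \<U>. norm (cmod (poly Q (of_real (\<rho> n) * circ t)) powr p) \<le> B powr p" for n
        using \<rho>[of n] p by (intro AE_I2) (auto intro!: powr_mono2 B simp: norm_mult)
    qed auto
    have I1: "I 1 = circ_mean (\<lambda>z. cmod (poly P z) powr p) 1"
      unfolding I_def circ_mean_def by (simp add: Q(3))
    have "circ_mean (\<lambda>z. cmod (poly P z) powr p) r \<le> I 1" if r: "0 \<le> r" "r < 1"
    proof -
      have i: "integrable \<U> (\<lambda>t. cmod (poly S (of_real r * circ t)) powr p)" for S
      proof -
        obtain B where B: "\<And>z. cmod z \<le> 1 \<Longrightarrow> cmod (poly S z) \<le> B" using poly_bounded_cball by blast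
        show ?thesis using r p
          by (intro U.integrable_const_bound[of _ "B powr p"]) (auto intro!: powr_mono2 B simp: norm_mult)
      qed
      have "circ_mean (\<lambda>z. cmod (poly P z) powr p) r \<le> I r"
        unfolding I_def circ_mean_def using r p Q(2)
        by (intro integral_mono i powr_mono2) (auto simp: norm_mult)
      also have "\<dots> \<le> I 1"
      proof -
        obtain n0 where n0: "\<forall>n\<ge>n0. r < \<rho> n"
          using order_tendstoD(1)[OF \<rho>l r(2)] eventually_sequentially by auto
        have "I r \<le> I (\<rho> n)" if "n \<ge> n0" for n
          using circ_mean_norm_mono[OF H, of r "\<rho> n"] r \<rho>[of n] n0 that IH[of r] IH[of "\<rho> n"] by auto
        then show ?thesis by (intro Lim_bounded2[OF Il, of n0]) auto
      qed
      finally show ?thesis .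
    qed
    moreover have "cmod (poly P z) powr p * (1 - cmod z) \<le> I 1" if z: "cmod z < 1"
    proof -
      have "cmod (poly P z) powr p * (1 - cmod z) \<le> cmod (poly Q z) powr p * (1 - cmod z)"
        using Q(2)[of z] z p by (intro mult_right_mono powr_mono2) auto
      also have "\<dots> \<le> I 1"
      proof -
        obtain n0 where n0: "\<forall>n\<ge>n0. cmod z < \<rho> n"
          using order_tendstoD(1)[OF \<rho>l z] eventually_sequentially by auto
        have "cmod (poly Q z) powr p * (1 - cmod z / \<rho> n) \<le> I (\<rho> n)" if "n \<ge> n0" for n
          using norm_le_circ_mean[OF H, of z "\<rho> n"] n0 that \<rho>[of n] IH[of "\<rho> n"] nH[OF z] by simp
        then have ev: "\<exists>N. \<forall>n\<ge>N. cmod (poly Q z) powr p * (1 - cmod z / \<rho> n) \<le> I (\<rho> n)" by blast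
        have "(\<lambda>n. cmod (poly Q z) powr p * (1 - cmod z / \<rho> n)) \<longlonglongrightarrow> cmod (poly Q z) powr p * (1 - cmod z / 1)"
          by (intro tendsto_intros \<rho>l) auto
        then have "(\<lambda>n. cmod (poly Q z) powr p * (1 - cmod z / \<rho> n)) \<longlonglongrightarrow> cmod (poly Q z) powr p * (1 - cmod z)"
          by simp
        then show ?thesis using Il ev by (rule LIMSEQ_le)
      qed
      finally show ?thesis .
    qed
    ultimately show ?thesis using I1 by auto
  qed
  then show "0 \<le> r \<Longrightarrow> r < 1 \<Longrightarrow>
      circ_mean (\<lambda>z. cmod (poly P z) powr p) r \<le> circ_mean (\<lambda>z. cmod (poly P z) powr p) 1"
    "cmod z < 1 \<Longrightarrow>
      cmod (poly P z) powr p * (1 - cmod z) \<le> circ_mean (\<lambda>z. cmod (poly P z) powr p) 1"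
    by auto
qed

lemma continuous_on_norm_powr:
  assumes "continuous_on S f" "0 < p"
  shows "continuous_on S (\<lambda>z. cmod (f z) powr p)"
  using assms by (intro continuous_on_powr' continuous_intros) auto

text \<open>The Taylor polynomials of the dilation \<open>g (r' * z)\<close> converge boundedly on
  the closed unit disc, so the polynomial case passes to the limit; the dilation turns the radius
  \<open>r'\<close> into 1.\<close>

lemma circ_mean_powr_bounds:
  assumes g: "g holomorphic_on unit_disc" and p: "0 < p" and r': "0 < r'" "r' < 1"
  shows "0 \<le> r \<Longrightarrow> r \<le> r' \<Longrightarrow> circ_mean (\<lambda>z. cmod (g z) powr p) r \<le> circ_mean (\<lambda>z. cmod (g z) powr p) r'"
    and "cmod z < r' \<Longrightarrow> cmod (g z) powr p * (1 - cmod z / r') \<le> circ_mean (\<lambda>z. cmod (g z) powr p) r'"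
proof -
  define a where "a k = taylor g k * of_real r' ^ k" for k
  have sa: "summable (\<lambda>k. norm (a k))"
    unfolding a_def by (rule taylor_summable[OF g]) (use r' in auto)
  define G where "G n = (\<Sum>k<n. monom (a k) k)" for n
  have G: "poly (G n) z = (\<Sum>k<n. a k * z ^ k)" for n z
    by (simp add: G_def poly_sum poly_monom)
  have Gl: "(\<lambda>n. poly (G n) z) \<longlonglongrightarrow> g (of_real r' * z)" if "cmod z \<le> 1" for z
  proof -
    have "cmod (of_real r' * z) < 1" using r' that by (simp add: norm_mult) (metis mult_left_le less_le_trans not_le less_imp_le)
    then have "(\<lambda>k. a k * z ^ k) sums g (of_real r' * z)"
      using taylor_sums[OF g, of "of_real r' * z"] by (simp add: a_def power_mult_distrib mult.assoc)
    then show ?thesis by (simp add: G sums_def)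
  qed
  define B where "B = (\<Sum>k. norm (a k))"
  have GB: "cmod (poly (G n) z) \<le> B" if "cmod z \<le> 1" for n z
  proof -
    have "cmod (poly (G n) z) \<le> (\<Sum>k<n. norm (a k))"
      unfolding G using that by (intro sum_norm_le) (auto simp: norm_mult norm_power intro!: mult_left_le power_le_one)
    also have "\<dots> \<le> B" unfolding B_def by (rule sum_le_suminf[OF sa]) auto
    finally show ?thesis .
  qed
  have lim: "(\<lambda>n. circ_mean (\<lambda>z. cmod (poly (G n) z) powr p) s) \<longlonglongrightarrow> circ_mean (\<lambda>z. cmod (g z) powr p) (r' * s)"
    if s: "0 \<le> s" "s \<le> 1" for s
    unfolding circ_mean_def
  proof (rule integral_dominated_convergence[where w = "\<lambda>_. B powr p"])
    have "(\<lambda>t. g (of_real (r' * s) * circ t)) \<in> borel_measurable \<U>"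
      by (rule circle_measurable[OF holomorphic_measurable_D[OF g]])
         (use r' s in \<open>auto intro!: le_less_trans[OF mult_left_le]\<close>)
    then show "(\<lambda>t. cmod (g (of_real (r' * s) * circ t)) powr p) \<in> borel_measurable \<U>" by measurable
    show "AE t in \<U>. (\<lambda>n. cmod (poly (G n) (of_real s * circ t)) powr p) \<longlonglongrightarrow> cmod (g (of_real (r' * s) * circ t)) powr p"
    proof (rule AE_I2)
      fix t
      have "(\<lambda>n. poly (G n) (of_real s * circ t)) \<longlonglongrightarrow> g (of_real (r' * s) * circ t)"
        using Gl[of "of_real s * circ t"] s by (simp add: norm_mult mult.assoc)
      then show "(\<lambda>n. cmod (poly (G n) (of_real s * circ t)) powr p) \<longlonglongrightarrow> cmod (g (of_real (r' * s) * circ t)) powr p"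
        using p by (intro tendsto_powr' tendsto_norm tendsto_const) auto
    qed
    show "AE t in \<U>. norm (cmod (poly (G n) (of_real s * circ t)) powr p) \<le> B powr p" for n
      using s p by (intro AE_I2) (auto intro!: powr_mono2 GB simp: norm_mult)
  qed auto
  show "circ_mean (\<lambda>z. cmod (g z) powr p) r \<le> circ_mean (\<lambda>z. cmod (g z) powr p) r'" if r: "0 \<le> r" "r \<le> r'"
  proof (cases "r = r'")
    case False
    define s where "s = r / r'"
    have s: "0 \<le> s" "s < 1" "r' * s = r" using r r' False by (auto simp: s_def)
    show ?thesis
      using LIMSEQ_le[OF lim[of s] lim[of 1]] poly_circ_mean_bounds(1)[OF p, of s] s by auto
  qed simp
  show "cmod (g z) powr p * (1 - cmod z / r') \<le> circ_mean (\<lambda>z. cmod (g z) powr p) r'" if z: "cmod z < r'"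
  proof -
    define y where "y = z / of_real r'"
    have y: "cmod y < 1" "of_real r' * y = z" using z r' by (auto simp: y_def norm_divide)
    have ny: "cmod y = cmod z / r'" using r' by (simp add: y_def norm_divide)
    have "(\<lambda>n. poly (G n) y) \<longlonglongrightarrow> g z" using Gl[of y] y by simp
    then have l: "(\<lambda>n. cmod (poly (G n) y) powr p * (1 - cmod z / r')) \<longlonglongrightarrow> cmod (g z) powr p * (1 - cmod z / r')"
      using p by (intro tendsto_mult tendsto_powr' tendsto_norm tendsto_const) auto
    show ?thesis
      using LIMSEQ_le[OF l lim[of 1]] poly_circ_mean_bounds(2)[OF p, of y] y ny by auto
  qed
qed

subsection \<open>Doubling weights\<close>

text \<open>The tail \<open>T\<close> is a parameter beside the density \<open>w\<close>, because
  the tail of a weight is given beforehand while \<open>w\<close> is merely a Borel representative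
  of its profile.\<close>

locale doubling_tail =
  fixes w T :: "real \<Rightarrow> real"
  assumes w_meas [measurable]: "w \<in> borel_measurable borel"
    and w_nonneg: "0 \<le> w s"
    and T_eq: "0 \<le> r \<Longrightarrow> r < 1 \<Longrightarrow> ennreal (T r) = (\<integral>\<^sup>+s. ennreal (w s) * indicator {r..} s \<partial>\<U>)"
    and T_pos: "0 \<le> r \<Longrightarrow> r < 1 \<Longrightarrow> 0 < T r"
    and upper_doubling: "\<exists>C\<ge>1. \<forall>r\<in>{0..<1}. T r \<le> C * T ((1 + r) / 2)"
    and lower_doubling: "\<exists>K>1. \<exists>C>1. \<forall>r\<in>{0..<1}. C * T (1 - (1 - r) / K) \<le> T r"
begin

lemma T_antimono: "0 \<le> r \<Longrightarrow> r \<le> t \<Longrightarrow> t < 1 \<Longrightarrow> T t \<le> T r"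
proof -
  assume *: "0 \<le> r" "r \<le> t" "t < 1"
  have "ennreal (T t) \<le> ennreal (T r)"
    unfolding T_eq[of t, OF order_trans[OF *(1,2)] *(3)] T_eq[of r, OF *(1) le_less_trans[OF *(2,3)]]
    using *(2) by (intro nn_integral_mono) (auto simp: indicator_def)
  then show "T t \<le> T r" using T_pos[of r] * by (simp add: ennreal_le_iff)
qed

lemma T_diff:
  assumes "0 \<le> r" "r \<le> t" "t < 1"
  shows "(\<integral>\<^sup>+s. ennreal (w s) * indicator {r..<t} s \<partial>\<U>) = ennreal (T r - T t)"
proof -
  have "ennreal (T r) = (\<integral>\<^sup>+s. ennreal (w s) * indicator {r..<t} s + ennreal (w s) * indicator {t..} s \<partial>\<U>)"
    unfolding T_eq[of r, OF assms(1) le_less_trans[OF assms(2,3)]]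
    using assms by (intro nn_integral_cong) (auto simp: indicator_def)
  also have "\<dots> = (\<integral>\<^sup>+s. ennreal (w s) * indicator {r..<t} s \<partial>\<U>) + (\<integral>\<^sup>+s. ennreal (w s) * indicator {t..} s \<partial>\<U>)"
    by (intro nn_integral_add borel_measurable_U) measurable
  also have "(\<integral>\<^sup>+s. ennreal (w s) * indicator {t..} s \<partial>\<U>) = ennreal (T t)"
    using T_eq[of t] assms by simp
  finally have "ennreal (T r) = (\<integral>\<^sup>+s. ennreal (w s) * indicator {r..<t} s \<partial>\<U>) + ennreal (T t)" .
  then have "ennreal (T r) - ennreal (T t) = (\<integral>\<^sup>+s. ennreal (w s) * indicator {r..<t} s \<partial>\<U>)"
    by (simp add: ennreal_add_diff_cancel_right)
  then show ?thesis using T_pos[of t] assms by (simp add: ennreal_minus)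
qed

text \<open>\<open>T\<close> is unconstrained outside \<open>{0..<1}\<close>; a decreasing
  modification is Borel because it is monotone.\<close>

lemma T_borel:
  obtains T' where "T' \<in> borel_measurable borel" "\<And>s. 0 \<le> s \<Longrightarrow> s < 1 \<Longrightarrow> T' s = T s"
proof -
  define T' where "T' s = (if s < 0 then T 0 else if s < 1 then T s else 0)" for s
  have "mono (\<lambda>s. - T' s)"
    using T_pos T_antimono by (intro monoI) (auto simp: T'_def less_imp_le)
  then have "(\<lambda>s. - T' s) \<in> borel_measurable borel" by (rule borel_measurable_mono)
  then have "T' \<in> borel_measurable borel" by simp
  then show ?thesis by (rule that) (simp add: T'_def)
qed

text \<open>Doubling is iterated about \<open>log 2 ((1 - s) / (1 - t))\<close> times, and
  \<open>C < 2 ^ b\<close> turns the resulting power of \<open>C\<close> into a power of the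
  ratio.\<close>

lemma T_growth:
  obtains C and b :: nat where "C \<ge> 1" "\<And>s t. 0 \<le> s \<Longrightarrow> s \<le> t \<Longrightarrow> t < 1 \<Longrightarrow> T s \<le> C * ((1 - s) / (1 - t)) ^ b * T t"
proof -
  obtain C where C: "C \<ge> 1" "\<And>r. 0 \<le> r \<Longrightarrow> r < 1 \<Longrightarrow> T r \<le> C * T ((1 + r) / 2)"
    using upper_doubling by auto
  have step: "T s \<le> C ^ j * T t" if "0 \<le> s" "s \<le> t" "t < 1" "1 - s \<le> 2 ^ j * (1 - t)" for s t j
    using that
  proof (induction j arbitrary: s)
    case 0
    then have "s = t" by simp
    then show ?case by simp
  next
    case (Suc j)
    define s' where "s' = (1 + s) / 2"
    have s': "0 \<le> s'" "s' < 1" "1 - s' = (1 - s) / 2" "s \<le> s'" using Suc.prems by (auto simp: s'_def field_simps)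
    have "T s' \<le> C ^ j * T t"
    proof (cases "s' \<le> t")
      case True
      then show ?thesis using Suc.prems s' by (intro Suc.IH) (auto simp: field_simps)
    next
      case False
      then have "T s' \<le> T t" using Suc.prems s' by (intro T_antimono) auto
      also have "\<dots> \<le> C ^ j * T t" using C(1) T_pos[of t] Suc.prems by simp
      finally show ?thesis .
    qed
    then have "C * T s' \<le> C * (C ^ j * T t)" using C(1) by (intro mult_left_mono) auto
    then show ?case using C(2)[of s] Suc.prems by (simp add: s'_def mult_ac)
  qed
  obtain b where b: "C < 2 ^ b" using real_arch_pow[of 2 C] by auto
  show ?thesis
  proof (rule that[of "2 ^ b" b])
    fix s t :: real assume st: "0 \<le> s" "s \<le> t" "t < 1"
    define x where "x = (1 - s) / (1 - t)"
    have x1: "1 \<le> x" using st by (simp add: x_def)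
    have ex: "\<exists>j. x \<le> 2 ^ j" using real_arch_pow[of 2 x] by (auto intro: less_imp_le)
    \<comment> \<open>The least such \<open>j\<close> overshoots \<open>x\<close> by at most a
      factor 2, which is the origin of the constant \<open>2 ^ b\<close>.\<close>
    define j where "j = (LEAST j. x \<le> 2 ^ j)"
    have j: "x \<le> 2 ^ j" unfolding j_def by (rule LeastI_ex[OF ex])
    have j2: "2 ^ j \<le> 2 * x"
    proof (cases j)
      case 0
      then show ?thesis using x1 by simp
    next
      case (Suc i)
      then have "\<not> x \<le> 2 ^ i" using not_less_Least[of i "\<lambda>j. x \<le> 2 ^ j"] by (simp add: j_def)
      then show ?thesis using Suc by simp
    qed
    have "T s \<le> C ^ j * T t" using st j by (intro step) (auto simp: x_def field_simps)
    also have "C ^ j * T t \<le> (2 ^ b) ^ j * T t"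
      using b C(1) T_pos[of t] st by (intro mult_right_mono power_mono) auto
    also have "(2 ^ b) ^ j * T t = (2 ^ j) ^ b * T t" by (simp add: power_mult[symmetric] mult.commute)
    also have "\<dots> \<le> (2 * x) ^ b * T t" using j2 T_pos[of t] st by (intro mult_right_mono power_mono) auto
    also have "\<dots> = 2 ^ b * x ^ b * T t" by (simp add: power_mult_distrib)
    finally show "T s \<le> 2 ^ b * ((1 - s) / (1 - t)) ^ b * T t" unfolding x_def .
  qed simp
qed

text \<open>Lower doubling is iterated as often as whole powers of \<open>K\<close> fit into
  \<open>x = (1 - s) / (1 - t)\<close>. Since \<open>C = K powr \<alpha>\<close>, rounding down
  costs at most one factor \<open>C\<close>.\<close>

lemma T_decay:
  obtains C \<alpha> where "C > 0" "\<alpha> > 0" "\<And>s t. 0 \<le> s \<Longrightarrow> s \<le> t \<Longrightarrow> t < 1 \<Longrightarrow> T t \<le> C * ((1 - t) / (1 - s)) powr \<alpha> * T s"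
proof -
  obtain K C where K: "K > 1" and C: "C > 1" "\<And>r. 0 \<le> r \<Longrightarrow> r < 1 \<Longrightarrow> C * T (1 - (1 - r) / K) \<le> T r"
    using lower_doubling by auto
  have step: "C ^ j * T t \<le> T s" if "0 \<le> s" "s \<le> t" "t < 1" "K ^ j * (1 - t) \<le> 1 - s" for s t j
    using that
  proof (induction j arbitrary: s)
    case 0
    then show ?case by (simp add: T_antimono)
  next
    case (Suc j)
    define s' where "s' = 1 - (1 - s) / K"
    have "(1 - s) / K \<le> (1 - s) / 1" using K Suc.prems by (intro divide_left_mono) auto
    then have s': "s \<le> s'" "s' < 1" using K Suc.prems by (auto simp: s'_def)
    have le: "K ^ j * (1 - t) \<le> 1 - s'" using Suc.prems(4) K by (simp add: s'_def field_simps)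
    have "1 - t \<le> K ^ j * (1 - t)" using K Suc.prems by simp
    then have "s' \<le> t" using le by linarith
    then have "C ^ j * T t \<le> T s'" using Suc.prems s' le by (intro Suc.IH) auto
    then have "C * (C ^ j * T t) \<le> C * T s'" using C(1) by (intro mult_left_mono) auto
    then show ?case using C(2)[of s] Suc.prems by (simp add: s'_def mult_ac)
  qed
  define \<alpha> where "\<alpha> = log K C"
  have \<alpha>: "\<alpha> > 0" using K C(1) by (simp add: \<alpha>_def)
  show ?thesis
  proof (rule that[of C \<alpha>])
    fix s t :: real assume st: "0 \<le> s" "s \<le> t" "t < 1"
    define x where "x = (1 - s) / (1 - t)"
    have x1: "1 \<le> x" using st by (simp add: x_def)
    define j where "j = nat \<lfloor>log K x\<rfloor>"
    have l0: "0 \<le> log K x" using K x1 by simp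
    have j: "real j \<le> log K x" "log K x < real j + 1" using l0 by (auto simp: j_def)
    have "K ^ j \<le> x" using j(1) K x1 by (simp add: le_log_iff powr_realpow)
    then have "K ^ j * (1 - t) \<le> 1 - s" using st by (simp add: x_def field_simps)
    with st have 1: "C ^ j * T t \<le> T s" by (intro step) auto
    have "x powr \<alpha> = C powr (log K x)"
      using K C(1) x1 by (simp add: \<alpha>_def powr_def log_def)
    also have "\<dots> \<le> C powr (real j + 1)" using j C(1) by (intro powr_mono) auto
    also have "\<dots> = C ^ j * C" using C(1) by (simp add: powr_add powr_realpow)
    finally have "x powr \<alpha> * T t \<le> C ^ j * C * T t" using T_pos[of t] st by (intro mult_right_mono) auto
    also have "\<dots> \<le> C * T s" using 1 C(1) by (simp add: mult_ac)
    finally have "T t \<le> C * T s / x powr \<alpha>" using x1 by (simp add: field_simps)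
    also have "\<dots> = C * ((1 - t) / (1 - s)) powr \<alpha> * T s"
    proof -
      have "(1 - t) / (1 - s) = inverse x" by (simp add: x_def)
      then show ?thesis using x1 by (simp add: powr_minus[symmetric] inverse_powr divide_inverse mult_ac)
    qed
    finally show "T t \<le> C * ((1 - t) / (1 - s)) powr \<alpha> * T s" .
  qed (use C(1) \<alpha> in auto)
qed

section \<open>Integrals of the density over geometric shells\<close>

lemma nn_integral_U_split:
  assumes [measurable]: "f \<in> borel_measurable \<U>" and "r \<le> t"
  shows "(\<integral>\<^sup>+s. f s * indicator {0..<t} s \<partial>\<U>) \<le> (\<integral>\<^sup>+s. f s * indicator {0..<r} s \<partial>\<U>) + (\<integral>\<^sup>+s. f s * indicator {r..<t} s \<partial>\<U>)"
proof -
  have [measurable]: "indicator A \<in> borel_measurable \<U>" if "A \<in> sets borel" for A :: "real set" and b :: "ennreal"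
    using that by (intro borel_measurable_U borel_measurable_indicator)
  have "(\<integral>\<^sup>+s. f s * indicator {0..<t} s \<partial>\<U>) \<le> (\<integral>\<^sup>+s. f s * indicator {0..<r} s + f s * indicator {r..<t} s \<partial>\<U>)"
    by (intro nn_integral_mono) (auto simp: indicator_def)
  also have "\<dots> = (\<integral>\<^sup>+s. f s * indicator {0..<r} s \<partial>\<U>) + (\<integral>\<^sup>+s. f s * indicator {r..<t} s \<partial>\<U>)"
    by (rule nn_integral_add) (auto intro!: borel_measurable_times_ennreal borel_measurable_U borel_measurable_indicator)
  finally show ?thesis .
qed

lemma dyadic_point:
  assumes "0 \<le> (a::real)" "a < 1"
  obtains j :: nat where "1 - (1/2) ^ j \<le> a" "a < 1 - (1/2) ^ Suc j"
proof -
  obtain i where "(1/2) ^ i < 1 - a" using real_arch_pow_inv[of "1 - a" "1/2"] assms by auto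
  then have "(1/2) ^ Suc i < 1 - a"
    using assms by simp
  then have ex: "\<exists>j. (1/2) ^ Suc j < 1 - a" by blast
  define j where "j = (LEAST j. (1/2) ^ Suc j < 1 - a)"
  have j: "(1/2) ^ Suc j < 1 - a" unfolding j_def by (rule LeastI_ex[OF ex])
  have "1 - a \<le> (1/2) ^ j"
  proof (cases j)
    case 0
    then show ?thesis using assms by simp
  next
    case (Suc i)
    then show ?thesis using not_less_Least[of i "\<lambda>j. (1/2) ^ Suc j < 1 - a"] by (simp add: j_def)
  qed
  with j show ?thesis by (intro that[of j]) auto
qed

text \<open>Once \<open>2 powr c \<ge> 2 * C1\<close>, the power of \<open>1 - s\<close> grows from
  one dyadic shell to the next at least twice as much as the tail can shrink, so the last shell
  before \<open>a\<close> dominates all earlier ones. From \<open>a\<close> on the power is at most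
  \<open>(1 - a) powr (- c)\<close> and the remaining mass is \<open>T a\<close>.\<close>

lemma T_weighted_powr:
  "\<exists>c0. \<forall>c\<ge>c0. \<exists>C>0. \<forall>a\<in>{0..<1}.
     (\<integral>\<^sup>+s. ennreal (w s * (1 - a * s) powr (- c)) \<partial>\<U>) \<le> ennreal (C * T a * (1 - a) powr (- c))"
proof -
  obtain C1 where C1: "C1 \<ge> 1" "\<And>r. 0 \<le> r \<Longrightarrow> r < 1 \<Longrightarrow> T r \<le> C1 * T ((1 + r) / 2)"
    using upper_doubling by auto
  show ?thesis
  proof (rule exI[of _ "max 0 (log 2 (2 * C1))"], intro allI impI)
    fix c :: real assume c: "c \<ge> max 0 (log 2 (2 * C1))"
    have c0: "c \<ge> 0" using c by simp
    have c2: "2 * C1 \<le> 2 powr c" using c C1(1) by (simp add: log_le_iff)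
    \<comment> \<open>Chosen so that the induction closes:
      \<open>B + 2 powr c \<le> 2 * 2 powr c\<close>, after which passing from
      \<open>T (a j)\<close> to \<open>T (a (Suc j))\<close> costs \<open>C1\<close>, and
      \<open>2 * C1 = B\<close>.\<close>
    define B where "B = 2 * C1"
    define a where "a j = 1 - (1/2::real) ^ j" for j :: nat
    have a: "0 \<le> a j" "a j < 1" "a j \<le> a (Suc j)" "a (Suc j) = (1 + a j) / 2" for j
      by (auto simp: a_def power_le_one)
    have am: "(1 - a j) powr (- c) = 2 powr (real j * c)" for j
    proof -
      have "1 - a j = 2 powr (- real j)" by (simp add: a_def powr_minus powr_realpow power_one_over inverse_eq_divide)
      then show ?thesis by (simp add: powr_powr)
    qed
    have claim: "(\<integral>\<^sup>+s. ennreal (w s * (1 - s) powr (- c)) * indicator {0..<a j} s \<partial>\<U>) \<le> ennreal (B * T (a j) * 2 powr (real j * c))" for j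
    proof (induction j)
      case 0
      then show ?case by (simp add: a_def)
    next
      case (Suc j)
      have m: "(\<lambda>s. ennreal (w s * (1 - s) powr (- c))) \<in> borel_measurable \<U>"
        by (rule borel_measurable_U) measurable
      have "(\<integral>\<^sup>+s. ennreal (w s * (1 - s) powr (- c)) * indicator {a j..<a (Suc j)} s \<partial>\<U>) \<le>
         (\<integral>\<^sup>+s. ennreal (2 powr (real (Suc j) * c)) * (ennreal (w s) * indicator {a j..<a (Suc j)} s) \<partial>\<U>)"
      proof (rule nn_integral_mono)
        fix s :: real
        have "w s * (1 - s) powr (- c) \<le> w s * 2 powr (real (Suc j) * c)" if "s < a (Suc j)"
          unfolding am[symmetric] using that a[of "Suc j"] c0 w_nonneg
          by (intro mult_left_mono powr_mono2') auto
        then show "ennreal (w s * (1 - s) powr (- c)) * indicator {a j..<a (Suc j)} s \<le> ennreal (2 powr (real (Suc j) * c)) * (ennreal (w s) * indicator {a j..<a (Suc j)} s)"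
          using w_nonneg by (auto simp: indicator_def ennreal_mult[symmetric] mult.commute intro!: ennreal_leI)
      qed
      also have "\<dots> = ennreal (2 powr (real (Suc j) * c)) * ennreal (T (a j) - T (a (Suc j)))"
        using a[of j] a[of "Suc j"] by (subst nn_integral_cmult) (auto simp: T_diff intro!: borel_measurable_U)
      also have "\<dots> \<le> ennreal (2 powr (real (Suc j) * c) * T (a j))"
      proof -
        have "0 < T (a j)" "0 < T (a (Suc j))" "T (a (Suc j)) \<le> T (a j)"
          by (auto intro!: T_pos T_antimono a simp del: a(4))
        then show ?thesis by (subst ennreal_mult[symmetric]) (auto intro!: ennreal_leI)
      qed
      finally have 2: "(\<integral>\<^sup>+s. ennreal (w s * (1 - s) powr (- c)) * indicator {a j..<a (Suc j)} s \<partial>\<U>) \<le> ennreal (2 powr (real (Suc j) * c) * T (a j))" .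
      have "(\<integral>\<^sup>+s. ennreal (w s * (1 - s) powr (- c)) * indicator {0..<a (Suc j)} s \<partial>\<U>) \<le>
          ennreal (B * T (a j) * 2 powr (real j * c)) + ennreal (2 powr (real (Suc j) * c) * T (a j))"
        using order_trans[OF nn_integral_U_split[OF m a(3)[of j]] add_mono[OF Suc.IH 2]] .
      also have "\<dots> = ennreal (B * T (a j) * 2 powr (real j * c) + 2 powr (real (Suc j) * c) * T (a j))"
        using T_pos[of "a j"] a[of j] C1(1) by (intro ennreal_plus[symmetric]) (auto simp: B_def)
      also have "B * T (a j) * 2 powr (real j * c) + 2 powr (real (Suc j) * c) * T (a j) =
          T (a j) * 2 powr (real j * c) * (B + 2 powr c)"
        by (simp add: distrib_right powr_add algebra_simps)
      also have "\<dots> \<le> T (a j) * 2 powr (real j * c) * (2 * 2 powr c)"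
        using c2 T_pos[of "a j"] a[of j] by (intro mult_left_mono) (auto simp: B_def)
      also have "\<dots> = 2 * T (a j) * 2 powr (real (Suc j) * c)"
        by (simp add: distrib_right powr_add algebra_simps)
      also have "\<dots> \<le> B * T (a (Suc j)) * 2 powr (real (Suc j) * c)"
      proof -
        have "T (a j) \<le> C1 * T (a (Suc j))" unfolding a(4) using C1(2) a(1,2) by blast
        then show ?thesis by (intro mult_right_mono) (auto simp: B_def)
      qed
      finally show ?case by (simp add: ennreal_leI)
    qed
    show "\<exists>C>0. \<forall>a\<in>{0..<1}. (\<integral>\<^sup>+s. ennreal (w s * (1 - a * s) powr (- c)) \<partial>\<U>) \<le> ennreal (C * T a * (1 - a) powr (- c))"
    proof (intro exI[of _ "B * 2 powr c + 1"] conjI ballI)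
      show "0 < B * 2 powr c + 1" using C1(1) by (simp add: B_def add_pos_pos)
      fix x :: real assume "x \<in> {0..<1}"
      then have x: "0 \<le> x" "x < 1" by auto
      obtain j where j: "a j \<le> x" "x < a (Suc j)" using dyadic_point[OF x] unfolding a_def by metis
      have "(\<integral>\<^sup>+s. ennreal (w s * (1 - x * s) powr (- c)) \<partial>\<U>) \<le>
        (\<integral>\<^sup>+s. ennreal (w s * (1 - s) powr (- c)) * indicator {0..<a (Suc j)} s + ennreal ((1 - x) powr (- c)) * (ennreal (w s) * indicator {x..} s) \<partial>\<U>)"
      proof (rule nn_integral_mono)
        fix s assume "s \<in> space \<U>"
        then have s: "0 \<le> s" "s < 1" by auto
        have xs: "x * s \<le> s" "x * s \<le> x" using s x by (auto simp: mult_left_le_one_le mult_left_le)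
        \<comment> \<open>Two bounds for one integrand: the first is used on the shells up to
          \<open>a (Suc j)\<close>, the second beyond, where in particular
          \<open>x \<le> s\<close>.\<close>
        have 1: "w s * (1 - x * s) powr (- c) \<le> w s * (1 - s) powr (- c)"
          using xs s c0 w_nonneg by (intro mult_left_mono powr_mono2') auto
        have 2: "w s * (1 - x * s) powr (- c) \<le> (1 - x) powr (- c) * w s"
          using xs x c0 w_nonneg by (subst mult.commute) (intro mult_right_mono powr_mono2', auto)
        show "ennreal (w s * (1 - x * s) powr (- c)) \<le> ennreal (w s * (1 - s) powr (- c)) * indicator {0..<a (Suc j)} s + ennreal ((1 - x) powr (- c)) * (ennreal (w s) * indicator {x..} s)"
        proof (cases "s < a (Suc j)")
          case True
          then show ?thesis using s ennreal_leI[OF 1] by (auto intro: add_increasing2)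
        next
          case False
          then have "x \<le> s" using j by linarith
          then show ?thesis using ennreal_leI[OF 2] w_nonneg by (auto simp: ennreal_mult[symmetric] intro: add_increasing)
        qed
      qed
      also have "\<dots> = (\<integral>\<^sup>+s. ennreal (w s * (1 - s) powr (- c)) * indicator {0..<a (Suc j)} s \<partial>\<U>) + ennreal ((1 - x) powr (- c)) * ennreal (T x)"
        unfolding T_eq[OF x]
        by (subst nn_integral_add) (auto intro!: borel_measurable_U simp: nn_integral_cmult)
      also have "\<dots> \<le> ennreal (B * T (a (Suc j)) * 2 powr (real (Suc j) * c)) + ennreal ((1 - x) powr (- c)) * ennreal (T x)"
        by (intro add_mono claim order_refl)
      also have "\<dots> = ennreal (B * T (a (Suc j)) * 2 powr (real (Suc j) * c) + (1 - x) powr (- c) * T x)"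
        using T_pos[of "a (Suc j)"] T_pos[of x] x a[of "Suc j"] C1(1)
        by (subst ennreal_plus) (auto simp: B_def ennreal_mult)
      also have "\<dots> \<le> ennreal ((B * 2 powr c + 1) * T x * (1 - x) powr (- c))"
      proof (rule ennreal_leI)
        have "(1 - a j) powr (- c) \<le> (1 - x) powr (- c)"
          using j x c0 by (intro powr_mono2') auto
        then have "2 powr (real (Suc j) * c) \<le> 2 powr c * (1 - x) powr (- c)"
          unfolding am by (simp add: distrib_right powr_add)
        moreover have "T (a (Suc j)) \<le> T x" using j x a[of "Suc j"] by (intro T_antimono) auto
        ultimately have "B * T (a (Suc j)) * 2 powr (real (Suc j) * c) \<le> B * T x * (2 powr c * (1 - x) powr (- c))"
          using C1(1) T_pos[of x] x T_pos[of "a (Suc j)"] a[of "Suc j"] by (intro mult_mono) (auto simp: B_def)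
        then show "B * T (a (Suc j)) * 2 powr (real (Suc j) * c) + (1 - x) powr (- c) * T x \<le> (B * 2 powr c + 1) * T x * (1 - x) powr (- c)"
          by (simp add: algebra_simps)
      qed
      finally show "(\<integral>\<^sup>+s. ennreal (w s * (1 - x * s) powr (- c)) \<partial>\<U>) \<le> ennreal ((B * 2 powr c + 1) * T x * (1 - x) powr (- c))" .
    qed
  qed
qed

text \<open>Each dyadic shell contributes at most \<open>C1\<close>, since the tail drops by at most
  that factor across it, and the number of shells before \<open>x\<close> is of the order of the
  logarithm. From \<open>x\<close> on the integrand is at most \<open>w s / T x\<close>, of total
  mass 1. This is where the logarithm of the theorem originates.\<close>

lemma T_log_integral:
  "\<exists>C>0. \<forall>x\<in>{0..<1}. (\<integral>\<^sup>+s. ennreal (w s / T (x * s)) \<partial>\<U>) \<le> ennreal (C * ln (exp 1 / (1 - x)))"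
proof -
  obtain C1 where C1: "C1 \<ge> 1" "\<And>r. 0 \<le> r \<Longrightarrow> r < 1 \<Longrightarrow> T r \<le> C1 * T ((1 + r) / 2)"
    using upper_doubling by auto
  define a where "a j = 1 - (1/2::real) ^ j" for j :: nat
  have a: "0 \<le> a j" "a j < 1" "a j \<le> a (Suc j)" "a (Suc j) = (1 + a j) / 2" for j
    by (auto simp: a_def power_le_one)
  define h where "h s = ennreal (w s) / ennreal (T s)" for s
  have Tm: "(\<lambda>s. ennreal (T s)) \<in> borel_measurable \<U>"
  proof -
    obtain T' where [measurable]: "T' \<in> borel_measurable borel" and T': "\<And>s. 0 \<le> s \<Longrightarrow> s < 1 \<Longrightarrow> T' s = T s"
      using T_borel by blast
    have "(\<lambda>s. ennreal (T' s)) \<in> borel_measurable \<U>" by (rule borel_measurable_U) measurable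
    then show ?thesis by (rule measurable_cong[THEN iffD1, rotated]) (auto simp: T')
  qed
  have hm: "h \<in> borel_measurable \<U>"
    unfolding h_def by (rule borel_measurable_divide_ennreal[OF borel_measurable_U Tm]) measurable
  have claim: "(\<integral>\<^sup>+s. h s * indicator {0..<a j} s \<partial>\<U>) \<le> ennreal (C1 * real j)" for j
  proof (induction j)
    case 0
    then show ?case by (simp add: a_def)
  next
    case (Suc j)
    have Tj: "0 < T (a j)" "0 < T (a (Suc j))" using a[of j] a[of "Suc j"] T_pos by auto
    have "(\<integral>\<^sup>+s. h s * indicator {a j..<a (Suc j)} s \<partial>\<U>) \<le>
       (\<integral>\<^sup>+s. ennreal (1 / T (a (Suc j))) * (ennreal (w s) * indicator {a j..<a (Suc j)} s) \<partial>\<U>)"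
    proof (rule nn_integral_mono)
      fix s :: real
      show "h s * indicator {a j..<a (Suc j)} s \<le> ennreal (1 / T (a (Suc j))) * (ennreal (w s) * indicator {a j..<a (Suc j)} s)"
      proof (cases "s \<in> {a j..<a (Suc j)}")
        case True
        then have s: "0 \<le> s" "s < 1" "s \<le> a (Suc j)" using a[of j] a[of "Suc j"] by auto
        then have "w s / T s \<le> (1 / T (a (Suc j))) * w s"
          using T_antimono[OF s(1,3) a(2)] Tj w_nonneg[of s] by (simp add: frac_le)
        then show ?thesis using True T_pos[OF s(1,2)] Tj w_nonneg[of s]
          by (simp add: h_def divide_ennreal ennreal_mult[symmetric] ennreal_leI)
      qed simp
    qed
    also have "\<dots> = ennreal (1 / T (a (Suc j))) * ennreal (T (a j) - T (a (Suc j)))"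
      using a[of j] a[of "Suc j"] by (subst nn_integral_cmult) (auto simp: T_diff intro!: borel_measurable_U)
    also have "\<dots> = ennreal ((T (a j) - T (a (Suc j))) / T (a (Suc j)))"
      using Tj T_antimono[OF a(1)[of j] a(3) a(2)] by (simp add: ennreal_mult[symmetric])
    also have "\<dots> \<le> ennreal C1"
    proof -
      have "T (a j) \<le> C1 * T (a (Suc j))" unfolding a(4) using C1(2) a(1,2) by blast
      then show ?thesis using Tj by (intro ennreal_leI) (simp add: pos_divide_le_eq)
    qed
    finally have 2: "(\<integral>\<^sup>+s. h s * indicator {a j..<a (Suc j)} s \<partial>\<U>) \<le> ennreal C1" .
    have "(\<integral>\<^sup>+s. h s * indicator {0..<a (Suc j)} s \<partial>\<U>) \<le> ennreal (C1 * real j) + ennreal C1"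
      using order_trans[OF nn_integral_U_split[OF hm a(3)[of j]] add_mono[OF Suc.IH 2]] .
    also have "\<dots> = ennreal (C1 * real (Suc j))"
      using C1(1) by (simp add: ennreal_plus[symmetric] algebra_simps del: ennreal_plus)
    finally show ?case .
  qed
  show ?thesis
  proof (intro exI[of _ "4 * C1"] conjI ballI)
    show "0 < 4 * C1" using C1 by simp
    fix x :: real assume "x \<in> {0..<1}"
    then have x: "0 \<le> x" "x < 1" by auto
    obtain j where j: "a j \<le> x" "x < a (Suc j)" using dyadic_point[OF x] unfolding a_def by metis
    have "(\<integral>\<^sup>+s. ennreal (w s / T (x * s)) \<partial>\<U>) \<le>
      (\<integral>\<^sup>+s. h s * indicator {0..<a (Suc j)} s + ennreal (1 / T x) * (ennreal (w s) * indicator {x..} s) \<partial>\<U>)"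
    proof (rule nn_integral_mono)
      fix s assume "s \<in> space \<U>"
      then have s: "0 \<le> s" "s < 1" by auto
      have xs: "x * s \<le> s" "x * s \<le> x" "0 \<le> x * s" "x * s < 1"
        using s x by (auto simp: mult_left_le_one_le mult_left_le intro: le_less_trans[OF mult_left_le])
      have 1: "w s / T (x * s) \<le> w s / T s"
        using T_antimono[OF xs(3,1) s(2)] T_pos[OF s] w_nonneg by (intro divide_left_mono) (auto intro!: mult_pos_pos T_pos xs)
      have 2: "w s / T (x * s) \<le> (1 / T x) * w s"
        using T_antimono[OF xs(3,2) x(2)] T_pos[OF x] w_nonneg[of s] by (simp add: frac_le)
      show "ennreal (w s / T (x * s)) \<le> h s * indicator {0..<a (Suc j)} s + ennreal (1 / T x) * (ennreal (w s) * indicator {x..} s)"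
      proof (cases "s < a (Suc j)")
        case True
        then show ?thesis using s ennreal_leI[OF 1] T_pos[OF s] w_nonneg[of s] by (auto simp: h_def divide_ennreal intro: add_increasing2)
      next
        case False
        then have "x \<le> s" using j by linarith
        then show ?thesis using ennreal_leI[OF 2] w_nonneg[of s] T_pos[OF x] by (auto simp: ennreal_mult[symmetric] intro: add_increasing)
      qed
    qed
    also have "\<dots> = (\<integral>\<^sup>+s. h s * indicator {0..<a (Suc j)} s \<partial>\<U>) + ennreal (1 / T x) * ennreal (T x)"
      unfolding T_eq[OF x] using hm
      by (subst nn_integral_add) (auto intro!: borel_measurable_U borel_measurable_times_ennreal simp: nn_integral_cmult)
    also have "\<dots> \<le> ennreal (C1 * real (Suc j)) + ennreal (1 / T x) * ennreal (T x)"
      by (intro add_mono claim order_refl)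
    also have "\<dots> = ennreal (C1 * real (Suc j) + 1)"
    proof -
      have "ennreal (1 / T x) * ennreal (T x) = ennreal 1" using T_pos[OF x] by (subst ennreal_mult[symmetric]) auto
      then show ?thesis using C1(1) by (subst ennreal_plus) auto
    qed
    also have "\<dots> \<le> ennreal (4 * C1 * ln (exp 1 / (1 - x)))"
    proof (rule ennreal_leI)
      have L: "ln (exp 1 / (1 - x)) = 1 - ln (1 - x)" using x by (simp add: ln_div)
      have "1 - x \<le> (1/2) ^ j" using j by (simp add: a_def)
      then have "ln (1 - x) \<le> real j * ln (1/2)" using x by (simp add: ln_realpow[symmetric])
      moreover have "ln (1/2) \<le> (-1/2 :: real)" using ln_le_minus_one[of "1/2"] by simp
      then have "real j * ln (1/2) \<le> real j * (-1/2)" by (intro mult_left_mono) auto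
      ultimately have "real j \<le> 2 * (- ln (1 - x))" by simp
      moreover have "0 \<le> - ln (1 - x)" using x by simp
      ultimately have jj: "real (Suc j) + 1 \<le> 4 * ln (exp 1 / (1 - x))" unfolding L by simp
      have "C1 * real (Suc j) + 1 \<le> C1 * (real (Suc j) + 1)" using C1(1) by (simp add: algebra_simps)
      also have "\<dots> \<le> C1 * (4 * ln (exp 1 / (1 - x)))" using jj C1(1) by (intro mult_left_mono) auto
      finally show "C1 * real (Suc j) + 1 \<le> 4 * C1 * ln (exp 1 / (1 - x))" by simp
    qed
    finally show "(\<integral>\<^sup>+s. ennreal (w s / T (x * s)) \<partial>\<U>) \<le> ennreal (4 * C1 * ln (exp 1 / (1 - x)))" .
  qed
qed

text \<open>As \<open>M\<close> increases, each shell is absorbed by the next one, whose mass \<open>lower_doubling\<close> bounds from below.\<close>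

lemma T_regularised_le:
  "\<exists>C>0. \<forall>M. M \<in> borel_measurable \<U> \<longrightarrow> (\<forall>r t. 0 \<le> r \<longrightarrow> r \<le> t \<longrightarrow> t < 1 \<longrightarrow> M r \<le> M t) \<longrightarrow>
     (\<integral>\<^sup>+r. M r * ennreal (T r / (1 - r)) \<partial>\<U>) \<le> ennreal C * (\<integral>\<^sup>+r. ennreal (2 * r) * ennreal (w r) * M r \<partial>\<U>)"
proof -
  obtain K C2 where K: "K > 1" and C2: "C2 > 1" "\<And>r. 0 \<le> r \<Longrightarrow> r < 1 \<Longrightarrow> C2 * T (1 - (1 - r) / K) \<le> T r"
    using lower_doubling by auto
  obtain Cg b where Cg: "Cg \<ge> 1" "\<And>s t. 0 \<le> s \<Longrightarrow> s \<le> t \<Longrightarrow> t < 1 \<Longrightarrow> T s \<le> Cg * ((1 - s) / (1 - t)) ^ b * T t"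
    using T_growth by blast
  \<comment> \<open>The ratio of the shells is the \<open>K\<close> of lower doubling, so that every
    shell carries at least a fixed fraction of the tail at its left end.\<close>
  define a where "a j = 1 - (1/K) ^ j" for j :: nat
  have a: "0 \<le> a j" "a j < 1" "a j \<le> a (Suc j)" "a (Suc j) = 1 - (1 - a j) / K" for j
    using K by (auto simp: a_def power_le_one field_simps)
  have K1: "(1 - a j) / (1 - a (Suc j)) = K" for j using K a(2)[of j] by (simp add: a(4))
  \<comment> \<open>\<open>K - 1\<close> is the length of a shell divided by the distance of its
    right end from 1, \<open>Cg * K ^ b\<close> compares the tails at consecutive points,
    \<open>1 - 1 / C2\<close> is the fraction of the tail carried by one shell, and
    \<open>2 * (1 - 1 / K)\<close> bounds the area factor \<open>2 * r\<close> from below on all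
    shells but the first.\<close>
  define D where "D = (K - 1) * (Cg * K ^ b) / ((1 - 1 / C2) * (2 * (1 - 1 / K)))"
  have "0 < (1 - 1 / C2) * (2 * (1 - 1 / K))" "0 < (K - 1) * (Cg * K ^ b)"
    using K C2(1) Cg(1) by (intro mult_pos_pos zero_less_power; simp)+
  then have D: "0 < D" unfolding D_def by (rule divide_pos_pos[rotated])
  have base: "(K - 1) * T (a j) \<le> D * (2 * (1 - 1 / K)) * (T (a (Suc j)) - T (a (Suc (Suc j))))" for j
  proof -
    have 1: "T (a j) \<le> Cg * K ^ b * T (a (Suc j))"
      using Cg(2)[OF a(1)[of j] a(3) a(2)] K1 by simp
    have "C2 * T (a (Suc (Suc j))) \<le> T (a (Suc j))" using C2(2)[OF a(1) a(2), of "Suc j"] by (simp only: a(4)[symmetric])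
    then have 2: "(1 - 1 / C2) * T (a (Suc j)) \<le> T (a (Suc j)) - T (a (Suc (Suc j)))"
      using C2(1) by (simp add: field_simps)
    have "(K - 1) * T (a j) \<le> (K - 1) * (Cg * K ^ b) * T (a (Suc j))"
      using 1 K by (simp add: mult.assoc)
    also have "\<dots> = D * (2 * (1 - 1 / K)) * ((1 - 1 / C2) * T (a (Suc j)))"
    proof -
      have gen: "X * t = X / (e1 * e2) * e2 * (e1 * t)" if "e1 \<noteq> 0" "e2 \<noteq> 0" for X e1 e2 t :: real
        using that by simp
      show ?thesis unfolding D_def by (rule gen) (use K C2(1) in \<open>auto simp: field_simps\<close>)
    qed
    also have "\<dots> \<le> D * (2 * (1 - 1 / K)) * (T (a (Suc j)) - T (a (Suc (Suc j))))"
    proof (rule mult_left_mono[OF 2])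
      have "0 \<le> 2 * (1 - 1 / K)" using K by (simp add: field_simps)
      then show "0 \<le> D * (2 * (1 - 1 / K))" using D by (intro mult_nonneg_nonneg) auto
    qed
    finally show ?thesis .
  qed
  show ?thesis
  proof (intro exI[of _ D] conjI D allI impI)
    fix M :: "real \<Rightarrow> ennreal"
    assume Mm [measurable]: "M \<in> borel_measurable \<U>"
    assume "\<forall>r t. 0 \<le> r \<longrightarrow> r \<le> t \<longrightarrow> t < 1 \<longrightarrow> M r \<le> M t"
    then have mono: "\<And>r t. 0 \<le> r \<Longrightarrow> r \<le> t \<Longrightarrow> t < 1 \<Longrightarrow> M r \<le> M t" by blast
    define f where "f r = M r * ennreal (T r / (1 - r))" for r
    define g where "g r = ennreal (2 * r) * ennreal (w r) * M r" for r
    have wm: "(\<lambda>r. ennreal (2 * r) * ennreal (w r)) \<in> borel_measurable \<U>"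
      by (rule borel_measurable_U) measurable
    have gm [measurable]: "g \<in> borel_measurable \<U>" unfolding g_def
      by (rule borel_measurable_times_ennreal[OF wm Mm])
    have im [measurable]: "indicator {s..<t} \<in> borel_measurable \<U>" for s t :: real
      by (intro borel_measurable_U) measurable
    have piece: "(\<integral>\<^sup>+r. f r * indicator {a j..<a (Suc j)} r \<partial>\<U>) \<le> ennreal D * (\<integral>\<^sup>+r. g r * indicator {a (Suc j)..<a (Suc (Suc j))} r \<partial>\<U>)" for j
    proof -
      have Tj: "0 < T (a j)" "0 < T (a (Suc j))" using a[of j] a[of "Suc j"] T_pos by auto
      have K0: "0 \<le> 1 - 1 / K" using K by simp
      have "(\<integral>\<^sup>+r. f r * indicator {a j..<a (Suc j)} r \<partial>\<U>) \<le>
        (\<integral>\<^sup>+r. (M (a (Suc j)) * ennreal (T (a j) / (1 - a (Suc j)))) * indicator {a j..<a (Suc j)} r \<partial>\<U>)"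
      proof (rule nn_integral_mono)
        fix r :: real
        show "f r * indicator {a j..<a (Suc j)} r \<le> (M (a (Suc j)) * ennreal (T (a j) / (1 - a (Suc j)))) * indicator {a j..<a (Suc j)} r"
        proof (cases "r \<in> {a j..<a (Suc j)}")
          case True
          then have r: "0 \<le> r" "r < 1" "r \<le> a (Suc j)" "a j \<le> r" using a[of j] a[of "Suc j"] by auto
          have "T r / (1 - r) \<le> T (a j) / (1 - a (Suc j))"
            using T_antimono[OF a(1) r(4,2)] T_pos[OF a(1,2), of j] r a[of "Suc j"] by (intro frac_le) auto
          then show ?thesis using True mono[OF r(1,3) a(2)] unfolding f_def
            by (simp add: mult_mono ennreal_leI)
        qed simp
      qed
      also have "\<dots> = (M (a (Suc j)) * ennreal (T (a j) / (1 - a (Suc j)))) * ennreal (a (Suc j) - a j)"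
      proof -
        have "emeasure \<U> {a j..<a (Suc j)} = ennreal (a (Suc j) - a j)"
          using a[of j] a[of "Suc j"] by (subst emeasure_restrict_space) auto
        moreover have "{a j..<a (Suc j)} \<in> sets \<U>"
          using a[of j] a[of "Suc j"] by (auto simp: sets_restrict_space intro!: image_eqI[of _ _ "{a j..<a (Suc j)}"])
        ultimately show ?thesis by (simp add: nn_integral_cmult_indicator)
      qed
      also have "\<dots> = M (a (Suc j)) * ennreal ((K - 1) * T (a j))"
      proof -
        have "T (a j) / (1 - a (Suc j)) * (a (Suc j) - a j) = (K - 1) * T (a j)"
          using K a(2)[of j] by (simp add: a(4) field_simps)
        moreover have "0 \<le> T (a j) / (1 - a (Suc j))" "0 \<le> a (Suc j) - a j"
          using Tj(1) a(2)[of "Suc j"] a(3)[of j] by (simp_all del: a(4))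
        ultimately have "ennreal (T (a j) / (1 - a (Suc j))) * ennreal (a (Suc j) - a j) = ennreal ((K - 1) * T (a j))"
          by (simp only: ennreal_mult[symmetric])
        then show ?thesis by (simp only: mult.assoc)
      qed
      also have "\<dots> \<le> M (a (Suc j)) * ennreal (D * (2 * (1 - 1 / K)) * (T (a (Suc j)) - T (a (Suc (Suc j)))))"
        by (intro mult_left_mono ennreal_leI base) auto
      also have "\<dots> = ennreal D * (M (a (Suc j)) * ennreal (2 * (1 - 1 / K)) * ennreal (T (a (Suc j)) - T (a (Suc (Suc j)))))"
        using D K0 T_antimono[OF a(1)[of "Suc j"] a(3) a(2)] by (simp add: ennreal_mult mult_ac)
      also have "\<dots> = ennreal D * (M (a (Suc j)) * ennreal (2 * (1 - 1 / K)) * (\<integral>\<^sup>+s. ennreal (w s) * indicator {a (Suc j)..<a (Suc (Suc j))} s \<partial>\<U>))"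
        by (subst T_diff) (use a[of "Suc j"] a[of "Suc (Suc j)"] in auto)
      also have "\<dots> = ennreal D * (\<integral>\<^sup>+s. M (a (Suc j)) * ennreal (2 * (1 - 1 / K)) * (ennreal (w s) * indicator {a (Suc j)..<a (Suc (Suc j))} s) \<partial>\<U>)"
        by (subst nn_integral_cmult) (auto intro!: borel_measurable_U)
      also have "\<dots> \<le> ennreal D * (\<integral>\<^sup>+r. g r * indicator {a (Suc j)..<a (Suc (Suc j))} r \<partial>\<U>)"
      proof (intro mult_left_mono nn_integral_mono)
        fix r :: real
        show "M (a (Suc j)) * ennreal (2 * (1 - 1 / K)) * (ennreal (w r) * indicator {a (Suc j)..<a (Suc (Suc j))} r) \<le> g r * indicator {a (Suc j)..<a (Suc (Suc j))} r"
        proof (cases "r \<in> {a (Suc j)..<a (Suc (Suc j))}")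
          case True
          then have r: "a (Suc j) \<le> r" "r < 1" using a[of "Suc (Suc j)"] by auto
          have "(1/K) ^ Suc j \<le> 1 / K" using power_decreasing[of 1 "Suc j" "1/K"] K by simp
          then have "1 - 1 / K \<le> r" using r by (simp add: a_def)
          then have "ennreal (2 * (1 - 1 / K)) \<le> ennreal (2 * r)" by (intro ennreal_leI) auto
          then have "M (a (Suc j)) * ennreal (2 * (1 - 1 / K)) * ennreal (w r) \<le> M r * ennreal (2 * r) * ennreal (w r)"
            using mono[OF a(1) r] by (intro mult_mono) auto
          then show ?thesis using True by (simp add: g_def mult_ac)
        qed simp
      qed auto
      finally show ?thesis .
    qed
    have Tm: "(\<lambda>s. ennreal (T s / (1 - s))) \<in> borel_measurable \<U>"
    proof -
      obtain T' where [measurable]: "T' \<in> borel_measurable borel" and T': "\<And>s. 0 \<le> s \<Longrightarrow> s < 1 \<Longrightarrow> T' s = T s"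
        using T_borel by blast
      have "(\<lambda>s. ennreal (T' s / (1 - s))) \<in> borel_measurable \<U>" by (rule borel_measurable_U) measurable
      then show ?thesis by (rule measurable_cong[THEN iffD1, rotated]) (auto simp: T')
    qed
    have fm [measurable]: "f \<in> borel_measurable \<U>" unfolding f_def using Tm Mm by (rule borel_measurable_times_ennreal[rotated])
    have part: "(\<integral>\<^sup>+r. f r * indicator {0..<a j} r \<partial>\<U>) \<le> ennreal D * (\<integral>\<^sup>+r. g r * indicator {0..<a (Suc j)} r \<partial>\<U>)" for j
    proof (induction j)
      case 0
      then show ?case by (simp add: a_def)
    next
      case (Suc j)
      have "(\<integral>\<^sup>+r. f r * indicator {0..<a (Suc j)} r \<partial>\<U>) \<le>
        ennreal D * (\<integral>\<^sup>+r. g r * indicator {0..<a (Suc j)} r \<partial>\<U>) + ennreal D * (\<integral>\<^sup>+r. g r * indicator {a (Suc j)..<a (Suc (Suc j))} r \<partial>\<U>)"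
        using order_trans[OF nn_integral_U_split[OF fm a(3)[of j]] add_mono[OF Suc.IH piece]] .
      also have "\<dots> = ennreal D * (\<integral>\<^sup>+r. g r * indicator {0..<a (Suc j)} r + g r * indicator {a (Suc j)..<a (Suc (Suc j))} r \<partial>\<U>)"
        by (subst nn_integral_add) (auto simp: distrib_left)
      also have "\<dots> = ennreal D * (\<integral>\<^sup>+r. g r * indicator {0..<a (Suc (Suc j))} r \<partial>\<U>)"
        using a(3)[of "Suc j"] a(1)[of "Suc j"] by (intro arg_cong2[where f="(*)"] nn_integral_cong) (auto simp: indicator_def)
      finally show ?case .
    qed
    have "(\<integral>\<^sup>+r. f r \<partial>\<U>) = (\<integral>\<^sup>+r. (SUP j. f r * indicator {0..<a j} r) \<partial>\<U>)"
    proof (rule nn_integral_cong)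
      fix r assume "r \<in> space \<U>"
      then have r: "0 \<le> r" "r < 1" by auto
      obtain j where "(1/K) ^ j < 1 - r" using real_arch_pow_inv[of "1 - r" "1/K"] r K by auto
      then have "f r = f r * indicator {0..<a j} r" using r by (simp add: a_def)
      then have "f r \<le> (SUP j. f r * indicator {0..<a j} r)" by (metis (mono_tags, lifting) SUP_upper UNIV_I)
      moreover have "(SUP j. f r * indicator {0..<a j} r) \<le> f r"
        by (rule SUP_least) (auto simp: indicator_def)
      ultimately show "f r = (SUP j. f r * indicator {0..<a j} r)" by simp
    qed
    also have "\<dots> = (SUP j. \<integral>\<^sup>+r. f r * indicator {0..<a j} r \<partial>\<U>)"
    proof (rule nn_integral_monotone_convergence_SUP)
      show "incseq (\<lambda>j r. f r * indicator {0..<a j} r)"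
        by (rule incseq_SucI) (use a(3) in \<open>auto simp: le_fun_def indicator_def intro: less_le_trans\<close>)
    qed measurable
    also have "\<dots> \<le> ennreal D * (\<integral>\<^sup>+r. g r \<partial>\<U>)"
    proof (rule SUP_least)
      fix j
      have "(\<integral>\<^sup>+r. g r * indicator {0..<a (Suc j)} r \<partial>\<U>) \<le> (\<integral>\<^sup>+r. g r \<partial>\<U>)"
        by (intro nn_integral_mono) (auto simp: indicator_def)
      then show "(\<integral>\<^sup>+r. f r * indicator {0..<a j} r \<partial>\<U>) \<le> ennreal D * (\<integral>\<^sup>+r. g r \<partial>\<U>)"
        using part[of j] by (meson mult_left_mono order_trans zero_le)
    qed
    finally show "(\<integral>\<^sup>+r. M r * ennreal (T r / (1 - r)) \<partial>\<U>) \<le> ennreal D * (\<integral>\<^sup>+r. ennreal (2 * r) * ennreal (w r) * M r \<partial>\<U>)"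
      by (simp add: f_def g_def)
  qed
qed

end

subsection \<open>Moments and the reproducing kernel\<close>

text \<open>Exponential decay of \<open>s ^ k\<close> beats polynomials in
  \<open>k * (1 - s)\<close>: for the bracket \<open>y\<close> one has
  \<open>y ^ c \<le> fact c * exp y\<close>, while \<open>s ^ k \<le> exp (- k * (1 - s))\<close>
  and \<open>y - k * (1 - s) = 2 * (1 - s) + 1 \<le> 3\<close>.\<close>

lemma power_poly_bound:
  fixes s :: real
  assumes "0 \<le> s" "s \<le> 1"
  shows "s ^ k * ((real k + 2) * (1 - s) + 1) ^ c \<le> fact c * exp 3"
proof -
  define y where "y = (real k + 2) * (1 - s) + 1"
  have y0: "0 \<le> y" using assms by (simp add: y_def)
  have "s \<le> exp (- (1 - s))" using exp_ge_add_one_self[of "- (1 - s)"] by simp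
  then have "s ^ k \<le> exp (- (1 - s)) ^ k" using assms by (intro power_mono) auto
  also have "\<dots> = exp (- (real k * (1 - s)))" by (simp add: exp_of_nat_mult[symmetric] algebra_simps)
  finally have 1: "s ^ k \<le> exp (- (real k * (1 - s)))" .
  have "y ^ c / fact c \<le> exp y"
  proof -
    have "(\<Sum>n\<in>{c}. y ^ n /\<^sub>R fact n) \<le> (\<Sum>n. y ^ n /\<^sub>R fact n)"
      using y0 by (intro sum_le_suminf summable_exp_generic) auto
    then show ?thesis by (simp add: exp_def divide_inverse mult.commute)
  qed
  then have 2: "y ^ c \<le> fact c * exp y" by (simp add: field_simps)
  have "s ^ k * y ^ c \<le> exp (- (real k * (1 - s))) * (fact c * exp y)"
    using y0 assms by (intro mult_mono 1 2) auto
  also have "\<dots> = fact c * exp (y - real k * (1 - s))"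
  proof -
    have "exp (- a) * (f * exp y) = f * exp (y - a)" for a f :: real
      by (simp add: exp_diff exp_minus field_simps)
    then show ?thesis .
  qed
  also have "\<dots> \<le> fact c * exp 3"
    using assms by (intro mult_left_mono) (auto simp: y_def algebra_simps)
  finally show ?thesis by (simp add: y_def)
qed

lemma circ_mean_square_sums:
  assumes f: "\<And>z. z \<in> unit_disc \<Longrightarrow> (\<lambda>k. a k * z ^ k) sums f z" and r: "0 \<le> r" "r < 1"
  shows "(\<lambda>k. (cmod (a k) * r ^ k)\<^sup>2) sums circ_mean (\<lambda>z. (cmod (f z))\<^sup>2) r"
proof -
  have s: "summable (\<lambda>k. norm (a k * of_real r ^ k))"
    by (rule power_series_summable_norm[OF f]) (use r in auto)
  then have s': "summable (\<lambda>k. norm (cnj (a k * of_real r ^ k)))" by (simp only: complex_mod_cnj)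
  have e1: "(\<lambda>k. (a k * of_real r ^ k) * circ t ^ k) sums f (of_real r * circ t)" for t
    using f[of "of_real r * circ t"] r by (simp add: norm_mult power_mult_distrib mult.assoc)
  have e2: "(\<lambda>k. cnj (a k * of_real r ^ k) * cnj (circ t) ^ k) sums cnj (f (of_real r * circ t))" for t
    using e1[of t] unfolding sums_cnj[symmetric, of "\<lambda>k. (a k * of_real r ^ k) * circ t ^ k"] by simp
  have "(\<lambda>k. (a k * of_real r ^ k) * cnj (a k * of_real r ^ k)) sums
     (\<integral>t. f (of_real r * circ t) * cnj (f (of_real r * circ t)) \<partial>\<U>)"
    using circle_parseval[OF s s'] sums_unique[OF e1, symmetric] sums_unique[OF e2, symmetric] by simp
  then have "(\<lambda>k. of_real ((cmod (a k * of_real r ^ k))\<^sup>2)) sums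
     (\<integral>t. complex_of_real ((cmod (f (of_real r * circ t)))\<^sup>2) \<partial>\<U>)"
    by (simp only: complex_norm_square)
  then have "(\<lambda>k. of_real ((cmod (a k * of_real r ^ k))\<^sup>2)) sums
     complex_of_real (circ_mean (\<lambda>z. (cmod (f z))\<^sup>2) r)"
    by (simp only: integral_complex_of_real circ_mean_def)
  then show ?thesis
    using r by (simp only: sums_of_real_iff) (simp add: norm_mult norm_power)
qed

lemma circ_mean_geometric:
  assumes s: "0 \<le> s" "s < 1"
  shows "circ_mean (\<lambda>z. (cmod (1 / (1 - z)))\<^sup>2) s \<le> 1 / (1 - s)"
proof -
  have "(\<lambda>k. 1 * z ^ k) sums (1 / (1 - z))" if "z \<in> unit_disc" for z :: complex
    using geometric_sums[of z] that by simp
  then have sA: "(\<lambda>k. (cmod 1 * s ^ k)\<^sup>2) sums circ_mean (\<lambda>z. (cmod (1 / (1 - z)))\<^sup>2) s"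
    by (rule circ_mean_square_sums) (use s in auto)
  have "(cmod 1 * s ^ k)\<^sup>2 \<le> s ^ k" for k
    using s by (simp add: power2_eq_square mult_left_le power_le_one)
  then show ?thesis by (rule sums_le[OF _ sA]) (use s geometric_sums[of s] in auto)
qed

context doubling_tail begin

lemma nn_integral_w: "(\<integral>\<^sup>+s. ennreal (w s) \<partial>\<U>) = ennreal (T 0)"
  by (subst T_eq) (auto intro!: nn_integral_cong)

lemma w_integrable: "integrable \<U> w"
  by (rule integrableI_nonneg) (auto simp: nn_integral_w w_nonneg intro!: borel_measurable_U)

text \<open>The squared norm of \<open>z ^ k\<close> in the weighted space, hence the reciprocal of
  the \<open>k\<close>-th coefficient of the reproducing kernel.\<close>

definition moment :: "nat \<Rightarrow> real" where
  "moment k = (\<integral>r. 2 * r ^ (2 * k + 1) * w r \<partial>\<U>)"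

lemma bounded_times_w_integrable:
  assumes "f \<in> borel_measurable borel" "\<And>r. 0 \<le> r \<Longrightarrow> r < 1 \<Longrightarrow> \<bar>f r\<bar> \<le> B"
  shows "integrable \<U> (\<lambda>r. f r * w r)"
proof (rule Bochner_Integration.integrable_bound[OF integrable_mult_right[OF w_integrable, of B]])
  show "(\<lambda>r. f r * w r) \<in> borel_measurable \<U>" 
    using assms(1) w_meas by (intro borel_measurable_U) measurable
  show "AE r in \<U>. norm (f r * w r) \<le> norm (B * w r)"
    using assms(2) w_nonneg
    by (intro AE_I2) (auto simp: abs_mult intro!: mult_right_mono order_trans[OF assms(2) abs_ge_self])
qed

lemma moment_integrable: "integrable \<U> (\<lambda>r. 2 * r ^ (2 * k + 1) * w r)"
  by (rule bounded_times_w_integrable[where B = 2]) (auto simp: abs_mult power_abs intro!: mult_le_one power_le_one)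

text \<open>From \<open>1 - 1 / (k + 2)\<close> on, the power \<open>s ^ (2 * k + 1)\<close> stays
  above \<open>exp (-2)\<close>. The offset 2 keeps this point positive also for
  \<open>k = 0\<close>.\<close>

lemma moment_lower: "2 * exp (-2) * T (1 - 1 / (real k + 2)) \<le> moment k"
proof -
  define r where "r = 1 - 1 / (real k + 2)"
  have r: "0 < r" "r < 1" by (auto simp: r_def field_simps)
  have "exp (-2) \<le> r ^ (2 * k + 2)"
  proof -
    have "1 / r = 1 + 1 / (real k + 1)" by (simp add: r_def field_simps)
    also have "\<dots> \<le> exp (1 / (real k + 1))" by (rule exp_ge_add_one_self)
    finally have "(1 / r) ^ (2 * k + 2) \<le> exp (1 / (real k + 1)) ^ (2 * k + 2)" using r by (intro power_mono) auto
    also have "\<dots> = exp 2"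
    proof -
      have "real (2 * k + 2) * (1 / (real k + 1)) = 2" by (simp add: field_simps)
      then show ?thesis by (simp only: exp_of_nat_mult[symmetric])
    qed
    finally have "inverse (exp 2) \<le> inverse ((1 / r) ^ (2 * k + 2))" using r by (intro le_imp_inverse_le) auto
    then show ?thesis by (simp add: exp_minus power_one_over)
  qed
  also have "\<dots> \<le> r ^ (2 * k + 1)" using r by (intro power_decreasing) auto
  finally have e: "exp (-2) \<le> r ^ (2 * k + 1)" .
  have "ennreal (2 * exp (-2) * T r) = (\<integral>\<^sup>+s. ennreal (2 * exp (-2)) * (ennreal (w s) * indicator {r..} s) \<partial>\<U>)"
    using r T_eq[of r] T_pos[of r] by (subst nn_integral_cmult) (auto simp: ennreal_mult intro!: borel_measurable_U)
  also have "\<dots> \<le> (\<integral>\<^sup>+s. ennreal (2 * s ^ (2 * k + 1) * w s) \<partial>\<U>)"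
  proof (rule nn_integral_mono)
    fix s
    have "2 * exp (-2) * w s \<le> 2 * s ^ (2 * k + 1) * w s" if "r \<le> s"
      using order_trans[OF e power_mono[OF that, of "2 * k + 1"]] r w_nonneg by (intro mult_right_mono) auto
    then show "ennreal (2 * exp (-2)) * (ennreal (w s) * indicator {r..} s) \<le> ennreal (2 * s ^ (2 * k + 1) * w s)"
      using w_nonneg[of s] by (auto simp: indicator_def ennreal_mult[symmetric] intro!: ennreal_leI)
  qed
  also have "\<dots> = ennreal (moment k)"
    unfolding moment_def using w_nonneg by (intro nn_integral_eq_integral moment_integrable AE_I2) auto
  finally show ?thesis
    using T_pos[of r] r unfolding r_def[symmetric] by (subst (asm) ennreal_le_iff2) (auto simp: mult_le_0_iff)
qed

lemma moment_pos: "0 < moment k"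
  by (rule less_le_trans[OF _ moment_lower]) (auto intro!: mult_pos_pos T_pos simp: field_simps)

lemma moment_Suc_le: "moment (Suc k) \<le> moment k"
  unfolding moment_def
  by (intro integral_mono moment_integrable mult_right_mono w_nonneg mult_left_mono power_decreasing) auto

text \<open>The moments vary slowly. The difference of the two powers is of order
  \<open>1 - s\<close> times a power of \<open>s\<close>, and \<open>k * (1 - s)\<close> is harmless
  next to \<open>s ^ k\<close>; what remains is an integral concentrated near
  \<open>a = 1 - 1 / (k + 2)\<close>, which \<open>T_weighted_powr\<close> bounds by
  \<open>T a\<close> and thus by the moment itself.\<close>

lemma moment_difference:
  obtains C where "C > 0" "\<And>k. real k * (moment k - moment (Suc k)) \<le> C * moment k"
proof -
  obtain c0 where c0: "\<And>c. c \<ge> c0 \<Longrightarrow> \<exists>C>0. \<forall>a\<in>{0..<1}.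
     (\<integral>\<^sup>+s. ennreal (w s * (1 - a * s) powr (- c)) \<partial>\<U>) \<le> ennreal (C * T a * (1 - a) powr (- c))"
    using T_weighted_powr by blast
  obtain c :: nat where "c0 \<le> real c" using real_arch_simple by blast
  then obtain C where C: "C > 0" "\<And>a. 0 \<le> a \<Longrightarrow> a < 1 \<Longrightarrow>
     (\<integral>\<^sup>+s. ennreal (w s * (1 - a * s) powr (- real c)) \<partial>\<U>) \<le> ennreal (C * T a * (1 - a) powr (- real c))"
    using c0[of "real c"] by auto
  define D where "D = 4 * exp 3 * (fact c * exp 3) * C / (2 * exp (-2))"
  have D: "D > 0" using C(1) by (simp add: D_def)
  show ?thesis
  proof (rule that[OF D])
    fix k
    define a where "a = 1 - 1 / (real k + 2)"
    have a: "0 \<le> a" "a < 1" "1 - a = 1 / (real k + 2)" by (auto simp: a_def field_simps)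
    \<comment> \<open>One copy of \<open>s ^ k\<close> absorbs the factor
      \<open>k * (1 - s)\<close>; the other is traded for the ratio
      \<open>((1 - a) / (1 - a * s)) ^ c\<close>.\<close>
    have pw: "real k * (2 * s ^ (2 * k + 1) - 2 * s ^ (2 * Suc k + 1)) * w s \<le>
        (4 * exp 3 * (fact c * exp 3) * (1 - a) ^ c) * (w s * (1 - a * s) powr (- real c))" if s: "0 \<le> s" "s < 1" for s
    proof -
      have as: "a * s < 1" using mult_left_le[of s a] s a by simp
      have "real k * (2 * s ^ (2 * k + 1) - 2 * s ^ (2 * Suc k + 1)) = 2 * (s ^ k * (real k * (1 - s))) * (s ^ k * (s * (1 + s)))"
        by (simp add: power_add power_mult power2_eq_square algebra_simps power_mult_distrib)
      also have "\<dots> \<le> 2 * exp 3 * (s ^ k * 2)"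
      proof (intro mult_mono)
        have "s ^ k * (real k * (1 - s)) \<le> s ^ k * ((real k + 2) * (1 - s) + 1)"
          using s by (intro mult_left_mono) (auto simp: algebra_simps)
        also have "\<dots> \<le> exp 3" using power_poly_bound[of s k 1] s by simp
        finally show "s ^ k * (real k * (1 - s)) \<le> exp 3" .
        show "s * (1 + s) \<le> 2" using s mult_mono[of s 1 "1 + s" 2] by simp
      qed (use s in auto)
      finally have 1: "real k * (2 * s ^ (2 * k + 1) - 2 * s ^ (2 * Suc k + 1)) \<le> 4 * exp 3 * s ^ k" by simp
      have "(1 - a * s) = (1 - s) + s * (1 - a)" by (simp add: algebra_simps)
      also have "\<dots> \<le> (1 - s) + 1 * (1 - a)" using s a(1,2) by (intro add_mono mult_right_mono) auto
      also have "\<dots> = ((real k + 2) * (1 - s) + 1) * (1 - a)" unfolding a(3) by (simp add: field_simps)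
      finally have "(1 - a * s) ^ c \<le> (((real k + 2) * (1 - s) + 1) * (1 - a)) ^ c" using as by (intro power_mono) auto
      then have "s ^ k * (1 - a * s) ^ c \<le> (s ^ k * ((real k + 2) * (1 - s) + 1) ^ c) * (1 - a) ^ c"
        using s by (simp add: power_mult_distrib mult_left_mono mult.assoc)
      also have "\<dots> \<le> (fact c * exp 3) * (1 - a) ^ c"
        using power_poly_bound[of s k c] s a by (intro mult_right_mono) auto
      finally have 2: "s ^ k \<le> (fact c * exp 3) * (1 - a) ^ c * (1 - a * s) powr (- real c)"
        using as by (simp add: powr_minus powr_realpow field_simps)
      have "real k * (2 * s ^ (2 * k + 1) - 2 * s ^ (2 * Suc k + 1)) \<le> 4 * exp 3 * ((fact c * exp 3) * (1 - a) ^ c * (1 - a * s) powr (- real c))"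
        using 1 2 by (meson mult_left_mono order_trans exp_ge_zero mult_nonneg_nonneg zero_le_numeral)
      then have "real k * (2 * s ^ (2 * k + 1) - 2 * s ^ (2 * Suc k + 1)) * w s \<le> 4 * exp 3 * ((fact c * exp 3) * (1 - a) ^ c * (1 - a * s) powr (- real c)) * w s"
        using w_nonneg by (rule mult_right_mono)
      then show ?thesis by (simp add: mult_ac)
    qed
    have eq: "real k * (moment k - moment (Suc k)) = (\<integral>s. real k * (2 * s ^ (2 * k + 1) - 2 * s ^ (2 * Suc k + 1)) * w s \<partial>\<U>)"
    proof -
      have "real k * (moment k - moment (Suc k)) = (\<integral>s. real k * (2 * s ^ (2 * k + 1) * w s - 2 * s ^ (2 * Suc k + 1) * w s) \<partial>\<U>)"
        by (simp only: moment_def Bochner_Integration.integral_diff[OF moment_integrable moment_integrable] integral_mult_right_zero)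
      also have "\<dots> = (\<integral>s. real k * (2 * s ^ (2 * k + 1) - 2 * s ^ (2 * Suc k + 1)) * w s \<partial>\<U>)"
        by (intro Bochner_Integration.integral_cong refl) (simp only: mult.assoc left_diff_distrib)
      finally show ?thesis .
    qed
    have "ennreal (real k * (moment k - moment (Suc k))) \<le> (\<integral>\<^sup>+s. ennreal (real k * (2 * s ^ (2 * k + 1) - 2 * s ^ (2 * Suc k + 1)) * w s) \<partial>\<U>)"
    proof -
      have "0 \<le> real k * (2 * s ^ (2 * k + 1) - 2 * s ^ (2 * Suc k + 1)) * w s" if "0 \<le> s" "s < 1" for s
      proof -
        have "s ^ (2 * Suc k + 1) \<le> s ^ (2 * k + 1)" using that by (intro power_decreasing) auto
        then show ?thesis using w_nonneg[of s] by (intro mult_nonneg_nonneg) auto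
      qed
      moreover have "integrable \<U> (\<lambda>s. real k * (2 * s ^ (2 * k + 1) - 2 * s ^ (2 * Suc k + 1)) * w s)"
        using integrable_mult_right[OF Bochner_Integration.integrable_diff[OF moment_integrable[of k] moment_integrable[of "Suc k"]], of "real k"]
        by (simp add: algebra_simps)
      ultimately show ?thesis unfolding eq by (subst nn_integral_eq_integral) (auto intro!: AE_I2)
    qed
    also have "\<dots> \<le> (\<integral>\<^sup>+s. ennreal (4 * exp 3 * (fact c * exp 3) * (1 - a) ^ c) * ennreal (w s * (1 - a * s) powr (- real c)) \<partial>\<U>)"
    proof (rule nn_integral_mono)
      fix s assume "s \<in> space \<U>"
      then show "ennreal (real k * (2 * s ^ (2 * k + 1) - 2 * s ^ (2 * Suc k + 1)) * w s) \<le> ennreal (4 * exp 3 * (fact c * exp 3) * (1 - a) ^ c) * ennreal (w s * (1 - a * s) powr (- real c))"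
        using pw[of s] a w_nonneg[of s] by (subst ennreal_mult[symmetric]) (auto intro!: ennreal_leI)
    qed
    also have "\<dots> = ennreal (4 * exp 3 * (fact c * exp 3) * (1 - a) ^ c) * (\<integral>\<^sup>+s. ennreal (w s * (1 - a * s) powr (- real c)) \<partial>\<U>)"
      by (rule nn_integral_cmult, rule borel_measurable_U) measurable
    also have "\<dots> \<le> ennreal (4 * exp 3 * (fact c * exp 3) * (1 - a) ^ c) * ennreal (C * T a * (1 - a) powr (- real c))"
      using C(2)[OF a(1,2)] by (rule mult_left_mono) simp
    also have "\<dots> = ennreal (4 * exp 3 * (fact c * exp 3) * C * T a)"
      using a C(1) T_pos[OF a(1,2)] by (subst ennreal_mult[symmetric]) (auto simp: powr_minus powr_realpow)
    finally have "real k * (moment k - moment (Suc k)) \<le> 4 * exp 3 * (fact c * exp 3) * C * T a"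
      using C(1) T_pos[OF a(1,2)] by (subst (asm) ennreal_le_iff) auto
    also have "\<dots> = D * (2 * exp (-2) * T a)" by (simp add: D_def)
    also have "\<dots> \<le> D * moment k" unfolding a_def using D by (intro mult_left_mono moment_lower) auto
    finally show "real k * (moment k - moment (Suc k)) \<le> D * moment k" .
  qed
qed

text \<open>The moment is compared with the tail at \<open>1 - 1 / (k + n + 2)\<close>, and the tail
  is then moved to an arbitrary \<open>s\<close>. The price is polynomial in
  \<open>k * (1 - s)\<close>, so \<open>power_poly_bound\<close> removes it whenever a factor
  \<open>s ^ k\<close> is at hand.\<close>

lemma inverse_moment_le:
  obtains C b where "C > 0" "\<And>k s. 0 \<le> s \<Longrightarrow> s < 1 \<Longrightarrow>
    1 / moment (k + n) \<le> C * ((real k + 2) * (1 - s) + 1) ^ b / T s"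
proof -
  obtain Cg b where Cg: "Cg \<ge> 1" "\<And>s t. 0 \<le> s \<Longrightarrow> s \<le> t \<Longrightarrow> t < 1 \<Longrightarrow> T s \<le> Cg * ((1 - s) / (1 - t)) ^ b * T t"
    using T_growth by blast
  \<comment> \<open>The factor \<open>(n + 1) ^ b\<close> pays for the shift of the moment index by
    \<open>n\<close>.\<close>
  define C where "C = Cg * (real n + 1) ^ b / (2 * exp (-2))"
  show ?thesis
  proof (rule that[of C b])
    show "C > 0" using Cg(1) by (simp add: C_def)
    fix k s assume s: "0 \<le> s" "s < (1::real)"
    define t where "t = 1 - 1 / (real (k + n) + 2)"
    have t: "0 \<le> t" "t < 1" "1 - t = 1 / (real (k + n) + 2)" by (auto simp: t_def field_simps)
    define y where "y = (real k + 2) * (1 - s) + 1"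
    have y: "1 \<le> y" using s by (simp add: y_def)
    have "T s \<le> Cg * ((real n + 1) * y) ^ b * T t"
    proof (cases "s \<le> t")
      case True
      have "(1 - s) / (1 - t) = (real k + 2) * (1 - s) + real n * (1 - s)" unfolding t(3) by (simp add: algebra_simps)
      also have "\<dots> \<le> y + real n * y" 
      proof (intro add_mono mult_left_mono)
        show "1 - s \<le> y" using s y by linarith
      qed (simp_all add: y_def)
      finally have "(1 - s) / (1 - t) \<le> (real n + 1) * y" by (simp add: algebra_simps)
      then have "Cg * ((1 - s) / (1 - t)) ^ b * T t \<le> Cg * ((real n + 1) * y) ^ b * T t"
        using s t Cg(1) T_pos[of t] by (intro mult_right_mono mult_left_mono power_mono) auto
      then show ?thesis using Cg(2)[OF s(1) True t(2)] by linarith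
    next
      case False
      have "1 \<le> Cg * ((real n + 1) * y) ^ b"
        using Cg(1) y mult_mono[of 1 "real n + 1" 1 y] one_le_power[of "(real n + 1) * y" b] mult_mono[of 1 Cg 1 "((real n + 1) * y) ^ b"] by simp
      then have "1 * T t \<le> Cg * ((real n + 1) * y) ^ b * T t" using T_pos[of t] t by (intro mult_right_mono) auto
      moreover have "T s \<le> T t" using False t s by (intro T_antimono) auto
      ultimately show ?thesis by simp
    qed
    also have "\<dots> = C * y ^ b * (2 * exp (-2) * T t)" by (simp add: C_def power_mult_distrib)
    also have "\<dots> \<le> C * y ^ b * moment (k + n)"
      unfolding t_def using \<open>C > 0\<close> y moment_lower[of "k + n"] by (intro mult_left_mono) auto
    finally show "1 / moment (k + n) \<le> C * ((real k + 2) * (1 - s) + 1) ^ b / T s"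
      using moment_pos[of "k + n"] T_pos[OF s] by (simp add: field_simps y_def)
  qed
qed

section \<open>Convergence and circle means of the reproducing kernel\<close>

text \<open>At \<open>z \<in> unit_disc\<close> the reproducing kernel is \<open>\<zeta> \<mapsto> kern 0 (cnj z * \<zeta>)\<close>; the shifted kernels recover
  \<open>n\<close>-th derivatives.\<close>

definition kern :: "nat \<Rightarrow> complex \<Rightarrow> complex" where
  "kern n z = (\<Sum>k. z ^ k / of_real (moment (k + n)))"

lemma kern_summable:
  assumes z: "z \<in> unit_disc"
  shows "summable (\<lambda>k. norm (z ^ k / of_real (moment (k + n))))"
proof -
  obtain C b where C: "C > 0" "\<And>k s. 0 \<le> s \<Longrightarrow> s < 1 \<Longrightarrow>
    1 / moment (k + n) \<le> C * ((real k + 2) * (1 - s) + 1) ^ b / T s"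
    using inverse_moment_le by blast
  \<comment> \<open>A radius strictly between \<open>cmod z\<close> and 1: the power
    \<open>\<rho> ^ k\<close> controls the reciprocal moments, and a geometric series in
    \<open>cmod z / \<rho>\<close> is left.\<close>
  define \<rho> where "\<rho> = (1 + cmod z) / 2"
  have \<rho>: "0 < \<rho>" "\<rho> < 1" "cmod z < \<rho>" using z by (auto simp: \<rho>_def add_pos_nonneg)
  define B where "B = C * (fact b * exp 3) / T \<rho>"
  have "norm (norm (z ^ k / of_real (moment (k + n)))) \<le> B * (cmod z / \<rho>) ^ k" for k
  proof -
    have "norm (z ^ k / of_real (moment (k + n))) = (cmod z / \<rho>) ^ k * (\<rho> ^ k * (1 / moment (k + n)))"
      using \<rho> moment_pos[of "k + n"] by (simp add: norm_divide norm_power power_divide)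
    also have "\<dots> \<le> (cmod z / \<rho>) ^ k * (\<rho> ^ k * (C * ((real k + 2) * (1 - \<rho>) + 1) ^ b / T \<rho>))"
      using C(2)[of \<rho> k] \<rho> by (intro mult_left_mono) auto
    also have "\<dots> = (cmod z / \<rho>) ^ k * (C * (\<rho> ^ k * ((real k + 2) * (1 - \<rho>) + 1) ^ b) / T \<rho>)"
      by (simp add: mult_ac)
    also have "\<dots> \<le> (cmod z / \<rho>) ^ k * B"
      unfolding B_def using power_poly_bound[of \<rho> k b] \<rho> C(1) T_pos[of \<rho>]
      by (intro mult_left_mono divide_right_mono) auto
    finally show ?thesis by (simp add: mult.commute)
  qed
  moreover have "summable (\<lambda>k. B * (cmod z / \<rho>) ^ k)"
    using \<rho> by (intro summable_mult summable_geometric) auto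
  ultimately show ?thesis by (rule summable_comparison_test'[rotated])
qed

lemma kern_sums: "z \<in> unit_disc \<Longrightarrow> (\<lambda>k. (1 / of_real (moment (k + n))) * z ^ k) sums kern n z"
  unfolding kern_def using summable_sums[OF summable_norm_cancel[OF kern_summable]] by simp

lemma kern_holomorphic: "kern n holomorphic_on unit_disc"
  and taylor_kern: "taylor (kern n) = (\<lambda>k. 1 / of_real (moment (k + n)))"
  using power_series_taylor[of "\<lambda>k. 1 / of_real (moment (k + n))" "kern n"] kern_sums by blast+

lemma kern_cnj: "z \<in> unit_disc \<Longrightarrow> kern n (cnj z) = cnj (kern n z)"
proof -
  assume z: "z \<in> unit_disc"
  then have "(\<lambda>k. cnj ((1 / of_real (moment (k + n))) * z ^ k)) sums cnj (kern n z)"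
    using kern_sums[OF z] by (simp only: sums_cnj)
  moreover have "(\<lambda>k. cnj ((1 / of_real (moment (k + n))) * z ^ k)) sums kern n (cnj z)"
    using kern_sums[of "cnj z" n] z by simp
  ultimately show ?thesis by (rule sums_unique2[rotated])
qed

text \<open>The coefficients of \<open>(1 - z) kern' z\<close> are of the order of the inverse moments, so its square mean
  is easy to bound; splitting off \<open>1 / (1 - z)\<close> by the inequality of arithmetic and geometric means
  turns this into a bound for the mean of \<open>kern'\<close>.\<close>

lemma deriv_kern_mean:
  obtains C where "C > 0" "\<And>s. 0 \<le> s \<Longrightarrow> s < 1 \<Longrightarrow> circ_mean (\<lambda>z. cmod (deriv (kern n) z)) s \<le> C / ((1 - s) * T s)"
proof -
  obtain Cd where Cd: "Cd > 0" "\<And>k. real k * (moment k - moment (Suc k)) \<le> Cd * moment k"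
    using moment_difference by blast
  obtain Ci b where Ci: "Ci > 0" "\<And>k s. 0 \<le> s \<Longrightarrow> s < 1 \<Longrightarrow>
    1 / moment (k + Suc n) \<le> Ci * ((real k + 2) * (1 - s) + 1) ^ b / T s"
    using inverse_moment_le by blast
  define K' where "K' = deriv (kern n)"
  have K': "K' holomorphic_on unit_disc" unfolding K'_def by (rule holomorphic_deriv[OF kern_holomorphic open_ball])
  \<comment> \<open>\<open>d k\<close> is the \<open>k\<close>-th coefficient of
    \<open>(1 - z) * K' z\<close>, a difference of consecutive coefficients of \<open>K'\<close>;
    slow variation of the moments makes it as small as a single reciprocal moment.\<close>
  define d :: "nat \<Rightarrow> real" where "d k = real (Suc k) / moment (Suc k + n) - real k / moment (k + n)" for k
  have d: "0 \<le> d k" "d k \<le> (1 + Cd) * (1 / moment (k + Suc n))" for k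
  proof -
    define m m' where "m = moment (k + n)" and "m' = moment (Suc (k + n))"
    have m: "0 < m" "0 < m'" "m' \<le> m" unfolding m_def m'_def by (auto intro: moment_pos moment_Suc_le)
    have "real k * (m - m') \<le> real (k + n) * (m - m')" using m by (intro mult_right_mono) auto
    also have "\<dots> \<le> Cd * m" unfolding m_def m'_def by (rule Cd(2))
    finally have k: "real k * (m - m') \<le> Cd * m" .
    have "d k = 1 / m' + real k * (m - m') / (m * m')"
      using m unfolding d_def m_def m'_def by (simp add: field_simps)
    moreover have "real k * (m - m') / (m * m') \<le> Cd * m / (m * m')"
      using k m by (intro divide_right_mono) auto
    moreover have "0 \<le> real k * (m - m') / (m * m')" using m by simp
    ultimately show "0 \<le> d k" "d k \<le> (1 + Cd) * (1 / moment (k + Suc n))"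
      using m unfolding m'_def[symmetric] by (auto simp: m'_def[symmetric] add_divide_distrib)
  qed
  define \<Phi> where "\<Phi> z = (1 - z) * K' z" for z
  have \<Phi>s: "(\<lambda>k. of_real (d k) * z ^ k) sums \<Phi> z" if z: "z \<in> unit_disc" for z
  proof -
    have tk: "taylor K' k = of_real (real (Suc k) / moment (Suc k + n))" for k
      by (simp add: K'_def taylor_deriv taylor_kern)
    have s: "(\<lambda>k. taylor K' k * z ^ k) sums K' z" by (rule taylor_sums[OF K' z])
    have "(\<lambda>k. (case k of 0 \<Rightarrow> 0 | Suc j \<Rightarrow> taylor K' j * z ^ Suc j)) sums (z * K' z)"
      using sums_mult[OF s, of z] sums_Suc_iff[of "\<lambda>k. (case k of 0 \<Rightarrow> 0 | Suc j \<Rightarrow> taylor K' j * z ^ Suc j)" "z * K' z"]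
      by (simp add: mult_ac)
    then have "(\<lambda>k. taylor K' k * z ^ k - (case k of 0 \<Rightarrow> 0 | Suc j \<Rightarrow> taylor K' j * z ^ Suc j)) sums (K' z - z * K' z)"
      by (rule sums_diff[OF s])
    moreover have "taylor K' k * z ^ k - (case k of 0 \<Rightarrow> 0 | Suc j \<Rightarrow> taylor K' j * z ^ Suc j) = of_real (d k) * z ^ k" for k
      by (cases k) (simp_all add: tk d_def algebra_simps)
    ultimately show ?thesis by (simp add: \<Phi>_def algebra_simps)
  qed
  define C where "C = ((1 + Cd) * Ci)\<^sup>2 * (fact (2 * b) * exp 3)"
  have C0: "0 \<le> C" by (simp add: C_def)
  show ?thesis
  proof (rule that[of "(C + 1) / 2"])
    show "(C + 1) / 2 > 0" using C0 by simp
    fix s :: real assume s: "0 \<le> s" "s < 1"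
    have T0: "0 < T s" using T_pos[OF s] .
    have A: "circ_mean (\<lambda>z. (cmod (\<Phi> z))\<^sup>2) s \<le> C / ((1 - s) * (T s)\<^sup>2)"
    proof -
      have sA: "(\<lambda>k. (cmod (of_real (d k)) * s ^ k)\<^sup>2) sums circ_mean (\<lambda>z. (cmod (\<Phi> z))\<^sup>2) s"
        by (rule circ_mean_square_sums[OF \<Phi>s s])
      have sB: "(\<lambda>k. C / (T s)\<^sup>2 * s ^ k) sums (C / (T s)\<^sup>2 * (1 / (1 - s)))"
        using s by (intro sums_mult geometric_sums) auto
      have "(cmod (of_real (d k)) * s ^ k)\<^sup>2 \<le> C / (T s)\<^sup>2 * s ^ k" for k
      proof -
        define y where "y = (real k + 2) * (1 - s) + 1"
        have y0: "0 \<le> y" using s by (simp add: y_def)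
        have "d k \<le> (1 + Cd) * (Ci * y ^ b / T s)"
          using d(2)[of k] Ci(2)[OF s, of k] Cd(1) unfolding y_def by (meson add_nonneg_nonneg less_imp_le mult_left_mono order_trans zero_le_one)
        then have "(d k)\<^sup>2 \<le> ((1 + Cd) * (Ci * y ^ b / T s))\<^sup>2" using d(1) by (intro power_mono) auto
        then have "(d k * s ^ k)\<^sup>2 \<le> ((1 + Cd) * (Ci * y ^ b / T s))\<^sup>2 * (s ^ k)\<^sup>2"
          unfolding power_mult_distrib[of "d k"] by (intro mult_right_mono) auto
        also have "\<dots> = ((1 + Cd) * Ci)\<^sup>2 * (s ^ k * y ^ (2 * b)) / (T s)\<^sup>2 * s ^ k"
          by (simp add: power_mult_distrib power_divide power_mult power2_eq_square mult_ac power_add[symmetric] mult_2)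
        also have "\<dots> \<le> ((1 + Cd) * Ci)\<^sup>2 * (fact (2 * b) * exp 3) / (T s)\<^sup>2 * s ^ k"
          using power_poly_bound[of s k "2 * b"] s unfolding y_def
          by (intro mult_right_mono divide_right_mono mult_left_mono) auto
        finally show ?thesis using d(1)[of k] by (simp add: C_def)
      qed
      then have "circ_mean (\<lambda>z. (cmod (\<Phi> z))\<^sup>2) s \<le> C / (T s)\<^sup>2 * (1 / (1 - s))"
        by (rule sums_le[OF _ sA sB])
      then show ?thesis by (simp add: mult.commute)
    qed
    have B: "circ_mean (\<lambda>z. (cmod (1 / (1 - z)))\<^sup>2) s \<le> 1 / (1 - s)"
      by (rule circ_mean_geometric[OF s])
    have nz: "1 - z \<noteq> 0" if "z \<in> unit_disc" for z :: complex using that by auto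
    have c\<Phi>: "continuous_on unit_disc (\<lambda>z. (cmod (\<Phi> z))\<^sup>2)"
      unfolding \<Phi>_def by (intro continuous_intros holomorphic_on_imp_continuous_on K')
    have c1: "continuous_on unit_disc (\<lambda>z. (cmod (1 / (1 - z)))\<^sup>2)"
      by (intro continuous_intros) (use nz in auto)
    have cK: "continuous_on unit_disc (\<lambda>z. cmod (K' z))"
      by (intro continuous_intros holomorphic_on_imp_continuous_on K')
    note i = circle_integrable[OF c\<Phi> s] circle_integrable[OF c1 s] circle_integrable[OF cK s]
    \<comment> \<open>The arithmetic-geometric mean inequality is weighted by \<open>T s\<close>,
      which makes both halves of the order \<open>1 / ((1 - s) * T s)\<close>.\<close>
    have "circ_mean (\<lambda>z. cmod (K' z)) s \<le> (\<integral>t. (T s / 2) * (cmod (\<Phi> (of_real s * circ t)))\<^sup>2 + (1 / (2 * T s)) * (cmod (1 / (1 - of_real s * circ t)))\<^sup>2 \<partial>\<U>)"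
      unfolding circ_mean_def
    proof (rule integral_mono)
      fix t
      define z where "z = of_real s * circ t"
      have z: "z \<in> unit_disc" using s by (simp add: z_def norm_mult)
      define u v where "u = cmod (\<Phi> z)" and "v = cmod (1 / (1 - z))"
      have "cmod (K' z) = u * v" using nz[OF z] by (simp add: u_def v_def \<Phi>_def norm_mult norm_divide)
      moreover have "0 \<le> (T s * u - v)\<^sup>2 / (2 * T s)" using T0 by simp
      moreover have "(T s * u - v)\<^sup>2 / (2 * T s) = (T s / 2) * u\<^sup>2 + (1 / (2 * T s)) * v\<^sup>2 - u * v"
        using T0 by (simp add: power2_eq_square field_simps)
      ultimately show "cmod (K' (of_real s * circ t)) \<le> (T s / 2) * (cmod (\<Phi> (of_real s * circ t)))\<^sup>2 + (1 / (2 * T s)) * (cmod (1 / (1 - of_real s * circ t)))\<^sup>2"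
        unfolding z_def u_def v_def by linarith
    qed (use i in \<open>auto intro!: Bochner_Integration.integrable_add integrable_mult_right\<close>)
    also have "\<dots> = (T s / 2) * circ_mean (\<lambda>z. (cmod (\<Phi> z))\<^sup>2) s + (1 / (2 * T s)) * circ_mean (\<lambda>z. (cmod (1 / (1 - z)))\<^sup>2) s"
      unfolding circ_mean_def using i by (subst Bochner_Integration.integral_add) auto
    also have "\<dots> \<le> (T s / 2) * (C / ((1 - s) * (T s)\<^sup>2)) + (1 / (2 * T s)) * (1 / (1 - s))"
      using A B T0 by (intro add_mono mult_left_mono) auto
    also have "\<dots> = (C + 1) / 2 / ((1 - s) * T s)"
    proof -
      have "(x / 2) * (C / (e * x\<^sup>2)) + (1 / (2 * x)) * (1 / e) = (C + 1) / 2 / (e * x)" if "x > 0" "e > 0" for x e :: real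
        using that by (simp add: power2_eq_square divide_simps)
      then show ?thesis using T0 s by simp
    qed
    finally show "circ_mean (\<lambda>z. cmod (deriv (kern n) z)) s \<le> (C + 1) / 2 / ((1 - s) * T s)" by (simp add: K'_def)
  qed
qed

text \<open>The bound for the derivative is integrated along a radius, for the dual function
  \<open>F\<close> so that the mean itself is never differentiated. A mere bound of
  \<open>T t\<close> from below by \<open>T s\<close> would leave a logarithm; the decay exponent
  \<alpha> from lower doubling makes the integrand a power with a convergent integral.\<close>

lemma kern_mean:
  obtains C where "C > 0" "\<And>s. 0 \<le> s \<Longrightarrow> s < 1 \<Longrightarrow> circ_mean (\<lambda>z. cmod (kern n z)) s \<le> C / T s"
proof -
  obtain C1 where C1: "C1 > 0" "\<And>s. 0 \<le> s \<Longrightarrow> s < 1 \<Longrightarrow> circ_mean (\<lambda>z. cmod (deriv (kern n) z)) s \<le> C1 / ((1 - s) * T s)"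
    using deriv_kern_mean by blast
  obtain C2 \<alpha> where C2: "C2 > 0" "\<alpha> > 0" "\<And>s t. 0 \<le> s \<Longrightarrow> s \<le> t \<Longrightarrow> t < 1 \<Longrightarrow> T t \<le> C2 * ((1 - t) / (1 - s)) powr \<alpha> * T s"
    using T_decay by blast
  define C where "C = C1 * C2 / \<alpha> + T 0 / moment n"
  show ?thesis
  proof (rule that[of C])
    show "C > 0" using C1(1) C2(1,2) T_pos[of 0] moment_pos[of n] by (auto simp: C_def intro!: add_pos_pos)
    fix s :: real assume s: "0 \<le> s" "s < 1"
    have T0: "0 < T s" using T_pos[OF s] .
    obtain F where F: "F holomorphic_on unit_disc" "F (of_real s) = of_real (circ_mean (\<lambda>z. cmod (kern n z)) s)"
      "\<And>z. z \<in> unit_disc \<Longrightarrow> cmod (F z) \<le> circ_mean (\<lambda>z. cmod (kern n z)) (cmod z)"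
      "\<And>z. z \<in> unit_disc \<Longrightarrow> cmod (deriv F z) \<le> circ_mean (\<lambda>z. cmod (deriv (kern n) z)) (cmod z)"
      using circ_mean_dual[OF kern_holomorphic s] by metis
    have k0: "kern n 0 = 1 / of_real (moment n)"
      using sums_unique2[OF kern_sums[of 0 n] powser_sums_zero[of "\<lambda>k. 1 / of_real (moment (k + n))"]] by simp
    have "circ_mean (\<lambda>z. cmod (kern n z)) 0 = 1 / moment n"
      using moment_pos[of n] by (simp add: circ_mean_def k0 norm_divide measure_restrict_space measure_def)
    then have F0: "cmod (F 0) \<le> 1 / moment n" using F(3)[of 0] by simp
    \<comment> \<open>\<open>T_decay\<close> between \<open>t\<close> and \<open>s\<close> gives the
      derivative the bound \<open>A * (1 - t) powr (- \<alpha> - 1)\<close> for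
      \<open>t < s\<close>, whose primitive at \<open>s\<close> is of the order
      \<open>1 / T s\<close>.\<close>
    define A where "A = C1 * C2 * (1 - s) powr \<alpha> / T s"
    have diff: "cmod (F (of_real s) - F (of_real 0)) \<le> A / \<alpha> * (1 - s) powr (- \<alpha>) - A / \<alpha> * (1 - 0) powr (- \<alpha>)"
    proof (cases "s = 0")
      case False
      have sub: "of_real ` {0..s} \<subseteq> unit_disc" using s by auto
      show ?thesis
      proof (rule differentiable_bound_general[where f' = "\<lambda>t. deriv F (of_real t)" and \<phi>' = "\<lambda>t. A * (1 - t) powr (- \<alpha> - 1)"])
        show "0 < s" using False s by simp
        show "continuous_on {0..s} (\<lambda>t. F (of_real t))"
          by (rule continuous_on_compose2[OF holomorphic_on_imp_continuous_on[OF F(1)] _ sub]) (intro continuous_intros)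
        show "continuous_on {0..s} (\<lambda>t. A / \<alpha> * (1 - t) powr (- \<alpha>))"
          using s by (intro continuous_intros) auto
        fix t assume t: "0 < t" "t < s"
        show "((\<lambda>t. F (of_real t)) has_vector_derivative deriv F (of_real t)) (at t)"
          using t s by (intro has_vector_derivative_real_field holomorphic_derivI[OF F(1)]) auto
        show "((\<lambda>t. A / \<alpha> * (1 - t) powr (- \<alpha>)) has_vector_derivative A * (1 - t) powr (- \<alpha> - 1)) (at t)"
          unfolding has_real_derivative_iff_has_vector_derivative[symmetric] using t s C2(2)
          by (auto intro!: derivative_eq_intros simp: powr_diff)
        define q where "q = ((1 - s) / (1 - t)) powr \<alpha>"
        have "T s \<le> C2 * q * T t" using C2(3)[of t s] t s by (simp add: q_def)
        then have "1 / T t \<le> C2 * q / T s" using T0 T_pos[of t] t s by (simp add: field_simps)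
        then have "1 / T t / (1 - t) \<le> C2 * q / T s / (1 - t)" using t s by (intro divide_right_mono) auto
        then have "1 / ((1 - t) * T t) \<le> C2 * ((1 - s) / (1 - t)) powr \<alpha> / T s / (1 - t)"
          by (simp add: q_def mult.commute)
        then have "C1 / ((1 - t) * T t) \<le> C1 * (C2 * ((1 - s) / (1 - t)) powr \<alpha> / T s / (1 - t))"
          using C1(1) by (simp add: divide_inverse)
        also have "\<dots> = A * (1 - t) powr (- \<alpha> - 1)"
          using s t by (simp add: A_def powr_divide powr_minus powr_diff field_simps)
        finally show "cmod (deriv F (of_real t)) \<le> A * (1 - t) powr (- \<alpha> - 1)"
          using F(4)[of "of_real t"] C1(2)[of t] t s by simp
      qed
    qed simp
    have A0: "0 \<le> A" using C1(1) C2(1) T0 by (simp add: A_def)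
    have "circ_mean (\<lambda>z. cmod (kern n z)) s = cmod (F (of_real s))"
      unfolding F(2) by (simp add: circ_mean_nonneg)
    also have "\<dots> \<le> cmod (F (of_real s) - F (of_real 0)) + cmod (F 0)"
      using norm_triangle_sub[of "F (of_real s)" "F 0"] by simp
    also have "\<dots> \<le> A / \<alpha> * (1 - s) powr (- \<alpha>) + 1 / moment n"
      using diff F0 divide_nonneg_pos[OF A0 C2(2)] by simp
    also have "A / \<alpha> * (1 - s) powr (- \<alpha>) = C1 * C2 / \<alpha> / T s"
      using s by (simp add: A_def powr_minus field_simps)
    also have "1 / moment n \<le> T 0 / moment n / T s"
      using T_antimono[of 0 s] s T0 moment_pos[of n] by (simp add: field_simps)
    finally show "circ_mean (\<lambda>z. cmod (kern n z)) s \<le> C / T s"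
      by (simp add: C_def add_divide_distrib)
  qed
qed

end

subsection \<open>Pairings and the Euler operator\<close>

lemma ennreal_mult3: "0 \<le> a \<Longrightarrow> 0 \<le> b \<Longrightarrow> 0 \<le> c \<Longrightarrow> ennreal a * ennreal b * ennreal c = ennreal (a * b * c)"
  by (simp add: ennreal_mult)

lemma log_factor: "r < 1 \<Longrightarrow> ln (exp 1 / (1 - r)) = 1 - ln (1 - r)" for r :: real
  by (simp add: ln_div)

lemma log_factor_ge_1: "0 \<le> r \<Longrightarrow> r < 1 \<Longrightarrow> 1 \<le> ln (exp 1 / (1 - r))" for r :: real
  by (simp add: log_factor)

lemma circ_nn_measurable:
  assumes "F \<in> borel_measurable \<D>"
  shows "(\<lambda>r. \<integral>\<^sup>+t. F (complex_of_real r * circ t) \<partial>\<U>) \<in> borel_measurable \<U>"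
  using U.borel_measurable_nn_integral_fst[OF measurable_compose[OF polar_map_measurable assms]] by simp

definition finite_profile :: "(real \<Rightarrow> ennreal) \<Rightarrow> bool" where
  "finite_profile w \<longleftrightarrow> w \<in> borel_measurable borel \<and> (\<integral>\<^sup>+r. ennreal (2 * r) * w r \<partial>\<U>) < \<infinity>"

definition profile_moment :: "(real \<Rightarrow> ennreal) \<Rightarrow> nat \<Rightarrow> real" where
  "profile_moment w k = enn2real (\<integral>\<^sup>+r. ennreal (2 * r ^ (2 * k + 1)) * w r \<partial>\<U>)"

text \<open>On each circle only the \<open>k\<close>-th Taylor term survives the average against
  \<open>cnj \<zeta> ^ k\<close>; the two factors \<open>r ^ k\<close> and the area element then
  combine into the odd power of the moment.\<close>

lemma disc_coefficient:
  assumes w: "finite_profile w" and \<phi>: "\<phi> holomorphic_on unit_disc" "integrable (disc_measure w) \<phi>"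
  shows "(\<integral>\<zeta>. cnj \<zeta> ^ k * \<phi> \<zeta> \<partial>disc_measure w) = taylor \<phi> k * of_real (profile_moment w k)"
proof -
  have wm [measurable]: "w \<in> borel_measurable borel" and fin: "(\<integral>\<^sup>+r. ennreal (2 * r) * w r \<partial>\<U>) < \<infinity>"
    using w by (auto simp: finite_profile_def)
  have cm: "(\<lambda>\<zeta>. cnj \<zeta> ^ k) \<in> borel_measurable \<D>"
    by (intro continuous_on_measurable_D continuous_intros)
  have "integrable (disc_measure w) (\<lambda>\<zeta>. cnj \<zeta> ^ k * \<phi> \<zeta>)"
  proof (rule Bochner_Integration.integrable_bound[OF \<phi>(2)])
    show "AE \<zeta> in disc_measure w. norm (cnj \<zeta> ^ k * \<phi> \<zeta>) \<le> norm (\<phi> \<zeta>)"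
      by (intro AE_I2) (auto simp: norm_mult norm_power intro!: mult_left_le_one_le power_le_one)
  qed (use cm holomorphic_measurable_D[OF \<phi>(1)] in measurable)
  then have "(\<integral>\<zeta>. cnj \<zeta> ^ k * \<phi> \<zeta> \<partial>disc_measure w) =
      (\<integral>r. (\<integral>t. cnj (of_real r * circ t) ^ k * \<phi> (of_real r * circ t) \<partial>\<U>) \<partial>density \<U> (\<lambda>r. ennreal (2 * r) * w r))"
    by (rule integral_disc_measure[OF wm fin])
  also have "\<dots> = (\<integral>r. taylor \<phi> k * of_real (r ^ (2 * k)) \<partial>density \<U> (\<lambda>r. ennreal (2 * r) * w r))"
  proof (rule Bochner_Integration.integral_cong)
    fix r assume "r \<in> space (density \<U> (\<lambda>r. ennreal (2 * r) * w r))"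
    then have r: "0 \<le> r" "r < 1" by auto
    have "(\<integral>t. cnj (of_real r * circ t) ^ k * \<phi> (of_real r * circ t) \<partial>\<U>) = (\<integral>t. of_real r ^ k * (\<phi> (of_real r * circ t) * cnj (circ t) ^ k) \<partial>\<U>)"
      by (simp add: power_mult_distrib mult_ac)
    also have "\<dots> = of_real r ^ k * (taylor \<phi> k * of_real r ^ k)"
      using power_series_circle_coeff[OF taylor_sums[OF \<phi>(1)] r, of k] by simp
    finally show "(\<integral>t. cnj (of_real r * circ t) ^ k * \<phi> (of_real r * circ t) \<partial>\<U>) = taylor \<phi> k * of_real (r ^ (2 * k))"
      by (simp add: mult_2 power_add)
  qed simp
  also have "\<dots> = taylor \<phi> k * of_real (\<integral>r. r ^ (2 * k) \<partial>density \<U> (\<lambda>r. ennreal (2 * r) * w r))"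
    by (simp only: integral_mult_right_zero integral_complex_of_real)
  also have "(\<integral>r. r ^ (2 * k) \<partial>density \<U> (\<lambda>r. ennreal (2 * r) * w r)) = enn2real (\<integral>\<^sup>+r. ennreal (r ^ (2 * k)) \<partial>density \<U> (\<lambda>r. ennreal (2 * r) * w r))"
  proof (rule integral_eq_nn_integral)
    show "(\<lambda>r. r ^ (2 * k)) \<in> borel_measurable (density \<U> (\<lambda>r. ennreal (2 * r) * w r))"
      by (simp add: borel_measurable_U)
  qed (auto intro!: AE_I2)
  also have "(\<integral>\<^sup>+r. ennreal (r ^ (2 * k)) \<partial>density \<U> (\<lambda>r. ennreal (2 * r) * w r)) = (\<integral>\<^sup>+r. ennreal (2 * r) * w r * ennreal (r ^ (2 * k)) \<partial>\<U>)"
    by (subst nn_integral_density) (auto intro!: borel_measurable_U)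
  also have "\<dots> = (\<integral>\<^sup>+r. ennreal (2 * r ^ (2 * k + 1)) * w r \<partial>\<U>)"
  proof (rule nn_integral_cong)
    fix r assume "r \<in> space \<U>"
    then have "ennreal (2 * r) * ennreal (r ^ (2 * k)) = ennreal (2 * r ^ (2 * k + 1))"
      by (subst ennreal_mult[symmetric]) auto
    then show "ennreal (2 * r) * w r * ennreal (r ^ (2 * k)) = ennreal (2 * r ^ (2 * k + 1)) * w r"
      by (metis mult.assoc mult.commute)
  qed
  finally show ?thesis by (simp add: profile_moment_def)
qed

lemma disc_pairing:
  assumes w: "finite_profile w" and \<phi>: "\<phi> holomorphic_on unit_disc" "integrable (disc_measure w) \<phi>"
    and b: "summable (\<lambda>k. norm (b k :: complex))"
  shows "(\<lambda>k. b k * (taylor \<phi> k * of_real (profile_moment w k))) sums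
    (\<integral>\<zeta>. (\<Sum>k. b k * cnj \<zeta> ^ k) * \<phi> \<zeta> \<partial>disc_measure w)"
proof -
  have cm: "(\<lambda>\<zeta>. cnj \<zeta> ^ k) \<in> borel_measurable (disc_measure w)" for k
    using continuous_on_measurable_D[of "\<lambda>\<zeta>. cnj \<zeta> ^ k"] by (simp add: continuous_intros)
  show ?thesis
    using integral_bounded_series(2)[OF b \<phi>(2) cm]
    by (simp add: disc_coefficient[OF w \<phi>] norm_power power_le_one)
qed

section \<open>Iterated tails and the Euler operator\<close>

text \<open>The transform divides the \<open>k\<close>-th moment of a profile by \<open>k + 1\<close>, which cancels the factor that
  \<open>euler_op\<close> puts on the \<open>k\<close>-th Taylor coefficient.\<close>

definition tail_profile :: "(real \<Rightarrow> ennreal) \<Rightarrow> real \<Rightarrow> ennreal" where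
  "tail_profile w r = 2 * (\<integral>\<^sup>+s. w s * ennreal (1 / s) * indicator {r..} s \<partial>\<U>)"

lemma tail_profile_joint_measurable:
  assumes [measurable]: "w \<in> borel_measurable borel"
  shows "(\<lambda>(r, s). w s * ennreal (1 / s) * indicator {r..} s) \<in> borel_measurable (borel \<Otimes>\<^sub>M \<U>)"
proof -
  have "(\<lambda>(r::real, s). w s * ennreal (1 / s) * indicator {r..} s) = (\<lambda>p. w (snd p) * ennreal (1 / snd p) * indicator {p. fst p \<le> snd p} p)"
    by (auto simp: fun_eq_iff indicator_def)
  moreover have id: "(\<lambda>r. r) \<in> borel_measurable \<U>" by (rule borel_measurable_U) simp
  have [measurable]: "snd \<in> borel_measurable (borel \<Otimes>\<^sub>M \<U>)"
    using measurable_compose[OF measurable_snd id] by auto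
  ultimately show ?thesis by simp
qed

lemma tail_profile_measurable [measurable]:
  assumes "w \<in> borel_measurable borel"
  shows "tail_profile w \<in> borel_measurable borel"
  unfolding tail_profile_def[abs_def]
  using U.borel_measurable_nn_integral[OF tail_profile_joint_measurable[OF assms]] by simp

text \<open>After Tonelli the inner integral of \<open>4 * r ^ (2 * k + 1)\<close> up to
  \<open>s\<close> is \<open>2 * s ^ (2 * k + 2) / (k + 1)\<close>; the factor \<open>1 / s\<close>
  in the transform restores the odd power of the moment.\<close>

lemma nn_integral_tail_profile:
  assumes w [measurable]: "w \<in> borel_measurable borel"
  shows "(\<integral>\<^sup>+r. ennreal (2 * r ^ (2 * k + 1)) * tail_profile w r \<partial>\<U>) =
    ennreal (1 / (real k + 1)) * (\<integral>\<^sup>+r. ennreal (2 * r ^ (2 * k + 1)) * w r \<partial>\<U>)"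
proof -
  interpret UU: pair_sigma_finite \<U> \<U> ..
  define h where "h r s = ennreal (2 * r ^ (2 * k + 1)) * (2 * (w s * ennreal (1 / s) * indicator {r..} s))" for r s :: real
  have jm: "(\<lambda>(r, s). w s * ennreal (1 / s) * indicator {r..} s) \<in> borel_measurable (\<U> \<Otimes>\<^sub>M \<U>)"
  proof -
    have id: "(\<lambda>r. r) \<in> borel_measurable \<U>" by (rule borel_measurable_U) simp
    have "(\<lambda>p. (fst p, snd p)) \<in> \<U> \<Otimes>\<^sub>M \<U> \<rightarrow>\<^sub>M borel \<Otimes>\<^sub>M \<U>"
      by (intro measurable_Pair measurable_snd measurable_compose[OF measurable_fst id])
    from measurable_compose[OF this tail_profile_joint_measurable[OF w]] show ?thesis by (simp add: split_beta')
  qed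
  have hm: "(\<lambda>(r, s). h r s) \<in> borel_measurable (\<U> \<Otimes>\<^sub>M \<U>)"
  proof -
    have id: "(\<lambda>r. r) \<in> borel_measurable \<U>" by (rule borel_measurable_U) simp
    have [measurable]: "fst \<in> borel_measurable (\<U> \<Otimes>\<^sub>M \<U>)"
      using measurable_compose[OF measurable_fst id] by auto
    show ?thesis using jm unfolding h_def split_beta' by measurable
  qed
  have "(\<integral>\<^sup>+r. ennreal (2 * r ^ (2 * k + 1)) * tail_profile w r \<partial>\<U>) = (\<integral>\<^sup>+r. (\<integral>\<^sup>+s. h r s \<partial>\<U>) \<partial>\<U>)"
  proof (rule nn_integral_cong)
    fix r :: real
    have m: "(\<lambda>s. w s * ennreal (1 / s) * indicator {r..} s) \<in> borel_measurable \<U>" by (rule borel_measurable_U) measurable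
    have "(\<integral>\<^sup>+s. h r s \<partial>\<U>) = ennreal (2 * r ^ (2 * k + 1)) * (2 * (\<integral>\<^sup>+s. w s * ennreal (1 / s) * indicator {r..} s \<partial>\<U>))"
      unfolding h_def using m by (simp add: nn_integral_cmult)
    then show "ennreal (2 * r ^ (2 * k + 1)) * tail_profile w r = (\<integral>\<^sup>+s. h r s \<partial>\<U>)" by (simp add: tail_profile_def)
  qed
  also have "\<dots> = (\<integral>\<^sup>+s. (\<integral>\<^sup>+r. h r s \<partial>\<U>) \<partial>\<U>)"
    using UU.Fubini'[OF hm] by simp
  also have "\<dots> = (\<integral>\<^sup>+s. ennreal (1 / (real k + 1)) * (ennreal (2 * s ^ (2 * k + 1)) * w s) \<partial>\<U>)"
  proof (rule nn_integral_cong)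
    fix s assume "s \<in> space \<U>"
    then have s: "0 \<le> s" "s < 1" by auto
    have "(\<integral>\<^sup>+r. h r s \<partial>\<U>) = (\<integral>\<^sup>+r. (w s * ennreal (1 / s)) * (ennreal (4 * r ^ (2 * k + 1)) * indicator {0..s} r) \<partial>lborel)"
      unfolding h_def using s
      by (subst nn_integral_restrict_space) (auto intro!: nn_integral_cong simp: indicator_def ennreal_mult'' mult_ac)
    also have "\<dots> = (w s * ennreal (1 / s)) * (\<integral>\<^sup>+r. ennreal (4 * r ^ (2 * k + 1)) * indicator {0..s} r \<partial>lborel)"
      by (rule nn_integral_cmult) measurable
    also have "(\<integral>\<^sup>+r. ennreal (4 * r ^ (2 * k + 1)) * indicator {0..s} r \<partial>lborel) = ennreal (2 / (real k + 1) * s ^ (2 * k + 2) - 2 / (real k + 1) * 0 ^ (2 * k + 2))"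
    proof (rule nn_integral_FTC_Icc)
      show "((\<lambda>r. 2 / (real k + 1) * r ^ (2 * k + 2)) has_real_derivative 4 * x ^ (2 * k + 1)) (at x)" for x
        by (rule derivative_eq_intros refl | simp)+ (simp add: field_simps)
    qed (use s in auto)
    also have "w s * ennreal (1 / s) * ennreal (2 / (real k + 1) * s ^ (2 * k + 2) - 2 / (real k + 1) * 0 ^ (2 * k + 2)) = ennreal (1 / s * (2 / (real k + 1) * s ^ (2 * k + 2))) * w s"
      using s by (subst ennreal_mult) (auto simp: mult_ac)
    also have "1 / s * (2 / (real k + 1) * s ^ (2 * k + 2)) = 1 / (real k + 1) * (2 * s ^ (2 * k + 1))"
      by (cases "s = 0") (auto simp: field_simps)
    also have "ennreal (1 / (real k + 1) * (2 * s ^ (2 * k + 1))) * w s = ennreal (1 / (real k + 1)) * (ennreal (2 * s ^ (2 * k + 1)) * w s)"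
      using s by (subst ennreal_mult) (auto simp: mult_ac)
    finally show "(\<integral>\<^sup>+r. h r s \<partial>\<U>) = ennreal (1 / (real k + 1)) * (ennreal (2 * s ^ (2 * k + 1)) * w s)" .
  qed
  also have "\<dots> = ennreal (1 / (real k + 1)) * (\<integral>\<^sup>+r. ennreal (2 * r ^ (2 * k + 1)) * w r \<partial>\<U>)"
    by (rule nn_integral_cmult, rule borel_measurable_U) measurable
  finally show ?thesis .
qed

lemma tail_profile_finite: "finite_profile w \<Longrightarrow> finite_profile (tail_profile w)"
  using nn_integral_tail_profile[of w 0] by (simp add: finite_profile_def tail_profile_measurable)

lemma tail_profile_moment:
  "finite_profile w \<Longrightarrow> profile_moment (tail_profile w) k = profile_moment w k / (real k + 1)"
  unfolding profile_moment_def
  by (subst nn_integral_tail_profile) (auto simp: finite_profile_def enn2real_mult)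

lemma tail_profile_pow:
  assumes "finite_profile w"
  shows "finite_profile ((tail_profile ^^ n) w)"
    and "profile_moment ((tail_profile ^^ n) w) k = profile_moment w k / (real k + 1) ^ n"
proof (induction n)
  case (Suc n)
  { case 1 then show ?case using Suc(1) by (simp add: tail_profile_finite) }
  { case 2 then show ?case using tail_profile_moment[OF Suc(1), of k] Suc(2) by (simp add: field_simps) }
qed (use assms in auto)

text \<open>This is the derivative of \<open>z * f z\<close>. Its multiplier \<open>k + 1\<close>
  never vanishes, so unlike \<open>z * deriv f z\<close> it does not lose the constant term.\<close>

definition euler_op :: "(complex \<Rightarrow> complex) \<Rightarrow> complex \<Rightarrow> complex" where
  "euler_op f z = f z + z * deriv f z"

lemma euler_op_holomorphic: "f holomorphic_on unit_disc \<Longrightarrow> euler_op f holomorphic_on unit_disc"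
  unfolding euler_op_def[abs_def] by (intro holomorphic_intros holomorphic_deriv) auto

lemma taylor_euler_op:
  assumes f: "f holomorphic_on unit_disc"
  shows "taylor (euler_op f) k = (of_nat k + 1) * taylor f k"
proof -
  have "(\<lambda>k. ((of_nat k + 1) * taylor f k) * z ^ k) sums euler_op f z" if z: "z \<in> unit_disc" for z
  proof -
    have df: "deriv f holomorphic_on unit_disc" by (rule holomorphic_deriv[OF f open_ball])
    have "(\<lambda>k. z * (taylor (deriv f) k * z ^ k)) sums (z * deriv f z)"
      by (rule sums_mult[OF taylor_sums[OF df z]])
    then have "(\<lambda>k. of_nat (Suc k) * taylor f (Suc k) * z ^ Suc k) sums (z * deriv f z)"
      by (simp only: taylor_deriv power_Suc mult_ac)
    then have "(\<lambda>k. of_nat k * taylor f k * z ^ k) sums (z * deriv f z)"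
      using sums_Suc_iff[of "\<lambda>k. of_nat k * taylor f k * z ^ k" "z * deriv f z"] by simp
    from sums_add[OF taylor_sums[OF f z] this] show ?thesis
      by (simp add: euler_op_def algebra_simps)
  qed
  then show ?thesis using power_series_taylor(2)[of "\<lambda>k. (of_nat k + 1) * taylor f k" "euler_op f"] by simp
qed

lemma euler_op_pow:
  assumes f: "f holomorphic_on unit_disc"
  shows "(euler_op ^^ n) f holomorphic_on unit_disc"
    and "taylor ((euler_op ^^ n) f) k = (of_nat k + 1) ^ n * taylor f k"
proof (induction n)
  case (Suc n)
  { case 1 then show ?case using Suc(1) by (simp add: euler_op_holomorphic) }
  { case 2 then show ?case using taylor_euler_op[OF Suc(1), of k] Suc(2) by (simp add: mult.assoc) }
qed (use f in auto)

text \<open>A bounded holomorphic \<open>G\<close> need not have summable coefficients, but its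
  dilations do; dominated convergence removes the dilation again.\<close>

lemma dilated_pairing_limit:
  assumes \<phi>: "integrable (disc_measure w) \<phi>" and G: "continuous_on unit_disc G" "\<And>z. z \<in> unit_disc \<Longrightarrow> cmod (G z) \<le> B"
    and \<rho>: "\<And>j. 0 \<le> \<rho> j" "\<And>j. \<rho> j < 1" "\<rho> \<longlonglongrightarrow> 1"
  shows "(\<lambda>j. \<integral>\<zeta>. cnj (G (of_real (\<rho> j) * \<zeta>)) * \<phi> \<zeta> \<partial>disc_measure w) \<longlonglongrightarrow> (\<integral>\<zeta>. cnj (G \<zeta>) * \<phi> \<zeta> \<partial>disc_measure w)"
proof (rule integral_dominated_convergence[where w = "\<lambda>\<zeta>. B * norm (\<phi> \<zeta>)"])
  have \<phi>m [measurable]: "\<phi> \<in> borel_measurable (disc_measure w)" using \<phi> by auto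
  have \<rho>z: "of_real (\<rho> j) * \<zeta> \<in> unit_disc" if "\<zeta> \<in> unit_disc" for j \<zeta>
    using \<rho>(1,2)[of j] that mult_left_le_one_le[of "cmod \<zeta>" "\<rho> j"] by (auto simp: norm_mult intro: le_less_trans)
  have "(\<lambda>\<zeta>. cnj (G \<zeta>)) \<in> borel_measurable \<D>" by (intro continuous_on_measurable_D continuous_intros G)
  then show "(\<lambda>\<zeta>. cnj (G \<zeta>) * \<phi> \<zeta>) \<in> borel_measurable (disc_measure w)" by simp
  show "(\<lambda>\<zeta>. cnj (G (of_real (\<rho> j) * \<zeta>)) * \<phi> \<zeta>) \<in> borel_measurable (disc_measure w)" for j
  proof -
    have "(\<lambda>\<zeta>. cnj (G (of_real (\<rho> j) * \<zeta>))) \<in> borel_measurable \<D>"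
      by (intro continuous_on_measurable_D continuous_on_cnj continuous_on_compose2[OF G(1)] continuous_intros) (use \<rho>z in auto)
    then show ?thesis by simp
  qed
  show "integrable (disc_measure w) (\<lambda>\<zeta>. B * norm (\<phi> \<zeta>))" using \<phi> by auto
  show "AE \<zeta> in disc_measure w. (\<lambda>j. cnj (G (of_real (\<rho> j) * \<zeta>)) * \<phi> \<zeta>) \<longlonglongrightarrow> cnj (G \<zeta>) * \<phi> \<zeta>"
  proof (rule AE_I2)
    fix \<zeta> assume "\<zeta> \<in> space (disc_measure w)"
    then have \<zeta>: "\<zeta> \<in> unit_disc" by simp
    have "(\<lambda>j. of_real (\<rho> j) * \<zeta>) \<longlonglongrightarrow> of_real 1 * \<zeta>" by (intro tendsto_intros \<rho>(3))
    moreover have "isCont G (of_real 1 * \<zeta>)" using G(1) \<zeta> by (simp add: continuous_on_eq_continuous_at)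
    ultimately have "(\<lambda>j. G (of_real (\<rho> j) * \<zeta>)) \<longlonglongrightarrow> G (of_real 1 * \<zeta>)"
      by (rule isCont_tendsto_compose[rotated])
    then show "(\<lambda>j. cnj (G (of_real (\<rho> j) * \<zeta>)) * \<phi> \<zeta>) \<longlonglongrightarrow> cnj (G \<zeta>) * \<phi> \<zeta>"
      by (intro tendsto_intros) simp
  qed
  show "AE \<zeta> in disc_measure w. norm (cnj (G (of_real (\<rho> j) * \<zeta>)) * \<phi> \<zeta>) \<le> B * norm (\<phi> \<zeta>)" for j
    using G(2) \<rho>z by (intro AE_I2) (auto simp: norm_mult intro!: mult_right_mono)
qed

text \<open>Both sides have the same Taylor expansion in \<open>G\<close>; dilating \<open>G\<close> makes the expansions converge.\<close>

lemma pairing_euler_op: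
  assumes w: "finite_profile w" and f: "f holomorphic_on unit_disc" "integrable (disc_measure w) f"
    and fn: "integrable (disc_measure ((tail_profile ^^ n) w)) ((euler_op ^^ n) f)"
    and G: "G holomorphic_on unit_disc" "\<And>z. z \<in> unit_disc \<Longrightarrow> cmod (G z) \<le> B"
  shows "(\<integral>\<zeta>. cnj (G \<zeta>) * f \<zeta> \<partial>disc_measure w) =
    (\<integral>\<zeta>. cnj (G \<zeta>) * (euler_op ^^ n) f \<zeta> \<partial>disc_measure ((tail_profile ^^ n) w))"
proof -
  define \<rho> where "\<rho> j = 1 - inverse (real (Suc j))" for j
  have \<rho>: "0 \<le> \<rho> j" "\<rho> j < 1" for j by (auto simp: \<rho>_def field_simps)
  have \<rho>l: "\<rho> \<longlonglongrightarrow> 1"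
    unfolding \<rho>_def using tendsto_diff[OF tendsto_const LIMSEQ_inverse_real_of_nat, of 1] by simp
  have cG: "continuous_on unit_disc G" using G(1) by (rule holomorphic_on_imp_continuous_on)
  note lim = dilated_pairing_limit[OF _ cG G(2) \<rho> \<rho>l]
  have eq: "(\<integral>\<zeta>. cnj (G (of_real (\<rho> j) * \<zeta>)) * f \<zeta> \<partial>disc_measure w) =
    (\<integral>\<zeta>. cnj (G (of_real (\<rho> j) * \<zeta>)) * (euler_op ^^ n) f \<zeta> \<partial>disc_measure ((tail_profile ^^ n) w))" for j
  proof -
    define b where "b k = cnj (taylor G k * of_real (\<rho> j) ^ k)" for k
    have b: "summable (\<lambda>k. norm (b k))"
      unfolding b_def complex_mod_cnj by (rule taylor_summable[OF G(1)]) (use \<rho>[of j] in auto)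
    have bs: "(\<Sum>k. b k * cnj \<zeta> ^ k) = cnj (G (of_real (\<rho> j) * \<zeta>))" if "\<zeta> \<in> unit_disc" for \<zeta>
    proof -
      have "of_real (\<rho> j) * \<zeta> \<in> unit_disc"
        using \<rho>[of j] that mult_left_le_one_le[of "cmod \<zeta>" "\<rho> j"] by (auto simp: norm_mult intro: le_less_trans)
      then have "(\<lambda>k. cnj (taylor G k * (of_real (\<rho> j) * \<zeta>) ^ k)) sums cnj (G (of_real (\<rho> j) * \<zeta>))"
        unfolding sums_cnj by (rule taylor_sums[OF G(1)])
      then show ?thesis by (simp add: b_def sums_iff power_mult_distrib mult.assoc)
    qed
    have "(\<integral>\<zeta>. cnj (G (of_real (\<rho> j) * \<zeta>)) * f \<zeta> \<partial>disc_measure w) = (\<integral>\<zeta>. (\<Sum>k. b k * cnj \<zeta> ^ k) * f \<zeta> \<partial>disc_measure w)"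
      using bs by (intro Bochner_Integration.integral_cong) auto
    moreover have "(\<integral>\<zeta>. cnj (G (of_real (\<rho> j) * \<zeta>)) * (euler_op ^^ n) f \<zeta> \<partial>disc_measure ((tail_profile ^^ n) w)) = (\<integral>\<zeta>. (\<Sum>k. b k * cnj \<zeta> ^ k) * (euler_op ^^ n) f \<zeta> \<partial>disc_measure ((tail_profile ^^ n) w))"
      using bs by (intro Bochner_Integration.integral_cong) auto
    moreover have "(of_nat k + 1) ^ n * taylor f k * of_real (profile_moment w k / (real k + 1) ^ n) = taylor f k * of_real (profile_moment w k)" for k
    proof -
      have nz: "(of_nat k + 1 :: complex) \<noteq> 0" by (metis of_nat_Suc of_nat_eq_0_iff nat.distinct(1) add.commute)
      have "complex_of_real (profile_moment w k / (real k + 1) ^ n) = of_real (profile_moment w k) / (of_nat k + 1) ^ n" by simp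
      then show ?thesis using nz by (simp add: field_simps)
    qed
    ultimately show ?thesis
      using sums_unique2[OF disc_pairing[OF w f b]]
        disc_pairing[OF tail_profile_pow(1)[OF w] euler_op_pow(1)[OF f(1)] fn b]
      by (simp add: tail_profile_pow(2)[OF w] euler_op_pow(2)[OF f(1)])
  qed
  show ?thesis
    using LIMSEQ_unique[OF lim[OF f(2)]] lim[OF fn] unfolding eq by simp
qed

section \<open>Iterated tails of a doubling weight, the logarithm of the kernel and the Carleson
  embedding\<close>

context doubling_tail begin

abbreviation "wmeasure \<equiv> disc_measure (\<lambda>s. ennreal (w s))"

lemma finite_profile_w: "finite_profile (\<lambda>s. ennreal (w s))"
proof -
  have "(\<integral>\<^sup>+r. ennreal (2 * r) * ennreal (w r) \<partial>\<U>) \<le> (\<integral>\<^sup>+r. 2 * ennreal (w r) \<partial>\<U>)"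
    by (intro nn_integral_mono mult_right_mono) (auto simp: ennreal_numeral[symmetric] simp del: ennreal_numeral intro!: ennreal_leI)
  also have "\<dots> = 2 * ennreal (T 0)"
    using w_meas by (subst nn_integral_cmult) (auto simp: nn_integral_w intro!: borel_measurable_U)
  also have "\<dots> < \<infinity>" by (simp add: ennreal_mult_less_top)
  finally show ?thesis using w_meas by (simp add: finite_profile_def)
qed

lemma profile_moment_w: "profile_moment (\<lambda>s. ennreal (w s)) k = moment k"
proof -
  have "(\<integral>\<^sup>+r. ennreal (2 * r ^ (2 * k + 1)) * ennreal (w r) \<partial>\<U>) = (\<integral>\<^sup>+r. ennreal (2 * r ^ (2 * k + 1) * w r) \<partial>\<U>)"
    using w_nonneg by (intro nn_integral_cong) (auto simp: ennreal_mult[symmetric])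
  also have "\<dots> = ennreal (moment k)"
    unfolding moment_def using w_nonneg by (intro nn_integral_eq_integral moment_integrable AE_I2) auto
  finally show ?thesis using moment_pos[of k] by (simp add: profile_moment_def)
qed

lemma finite_measure_w: "finite_measure wmeasure"
  using finite_profile_w by (intro finite_disc_measure) (auto simp: finite_profile_def)

text \<open>Integrating \<open>A / s^2\<close> from \<open>r\<close> to 1 gives
  \<open>A * (1 - r) / r\<close>: every further tail gains a factor \<open>1 - r\<close>, while the
  singularity at the origin stays of order \<open>1 / r\<close>, which the area factor
  \<open>2 * r\<close> absorbs.\<close>

lemma tail_profile_pow_bound:
  assumes "0 < r" "r < 1"
  shows "(tail_profile ^^ Suc n) (\<lambda>s. ennreal (w s)) r \<le> ennreal (2 ^ Suc n * (1 - r) ^ n * T r / r)"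
  using assms
proof (induction n arbitrary: r)
  case 0
  then have r: "0 < r" "r < 1" "0 < T r" using T_pos[of r] by auto
  have "(\<integral>\<^sup>+s. ennreal (w s) * ennreal (1 / s) * indicator {r..} s \<partial>\<U>) \<le> (\<integral>\<^sup>+s. ennreal (1 / r) * (ennreal (w s) * indicator {r..} s) \<partial>\<U>)"
    using r by (intro nn_integral_mono) (auto simp: indicator_def mult.commute intro!: mult_left_mono ennreal_leI divide_left_mono)
  also have "\<dots> = ennreal (1 / r) * ennreal (T r)"
    using r by (subst nn_integral_cmult) (auto simp: T_eq intro!: borel_measurable_U)
  also have "\<dots> = ennreal (T r / r)" using r by (subst ennreal_mult[symmetric]) auto
  finally have "tail_profile (\<lambda>s. ennreal (w s)) r \<le> 2 * ennreal (T r / r)"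
    unfolding tail_profile_def by (rule mult_left_mono) simp
  also have "\<dots> = ennreal (2 * (T r / r))" using r by (subst ennreal_mult) auto
  finally show ?case by simp
next
  case (Suc n)
  then have r: "0 < r" "r < 1" "0 < T r" using T_pos[of r] by auto
  define w' where "w' = (tail_profile ^^ Suc n) (\<lambda>s. ennreal (w s))"
  define A where "A = 2 ^ Suc n * (1 - r) ^ n * T r"
  have A: "0 \<le> A" using r by (simp add: A_def)
  have "(\<integral>\<^sup>+s. w' s * ennreal (1 / s) * indicator {r..} s \<partial>\<U>) \<le> (\<integral>\<^sup>+s. ennreal (A / s\<^sup>2) * indicator {r..1} s \<partial>lborel)"
  proof -
    have "(\<integral>\<^sup>+s. w' s * ennreal (1 / s) * indicator {r..} s \<partial>\<U>) = (\<integral>\<^sup>+s. w' s * ennreal (1 / s) * indicator {r..} s * indicator {0..<1} s \<partial>lborel)"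
      by (subst nn_integral_restrict_space) auto
    also have "\<dots> \<le> (\<integral>\<^sup>+s. ennreal (A / s\<^sup>2) * indicator {r..1} s \<partial>lborel)"
    proof (rule nn_integral_mono)
      fix s :: real
      show "w' s * ennreal (1 / s) * indicator {r..} s * indicator {0..<1} s \<le> ennreal (A / s\<^sup>2) * indicator {r..1} s"
      proof (cases "r \<le> s \<and> s < 1")
        case True
        then have s: "0 < s" "s < 1" "r \<le> s" using r by auto
        have "2 ^ Suc n * (1 - s) ^ n * T s / s \<le> A / s"
          unfolding A_def using s r T_pos[of s] T_antimono[of r s]
          by (intro divide_right_mono mult_mono power_mono) auto
        then have "w' s \<le> ennreal (A / s)"
          unfolding w'_def using Suc.IH[OF s(1,2)] by (meson ennreal_leI order_trans)
        then have "w' s * ennreal (1 / s) \<le> ennreal (A / s) * ennreal (1 / s)" by (rule mult_right_mono) simp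
        also have "\<dots> = ennreal (A / s\<^sup>2)" using s A by (subst ennreal_mult[symmetric]) (auto simp: power2_eq_square)
        finally show ?thesis using True r by (simp add: indicator_def)
      qed (auto simp: indicator_def)
    qed
    finally show "(\<integral>\<^sup>+s. w' s * ennreal (1 / s) * indicator {r..} s \<partial>\<U>) \<le> (\<integral>\<^sup>+s. ennreal (A / s\<^sup>2) * indicator {r..1} s \<partial>lborel)" .
  qed
  also have "\<dots> = ennreal (- A / 1 - - A / r)"
  proof (rule nn_integral_FTC_Icc[where F = "\<lambda>s. - A / s"])
    show "((\<lambda>s. - A / s) has_real_derivative A / x\<^sup>2) (at x)" if "x \<in> {r..1}" for x
      using that r by (auto intro!: derivative_eq_intros simp: power2_eq_square field_simps)
  qed (use r A in auto)
  also have "- A / 1 - - A / r = 2 ^ Suc n * (1 - r) ^ Suc n * T r / r" using r by (simp add: A_def field_simps)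
  finally have "tail_profile w' r \<le> 2 * ennreal (2 ^ Suc n * (1 - r) ^ Suc n * T r / r)"
    unfolding tail_profile_def by (rule mult_left_mono) simp
  also have "\<dots> = ennreal (2 * (2 ^ Suc n * (1 - r) ^ Suc n * T r / r))" using r by (subst ennreal_mult) auto
  finally show ?case by (simp add: w'_def mult.assoc)
qed

text \<open>For \<open>z\<close> on the circle of radius \<open>r\<close> the average is the kernel
  mean at radius \<open>cmod \<zeta> * r\<close>, at most a constant over the tail there;
  \<open>T_log_integral\<close> performs the remaining integration over \<open>r\<close>.\<close>

lemma kern_log:
  obtains C where "C > 0" "\<And>\<zeta>. \<zeta> \<in> unit_disc \<Longrightarrow>
    (\<integral>\<^sup>+z. ennreal (cmod (kern 0 (cnj z * \<zeta>))) \<partial>wmeasure) \<le> ennreal (C * ln (exp 1 / (1 - cmod \<zeta>)))"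
proof -
  obtain C1 where C1: "C1 > 0" "\<And>s. 0 \<le> s \<Longrightarrow> s < 1 \<Longrightarrow> circ_mean (\<lambda>z. cmod (kern 0 z)) s \<le> C1 / T s"
    using kern_mean by blast
  obtain C2 where C2: "C2 > 0" "\<And>x. 0 \<le> x \<Longrightarrow> x < 1 \<Longrightarrow> (\<integral>\<^sup>+s. ennreal (w s / T (x * s)) \<partial>\<U>) \<le> ennreal (C2 * ln (exp 1 / (1 - x)))"
    using T_log_integral by auto
  have ck: "continuous_on unit_disc (\<lambda>z. cmod (kern 0 z))"
    by (intro continuous_intros holomorphic_on_imp_continuous_on kern_holomorphic)
  show ?thesis
  proof (rule that[of "2 * C1 * C2"])
    show "2 * C1 * C2 > 0" using C1 C2 by simp
    fix \<zeta> :: complex assume \<zeta>: "\<zeta> \<in> unit_disc"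
    have sub: "cnj z * \<zeta> \<in> unit_disc" if "z \<in> unit_disc" for z
      using that \<zeta> mult_left_le_one_le[of "cmod \<zeta>" "cmod z"] by (auto simp: norm_mult intro: le_less_trans)
    have m: "(\<lambda>z. ennreal (cmod (kern 0 (cnj z * \<zeta>)))) \<in> borel_measurable \<D>"
    proof -
      have "(\<lambda>z. cmod (kern 0 (cnj z * \<zeta>))) \<in> borel_measurable \<D>"
        by (intro continuous_on_measurable_D continuous_on_compose2[OF ck] continuous_intros) (use sub in auto)
      then show ?thesis by simp
    qed
    have "(\<integral>\<^sup>+z. ennreal (cmod (kern 0 (cnj z * \<zeta>))) \<partial>wmeasure) =
      (\<integral>\<^sup>+r. ennreal (2 * r) * ennreal (w r) * (\<integral>\<^sup>+t. ennreal (cmod (kern 0 (cnj (of_real r * circ t) * \<zeta>))) \<partial>\<U>) \<partial>\<U>)"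
      using w_meas by (intro nn_integral_disc_measure m) measurable
    also have "\<dots> \<le> (\<integral>\<^sup>+r. ennreal (2 * C1) * ennreal (w r / T (cmod \<zeta> * r)) \<partial>\<U>)"
    proof (rule nn_integral_mono)
      fix r assume "r \<in> space \<U>"
      then have r: "0 \<le> r" "r < 1" by auto
      have rz: "of_real r * cnj \<zeta> \<in> unit_disc"
        using r \<zeta> mult_left_le_one_le[of "cmod \<zeta>" r] by (auto simp: norm_mult intro: le_less_trans)
      have x: "0 \<le> cmod \<zeta> * r" "cmod \<zeta> * r < 1" using rz r by (auto simp: norm_mult mult.commute)
      have "cmod (kern 0 (cnj (of_real r * circ t) * \<zeta>)) = cmod (kern 0 ((of_real r * cnj \<zeta>) * circ t))" for t
        using kern_cnj[of "(of_real r * cnj \<zeta>) * circ t" 0] rz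
        by (simp add: norm_mult mult_ac)
      then have "(\<integral>\<^sup>+t. ennreal (cmod (kern 0 (cnj (of_real r * circ t) * \<zeta>))) \<partial>\<U>) = (\<integral>\<^sup>+t. ennreal (cmod (kern 0 ((of_real r * cnj \<zeta>) * circ t))) \<partial>\<U>)"
        by simp
      also have "\<dots> = ennreal (circ_mean (\<lambda>z. cmod (kern 0 z)) (cmod \<zeta> * r))"
        using circ_mean_shift[OF ck _ rz] r by (subst nn_integral_eq_integral) (auto simp: norm_mult mult.commute)
      also have "\<dots> \<le> ennreal (C1 / T (cmod \<zeta> * r))" by (intro ennreal_leI C1(2) x)
      finally have "ennreal (2 * r) * ennreal (w r) * (\<integral>\<^sup>+t. ennreal (cmod (kern 0 (cnj (of_real r * circ t) * \<zeta>))) \<partial>\<U>) \<le> ennreal (2 * r) * ennreal (w r) * ennreal (C1 / T (cmod \<zeta> * r))"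
        by (rule mult_left_mono) simp
      also have "\<dots> = ennreal (2 * r * w r * (C1 / T (cmod \<zeta> * r)))"
        using r w_nonneg[of r] C1(1) T_pos[OF x] by (intro ennreal_mult3) auto
      also have "\<dots> \<le> ennreal (2 * C1 * (w r / T (cmod \<zeta> * r)))"
      proof (rule ennreal_leI)
        have "0 \<le> 2 * C1 * (w r / T (cmod \<zeta> * r))" using w_nonneg[of r] C1(1) T_pos[OF x] by simp
        from mult_right_mono[OF less_imp_le[OF r(2)] this]
        show "2 * r * w r * (C1 / T (cmod \<zeta> * r)) \<le> 2 * C1 * (w r / T (cmod \<zeta> * r))" by (simp add: mult_ac)
      qed
      also have "\<dots> = ennreal (2 * C1) * ennreal (w r / T (cmod \<zeta> * r))"
        using w_nonneg[of r] C1(1) T_pos[OF x] by (subst ennreal_mult) auto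
      finally show "ennreal (2 * r) * ennreal (w r) * (\<integral>\<^sup>+t. ennreal (cmod (kern 0 (cnj (of_real r * circ t) * \<zeta>))) \<partial>\<U>) \<le> ennreal (2 * C1) * ennreal (w r / T (cmod \<zeta> * r))" .
    qed
    also have "\<dots> = ennreal (2 * C1) * (\<integral>\<^sup>+r. ennreal (w r / T (cmod \<zeta> * r)) \<partial>\<U>)"
    proof (rule nn_integral_cmult)
      obtain T' where [measurable]: "T' \<in> borel_measurable borel" and T': "\<And>s. 0 \<le> s \<Longrightarrow> s < 1 \<Longrightarrow> T' s = T s"
        using T_borel by blast
      have "(\<lambda>s. ennreal (w s / T' (cmod \<zeta> * s))) \<in> borel_measurable \<U>"
        using w_meas by (intro borel_measurable_U) measurable
      moreover have "T' (cmod \<zeta> * s) = T (cmod \<zeta> * s)" if "0 \<le> s" "s < 1" for s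
      proof -
        have "cmod \<zeta> * s < 1" using \<zeta> that mult_left_le_one_le[of s "cmod \<zeta>"] by auto
        then show ?thesis using that by (simp add: T')
      qed
      ultimately show "(\<lambda>s. ennreal (w s / T (cmod \<zeta> * s))) \<in> borel_measurable \<U>"
        by (subst measurable_cong[of _ _ "\<lambda>s. ennreal (w s / T' (cmod \<zeta> * s))"]) auto
    qed
    also have "\<dots> \<le> ennreal (2 * C1) * ennreal (C2 * ln (exp 1 / (1 - cmod \<zeta>)))"
      using \<zeta> by (intro mult_left_mono C2(2)) auto
    also have "\<dots> = ennreal (2 * C1 * C2 * ln (exp 1 / (1 - cmod \<zeta>)))"
    proof -
      have "1 \<le> ln (exp 1 / (1 - cmod \<zeta>))" by (rule log_factor_ge_1) (use \<zeta> in auto)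
      then have "0 \<le> ln (exp 1 / (1 - cmod \<zeta>))" by linarith
      then show ?thesis using C1(1) C2(1) by (subst ennreal_mult[symmetric]) (simp_all add: mult.assoc del: ln_ge_zero_iff)
    qed
    finally show "(\<integral>\<^sup>+z. ennreal (cmod (kern 0 (cnj z * \<zeta>))) \<partial>wmeasure) \<le> ennreal (2 * C1 * C2 * ln (exp 1 / (1 - cmod \<zeta>)))" .
  qed
qed

lemma nn_integral_radial_mean:
  assumes u: "continuous_on unit_disc u" "\<And>z. 0 \<le> u z"
  shows "(\<integral>\<^sup>+z. ennreal (u z) \<partial>wmeasure) = (\<integral>\<^sup>+r. ennreal (2 * r) * ennreal (w r) * ennreal (circ_mean u r) \<partial>\<U>)"
proof -
  have "(\<integral>\<^sup>+z. ennreal (u z) \<partial>wmeasure) = (\<integral>\<^sup>+r. ennreal (2 * r) * ennreal (w r) * (\<integral>\<^sup>+t. ennreal (u (of_real r * circ t)) \<partial>\<U>) \<partial>\<U>)"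
    by (intro nn_integral_disc_measure) (use w_meas continuous_on_measurable_D[OF u(1)] in auto)
  also have "\<dots> = (\<integral>\<^sup>+r. ennreal (2 * r) * ennreal (w r) * ennreal (circ_mean u r) \<partial>\<U>)"
    by (intro nn_integral_cong) (simp add: circ_mean_nn[OF u])
  finally show ?thesis .
qed

text \<open>At every radius beyond the midpoint \<open>(1 + r) / 2\<close> the circle mean is at
  least \<open>(1 - r) / 2\<close> times the value at \<open>z\<close>. Integrating over these radii
  produces the tail at the midpoint, which upper doubling compares with the tail at
  \<open>r\<close>.\<close>

lemma point_evaluation:
  assumes p: "0 < p"
  obtains C where "C > 0" "\<And>g z. g holomorphic_on unit_disc \<Longrightarrow> z \<in> unit_disc \<Longrightarrow>
    ennreal (cmod (g z) powr p * (T (cmod z) * (1 - cmod z))) \<le> ennreal C * (\<integral>\<^sup>+\<zeta>. ennreal (cmod (g \<zeta>) powr p) \<partial>wmeasure)"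
proof -
  obtain C1 where C1: "C1 \<ge> 1" "\<And>r. 0 \<le> r \<Longrightarrow> r < 1 \<Longrightarrow> T r \<le> C1 * T ((1 + r) / 2)"
    using upper_doubling by auto
  show ?thesis
  proof (rule that[of "2 * C1"])
    show "2 * C1 > 0" using C1(1) by simp
    fix g z assume g: "g holomorphic_on unit_disc" and z: "z \<in> unit_disc"
    define r \<rho> where "r = cmod z" and "\<rho> = (1 + r) / 2"
    have r: "0 \<le> r" "r < 1" using z by (auto simp: r_def)
    have \<rho>: "0 \<le> \<rho>" "\<rho> < 1" "r < \<rho>" "1/2 \<le> \<rho>" using r by (auto simp: \<rho>_def)
    define A where "A = cmod (g z) powr p * ((1 - r) / 2)"
    have A0: "0 \<le> A" using r by (simp add: A_def)
    have cg: "continuous_on unit_disc (\<lambda>z. cmod (g z) powr p)"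
      by (intro continuous_on_norm_powr holomorphic_on_imp_continuous_on g p)
    have A: "A \<le> circ_mean (\<lambda>z. cmod (g z) powr p) s" if s: "\<rho> \<le> s" "s < 1" for s
    proof -
      have "(1 - r) / 2 \<le> 1 - r / s"
      proof -
        have k: "2 * r \<le> 1 + r * r"
          using zero_le_power2[of "1 - r"] by (simp add: power2_eq_square algebra_simps)
        have "r / s \<le> r / \<rho>" using s \<rho> r by (intro divide_left_mono) auto
        also have "r / \<rho> = 2 * r / (1 + r)" by (simp add: \<rho>_def)
        also have "2 * r / (1 + r) \<le> (1 + r) / 2"
        proof -
          have "2 * r \<le> (1 + r) / 2 * (1 + r)" using k by (simp add: field_simps)
          then show ?thesis using r by (subst pos_divide_le_eq) auto
        qed
        finally show ?thesis by (simp add: field_simps)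
      qed
      then have "A \<le> cmod (g z) powr p * (1 - r / s)" unfolding A_def by (intro mult_left_mono) auto
      also have "\<dots> \<le> circ_mean (\<lambda>z. cmod (g z) powr p) s"
        unfolding r_def using circ_mean_powr_bounds(2)[OF g p, of s z] s \<rho> by (simp add: r_def)
      finally show ?thesis .
    qed
    have "ennreal (cmod (g z) powr p * (T r * (1 - r))) \<le> ennreal (2 * C1 * (A * T \<rho>))"
    proof (rule ennreal_leI)
      have "cmod (g z) powr p * (T r * (1 - r)) = 2 * A * T r" by (simp add: A_def)
      also have "\<dots> \<le> 2 * A * (C1 * T \<rho>)" using C1(2)[OF r] A0 by (intro mult_left_mono) (auto simp: \<rho>_def)
      finally show "cmod (g z) powr p * (T r * (1 - r)) \<le> 2 * C1 * (A * T \<rho>)" by (simp add: mult_ac)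
    qed
    also have "\<dots> = ennreal (2 * C1) * (\<integral>\<^sup>+s. ennreal A * (ennreal (w s) * indicator {\<rho>..} s) \<partial>\<U>)"
      using C1(1) A0 T_pos[OF \<rho>(1,2)] w_meas by (subst nn_integral_cmult) (auto simp: T_eq[OF \<rho>(1,2), symmetric] ennreal_mult intro!: borel_measurable_U)
    also have "\<dots> \<le> ennreal (2 * C1) * (\<integral>\<^sup>+s. ennreal (2 * s) * ennreal (w s) * ennreal (circ_mean (\<lambda>z. cmod (g z) powr p) s) \<partial>\<U>)"
    proof (intro mult_left_mono nn_integral_mono)
      fix s assume "s \<in> space \<U>"
      then have s: "0 \<le> s" "s < 1" by auto
      show "ennreal A * (ennreal (w s) * indicator {\<rho>..} s) \<le> ennreal (2 * s) * ennreal (w s) * ennreal (circ_mean (\<lambda>z. cmod (g z) powr p) s)"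
      proof (cases "\<rho> \<le> s")
        case True
        have "ennreal (1 * w s * A) \<le> ennreal (2 * s * w s * circ_mean (\<lambda>z. cmod (g z) powr p) s)"
          using A[OF True s(2)] A0 True \<rho>(4) w_nonneg[of s] by (intro ennreal_leI mult_mono) auto
        then show ?thesis using True s w_nonneg[of s] A0 circ_mean_nonneg[of "\<lambda>z. cmod (g z) powr p" s]
          by (simp add: ennreal_mult mult_ac)
      qed simp
    qed simp
    also have "\<dots> = ennreal (2 * C1) * (\<integral>\<^sup>+\<zeta>. ennreal (cmod (g \<zeta>) powr p) \<partial>wmeasure)"
      by (subst nn_integral_radial_mean[OF cg]) auto
    finally show "ennreal (cmod (g z) powr p * (T (cmod z) * (1 - cmod z))) \<le> ennreal (2 * C1) * (\<integral>\<^sup>+\<zeta>. ennreal (cmod (g \<zeta>) powr p) \<partial>wmeasure)"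
      by (simp add: r_def)
  qed
qed

text \<open>The density \<open>w\<close> may vanish on whole intervals and cannot be compared
  pointwise with \<open>T r / (1 - r)\<close>; circle means increase with the radius, which is what
  \<open>T_regularised_le\<close> asks for.\<close>

lemma circ_mean_regularised_le:
  obtains C where "C > 0" "\<And>g p. g holomorphic_on unit_disc \<Longrightarrow> 0 < p \<Longrightarrow>
    (\<integral>\<^sup>+r. ennreal (circ_mean (\<lambda>z. cmod (g z) powr p) r) * ennreal (T r / (1 - r)) \<partial>\<U>)
      \<le> ennreal C * (\<integral>\<^sup>+\<zeta>. ennreal (cmod (g \<zeta>) powr p) \<partial>wmeasure)"
proof -
  obtain C where C: "C > 0" "\<And>M. M \<in> borel_measurable \<U> \<Longrightarrow> (\<forall>r t. 0 \<le> r \<longrightarrow> r \<le> t \<longrightarrow> t < 1 \<longrightarrow> M r \<le> M t) \<Longrightarrow>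
     (\<integral>\<^sup>+r. M r * ennreal (T r / (1 - r)) \<partial>\<U>) \<le> ennreal C * (\<integral>\<^sup>+r. ennreal (2 * r) * ennreal (w r) * M r \<partial>\<U>)"
    using T_regularised_le by blast
  show ?thesis
  proof (rule that[OF C(1)])
    fix g :: "complex \<Rightarrow> complex" and p :: real assume g: "g holomorphic_on unit_disc" and p: "0 < p"
    have cg: "continuous_on unit_disc (\<lambda>z. cmod (g z) powr p)"
      by (intro continuous_on_norm_powr holomorphic_on_imp_continuous_on g p)
    have "(\<lambda>r. \<integral>\<^sup>+t. ennreal (cmod (g (of_real r * circ t)) powr p) \<partial>\<U>) \<in> borel_measurable \<U>"
      using continuous_on_measurable_D[OF cg] by (intro circ_nn_measurable) simp
    then have m: "(\<lambda>r. ennreal (circ_mean (\<lambda>z. cmod (g z) powr p) r)) \<in> borel_measurable \<U>"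
      by (rule measurable_cong[THEN iffD1, rotated]) (auto simp: circ_mean_nn[OF cg])
    have mono: "\<forall>r t. 0 \<le> r \<longrightarrow> r \<le> t \<longrightarrow> t < 1 \<longrightarrow> ennreal (circ_mean (\<lambda>z. cmod (g z) powr p) r) \<le> ennreal (circ_mean (\<lambda>z. cmod (g z) powr p) t)"
    proof (intro allI impI ennreal_leI)
      fix r t :: real assume rt: "0 \<le> r" "r \<le> t" "t < 1"
      show "circ_mean (\<lambda>z. cmod (g z) powr p) r \<le> circ_mean (\<lambda>z. cmod (g z) powr p) t"
        by (cases "t = 0") (use rt circ_mean_powr_bounds(1)[OF g p, of t r] in auto)
    qed
    show "(\<integral>\<^sup>+r. ennreal (circ_mean (\<lambda>z. cmod (g z) powr p) r) * ennreal (T r / (1 - r)) \<partial>\<U>)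
      \<le> ennreal C * (\<integral>\<^sup>+\<zeta>. ennreal (cmod (g \<zeta>) powr p) \<partial>wmeasure)"
      using C(2)[OF m mono] by (subst nn_integral_radial_mean[OF cg]) auto
  qed
qed

text \<open>One factor \<open>cmod (g z) powr p\<close> is kept and integrated against
  \<open>T r / (1 - r)\<close>; the remaining power \<open>1 - p\<close>, which is
  \<open>p * q\<close> with \<open>q = 1 / p - 1\<close>, is bounded by point evaluation. The powers
  \<open>q\<close> and 1 of the integral \<open>X\<close> add up to \<open>1 / p\<close>.\<close>

lemma bergman_embedding:
  assumes p: "0 < p" "p \<le> 1"
  obtains C where "C > 0" "\<And>g. g holomorphic_on unit_disc \<Longrightarrow> integrable wmeasure (\<lambda>\<zeta>. cmod (g \<zeta>) powr p) \<Longrightarrow>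
    (\<integral>\<^sup>+r. ennreal ((T r * (1 - r)) powr (1 / p) / (1 - r)\<^sup>2) * (\<integral>\<^sup>+t. ennreal (cmod (g (of_real r * circ t))) \<partial>\<U>) \<partial>\<U>)
      \<le> ennreal (C * (\<integral>\<zeta>. cmod (g \<zeta>) powr p \<partial>wmeasure) powr (1 / p))"
proof -
  obtain C1 where C1: "C1 > 0" "\<And>g z. g holomorphic_on unit_disc \<Longrightarrow> z \<in> unit_disc \<Longrightarrow>
    ennreal (cmod (g z) powr p * (T (cmod z) * (1 - cmod z))) \<le> ennreal C1 * (\<integral>\<^sup>+\<zeta>. ennreal (cmod (g \<zeta>) powr p) \<partial>wmeasure)"
    using point_evaluation[OF p(1)] by blast
  obtain C2 where C2: "C2 > 0" "\<And>g p. g holomorphic_on unit_disc \<Longrightarrow> 0 < p \<Longrightarrow>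
    (\<integral>\<^sup>+r. ennreal (circ_mean (\<lambda>z. cmod (g z) powr p) r) * ennreal (T r / (1 - r)) \<partial>\<U>)
      \<le> ennreal C2 * (\<integral>\<^sup>+\<zeta>. ennreal (cmod (g \<zeta>) powr p) \<partial>wmeasure)"
    using circ_mean_regularised_le by blast
  define q where "q = 1 / p - 1"
  have q: "0 \<le> q" "1 / p = q + 1" "p * q + p = 1" using p by (auto simp: q_def field_simps)
  show ?thesis
  proof (rule that[of "C1 powr q * C2"])
    show "C1 powr q * C2 > 0" using C1(1) C2(1) by simp
    fix g assume g: "g holomorphic_on unit_disc" and gi: "integrable wmeasure (\<lambda>\<zeta>. cmod (g \<zeta>) powr p)"
    define X where "X = (\<integral>\<zeta>. cmod (g \<zeta>) powr p \<partial>wmeasure)"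
    have X0: "0 \<le> X" unfolding X_def by (simp add: integral_nonneg_AE)
    have Xe: "(\<integral>\<^sup>+\<zeta>. ennreal (cmod (g \<zeta>) powr p) \<partial>wmeasure) = ennreal X"
      unfolding X_def using gi by (intro nn_integral_eq_integral) auto
    have pe: "cmod (g z) powr p * (T (cmod z) * (1 - cmod z)) \<le> C1 * X" if "z \<in> unit_disc" for z
    proof -
      have "ennreal (cmod (g z) powr p * (T (cmod z) * (1 - cmod z))) \<le> ennreal (C1 * X)"
        using C1(2)[OF g that] X0 C1(1) unfolding Xe by (simp add: ennreal_mult)
      then show ?thesis using X0 C1(1) by (subst (asm) ennreal_le_iff) auto
    qed
    have cg: "continuous_on unit_disc (\<lambda>z. cmod (g z) powr p)"
      by (intro continuous_on_norm_powr holomorphic_on_imp_continuous_on g p)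
    have pw: "(T r * (1 - r)) powr (1 / p) / (1 - r)\<^sup>2 * cmod (g z) \<le> (C1 * X) powr q * (cmod (g z) powr p * (T r / (1 - r)))"
      if z: "cmod z = r" and r: "0 \<le> r" "r < 1" for z r
    proof (cases "g z = 0")
      case False
      have zd: "z \<in> unit_disc" using z r by simp
      have S: "0 < T r * (1 - r)" using T_pos[OF r] r by simp
      have "(cmod (g z) powr p) powr q * (T r * (1 - r)) powr q = (cmod (g z) powr p * (T r * (1 - r))) powr q"
        using S by (simp add: powr_mult)
      also have "\<dots> \<le> (C1 * X) powr q" using pe[OF zd] z S q by (intro powr_mono2) auto
      finally have 1: "(cmod (g z) powr p) powr q * (T r * (1 - r)) powr q \<le> (C1 * X) powr q" .
      have g1: "cmod (g z) = (cmod (g z) powr p) powr q * cmod (g z) powr p"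
        using False q(3) by (simp add: powr_powr powr_add[symmetric])
      have S1: "(T r * (1 - r)) powr (1 / p) = (T r * (1 - r)) powr q * (T r * (1 - r))"
        unfolding q(2) using S by (simp add: powr_add)
      have "c * d / e * (a * b) = (a * c) * (b * (d / e))" for a b c d e :: real by simp
      then have "(T r * (1 - r)) powr (1 / p) / (1 - r)\<^sup>2 * cmod (g z) =
        ((cmod (g z) powr p) powr q * (T r * (1 - r)) powr q) * (cmod (g z) powr p * (T r * (1 - r) / (1 - r)\<^sup>2))"
        by (subst g1, subst S1) blast
      also have "T r * (1 - r) / (1 - r)\<^sup>2 = T r / (1 - r)" using r by (simp add: power2_eq_square)
      also have "((cmod (g z) powr p) powr q * (T r * (1 - r)) powr q) * (cmod (g z) powr p * (T r / (1 - r))) \<le> (C1 * X) powr q * (cmod (g z) powr p * (T r / (1 - r)))"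
        using 1 T_pos[OF r] r by (intro mult_right_mono) auto
      finally show ?thesis .
    qed simp
    have "(\<integral>\<^sup>+r. ennreal ((T r * (1 - r)) powr (1 / p) / (1 - r)\<^sup>2) * (\<integral>\<^sup>+t. ennreal (cmod (g (of_real r * circ t))) \<partial>\<U>) \<partial>\<U>) \<le>
      (\<integral>\<^sup>+r. ennreal ((C1 * X) powr q) * (ennreal (circ_mean (\<lambda>z. cmod (g z) powr p) r) * ennreal (T r / (1 - r))) \<partial>\<U>)"
    proof (rule nn_integral_mono)
      fix r assume "r \<in> space \<U>"
      then have r: "0 \<le> r" "r < 1" by auto
      have m1: "(\<lambda>t. cmod (g (of_real r * circ t))) \<in> borel_measurable \<U>"
        using circle_measurable[OF holomorphic_measurable_D[OF g] r] by simp
      have m2: "(\<lambda>t. cmod (g (of_real r * circ t)) powr p) \<in> borel_measurable \<U>"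
        using m1 by measurable
      have "ennreal ((T r * (1 - r)) powr (1 / p) / (1 - r)\<^sup>2) * (\<integral>\<^sup>+t. ennreal (cmod (g (of_real r * circ t))) \<partial>\<U>) =
        (\<integral>\<^sup>+t. ennreal ((T r * (1 - r)) powr (1 / p) / (1 - r)\<^sup>2 * cmod (g (of_real r * circ t))) \<partial>\<U>)"
        using m1 by (subst nn_integral_cmult[symmetric], simp) (intro nn_integral_cong ennreal_mult[symmetric], auto)
      also have "\<dots> \<le> (\<integral>\<^sup>+t. ennreal ((C1 * X) powr q * (T r / (1 - r))) * ennreal (cmod (g (of_real r * circ t)) powr p) \<partial>\<U>)"
      proof (rule nn_integral_mono)
        fix t
        have "ennreal ((T r * (1 - r)) powr (1 / p) / (1 - r)\<^sup>2 * cmod (g (of_real r * circ t))) \<le> ennreal ((C1 * X) powr q * (cmod (g (of_real r * circ t)) powr p * (T r / (1 - r))))"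
          by (intro ennreal_leI pw r) (use r in \<open>simp add: norm_mult\<close>)
        also have "\<dots> = ennreal ((C1 * X) powr q * (T r / (1 - r))) * ennreal (cmod (g (of_real r * circ t)) powr p)"
          using T_pos[OF r] r by (subst ennreal_mult[symmetric]) (auto simp: mult_ac)
        finally show "ennreal ((T r * (1 - r)) powr (1 / p) / (1 - r)\<^sup>2 * cmod (g (of_real r * circ t))) \<le> ennreal ((C1 * X) powr q * (T r / (1 - r))) * ennreal (cmod (g (of_real r * circ t)) powr p)" .
      qed
      also have "\<dots> = ennreal ((C1 * X) powr q * (T r / (1 - r))) * ennreal (circ_mean (\<lambda>z. cmod (g z) powr p) r)"
        using m2 by (subst nn_integral_cmult) (auto simp: circ_mean_nn[OF cg _ r])
      also have "\<dots> = ennreal ((C1 * X) powr q) * (ennreal (circ_mean (\<lambda>z. cmod (g z) powr p) r) * ennreal (T r / (1 - r)))"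
        using T_pos[OF r] r by (subst ennreal_mult) (auto simp: mult_ac)
      finally show "ennreal ((T r * (1 - r)) powr (1 / p) / (1 - r)\<^sup>2) * (\<integral>\<^sup>+t. ennreal (cmod (g (of_real r * circ t))) \<partial>\<U>) \<le> ennreal ((C1 * X) powr q) * (ennreal (circ_mean (\<lambda>z. cmod (g z) powr p) r) * ennreal (T r / (1 - r)))" .
    qed
    also have "\<dots> = ennreal ((C1 * X) powr q) * (\<integral>\<^sup>+r. ennreal (circ_mean (\<lambda>z. cmod (g z) powr p) r) * ennreal (T r / (1 - r)) \<partial>\<U>)"
    proof (rule nn_integral_cmult)
      have "(\<lambda>r. \<integral>\<^sup>+t. ennreal (cmod (g (of_real r * circ t)) powr p) \<partial>\<U>) \<in> borel_measurable \<U>"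
        using continuous_on_measurable_D[OF cg] by (intro circ_nn_measurable) simp
      then have m: "(\<lambda>r. ennreal (circ_mean (\<lambda>z. cmod (g z) powr p) r)) \<in> borel_measurable \<U>"
        by (rule measurable_cong[THEN iffD1, rotated]) (auto simp: circ_mean_nn[OF cg])
      obtain T' where [measurable]: "T' \<in> borel_measurable borel" and T': "\<And>s. 0 \<le> s \<Longrightarrow> s < 1 \<Longrightarrow> T' s = T s"
        using T_borel by blast
      have "(\<lambda>s. ennreal (T' s / (1 - s))) \<in> borel_measurable \<U>" by (rule borel_measurable_U) measurable
      then have "(\<lambda>s. ennreal (T s / (1 - s))) \<in> borel_measurable \<U>"
        by (rule measurable_cong[THEN iffD1, rotated]) (auto simp: T')
      with m show "(\<lambda>r. ennreal (circ_mean (\<lambda>z. cmod (g z) powr p) r) * ennreal (T r / (1 - r))) \<in> borel_measurable \<U>"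
        by (rule borel_measurable_times_ennreal)
    qed
    also have "\<dots> \<le> ennreal ((C1 * X) powr q) * (ennreal C2 * ennreal X)"
      using C2(2)[OF g p(1)] unfolding Xe by (rule mult_left_mono) simp
    also have "\<dots> = ennreal (C1 powr q * C2 * X powr (1 / p))"
    proof -
      have "(C1 * X) powr q * (C2 * X) = C1 powr q * C2 * X powr (1 / p)"
        using X0 C1(1) by (cases "X = 0") (auto simp: q(2) powr_add powr_mult)
      then show ?thesis using C2(1) X0 by (simp add: ennreal_mult[symmetric])
    qed
    finally show "(\<integral>\<^sup>+r. ennreal ((T r * (1 - r)) powr (1 / p) / (1 - r)\<^sup>2) * (\<integral>\<^sup>+t. ennreal (cmod (g (of_real r * circ t))) \<partial>\<U>) \<partial>\<U>)
      \<le> ennreal (C1 powr q * C2 * (\<integral>\<zeta>. cmod (g \<zeta>) powr p \<partial>wmeasure) powr (1 / p))" unfolding X_def .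
  qed
qed

end

section \<open>The binomial series and derivatives of the Euler operator\<close>

lemma binomial_series_neg:
  assumes "z \<in> unit_disc"
  shows "(\<lambda>j. of_nat ((j + n) choose n) * z ^ j) sums (1 / (1 - z) ^ Suc n)"
  using assms
proof (induction n arbitrary: z)
  case 0
  then show ?case using geometric_sums[of z] by simp
next
  case (Suc n)
  have z1: "1 - z \<noteq> 0" using Suc.prems by auto
  have a: "summable (\<lambda>j. norm (of_nat ((j + n) choose n) * z ^ j))"
    by (rule power_series_summable_norm[OF Suc.IH Suc.prems])
  have b: "summable (\<lambda>j. norm (z ^ j))"
    using Suc.prems by (simp add: norm_power summable_geometric)
  \<comment> \<open>A Cauchy product with the geometric series raises the exponent by one; the
    coefficients add up by the hockey-stick identity.\<close>
  have "(\<Sum>i\<le>k. of_nat ((i + n) choose n) * z ^ i * z ^ (k - i)) = of_nat ((k + Suc n) choose Suc n) * z ^ k" for k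
  proof -
    have "(\<Sum>i\<le>k. of_nat ((i + n) choose n) * z ^ i * z ^ (k - i)) = (\<Sum>i\<le>k. of_nat ((n + i) choose i) * z ^ k)"
    proof (rule sum.cong)
      fix i assume "i \<in> {..k}"
      then have "z ^ i * z ^ (k - i) = z ^ k" by (simp add: power_add[symmetric])
      moreover have "(i + n) choose n = (n + i) choose i" using binomial_symmetric[of n "i + n"] by (simp add: add.commute)
      ultimately show "of_nat ((i + n) choose n) * z ^ i * z ^ (k - i) = of_nat ((n + i) choose i) * z ^ k" by (simp add: mult.assoc)
    qed simp
    also have "\<dots> = of_nat (\<Sum>i\<le>k. (n + i) choose i) * z ^ k" by (simp add: sum_distrib_right)
    also have "(\<Sum>i\<le>k. (n + i) choose i) = Suc (n + k) choose k" by (rule sum_choose_lower)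
    also have "Suc (n + k) choose k = (k + Suc n) choose Suc n" using binomial_symmetric[of k "Suc (n + k)"] by (simp add: add.commute)
    finally show ?thesis .
  qed
  then have "(\<lambda>k. of_nat ((k + Suc n) choose Suc n) * z ^ k) sums ((\<Sum>j. of_nat ((j + n) choose n) * z ^ j) * (\<Sum>j. z ^ j))"
    using Cauchy_product_sums[OF a b] by simp
  also have "(\<Sum>j. of_nat ((j + n) choose n) * z ^ j) = 1 / (1 - z) ^ Suc n"
    using Suc.IH[OF Suc.prems] by (simp add: sums_iff)
  also have "(\<Sum>j. z ^ j) = 1 / (1 - z)" using Suc.prems by (simp add: suminf_geometric)
  finally show ?case by (simp add: mult.commute)
qed

lemma higher_deriv_euler_op:
  assumes f: "f holomorphic_on unit_disc" and z: "z \<in> unit_disc"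
  shows "(deriv ^^ i) (euler_op f) z = (1 + of_nat i) * (deriv ^^ i) f z + z * (deriv ^^ Suc i) f z"
  using z
proof (induction i arbitrary: z)
  case 0
  then show ?case by (simp add: euler_op_def)
next
  case (Suc i)
  have h: "(deriv ^^ j) f holomorphic_on unit_disc" for j by (rule holomorphic_higher_deriv[OF f open_ball])
  have d: "((deriv ^^ j) f has_field_derivative (deriv ^^ Suc j) f z) (at z)" for j
    using holomorphic_derivI[OF h open_ball Suc.prems] by simp
  have "((\<lambda>z. (1 + of_nat i) * (deriv ^^ i) f z + z * (deriv ^^ Suc i) f z) has_field_derivative
      ((1 + of_nat i) * (deriv ^^ Suc i) f z + (1 * (deriv ^^ Suc i) f z + (deriv ^^ Suc (Suc i)) f z * z))) (at z)"
    by (rule DERIV_add[OF DERIV_cmult[OF d] DERIV_mult[OF DERIV_ident d]])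
  then have "((deriv ^^ i) (euler_op f) has_field_derivative
      ((1 + of_nat i) * (deriv ^^ Suc i) f z + (1 * (deriv ^^ Suc i) f z + (deriv ^^ Suc (Suc i)) f z * z))) (at z)"
    by (rule has_field_derivative_transform_within_open[OF _ open_ball Suc.prems]) (use Suc.IH in simp)
  then show ?case by (simp add: DERIV_imp_deriv algebra_simps)
qed

text \<open>The innermost operator is peeled off, so that the hypothesis for \<open>n\<close>
  applies to \<open>euler_op f\<close>, whose derivatives up to order \<open>n\<close> involve those
  of \<open>f\<close> up to order \<open>n + 1\<close>.\<close>

lemma euler_op_pow_bound:
  "\<exists>C>0. \<forall>f z. f holomorphic_on unit_disc \<longrightarrow> z \<in> unit_disc \<longrightarrow>
     cmod ((euler_op ^^ n) f z) \<le> C * (\<Sum>j\<le>n. cmod ((deriv ^^ j) f z))"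
proof (induction n)
  case 0
  show ?case by (intro exI[of _ 1]) auto
next
  case (Suc n)
  then obtain C where C: "C > 0" "\<And>f z. f holomorphic_on unit_disc \<Longrightarrow> z \<in> unit_disc \<Longrightarrow>
     cmod ((euler_op ^^ n) f z) \<le> C * (\<Sum>j\<le>n. cmod ((deriv ^^ j) f z))" by blast
  show ?case
  proof (intro exI[of _ "C * (real n + 2)"] conjI allI impI)
    show "0 < C * (real n + 2)" using C(1) by simp
    fix f z assume f: "f holomorphic_on unit_disc" and z: "z \<in> unit_disc"
    define a where "a j = cmod ((deriv ^^ j) f z)" for j
    have a0: "0 \<le> a j" for j by (simp add: a_def)
    have "cmod ((euler_op ^^ Suc n) f z) = cmod ((euler_op ^^ n) (euler_op f) z)" by (simp add: funpow_swap1)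
    also have "\<dots> \<le> C * (\<Sum>j\<le>n. cmod ((deriv ^^ j) (euler_op f) z))"
      by (rule C(2)[OF euler_op_holomorphic[OF f] z])
    also have "\<dots> \<le> C * ((\<Sum>j\<le>n. (real n + 1) * a j) + (\<Sum>j\<le>n. a (Suc j)))"
    proof (intro mult_left_mono)
      have "cmod ((deriv ^^ j) (euler_op f) z) \<le> (real n + 1) * a j + a (Suc j)" if "j \<le> n" for j
      proof -
        have "cmod ((deriv ^^ j) (euler_op f) z) \<le> cmod ((1 + of_nat j) * (deriv ^^ j) f z) + cmod (z * (deriv ^^ Suc j) f z)"
          unfolding higher_deriv_euler_op[OF f z] by (rule norm_triangle_ineq)
        also have "\<dots> \<le> (real n + 1) * a j + 1 * a (Suc j)"
        proof (intro add_mono)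
          have "cmod (1 + of_nat j) = real j + 1" by (metis add.commute norm_of_nat of_nat_Suc)
          then show "cmod ((1 + of_nat j) * (deriv ^^ j) f z) \<le> (real n + 1) * a j"
            using that by (simp add: norm_mult a_def mult_right_mono)
          show "cmod (z * (deriv ^^ Suc j) f z) \<le> 1 * a (Suc j)"
            using z by (simp only: norm_mult a_def) (intro mult_right_mono, auto)
        qed
        finally show ?thesis by simp
      qed
      then have "(\<Sum>j\<le>n. cmod ((deriv ^^ j) (euler_op f) z)) \<le> (\<Sum>j\<le>n. (real n + 1) * a j + a (Suc j))"
        by (intro sum_mono) auto
      then show "(\<Sum>j\<le>n. cmod ((deriv ^^ j) (euler_op f) z)) \<le> (\<Sum>j\<le>n. (real n + 1) * a j) + (\<Sum>j\<le>n. a (Suc j))"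
        by (simp add: sum.distrib)
    qed (use C(1) in simp)
    also have "\<dots> \<le> C * ((real n + 1) * (\<Sum>j\<le>Suc n. a j) + (\<Sum>j\<le>Suc n. a j))"
    proof (intro mult_left_mono add_mono)
      show "(\<Sum>j\<le>n. (real n + 1) * a j) \<le> (real n + 1) * (\<Sum>j\<le>Suc n. a j)"
        unfolding sum_distrib_left[symmetric] using a0 by (intro mult_left_mono) auto
      have "(\<Sum>j\<le>Suc n. a j) = a 0 + (\<Sum>j\<le>n. a (Suc j))" by (rule sum.atMost_Suc_shift)
      then show "(\<Sum>j\<le>n. a (Suc j)) \<le> (\<Sum>j\<le>Suc n. a j)" using a0[of 0] by simp
    qed (use C(1) in simp)
    also have "\<dots> = C * (real n + 2) * (\<Sum>j\<le>Suc n. a j)" by (simp add: algebra_simps)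
    finally show "cmod ((euler_op ^^ Suc n) f z) \<le> C * (real n + 2) * (\<Sum>j\<le>Suc n. cmod ((deriv ^^ j) f z))"
      by (simp only: a_def)
  qed
qed

lemma H_infinityD:
  assumes "g \<in> H_infinity"
  shows "g holomorphic_on unit_disc" "\<exists>B\<ge>0. \<forall>z\<in>unit_disc. cmod (g z) \<le> B"
  using assms unfolding H_infinity_def bounded_iff
  by auto (metis (no_types, lifting) mem_ball_0 norm_ge_zero order_trans centre_in_ball zero_less_one)

subsection \<open>The Hankel form on one weight\<close>

context doubling_tail begin

lemma bounded_integrable_w:
  fixes u :: "complex \<Rightarrow> 'b::{banach, second_countable_topology}"
  assumes u: "continuous_on unit_disc u" and B: "\<And>z. z \<in> unit_disc \<Longrightarrow> norm (u z) \<le> B"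
  shows "integrable wmeasure u"
proof -
  interpret W: finite_measure wmeasure by (rule finite_measure_w)
  show ?thesis
    using continuous_on_measurable_D[OF u] B by (intro W.integrable_const_bound[of _ B]) auto
qed

lemma kern_bounded:
  assumes z: "z \<in> unit_disc"
  obtains B where "\<And>\<zeta>. \<zeta> \<in> unit_disc \<Longrightarrow> cmod (kern n (cnj z * \<zeta>)) \<le> B"
proof -
  obtain B where B: "\<And>y. cmod y \<le> cmod z \<Longrightarrow> norm (kern n y) \<le> B"
    using continuous_circle_bounded[OF holomorphic_on_imp_continuous_on[OF kern_holomorphic], of "cmod z" n] z by auto
  show ?thesis
    by (rule that[of B], rule B) (simp add: norm_mult mult_left_le)
qed

lemma kern_slice_holomorphic:
  assumes z: "z \<in> unit_disc"
  shows "(\<lambda>\<zeta>. kern n (cnj z * \<zeta>)) holomorphic_on unit_disc"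
proof -
  have "(kern n \<circ> (\<lambda>\<zeta>. cnj z * \<zeta>)) holomorphic_on unit_disc"
    by (rule holomorphic_on_compose_gen[OF _ kern_holomorphic])
       (use z in \<open>auto intro!: holomorphic_intros le_less_trans[OF mult_left_le] simp: norm_mult\<close>)
  then show ?thesis by (simp add: o_def)
qed

text \<open>The small Hankel operator with explicit kernel and with the weight as a measure. The
  holomorphic factors stand under one conjugation, the form in which \<open>pairing_euler_op\<close>
  applies.\<close>

definition hank :: "(complex \<Rightarrow> complex) \<Rightarrow> (complex \<Rightarrow> complex) \<Rightarrow> complex \<Rightarrow> complex" where
  "hank f g z = (\<integral>\<zeta>. cnj (g \<zeta> * kern 0 (cnj z * \<zeta>)) * f \<zeta> \<partial>wmeasure)"

text \<open>Up to the factor \<open>moment k\<close> these are the Taylor coefficients of the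
  image.\<close>

definition hank_coeff :: "(complex \<Rightarrow> complex) \<Rightarrow> (complex \<Rightarrow> complex) \<Rightarrow> nat \<Rightarrow> complex" where
  "hank_coeff f g k = (\<integral>\<zeta>. cnj \<zeta> ^ k * (cnj (g \<zeta>) * f \<zeta>) \<partial>wmeasure)"

lemma hank_integrable:
  assumes f: "integrable wmeasure f" and g: "g \<in> H_infinity"
  shows "integrable wmeasure (\<lambda>\<zeta>. cnj (g \<zeta>) * f \<zeta>)"
proof -
  obtain B where B: "B \<ge> 0" "\<And>z. z \<in> unit_disc \<Longrightarrow> cmod (g z) \<le> B" using H_infinityD(2)[OF g] by blast
  have gm: "(\<lambda>\<zeta>. cnj (g \<zeta>)) \<in> borel_measurable \<D>"
    using holomorphic_measurable_D[OF H_infinityD(1)[OF g]] by measurable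
  show ?thesis
  proof (rule Bochner_Integration.integrable_bound[OF integrable_mult_right[OF f, of "of_real B"]])
    show "(\<lambda>\<zeta>. cnj (g \<zeta>) * f \<zeta>) \<in> borel_measurable wmeasure"
      using gm borel_measurable_integrable[OF f] by simp
    show "AE \<zeta> in wmeasure. norm (cnj (g \<zeta>) * f \<zeta>) \<le> norm (of_real B * f \<zeta>)"
      using B by (intro AE_I2) (auto simp: norm_mult intro!: mult_right_mono)
  qed
qed

lemma cnj_power_measurable: "(\<lambda>\<zeta>. cnj \<zeta> ^ k) \<in> borel_measurable wmeasure"
  using continuous_on_measurable_D[of "\<lambda>\<zeta>. cnj \<zeta> ^ k"] by (simp add: continuous_intros)

text \<open>For fixed \<open>z\<close> the kernel series converges absolutely, uniformly over the
  disc in the other variable, so it may be integrated term by term. The image is therefore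
  holomorphic although only integrability of \<open>f\<close> is available.\<close>

lemma hank_sums:
  assumes f: "integrable wmeasure f" and g: "g \<in> H_infinity" and z: "z \<in> unit_disc"
  shows "(\<lambda>k. hank_coeff f g k / of_real (moment k) * z ^ k) sums hank f g z"
proof -
  have s: "summable (\<lambda>k. norm (z ^ k / of_real (moment k)))" using kern_summable[OF z, of 0] by simp
  have "(\<lambda>k. z ^ k / of_real (moment k) * hank_coeff f g k) sums
     (\<integral>\<zeta>. (\<Sum>k. z ^ k / of_real (moment k) * cnj \<zeta> ^ k) * (cnj (g \<zeta>) * f \<zeta>) \<partial>wmeasure)"
    unfolding hank_coeff_def
    by (rule integral_bounded_series(2)[OF s hank_integrable[OF f g] cnj_power_measurable]) (auto simp: norm_power power_le_one)
  also have "(\<integral>\<zeta>. (\<Sum>k. z ^ k / of_real (moment k) * cnj \<zeta> ^ k) * (cnj (g \<zeta>) * f \<zeta>) \<partial>wmeasure) = hank f g z"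
    unfolding hank_def
  proof (rule Bochner_Integration.integral_cong)
    fix \<zeta> assume "\<zeta> \<in> space wmeasure"
    then have \<zeta>: "\<zeta> \<in> unit_disc" by simp
    have d: "z * cnj \<zeta> \<in> unit_disc" "cnj z * \<zeta> \<in> unit_disc" using z \<zeta> mult_left_le[of "cmod \<zeta>" "cmod z"] by (auto simp: norm_mult intro: le_less_trans)
    have "(\<Sum>k. z ^ k / of_real (moment k) * cnj \<zeta> ^ k) = kern 0 (z * cnj \<zeta>)"
      by (simp add: kern_def power_mult_distrib)
    also have "\<dots> = cnj (kern 0 (cnj z * \<zeta>))" using kern_cnj[OF d(2), of 0] by simp
    finally show "(\<Sum>k. z ^ k / of_real (moment k) * cnj \<zeta> ^ k) * (cnj (g \<zeta>) * f \<zeta>) = cnj (g \<zeta> * kern 0 (cnj z * \<zeta>)) * f \<zeta>"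
      by simp
  qed simp
  finally show ?thesis by (simp add: mult_ac)
qed

lemma hank_holomorphic:
  assumes f: "integrable wmeasure f" and g: "g \<in> H_infinity"
  shows "hank f g holomorphic_on unit_disc"
    and "taylor (hank f g) = (\<lambda>k. hank_coeff f g k / of_real (moment k))"
  using power_series_taylor[of "\<lambda>k. hank_coeff f g k / of_real (moment k)" "hank f g"] hank_sums[OF f g] by blast+

text \<open>The pairing with the logarithmic test function \<open>\<Sum> b\<^sub>k z\<^sup>k\<close> only sees its Bloch norm.\<close>

lemma bloch_duality:
  obtains C where "C > 0" "\<And>h b q. h holomorphic_on unit_disc \<Longrightarrow> integrable wmeasure h \<Longrightarrow> 0 \<le> q \<Longrightarrow> q < 1 \<Longrightarrow>
    (\<And>k. (real k + 1) * cmod (b k) \<le> 2 * q ^ k) \<Longrightarrow>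
    \<exists>s. (\<lambda>k. b k * (taylor h k * of_real (moment k))) sums s \<and> cmod s \<le> C * (\<integral>\<zeta>. cmod (h \<zeta>) \<partial>wmeasure)"
proof -
  obtain C where C: "C > 0" "\<And>g p. g holomorphic_on unit_disc \<Longrightarrow> 0 < p \<Longrightarrow>
    (\<integral>\<^sup>+r. ennreal (circ_mean (\<lambda>z. cmod (g z) powr p) r) * ennreal (T r / (1 - r)) \<partial>\<U>)
      \<le> ennreal C * (\<integral>\<^sup>+\<zeta>. ennreal (cmod (g \<zeta>) powr p) \<partial>wmeasure)"
    using circ_mean_regularised_le by blast
  \<comment> \<open>One tail divides the \<open>k\<close>-th moment by \<open>k + 1\<close>, which
    is given back to \<open>b k\<close>. The pairing becomes one with \<open>G\<close>, whose
    coefficients are \<open>(k + 1) * b k\<close> and whose size is at most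
    \<open>2 / (1 - cmod \<zeta>)\<close>, while \<open>w1 r\<close> is at most a multiple of
    \<open>T r / r\<close>. With the area factor this yields the density
    \<open>T r / (1 - r)\<close>.\<close>
  define w1 where "w1 = tail_profile (\<lambda>s. ennreal (w s))"
  have fw1: "finite_profile w1" unfolding w1_def by (rule tail_profile_finite[OF finite_profile_w])
  have w1m: "w1 \<in> borel_measurable borel" using fw1 by (simp add: finite_profile_def)
  show ?thesis
  proof (rule that[of "8 * C"])
    show "8 * C > 0" using C(1) by simp
    fix h :: "complex \<Rightarrow> complex" and b :: "nat \<Rightarrow> complex" and q :: real
    assume h: "h holomorphic_on unit_disc" "integrable wmeasure h" and q: "0 \<le> q" "q < 1"
      and b: "\<And>k. (real k + 1) * cmod (b k) \<le> 2 * q ^ k"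
    define I where "I = (\<integral>\<zeta>. cmod (h \<zeta>) \<partial>wmeasure)"
    have I: "(\<integral>\<^sup>+\<zeta>. ennreal (cmod (h \<zeta>)) \<partial>wmeasure) = ennreal I"
      unfolding I_def using h(2) by (intro nn_integral_eq_integral) auto
    have I0: "0 \<le> I" unfolding I_def by (simp add: integral_nonneg_AE)
    have ch: "continuous_on unit_disc (\<lambda>z. cmod (h z))"
      by (intro continuous_intros holomorphic_on_imp_continuous_on h)
    have cm: "(\<lambda>\<zeta>. ennreal (2 / (1 - cmod \<zeta>) * cmod (h \<zeta>))) \<in> borel_measurable \<D>"
    proof -
      have "(\<lambda>\<zeta>. 2 / (1 - cmod \<zeta>) * cmod (h \<zeta>)) \<in> borel_measurable \<D>"
        by (intro continuous_on_measurable_D continuous_intros ch) auto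
      then show ?thesis by simp
    qed
    have main: "(\<integral>\<^sup>+\<zeta>. ennreal (2 / (1 - cmod \<zeta>) * cmod (h \<zeta>)) \<partial>disc_measure w1) \<le> ennreal (8 * C * I)"
    proof -
      have "(\<integral>\<^sup>+\<zeta>. ennreal (2 / (1 - cmod \<zeta>) * cmod (h \<zeta>)) \<partial>disc_measure w1) =
        (\<integral>\<^sup>+r. ennreal (2 * r) * w1 r * (\<integral>\<^sup>+t. ennreal (2 / (1 - cmod (of_real r * circ t)) * cmod (h (of_real r * circ t))) \<partial>\<U>) \<partial>\<U>)"
        by (rule nn_integral_disc_measure[OF cm w1m])
      also have "\<dots> \<le> (\<integral>\<^sup>+r. ennreal 8 * (ennreal (circ_mean (\<lambda>z. cmod (h z) powr 1) r) * ennreal (T r / (1 - r))) \<partial>\<U>)"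
      proof (rule nn_integral_mono)
        fix r assume "r \<in> space \<U>"
        then have r: "0 \<le> r" "r < 1" by auto
        define m where "m = circ_mean (\<lambda>z. cmod (h z)) r"
        have m0: "0 \<le> m" by (simp add: m_def circ_mean_nonneg)
        have "(\<integral>\<^sup>+t. ennreal (2 / (1 - cmod (of_real r * circ t)) * cmod (h (of_real r * circ t))) \<partial>\<U>) = (\<integral>\<^sup>+t. ennreal (2 / (1 - r)) * ennreal (cmod (h (of_real r * circ t))) \<partial>\<U>)"
          using r by (intro nn_integral_cong, subst ennreal_mult[symmetric]) (auto simp: norm_mult)
        also have "\<dots> = ennreal (2 / (1 - r)) * ennreal m"
          unfolding m_def using circle_measurable[OF continuous_on_measurable_D[OF ch] r]
          by (subst nn_integral_cmult) (auto simp: circ_mean_nn[OF ch _ r])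
        also have "\<dots> = ennreal (2 / (1 - r) * m)" using r m0 by (intro ennreal_mult[symmetric]) auto
        finally have e: "(\<integral>\<^sup>+t. ennreal (2 / (1 - cmod (of_real r * circ t)) * cmod (h (of_real r * circ t))) \<partial>\<U>) = ennreal (2 / (1 - r) * m)" .
        show "ennreal (2 * r) * w1 r * (\<integral>\<^sup>+t. ennreal (2 / (1 - cmod (of_real r * circ t)) * cmod (h (of_real r * circ t))) \<partial>\<U>) \<le> ennreal 8 * (ennreal (circ_mean (\<lambda>z. cmod (h z) powr 1) r) * ennreal (T r / (1 - r)))"
        proof (cases "r = 0")
          \<comment> \<open>The tail bound is singular at the origin; there the area factor
            \<open>2 * r\<close> vanishes and the claim is trivial.\<close>
          case False
          with r have r0: "0 < r" by simp
          have "w1 r \<le> ennreal (2 * T r / r)" using tail_profile_pow_bound[OF r0 r(2), of 0] by (simp add: w1_def)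
          then have "ennreal (2 * r) * w1 r * ennreal (2 / (1 - r) * m) \<le> ennreal (2 * r) * ennreal (2 * T r / r) * ennreal (2 / (1 - r) * m)"
            by (intro mult_right_mono mult_left_mono) auto
          also have "\<dots> = ennreal (2 * r * (2 * T r / r) * (2 / (1 - r) * m))"
            using r0 r T_pos[OF r] m0 by (intro ennreal_mult3) auto
          also have "2 * r * (2 * T r / r) * (2 / (1 - r) * m) = 8 * m * (T r / (1 - r))" using r0 by simp
          also have "ennreal (8 * m * (T r / (1 - r))) = ennreal 8 * ennreal m * ennreal (T r / (1 - r))"
            using r T_pos[OF r] m0 by (intro ennreal_mult3[symmetric]) auto
          finally show ?thesis unfolding e by (simp add: m_def mult.assoc)
        qed simp
      qed
      also have "\<dots> = ennreal 8 * (\<integral>\<^sup>+r. ennreal (circ_mean (\<lambda>z. cmod (h z) powr 1) r) * ennreal (T r / (1 - r)) \<partial>\<U>)"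
      proof (rule nn_integral_cmult)
        have "(\<lambda>r. \<integral>\<^sup>+t. ennreal (cmod (h (of_real r * circ t))) \<partial>\<U>) \<in> borel_measurable \<U>"
          using continuous_on_measurable_D[OF ch] by (intro circ_nn_measurable) simp
        then have m: "(\<lambda>r. ennreal (circ_mean (\<lambda>z. cmod (h z)) r)) \<in> borel_measurable \<U>"
          by (rule measurable_cong[THEN iffD1, rotated]) (auto simp: circ_mean_nn[OF ch])
        obtain T' where [measurable]: "T' \<in> borel_measurable borel" and T': "\<And>s. 0 \<le> s \<Longrightarrow> s < 1 \<Longrightarrow> T' s = T s"
          using T_borel by blast
        have "(\<lambda>s. ennreal (T' s / (1 - s))) \<in> borel_measurable \<U>" by (rule borel_measurable_U) measurable
        then have "(\<lambda>s. ennreal (T s / (1 - s))) \<in> borel_measurable \<U>"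
          by (rule measurable_cong[THEN iffD1, rotated]) (auto simp: T')
        with m show "(\<lambda>r. ennreal (circ_mean (\<lambda>z. cmod (h z) powr 1) r) * ennreal (T r / (1 - r))) \<in> borel_measurable \<U>"
          by simp
      qed
      also have "\<dots> \<le> ennreal 8 * (ennreal C * (\<integral>\<^sup>+\<zeta>. ennreal (cmod (h \<zeta>) powr 1) \<partial>wmeasure))"
        by (intro mult_left_mono C(2) h) auto
      also have "\<dots> = ennreal (8 * C * I)" using C(1) I0 by (simp add: I ennreal_mult mult.assoc)
      finally show ?thesis .
    qed
    define c where "c k = of_real (real k + 1) * b k" for k
    have nc: "norm (c k) \<le> 2 * q ^ k" for k using b[of k] unfolding c_def norm_mult norm_of_real by simp
    have sc: "summable (\<lambda>k. norm (c k))"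
      by (rule summable_comparison_test'[OF summable_mult[OF summable_geometric], of q 0 _ 2]) (use q nc in auto)
    define G where "G \<zeta> = (\<Sum>k. c k * cnj \<zeta> ^ k)" for \<zeta>
    \<comment> \<open>The decay \<open>q ^ k\<close> serves convergence only: bounding it by 1 keeps
      the estimate independent of \<open>q\<close>, which will be the modulus of the parameter of
      the test function.\<close>
    have Gb: "cmod (G \<zeta>) \<le> 2 / (1 - cmod \<zeta>)" if "\<zeta> \<in> unit_disc" for \<zeta>
    proof -
      have z1: "cmod \<zeta> < 1" using that by simp
      have sm: "summable (\<lambda>k. 2 * cmod \<zeta> ^ k)" using z1 by (intro summable_mult summable_geometric) auto
      have nk: "norm (c k * cnj \<zeta> ^ k) \<le> 2 * cmod \<zeta> ^ k" for k
      proof -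
        have "norm (c k * cnj \<zeta> ^ k) \<le> (2 * q ^ k) * cmod \<zeta> ^ k" using nc[of k] by (simp add: norm_mult norm_power mult_right_mono)
        also have "\<dots> \<le> (2 * 1) * cmod \<zeta> ^ k" using q by (intro mult_right_mono mult_left_mono power_le_one) auto
        finally show ?thesis by simp
      qed
      have sn: "summable (\<lambda>k. norm (c k * cnj \<zeta> ^ k))" by (rule summable_comparison_test'[OF sm, of 0]) (use nk in auto)
      have "cmod (G \<zeta>) \<le> (\<Sum>k. norm (c k * cnj \<zeta> ^ k))" unfolding G_def by (rule summable_norm[OF sn])
      also have "\<dots> \<le> (\<Sum>k. 2 * cmod \<zeta> ^ k)" by (rule suminf_le[OF nk sn sm])
      also have "\<dots> = 2 / (1 - cmod \<zeta>)" using z1 by (simp add: suminf_mult summable_geometric suminf_geometric)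
      finally show ?thesis .
    qed
    have hm: "h \<in> borel_measurable (disc_measure w1)" using holomorphic_measurable_D[OF h(1)] by simp
    have hi: "integrable (disc_measure w1) h"
      unfolding integrable_iff_bounded
    proof (intro conjI hm)
      have "(\<integral>\<^sup>+\<zeta>. ennreal (norm (h \<zeta>)) \<partial>disc_measure w1) \<le> (\<integral>\<^sup>+\<zeta>. ennreal (2 / (1 - cmod \<zeta>) * cmod (h \<zeta>)) \<partial>disc_measure w1)"
      proof (intro nn_integral_mono ennreal_leI)
        fix \<zeta> assume "\<zeta> \<in> space (disc_measure w1)"
        then have "1 \<le> 2 / (1 - cmod \<zeta>)" using norm_ge_zero[of \<zeta>] by (simp add: field_simps)
        from mult_right_mono[OF this norm_ge_zero] show "norm (h \<zeta>) \<le> 2 / (1 - cmod \<zeta>) * cmod (h \<zeta>)" by simp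
      qed
      also have "\<dots> < \<infinity>" using main by (rule le_less_trans) simp
      finally show "(\<integral>\<^sup>+\<zeta>. ennreal (norm (h \<zeta>)) \<partial>disc_measure w1) < \<infinity>" .
    qed
    have eq: "c k * (taylor h k * of_real (profile_moment w1 k)) = b k * (taylor h k * of_real (moment k))" for k
    proof -
      have "real k + 1 \<noteq> 0" by linarith
      then have "of_real (real k + 1) * complex_of_real (moment k / (real k + 1)) = of_real (moment k)"
        unfolding of_real_mult[symmetric] by simp
      then show ?thesis
        unfolding c_def w1_def tail_profile_moment[OF finite_profile_w] profile_moment_w by (metis mult.assoc mult.left_commute)
    qed
    have "(\<lambda>k. b k * (taylor h k * of_real (moment k))) sums (\<integral>\<zeta>. G \<zeta> * h \<zeta> \<partial>disc_measure w1)"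
      using disc_pairing[OF fw1 h(1) hi sc] unfolding eq G_def .
    moreover have "cmod (\<integral>\<zeta>. G \<zeta> * h \<zeta> \<partial>disc_measure w1) \<le> 8 * C * I"
    proof -
      have "integrable (disc_measure w1) (\<lambda>\<zeta>. G \<zeta> * h \<zeta>)"
        unfolding G_def
        by (rule integral_bounded_series(1)[OF sc hi]) (use continuous_on_measurable_D[of "\<lambda>\<zeta>. cnj \<zeta> ^ k" for k] in \<open>auto simp: norm_power power_le_one continuous_intros\<close>)
      then have "ennreal (cmod (\<integral>\<zeta>. G \<zeta> * h \<zeta> \<partial>disc_measure w1)) \<le> (\<integral>\<^sup>+\<zeta>. ennreal (norm (G \<zeta> * h \<zeta>)) \<partial>disc_measure w1)"
        by (rule integral_norm_bound_ennreal)
      also have "\<dots> \<le> (\<integral>\<^sup>+\<zeta>. ennreal (2 / (1 - cmod \<zeta>) * cmod (h \<zeta>)) \<partial>disc_measure w1)"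
        using Gb by (intro nn_integral_mono ennreal_leI) (simp only: norm_mult, intro mult_right_mono, auto)
      also have "\<dots> \<le> ennreal (8 * C * I)" by (rule main)
      finally show ?thesis using C(1) I0 by (subst (asm) ennreal_le_iff) auto
    qed
    ultimately show "\<exists>s. (\<lambda>k. b k * (taylor h k * of_real (moment k))) sums s \<and> cmod s \<le> 8 * C * (\<integral>\<zeta>. cmod (h \<zeta>) \<partial>wmeasure)"
      unfolding I_def by blast
  qed
qed

end

subsection \<open>Test functions\<close>

text \<open>The operator is tested on the quotients \<open>power_test n a / log_test a\<close>: pairing their image with \<open>log_test a\<close>
  costs only a constant and leaves the pairing of the symbol with \<open>power_test n a\<close>.\<close>

definition log_test :: "complex \<Rightarrow> complex \<Rightarrow> complex" where
  "log_test a \<zeta> = 1 - Ln (1 - cnj a * \<zeta>)"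

definition power_test :: "nat \<Rightarrow> complex \<Rightarrow> complex \<Rightarrow> complex" where
  "power_test n a \<zeta> = \<zeta> ^ n / (1 - cnj a * \<zeta>) ^ Suc n"

definition log_coeff :: "complex \<Rightarrow> nat \<Rightarrow> complex" where
  "log_coeff a k = (if k = 0 then 1 else cnj a ^ k / of_nat k)"

lemma test_arg_bounds:
  assumes "a \<in> unit_disc" "\<zeta> \<in> unit_disc"
  shows "1 - cmod a \<le> cmod (1 - cnj a * \<zeta>)" "cmod (1 - cnj a * \<zeta>) < 2" "0 < Re (1 - cnj a * \<zeta>)"
    "1 - cnj a * \<zeta> \<noteq> 0" "cmod (cnj a * \<zeta>) < 1"
proof -
  have *: "cmod (cnj a * \<zeta>) \<le> cmod a" "cmod (cnj a * \<zeta>) < 1"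
    using assms mult_left_le[of "cmod \<zeta>" "cmod a"] by (auto simp: norm_mult)
  show "1 - cmod a \<le> cmod (1 - cnj a * \<zeta>)" using norm_triangle_ineq2[of 1 "cnj a * \<zeta>"] * by simp
  show "cmod (1 - cnj a * \<zeta>) < 2" using norm_triangle_ineq4[of 1 "cnj a * \<zeta>"] * by simp
  show "0 < Re (1 - cnj a * \<zeta>)" using complex_Re_le_cmod[of "cnj a * \<zeta>"] * by simp
  show "1 - cnj a * \<zeta> \<noteq> 0" using * by auto
  show "cmod (cnj a * \<zeta>) < 1" by fact
qed

lemma log_test_sums:
  assumes "a \<in> unit_disc" "\<zeta> \<in> unit_disc"
  shows "(\<lambda>k. log_coeff a k * \<zeta> ^ k) sums log_test a \<zeta>"
proof -
  have "(\<lambda>n. - ((cnj a * \<zeta>) ^ n) / of_nat n) sums Ln (1 - cnj a * \<zeta>)"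
    using Ln_series'[of "- (cnj a * \<zeta>)"] test_arg_bounds(5)[OF assms] by simp
  moreover have "- ((cnj a * \<zeta>) ^ n) / of_nat n = - (if n = 0 then 0 else cnj a ^ n / of_nat n * \<zeta> ^ n)" for n
    by (simp add: power_mult_distrib)
  ultimately have "(\<lambda>n. - (if n = 0 then 0 else cnj a ^ n / of_nat n * \<zeta> ^ n)) sums Ln (1 - cnj a * \<zeta>)" by simp
  from sums_diff[OF sums_single[of 0 "\<lambda>_. 1"] this]
  have "(\<lambda>k. (if k = 0 then 1 else 0) - - (if k = 0 then 0 else cnj a ^ k / of_nat k * \<zeta> ^ k)) sums log_test a \<zeta>"
    by (simp add: log_test_def)
  then show ?thesis
    by (rule sums_cong[THEN iffD1, rotated]) (auto simp: log_coeff_def)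
qed

text \<open>The real part alone has this size. It is positive because the argument of the logarithm
  is below 2 in modulus and \<open>ln 2 < 1\<close>; this is why 1 is added in
  \<open>log_test\<close>, which thereby has no zero to spoil the quotient.\<close>

lemma log_test_lower:
  assumes "a \<in> unit_disc" "\<zeta> \<in> unit_disc"
  shows "1 - ln (cmod (1 - cnj a * \<zeta>)) \<le> cmod (log_test a \<zeta>)"
    and "0 < 1 - ln (cmod (1 - cnj a * \<zeta>))"
proof -
  have "1 - ln (cmod (1 - cnj a * \<zeta>)) = Re (log_test a \<zeta>)"
    using test_arg_bounds(4)[OF assms] by (simp add: log_test_def)
  then show "1 - ln (cmod (1 - cnj a * \<zeta>)) \<le> cmod (log_test a \<zeta>)" by (simp add: complex_Re_le_cmod)
  have "ln (cmod (1 - cnj a * \<zeta>)) < ln 2"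
    using test_arg_bounds(2,4)[OF assms] by (intro ln_less_cancel_iff[THEN iffD2]) auto
  then show "0 < 1 - ln (cmod (1 - cnj a * \<zeta>))" using ln_2_less_1 by linarith
qed

lemma log_test_ratio:
  assumes "a \<in> unit_disc" "\<zeta> \<in> unit_disc"
  shows "1 / cmod (log_test a \<zeta>) \<le> (1 + 1 / (1 - ln 2)) * cmod (1 - cnj a * \<zeta>) / ((1 - cmod a) * ln (exp 1 / (1 - cmod a)))"
proof -
  define x \<delta> where "x = cmod (1 - cnj a * \<zeta>)" and "\<delta> = 1 - cmod a"
  define \<kappa> :: real where "\<kappa> = 1 - ln 2"
  have \<delta>: "0 < \<delta>" "\<delta> \<le> x" "0 < x" "x < 2" using assms test_arg_bounds(1,2,4)[OF assms] by (auto simp: x_def \<delta>_def)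
  have \<kappa>: "0 < \<kappa>" using ln_2_less_1 by (simp add: \<kappa>_def)
  define L where "L = ln (exp 1 / \<delta>)"
  have L: "L = 1 - ln \<delta>" using \<delta> by (simp add: L_def ln_div)
  have L1: "1 \<le> L" using assms(1) log_factor_ge_1[of "cmod a"] by (simp add: L_def \<delta>_def)
  have u: "\<kappa> \<le> 1 - ln x" using \<delta> by (simp add: \<kappa>_def)
  have "ln (x / \<delta>) \<le> x / \<delta> - 1" using \<delta> by (intro ln_le_minus_one) auto
  then have "L \<le> (1 - ln x) + x / \<delta>" using \<delta> by (simp add: L ln_div)
  also have "\<dots> \<le> (1 - ln x) * (x / \<delta>) + (x / \<delta>) * ((1 - ln x) / \<kappa>)"
  proof (intro add_mono)
    have "1 \<le> x / \<delta>" using \<delta> by simp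
    then show "1 - ln x \<le> (1 - ln x) * (x / \<delta>)" using u \<kappa> mult_left_mono[of 1 "x / \<delta>" "1 - ln x"] by simp
    have "1 \<le> (1 - ln x) / \<kappa>" using u \<kappa> by simp
    then show "x / \<delta> \<le> (x / \<delta>) * ((1 - ln x) / \<kappa>)" using \<delta> mult_left_mono[of 1 "(1 - ln x) / \<kappa>" "x / \<delta>"] by simp
  qed
  also have "\<dots> = (1 + 1 / \<kappa>) * (x / \<delta>) * (1 - ln x)" by (simp add: algebra_simps add_divide_distrib diff_divide_distrib)
  also have "\<dots> \<le> (1 + 1 / \<kappa>) * (x / \<delta>) * cmod (log_test a \<zeta>)"
    using log_test_lower(1)[OF assms] \<delta> \<kappa> by (intro mult_left_mono) (auto simp: x_def)
  finally have "L \<le> (1 + 1 / \<kappa>) * (x / \<delta>) * cmod (log_test a \<zeta>)" .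
  moreover have "0 < cmod (log_test a \<zeta>)" using log_test_lower[OF assms] by linarith
  moreover have "1 / y \<le> A / L" if "L \<le> A * y" "0 < y" for A y :: real
    using that L1 by (simp add: field_simps)
  ultimately have "1 / cmod (log_test a \<zeta>) \<le> (1 + 1 / \<kappa>) * (x / \<delta>) / L" by blast
  then show ?thesis by (simp add: L_def x_def \<delta>_def \<kappa>_def divide_divide_eq_left)
qed

lemma test_functions_holomorphic:
  assumes a: "a \<in> unit_disc"
  shows "log_test a holomorphic_on unit_disc" "power_test n a holomorphic_on unit_disc"
    "(\<lambda>\<zeta>. power_test n a \<zeta> / log_test a \<zeta>) holomorphic_on unit_disc"
proof -
  show l: "log_test a holomorphic_on unit_disc"
    unfolding log_test_def[abs_def]
    by (intro holomorphic_intros) (use test_arg_bounds(3)[OF a] in \<open>auto simp: complex_nonpos_Reals_iff not_le\<close>)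
  show p: "power_test n a holomorphic_on unit_disc"
    unfolding power_test_def[abs_def]
    by (intro holomorphic_intros) (use test_arg_bounds(4)[OF a] in auto)
  have "log_test a \<zeta> \<noteq> 0" if "\<zeta> \<in> unit_disc" for \<zeta> using log_test_lower[OF a that] by auto
  then show "(\<lambda>\<zeta>. power_test n a \<zeta> / log_test a \<zeta>) holomorphic_on unit_disc"
    by (intro holomorphic_on_divide p l)
qed

text \<open>One of the \<open>n + 1\<close> powers of the denominator pays for freezing the
  logarithm.\<close>

lemma test_quotient_bound:
  assumes a: "a \<in> unit_disc" and \<zeta>: "\<zeta> \<in> unit_disc"
  shows "cmod (power_test n a \<zeta> / log_test a \<zeta>) \<le>
    (1 + 1 / (1 - ln 2)) / ((1 - cmod a) * ln (exp 1 / (1 - cmod a))) * (1 / cmod (1 - cnj a * \<zeta>) ^ n)"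
proof -
  define x where "x = cmod (1 - cnj a * \<zeta>)"
  have x: "0 < x" using test_arg_bounds(4)[OF assms] by (simp add: x_def)
  have "cmod (power_test n a \<zeta> / log_test a \<zeta>) = cmod \<zeta> ^ n / x ^ Suc n * (1 / cmod (log_test a \<zeta>))"
    by (simp add: power_test_def norm_divide norm_power norm_mult x_def)
  also have "\<dots> \<le> 1 / x ^ Suc n * ((1 + 1 / (1 - ln 2)) * x / ((1 - cmod a) * ln (exp 1 / (1 - cmod a))))"
    unfolding x_def using \<zeta> x log_test_ratio[OF assms]
    by (intro mult_mono divide_right_mono) (auto simp: power_le_one x_def)
  also have "\<dots> = (1 + 1 / (1 - ln 2)) / ((1 - cmod a) * ln (exp 1 / (1 - cmod a))) * (1 / x ^ n)"
    using x by simp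
  finally show ?thesis by (simp add: x_def)
qed

lemma test_quotient_H_infinity:
  assumes a: "a \<in> unit_disc"
  shows "(\<lambda>\<zeta>. power_test n a \<zeta> / log_test a \<zeta>) \<in> H_infinity"
proof -
  define K where "K = (1 + 1 / (1 - ln 2)) / ((1 - cmod a) * ln (exp 1 / (1 - cmod a)))"
  have L: "1 \<le> ln (exp 1 / (1 - cmod a))" using log_factor_ge_1[of "cmod a"] a by auto
  have K: "0 \<le> K"
  proof -
    have "0 \<le> (1 - cmod a) * ln (exp 1 / (1 - cmod a))"
      by (rule mult_nonneg_nonneg) (use a in simp, use L in linarith)
    moreover have "0 \<le> 1 + 1 / (1 - ln 2 :: real)" using ln_2_less_1 by simp
    ultimately show ?thesis unfolding K_def by (rule divide_nonneg_nonneg[rotated])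
  qed
  have "cmod (power_test n a \<zeta> / log_test a \<zeta>) \<le> K * (1 / (1 - cmod a) ^ n)" if \<zeta>: "\<zeta> \<in> unit_disc" for \<zeta>
  proof -
    have "1 / cmod (1 - cnj a * \<zeta>) ^ n \<le> 1 / (1 - cmod a) ^ n"
      using test_arg_bounds(1)[OF a \<zeta>] a by (intro divide_left_mono power_mono mult_pos_pos zero_less_power) auto
    then have "K * (1 / cmod (1 - cnj a * \<zeta>) ^ n) \<le> K * (1 / (1 - cmod a) ^ n)" using K by (rule mult_left_mono)
    then show ?thesis using test_quotient_bound[OF a \<zeta>, of n] unfolding K_def by linarith
  qed
  then show ?thesis
    using test_functions_holomorphic(3)[OF a] unfolding H_infinity_def bounded_iff
    by (intro CollectI conjI exI[of _ "K * (1 / (1 - cmod a) ^ n)"] ballI) auto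
qed

text \<open>The factor \<open>\<zeta> ^ n\<close> shifts the binomial series so that the
  \<open>k\<close>-th power carries \<open>k choose n\<close>, up to \<open>fact n\<close> the
  factor that an \<open>n\<close>-th derivative produces.\<close>

lemma power_test_sums:
  assumes "a \<in> unit_disc" "\<zeta> \<in> unit_disc"
  shows "(\<lambda>k. (if k < n then 0 else of_nat (k choose n) * cnj a ^ (k - n)) * \<zeta> ^ k) sums power_test n a \<zeta>"
proof -
  have "(\<lambda>j. of_nat ((j + n) choose n) * (cnj a * \<zeta>) ^ j) sums (1 / (1 - cnj a * \<zeta>) ^ Suc n)"
    by (rule binomial_series_neg) (use test_arg_bounds(5)[OF assms] in auto)
  from sums_mult[OF this, of "\<zeta> ^ n"]
  have "(\<lambda>j. of_nat ((j + n) choose n) * cnj a ^ j * \<zeta> ^ (j + n)) sums power_test n a \<zeta>"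
    by (simp add: power_test_def power_mult_distrib power_add mult_ac)
  then have "(\<lambda>j. (\<lambda>k. (if k < n then 0 else of_nat (k choose n) * cnj a ^ (k - n)) * \<zeta> ^ k) (j + n)) sums power_test n a \<zeta>"
    by simp
  then show ?thesis by (subst (asm) sums_iff_shift) simp
qed

text \<open>With the logarithm frozen, a power \<open>q = n * p\<close> of
  \<open>1 / cmod (1 - cnj a * \<zeta>)\<close> has to be integrated. On each circle two of these
  powers are kept for the square mean of \<open>1 / (1 - z)\<close> and the others are bounded by
  their maximum; one power is gained by averaging, and \<open>T_weighted_powr\<close> treats the
  radial integral.\<close>

lemma (in doubling_tail) test_quotient_norm:
  assumes p: "0 < p"
  obtains n0 where "\<And>n. n \<ge> n0 \<Longrightarrow> \<exists>C>0. \<forall>a\<in>unit_disc.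
    (\<integral>\<zeta>. cmod (power_test n a \<zeta> / log_test a \<zeta>) powr p \<partial>wmeasure) powr (1 / p) \<le>
      C * (T (cmod a) * (1 - cmod a)) powr (1 / p) / ((1 - cmod a) ^ Suc n * ln (exp 1 / (1 - cmod a)))"
proof -
  obtain c0 where c0: "\<And>c. c \<ge> c0 \<Longrightarrow> \<exists>C>0. \<forall>a\<in>{0..<1}.
     (\<integral>\<^sup>+s. ennreal (w s * (1 - a * s) powr (- c)) \<partial>\<U>) \<le> ennreal (C * T a * (1 - a) powr (- c))"
    using T_weighted_powr by blast
  \<comment> \<open>\<open>n * p \<ge> 2\<close> allows the square to be split off, and
    \<open>n * p - 1 \<ge> c0\<close> is the range of \<open>T_weighted_powr\<close>.\<close>
  obtain n0 :: nat where n0: "max (c0 + 1) 2 / p \<le> real n0" using real_arch_simple by blast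
  show ?thesis
  proof (rule that[of n0])
    fix n assume "n \<ge> n0"
    define q where "q = real n * p"
    have "max (c0 + 1) 2 \<le> q"
      using n0 \<open>n \<ge> n0\<close> p by (simp add: q_def pos_divide_le_eq) (smt (verit) mult_right_mono of_nat_mono)
    then have q: "q \<ge> 2" "q - 1 \<ge> c0" by auto
    obtain C where C: "C > 0" "\<And>a. 0 \<le> a \<Longrightarrow> a < 1 \<Longrightarrow>
     (\<integral>\<^sup>+s. ennreal (w s * (1 - a * s) powr (- (q - 1))) \<partial>\<U>) \<le> ennreal (C * T a * (1 - a) powr (- (q - 1)))"
      using c0[OF q(2)] by auto
    define K where "K = 1 + 1 / (1 - ln 2 :: real)"
    have K: "0 < K" unfolding K_def using ln_2_less_1 by (intro add_pos_pos) auto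
    show "\<exists>C>0. \<forall>a\<in>unit_disc.
      (\<integral>\<zeta>. cmod (power_test n a \<zeta> / log_test a \<zeta>) powr p \<partial>wmeasure) powr (1 / p) \<le>
      C * (T (cmod a) * (1 - cmod a)) powr (1 / p) / ((1 - cmod a) ^ Suc n * ln (exp 1 / (1 - cmod a)))"
    proof (intro exI[of _ "K * (2 * C) powr (1 / p)"] conjI ballI)
      show "0 < K * (2 * C) powr (1 / p)" using K C(1) by simp
      fix a :: complex assume a: "a \<in> unit_disc"
      define r0 \<delta> L where "r0 = cmod a" and "\<delta> = 1 - r0" and "L = ln (exp 1 / (1 - cmod a))"
      have r0: "0 \<le> r0" "r0 < 1" using a by (auto simp: r0_def)
      have \<delta>: "0 < \<delta>" using r0 by (simp add: \<delta>_def)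
      have L: "1 \<le> L" unfolding L_def using log_factor_ge_1[of "cmod a"] a by auto
      have T0: "0 < T r0" using T_pos[OF r0] .
      define M where "M = (K / (\<delta> * L)) powr p"
      have M0: "0 \<le> M" by (simp add: M_def)
      define g where "g \<zeta> = power_test n a \<zeta> / log_test a \<zeta>" for \<zeta>
      have gH: "g \<in> H_infinity" unfolding g_def[abs_def] by (rule test_quotient_H_infinity[OF a])
      have cg: "continuous_on unit_disc (\<lambda>z. cmod (g z) powr p)"
        by (intro continuous_on_norm_powr holomorphic_on_imp_continuous_on H_infinityD(1)[OF gH] p)
      obtain B where B: "B \<ge> 0" "\<And>z. z \<in> unit_disc \<Longrightarrow> cmod (g z) \<le> B" using H_infinityD(2)[OF gH] by blast
      have gi: "integrable wmeasure (\<lambda>z. cmod (g z) powr p)"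
        by (rule bounded_integrable_w[OF cg, of "B powr p"]) (use B p in \<open>auto intro!: powr_mono2\<close>)
      define X where "X = (\<integral>\<zeta>. cmod (g \<zeta>) powr p \<partial>wmeasure)"
      have X0: "0 \<le> X" unfolding X_def by (simp add: integral_nonneg_AE)
      have pw: "cmod (g \<zeta>) powr p \<le> M * ((1 - r0 * r) powr (- (q - 2)) * (cmod (1 / (1 - cnj a * \<zeta>)))\<^sup>2)"
        if \<zeta>: "cmod \<zeta> = r" and r: "r < 1" for \<zeta> r
      proof -
        have \<zeta>d: "\<zeta> \<in> unit_disc" using \<zeta> r by simp
        define x where "x = cmod (1 - cnj a * \<zeta>)"
        have x0: "0 < x" using test_arg_bounds(4)[OF a \<zeta>d] by (simp add: x_def)
        have xr: "1 - r0 * r \<le> x"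
          using norm_triangle_ineq2[of 1 "cnj a * \<zeta>"] \<zeta> by (simp add: x_def norm_mult r0_def)
        have rr: "0 < 1 - r0 * r" using test_arg_bounds(5)[OF a \<zeta>d] \<zeta> by (simp add: norm_mult r0_def)
        have "cmod (g \<zeta>) \<le> K / (\<delta> * L) * (1 / x ^ n)"
          using test_quotient_bound[OF a \<zeta>d, of n] by (simp add: g_def K_def \<delta>_def L_def r0_def x_def)
        then have "cmod (g \<zeta>) powr p \<le> (K / (\<delta> * L) * (1 / x ^ n)) powr p" using p by (intro powr_mono2) auto
        also have "\<dots> = M * (1 / x ^ n) powr p"
          unfolding M_def by (rule powr_mult)
        also have "(1 / x ^ n) powr p = x powr (- q)"
          using x0 by (simp add: q_def powr_minus powr_powr[symmetric] powr_realpow powr_divide inverse_eq_divide)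
        also have "x powr (- q) = x powr (- (q - 2)) * x powr (- 2)" by (simp add: powr_add[symmetric])
        also have "x powr (- 2) = (cmod (1 / (1 - cnj a * \<zeta>)))\<^sup>2"
          using x0 by (simp add: powr_minus powr_numeral norm_divide x_def power_divide inverse_eq_divide)
        also have "M * (x powr (- (q - 2)) * (cmod (1 / (1 - cnj a * \<zeta>)))\<^sup>2) \<le> M * ((1 - r0 * r) powr (- (q - 2)) * (cmod (1 / (1 - cnj a * \<zeta>)))\<^sup>2)"
          using M0 xr rr q by (intro mult_left_mono mult_right_mono powr_mono2') auto
        finally show ?thesis .
      qed
      have "ennreal X = (\<integral>\<^sup>+\<zeta>. ennreal (cmod (g \<zeta>) powr p) \<partial>wmeasure)"
        unfolding X_def using gi by (intro nn_integral_eq_integral[symmetric]) auto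
      also have "\<dots> = (\<integral>\<^sup>+r. ennreal (2 * r) * ennreal (w r) * ennreal (circ_mean (\<lambda>z. cmod (g z) powr p) r) \<partial>\<U>)"
        by (rule nn_integral_radial_mean[OF cg]) simp
      also have "\<dots> \<le> (\<integral>\<^sup>+r. ennreal (2 * M) * ennreal (w r * (1 - r0 * r) powr (- (q - 1))) \<partial>\<U>)"
      proof (rule nn_integral_mono)
        fix r assume "r \<in> space \<U>"
        then have r: "0 \<le> r" "r < 1" by auto
        have ar: "0 \<le> r0 * r" "r0 * r < 1" using r r0 mult_left_le[of r r0] by auto
        have cd: "continuous_on unit_disc (\<lambda>z::complex. (cmod (1 / (1 - z)))\<^sup>2)"
          by (intro continuous_intros) auto
        have az: "of_real r * cnj a \<in> unit_disc" using ar r by (simp add: norm_mult r0_def mult.commute)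
        note sh = circ_mean_shift[OF cd _ az]
        have e1: "cnj a * (of_real r * circ t) = of_real r * cnj a * circ t" for t by simp
        have "circ_mean (\<lambda>z. cmod (g z) powr p) r \<le> (\<integral>t. M * ((1 - r0 * r) powr (- (q - 2)) * (cmod (1 / (1 - of_real r * cnj a * circ t)))\<^sup>2) \<partial>\<U>)"
          unfolding circ_mean_def
        proof (rule integral_mono)
          show "integrable \<U> (\<lambda>t. cmod (g (of_real r * circ t)) powr p)" by (rule circle_integrable[OF cg r])
          show "integrable \<U> (\<lambda>t. M * ((1 - r0 * r) powr (- (q - 2)) * (cmod (1 / (1 - of_real r * cnj a * circ t)))\<^sup>2))"
            using sh(2) by (intro integrable_mult_right) auto
          fix t
          show "cmod (g (of_real r * circ t)) powr p \<le> M * ((1 - r0 * r) powr (- (q - 2)) * (cmod (1 / (1 - of_real r * cnj a * circ t)))\<^sup>2)"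
            using pw[of "of_real r * circ t" r] r unfolding e1 by (simp add: norm_mult)
        qed
        also have "\<dots> = M * ((1 - r0 * r) powr (- (q - 2)) * circ_mean (\<lambda>z. (cmod (1 / (1 - z)))\<^sup>2) (r0 * r))"
          using sh(1) r by (simp only: integral_mult_right_zero) (simp add: norm_mult r0_def mult.commute)
        also have "\<dots> \<le> M * ((1 - r0 * r) powr (- (q - 2)) * (1 / (1 - r0 * r)))"
          by (intro mult_left_mono circ_mean_geometric ar M0) auto
        also have "(1 - r0 * r) powr (- (q - 2)) * (1 / (1 - r0 * r)) = (1 - r0 * r) powr (- (q - 1))"
        proof -
          have "1 / (1 - r0 * r) = (1 - r0 * r) powr (- 1)" using ar by (simp add: powr_minus inverse_eq_divide)
          moreover have "(1 - r0 * r) powr (- (q - 1)) = (1 - r0 * r) powr (- (q - 2)) * (1 - r0 * r) powr (- 1)"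
            by (subst powr_add[symmetric]) (simp add: algebra_simps)
          ultimately show ?thesis by (simp only:)
        qed
        finally have m: "circ_mean (\<lambda>z. cmod (g z) powr p) r \<le> M * (1 - r0 * r) powr (- (q - 1))" .
        have "2 * r * w r * circ_mean (\<lambda>z. cmod (g z) powr p) r \<le> 2 * 1 * w r * (M * (1 - r0 * r) powr (- (q - 1)))"
          using m r w_nonneg[of r] circ_mean_nonneg[of "\<lambda>z. cmod (g z) powr p" r] by (intro mult_mono) auto
        then have "ennreal (2 * r * w r * circ_mean (\<lambda>z. cmod (g z) powr p) r) \<le> ennreal (2 * M * (w r * (1 - r0 * r) powr (- (q - 1))))"
          by (intro ennreal_leI) (simp add: mult_ac)
        moreover have "ennreal (2 * r) * ennreal (w r) * ennreal (circ_mean (\<lambda>z. cmod (g z) powr p) r) = ennreal (2 * r * w r * circ_mean (\<lambda>z. cmod (g z) powr p) r)"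
          using r w_nonneg[of r] circ_mean_nonneg[of "\<lambda>z. cmod (g z) powr p" r] by (intro ennreal_mult3) auto
        moreover have "ennreal (2 * M * (w r * (1 - r0 * r) powr (- (q - 1)))) = ennreal (2 * M) * ennreal (w r * (1 - r0 * r) powr (- (q - 1)))"
          using M0 w_nonneg[of r] by (intro ennreal_mult) auto
        ultimately show "ennreal (2 * r) * ennreal (w r) * ennreal (circ_mean (\<lambda>z. cmod (g z) powr p) r) \<le> ennreal (2 * M) * ennreal (w r * (1 - r0 * r) powr (- (q - 1)))"
          by simp
      qed
      also have "\<dots> = ennreal (2 * M) * (\<integral>\<^sup>+r. ennreal (w r * (1 - r0 * r) powr (- (q - 1))) \<partial>\<U>)"
        using w_meas by (intro nn_integral_cmult borel_measurable_U) measurable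
      also have "\<dots> \<le> ennreal (2 * M) * ennreal (C * T r0 * (1 - r0) powr (- (q - 1)))"
        by (intro mult_left_mono C(2) r0) auto
      also have "\<dots> = ennreal (2 * M * (C * T r0 * \<delta> powr (- (q - 1))))"
        using M0 C(1) T0 by (subst ennreal_mult) (auto simp: \<delta>_def)
      finally have "X \<le> 2 * M * (C * T r0 * \<delta> powr (- (q - 1)))"
        using M0 C(1) T0 by (subst (asm) ennreal_le_iff) auto
      also have "\<dots> = (2 * C) * (T r0 * \<delta>) * (\<delta> powr (- q) * M)"
      proof -
        have "\<delta> powr (- (q - 1)) = \<delta> powr (- q) * \<delta>" using \<delta> powr_add[of \<delta> "- q" 1] by simp
        then show ?thesis by simp
      qed
      finally have "X powr (1 / p) \<le> ((2 * C) * (T r0 * \<delta>) * (\<delta> powr (- q) * M)) powr (1 / p)"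
        using X0 p by (intro powr_mono2) auto
      also have "\<dots> = (2 * C) powr (1 / p) * (T r0 * \<delta>) powr (1 / p) * (\<delta> powr (- q) * M) powr (1 / p)"
        using C(1) T0 \<delta> M0 by (simp add: powr_mult)
      also have "(\<delta> powr (- q) * M) powr (1 / p) = K / (\<delta> ^ Suc n * L)"
      proof -
        have "(\<delta> powr (- q) * M) powr (1 / p) = \<delta> powr (- q * (1 / p)) * (K / (\<delta> * L)) powr (p * (1 / p))"
          using M0 by (simp add: powr_mult M_def powr_powr)
        also have "\<delta> powr (- q * (1 / p)) = 1 / \<delta> ^ n" using p \<delta> by (simp add: q_def powr_minus powr_realpow inverse_eq_divide)
        also have "(K / (\<delta> * L)) powr (p * (1 / p)) = K / (\<delta> * L)" using p K \<delta> L by simp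
        finally show ?thesis using \<delta> L by simp
      qed
      finally show "(\<integral>\<zeta>. cmod (power_test n a \<zeta> / log_test a \<zeta>) powr p \<partial>wmeasure) powr (1 / p) \<le>
        K * (2 * C) powr (1 / p) * (T (cmod a) * (1 - cmod a)) powr (1 / p) / ((1 - cmod a) ^ Suc n * ln (exp 1 / (1 - cmod a)))"
        by (simp add: X_def g_def L_def \<delta>_def r0_def mult_ac)
    qed
  qed
qed

subsection \<open>From the symbol to the operator\<close>

locale hankel_setting = O: doubling_tail wo To + N: doubling_tail wn Tn
  for wo To wn Tn :: "real \<Rightarrow> real" +
  fixes p :: real
  assumes p: "0 < p" "p \<le> 1"
begin

definition symbol_weight :: "nat \<Rightarrow> real \<Rightarrow> real" where
  "symbol_weight n r = (1 - r) ^ n * (Tn r * (1 - r) / (To r * (1 - r)) powr (1 / p)) * ln (exp 1 / (1 - r))"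

definition bergman_norm :: "(complex \<Rightarrow> complex) \<Rightarrow> real" where
  "bergman_norm g = (\<integral>\<zeta>. cmod (g \<zeta>) powr p \<partial>O.wmeasure) powr (1 / p)"

text \<open>Stated with the non-negative integral, so that finiteness already carries the
  integrability of the image.\<close>

abbreviation hankel_estimate :: "(complex \<Rightarrow> complex) \<Rightarrow> real \<Rightarrow> bool" where
  "hankel_estimate f A \<equiv> \<forall>g\<in>H_infinity.
     (\<integral>\<^sup>+z. ennreal (cmod (N.hank f g z)) \<partial>N.wmeasure) \<le> ennreal (A * bergman_norm g)"

lemma bergman_norm_nonneg: "0 \<le> bergman_norm g"
  by (simp add: bergman_norm_def)

lemma symbol_weight_pos:
  assumes "0 \<le> r" "r < 1"
  shows "0 < symbol_weight n r"
proof -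
  have "0 < ln (exp 1 / (1 - r))" using log_factor_ge_1[OF assms] by linarith
  moreover have "0 < To r" "0 < Tn r" using O.T_pos N.T_pos assms by auto
  moreover have "0 < 1 - r" using assms by simp
  ultimately show ?thesis unfolding symbol_weight_def
    by (intro mult_pos_pos divide_pos_pos zero_less_power) (auto simp: powr_gt_zero)
qed

text \<open>Put \<open>x = (1 - s) / (1 - r)\<close>. By \<open>T_growth\<close> the power
  \<open>1 / p\<close> in the denominator changes at most by a constant times
  \<open>x powr ((b + 1) / p)\<close>, for which \<open>(1 - r) ^ n\<close> pays once
  \<open>n \<ge> (b + 1) / p\<close>. The further factor \<open>1 - r\<close> pays for the
  logarithm, which changes by at most \<open>x\<close>.\<close>

lemma symbol_weight_almost_decreasing:
  obtains n1 where "\<And>n. n \<ge> n1 \<Longrightarrow> \<exists>C>0. \<forall>r\<in>{0..<1}. \<forall>s\<in>{0..r}. symbol_weight n r \<le> C * symbol_weight n s"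
proof -
  obtain C b where C: "C \<ge> 1" "\<And>s t. 0 \<le> s \<Longrightarrow> s \<le> t \<Longrightarrow> t < 1 \<Longrightarrow> To s \<le> C * ((1 - s) / (1 - t)) ^ b * To t"
    using O.T_growth by blast
  obtain n1 :: nat where n1: "(real b + 1) / p \<le> real n1" using real_arch_simple by blast
  show ?thesis
  proof (rule that[of n1])
    fix n assume n: "n \<ge> n1"
    show "\<exists>C>0. \<forall>r\<in>{0..<1}. \<forall>s\<in>{0..r}. symbol_weight n r \<le> C * symbol_weight n s"
    proof (intro exI[of _ "C powr (1 / p)"] conjI ballI)
      show "0 < C powr (1 / p)" using C(1) by simp
      fix r s :: real assume "r \<in> {0..<1}" "s \<in> {0..r}"
      then have r: "0 \<le> s" "s \<le> r" "r < 1" "0 \<le> r" "s < 1" by auto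
      define x where "x = (1 - s) / (1 - r)"
      have x: "1 \<le> x" "(1 - r) * x = 1 - s" using r by (auto simp: x_def)
      define Ds Dr where "Ds = (To s * (1 - s)) powr (1 / p)" and "Dr = (To r * (1 - r)) powr (1 / p)"
      have T: "0 < To s" "0 < To r" "0 < Tn s" "0 < Tn r" using O.T_pos N.T_pos r by auto
      have D: "0 < Ds" "0 < Dr" using T r by (auto simp: Ds_def Dr_def)
      have "To s * (1 - s) \<le> C * x ^ b * To r * (1 - s)"
        using C(2)[OF r(1-3)] r by (intro mult_right_mono) (auto simp: x_def)
      also have "\<dots> = C * x ^ Suc b * (To r * (1 - r))" using x(2)[symmetric] by (simp add: mult_ac)
      finally have "Ds \<le> (C * x ^ Suc b * (To r * (1 - r))) powr (1 / p)"
        unfolding Ds_def using p T r by (intro powr_mono2) auto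
      also have "\<dots> = C powr (1 / p) * (x ^ Suc b) powr (1 / p) * Dr" by (simp only: powr_mult Dr_def)
      also have "(x ^ Suc b) powr (1 / p) = x powr ((real b + 1) / p)"
        using x(1) by (simp add: powr_realpow[symmetric] powr_powr add.commute del: power_Suc)
      also have "x powr ((real b + 1) / p) \<le> x powr (real n)" using x(1) n1 n by (intro powr_mono) auto
      also have "x powr (real n) = x ^ n" using x(1) by (simp add: powr_realpow)
      finally have Dle: "Ds \<le> C powr (1 / p) * x ^ n * Dr" using C(1) D by (simp add: mult_left_mono mult_right_mono)
      have "ln x \<le> x - 1" using x(1) by (intro ln_le_minus_one) auto
      moreover have "ln x = ln (1 - s) - ln (1 - r)" using r by (simp add: x_def ln_div)
      ultimately have "ln (exp 1 / (1 - r)) \<le> ln (exp 1 / (1 - s)) + (x - 1) * 1"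
        using r by (simp add: log_factor)
      also have "\<dots> \<le> ln (exp 1 / (1 - s)) + (x - 1) * ln (exp 1 / (1 - s))"
        using log_factor_ge_1[of s] r x(1) by (intro add_left_mono mult_left_mono) auto
      finally have L: "ln (exp 1 / (1 - r)) \<le> x * ln (exp 1 / (1 - s))" by (simp add: algebra_simps)
      have L0: "0 \<le> ln (exp 1 / (1 - s))" "0 \<le> ln (exp 1 / (1 - r))"
        using log_factor_ge_1[of s] log_factor_ge_1[of r] r by linarith+
      have "symbol_weight n r = (1 - r) ^ Suc n * Tn r * ln (exp 1 / (1 - r)) * (1 / Dr)"
        by (simp add: symbol_weight_def Dr_def)
      also have "\<dots> \<le> (1 - r) ^ Suc n * Tn s * (x * ln (exp 1 / (1 - s))) * (C powr (1 / p) * x ^ n / Ds)"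
      proof (intro mult_mono order_refl L)
        show "1 / Dr \<le> C powr (1 / p) * x ^ n / Ds" using Dle D by (simp add: field_simps)
      qed (use r N.T_antimono T D L0 x in auto)
      also have "\<dots> = C powr (1 / p) * (((1 - r) * x) ^ Suc n * Tn s * ln (exp 1 / (1 - s)) * (1 / Ds))"
        by (simp only: power_mult_distrib power_Suc) (simp add: mult_ac)
      also have "\<dots> = C powr (1 / p) * symbol_weight n s"
        by (simp add: x(2) symbol_weight_def Ds_def)
      finally show "symbol_weight n r \<le> C powr (1 / p) * symbol_weight n s" .
    qed
  qed
qed

text \<open>Descending induction on the order, with \<open>i\<close> its distance from
  \<open>n\<close>. Because the weight is almost decreasing, the next derivative is bounded on the
  whole disc of radius \<open>cmod z\<close> by its bound at that radius, and the mean value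
  inequality leads back to the origin. The same weight is kept for all orders; nothing is gained
  from step to step, and nothing more is needed.\<close>

lemma lower_derivatives:
  assumes C: "C > 0" "\<And>r s. 0 \<le> s \<Longrightarrow> s \<le> r \<Longrightarrow> r < 1 \<Longrightarrow> symbol_weight n r \<le> C * symbol_weight n s"
  shows "\<exists>K>0. \<forall>f S. f holomorphic_on unit_disc \<longrightarrow>
    (\<forall>z\<in>unit_disc. cmod ((deriv ^^ n) f z) * symbol_weight n (cmod z) \<le> S) \<longrightarrow>
    (\<forall>j z. j + i = n \<longrightarrow> z \<in> unit_disc \<longrightarrow>
       cmod ((deriv ^^ j) f z) * symbol_weight n (cmod z) \<le> K * (S + (\<Sum>j<n. cmod ((deriv ^^ j) f 0))))"
proof (induction i)
  case 0
  show ?case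
  proof (intro exI[of _ 1] conjI allI impI)
    fix f S j and z :: complex
    assume "\<forall>z\<in>unit_disc. cmod ((deriv ^^ n) f z) * symbol_weight n (cmod z) \<le> S" "j + 0 = n" "z \<in> unit_disc"
    moreover have "0 \<le> (\<Sum>j<n. cmod ((deriv ^^ j) f 0))" by (intro sum_nonneg) simp
    ultimately show "cmod ((deriv ^^ j) f z) * symbol_weight n (cmod z) \<le> 1 * (S + (\<Sum>j<n. cmod ((deriv ^^ j) f 0)))"
      by (auto intro: add_increasing2)
  qed simp
next
  case (Suc i)
  then obtain K where K: "K > 0" "\<And>f S j z. f holomorphic_on unit_disc \<Longrightarrow>
    (\<And>z. z \<in> unit_disc \<Longrightarrow> cmod ((deriv ^^ n) f z) * symbol_weight n (cmod z) \<le> S) \<Longrightarrow> j + i = n \<Longrightarrow> z \<in> unit_disc \<Longrightarrow>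
       cmod ((deriv ^^ j) f z) * symbol_weight n (cmod z) \<le> K * (S + (\<Sum>j<n. cmod ((deriv ^^ j) f 0)))"
    by blast
  have w0: "0 < symbol_weight n 0" by (rule symbol_weight_pos) auto
  show ?case
  proof (intro exI[of _ "C * K + C * symbol_weight n 0"] conjI allI impI)
    \<comment> \<open>The first summand comes from integrating the next derivative, the second from
      the value at the origin, which is weighted with
      \<open>symbol_weight n (cmod z) \<le> C * symbol_weight n 0\<close>.\<close>
    show "0 < C * K + C * symbol_weight n 0" using C(1) K(1) w0 by (intro add_pos_pos mult_pos_pos)
    fix f S j and z :: complex
    assume f: "f holomorphic_on unit_disc"
      and S: "\<forall>z\<in>unit_disc. cmod ((deriv ^^ n) f z) * symbol_weight n (cmod z) \<le> S"
      and j: "j + Suc i = n" and z: "z \<in> unit_disc"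
    define Z where "Z = S + (\<Sum>j<n. cmod ((deriv ^^ j) f 0))"
    have S0: "0 \<le> S"
    proof -
      have "0 \<le> cmod ((deriv ^^ n) f 0) * symbol_weight n (cmod 0)" using w0 by (simp add: zero_le_mult_iff)
      also have "\<dots> \<le> S" by (rule bspec[OF S]) simp
      finally show ?thesis .
    qed
    have fj: "cmod ((deriv ^^ j) f 0) \<le> (\<Sum>j<n. cmod ((deriv ^^ j) f 0))"
      using j by (intro member_le_sum) auto
    have Z: "0 \<le> Z" "cmod ((deriv ^^ j) f 0) \<le> Z"
      using fj S0 order_trans[OF norm_ge_zero fj] by (simp_all add: Z_def)
    have z1: "cmod z < 1" "0 \<le> cmod z" using z by auto
    define W where "W = symbol_weight n (cmod z)"
    have W: "0 < W" unfolding W_def by (rule symbol_weight_pos) (use z1 in auto)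
    have d: "((deriv ^^ j) f has_field_derivative (deriv ^^ Suc j) f u) (at u within cball 0 (cmod z))"
      if "u \<in> cball 0 (cmod z)" for u
      using holomorphic_derivI[OF holomorphic_higher_deriv[OF f open_ball] open_ball, of u j] that z1
      by (auto intro: has_field_derivative_at_within)
    have "cmod ((deriv ^^ Suc j) f u) \<le> K * Z * C / W" if u: "u \<in> cball 0 (cmod z)" for u
    proof -
      have u1: "u \<in> unit_disc" "cmod u \<le> cmod z" using u z1 by auto
      have "W \<le> C * symbol_weight n (cmod u)" unfolding W_def using C(2)[of "cmod u" "cmod z"] u1 z1 by auto
      then have "cmod ((deriv ^^ Suc j) f u) * W \<le> cmod ((deriv ^^ Suc j) f u) * (C * symbol_weight n (cmod u))"
        by (rule mult_left_mono) simp
      also have "\<dots> = C * (cmod ((deriv ^^ Suc j) f u) * symbol_weight n (cmod u))" by (simp only: mult_ac)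
      also have "\<dots> \<le> C * (K * Z)"
        unfolding Z_def using C(1) j S f u1 by (intro mult_left_mono K(2)) auto
      finally show ?thesis using W by (simp add: field_simps)
    qed
    from field_differentiable_bound[OF convex_cball d this, of z 0]
    have "cmod ((deriv ^^ j) f z - (deriv ^^ j) f 0) \<le> K * Z * C / W * cmod z" by simp
    also have "\<dots> \<le> K * Z * C / W * 1" using K(1) Z(1) C(1) W z1 by (intro mult_left_mono) auto
    finally have "cmod ((deriv ^^ j) f z) \<le> K * Z * C / W + Z"
      using norm_triangle_ineq2[of "(deriv ^^ j) f z" "(deriv ^^ j) f 0"] Z(2) by linarith
    then have "cmod ((deriv ^^ j) f z) * W \<le> (K * Z * C / W + Z) * W" using W by (intro mult_right_mono) auto
    also have "\<dots> = K * Z * C + Z * W" using W by (simp add: field_simps)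
    also have "\<dots> \<le> K * Z * C + Z * (C * symbol_weight n 0)"
      unfolding W_def using C(2)[of 0 "cmod z"] z1 Z(1) by (intro add_left_mono mult_left_mono) auto
    also have "\<dots> = (C * K + C * symbol_weight n 0) * Z" by (simp add: algebra_simps)
    finally show "cmod ((deriv ^^ j) f z) * symbol_weight n (cmod z) \<le> (C * K + C * symbol_weight n 0) * (S + (\<Sum>j<n. cmod ((deriv ^^ j) f 0)))"
      unfolding W_def Z_def .
  qed
qed

lemma euler_op_growth:
  assumes C: "C > 0" "\<And>r s. 0 \<le> s \<Longrightarrow> s \<le> r \<Longrightarrow> r < 1 \<Longrightarrow> symbol_weight n r \<le> C * symbol_weight n s"
  obtains K where "K > 0" "\<And>f S z. f holomorphic_on unit_disc \<Longrightarrow>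
    (\<And>z. z \<in> unit_disc \<Longrightarrow> cmod ((deriv ^^ n) f z) * symbol_weight n (cmod z) \<le> S) \<Longrightarrow> z \<in> unit_disc \<Longrightarrow>
    cmod ((euler_op ^^ n) f z) * symbol_weight n (cmod z) \<le> K * (S + (\<Sum>j<n. cmod ((deriv ^^ j) f 0)))"
proof -
  have "\<forall>i. \<exists>K>0. \<forall>f S. f holomorphic_on unit_disc \<longrightarrow>
    (\<forall>z\<in>unit_disc. cmod ((deriv ^^ n) f z) * symbol_weight n (cmod z) \<le> S) \<longrightarrow>
    (\<forall>j z. j + i = n \<longrightarrow> z \<in> unit_disc \<longrightarrow>
       cmod ((deriv ^^ j) f z) * symbol_weight n (cmod z) \<le> K * (S + (\<Sum>j<n. cmod ((deriv ^^ j) f 0))))"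
    by (rule allI, rule lower_derivatives[OF C])
  then obtain K where K: "\<And>i. K i > 0" "\<And>i f S j z. f holomorphic_on unit_disc \<Longrightarrow>
    (\<And>z. z \<in> unit_disc \<Longrightarrow> cmod ((deriv ^^ n) f z) * symbol_weight n (cmod z) \<le> S) \<Longrightarrow> j + i = n \<Longrightarrow> z \<in> unit_disc \<Longrightarrow>
       cmod ((deriv ^^ j) f z) * symbol_weight n (cmod z) \<le> K i * (S + (\<Sum>j<n. cmod ((deriv ^^ j) f 0)))"
    by metis
  obtain E where E: "E > 0" "\<And>f z. f holomorphic_on unit_disc \<Longrightarrow> z \<in> unit_disc \<Longrightarrow>
     cmod ((euler_op ^^ n) f z) \<le> E * (\<Sum>j\<le>n. cmod ((deriv ^^ j) f z))"
    using euler_op_pow_bound[of n] by blast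
  show ?thesis
  proof (rule that[of "E * (\<Sum>j\<le>n. K (n - j))"])
    show "0 < E * (\<Sum>j\<le>n. K (n - j))" using E(1) K(1) by (intro mult_pos_pos sum_pos) auto
    fix f S and z :: complex
    assume f: "f holomorphic_on unit_disc"
      and S: "\<And>z. z \<in> unit_disc \<Longrightarrow> cmod ((deriv ^^ n) f z) * symbol_weight n (cmod z) \<le> S" and z: "z \<in> unit_disc"
    define Z where "Z = S + (\<Sum>j<n. cmod ((deriv ^^ j) f 0))"
    define W where "W = symbol_weight n (cmod z)"
    have W: "0 < W" unfolding W_def by (rule symbol_weight_pos) (use z in auto)
    have "cmod ((euler_op ^^ n) f z) * W \<le> E * (\<Sum>j\<le>n. cmod ((deriv ^^ j) f z)) * W"
      using E(2)[OF f z] W by (intro mult_right_mono) auto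
    also have "\<dots> = E * (\<Sum>j\<le>n. cmod ((deriv ^^ j) f z) * W)" by (simp add: sum_distrib_right mult.assoc)
    also have "\<dots> \<le> E * (\<Sum>j\<le>n. K (n - j) * Z)"
      unfolding Z_def W_def using E(1) by (intro mult_left_mono sum_mono K(2) f S z) auto
    also have "\<dots> = E * (\<Sum>j\<le>n. K (n - j)) * Z" by (simp add: sum_distrib_right mult.assoc)
    finally show "cmod ((euler_op ^^ n) f z) * symbol_weight n (cmod z) \<le> E * (\<Sum>j\<le>n. K (n - j)) * (S + (\<Sum>j<n. cmod ((deriv ^^ j) f 0)))"
      unfolding W_def Z_def .
  qed
qed

lemma bounded_p_integrable:
  assumes g: "g \<in> H_infinity"
  shows "integrable O.wmeasure (\<lambda>z. cmod (g z) powr p)"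
proof -
  obtain B where B: "B \<ge> 0" "\<And>z. z \<in> unit_disc \<Longrightarrow> cmod (g z) \<le> B" using H_infinityD(2)[OF g] by blast
  show ?thesis
    by (rule O.bounded_integrable_w[of _ "B powr p"])
      (use B p H_infinityD(1)[OF g] in \<open>auto intro!: powr_mono2 continuous_on_norm_powr holomorphic_on_imp_continuous_on\<close>)
qed

text \<open>At each radius everything cancels: the bound on \<open>F\<close> divides by the tail of
  the second weight, by the logarithm and by \<open>(1 - r) ^ (m + 2)\<close>, while the measure
  contributes the tail and \<open>(1 - r) ^ m\<close>. What remains is the density of
  \<open>bergman_embedding\<close>.\<close>

lemma weighted_symbol_integral:
  fixes F :: "complex \<Rightarrow> complex"
  obtains C where "C > 0" "\<And>F g X. F holomorphic_on unit_disc \<Longrightarrow> 0 \<le> X \<Longrightarrow>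
    (\<And>z. z \<in> unit_disc \<Longrightarrow> cmod (F z) * symbol_weight (Suc m) (cmod z) \<le> X) \<Longrightarrow> g \<in> H_infinity \<Longrightarrow>
    (\<integral>\<^sup>+\<zeta>. ennreal (cmod (F \<zeta>) * cmod (g \<zeta>) * ln (exp 1 / (1 - cmod \<zeta>))) \<partial>disc_measure ((tail_profile ^^ Suc m) (\<lambda>s. ennreal (wn s))))
      \<le> ennreal (C * X * bergman_norm g)"
proof -
  obtain C where C: "C > 0" "\<And>g. g holomorphic_on unit_disc \<Longrightarrow> integrable O.wmeasure (\<lambda>\<zeta>. cmod (g \<zeta>) powr p) \<Longrightarrow>
    (\<integral>\<^sup>+r. ennreal ((To r * (1 - r)) powr (1 / p) / (1 - r)\<^sup>2) * (\<integral>\<^sup>+t. ennreal (cmod (g (of_real r * circ t))) \<partial>\<U>) \<partial>\<U>)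
      \<le> ennreal (C * (\<integral>\<zeta>. cmod (g \<zeta>) powr p \<partial>O.wmeasure) powr (1 / p))"
    using O.bergman_embedding[OF p] by blast
  show ?thesis
  proof (rule that[of "2 * 2 ^ Suc m * C"])
    show "0 < 2 * 2 ^ Suc m * C" using C(1) by simp
    fix F g :: "complex \<Rightarrow> complex" and X :: real
    assume F: "F holomorphic_on unit_disc" and X0: "0 \<le> X"
      and X: "\<And>z. z \<in> unit_disc \<Longrightarrow> cmod (F z) * symbol_weight (Suc m) (cmod z) \<le> X" and g: "g \<in> H_infinity"
    define tp where "tp = (tail_profile ^^ Suc m) (\<lambda>s. ennreal (wn s))"
    have tpf: "finite_profile tp" unfolding tp_def by (rule tail_profile_pow(1)[OF N.finite_profile_w])
    then have tpm: "tp \<in> borel_measurable borel" by (simp add: finite_profile_def)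
    have gm: "g \<in> borel_measurable \<D>" by (rule holomorphic_measurable_D[OF H_infinityD(1)[OF g]])
    have Fm: "F \<in> borel_measurable \<D>" by (rule holomorphic_measurable_D[OF F])
    have lm: "(\<lambda>\<zeta>::complex. ln (exp 1 / (1 - cmod \<zeta>))) \<in> borel_measurable \<D>"
      by (rule measurable_restrict_space1) measurable
    define P where "P r = ennreal ((To r * (1 - r)) powr (1 / p) / (1 - r)\<^sup>2)" for r
    define I where "I r = (\<integral>\<^sup>+t. ennreal (cmod (g (of_real r * circ t))) \<partial>\<U>)" for r
    have "(\<integral>\<^sup>+\<zeta>. ennreal (cmod (F \<zeta>) * cmod (g \<zeta>) * ln (exp 1 / (1 - cmod \<zeta>))) \<partial>disc_measure tp) =
      (\<integral>\<^sup>+r. ennreal (2 * r) * tp r * (\<integral>\<^sup>+t. ennreal (cmod (F (of_real r * circ t)) * cmod (g (of_real r * circ t)) * ln (exp 1 / (1 - cmod (of_real r * circ t)))) \<partial>\<U>) \<partial>\<U>)"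
      by (rule nn_integral_disc_measure) (use gm Fm lm tpm in measurable)
    also have "\<dots> \<le> (\<integral>\<^sup>+r. ennreal (2 * 2 ^ Suc m * X) * (P r * I r) \<partial>\<U>)"
    proof (rule nn_integral_mono)
      fix r assume "r \<in> space \<U>"
      then have r: "0 \<le> r" "r < 1" by auto
      show "ennreal (2 * r) * tp r * (\<integral>\<^sup>+t. ennreal (cmod (F (of_real r * circ t)) * cmod (g (of_real r * circ t)) * ln (exp 1 / (1 - cmod (of_real r * circ t)))) \<partial>\<U>)
         \<le> ennreal (2 * 2 ^ Suc m * X) * (P r * I r)"
      proof (cases "r = 0")
        case True
        then show ?thesis by simp
      next
        case False
        define L W where "L = ln (exp 1 / (1 - r))" and "W = symbol_weight (Suc m) r"
        have L: "1 \<le> L" unfolding L_def by (rule log_factor_ge_1[OF r])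
        have W: "0 < W" unfolding W_def by (rule symbol_weight_pos[OF r])
        have T: "0 < To r" "0 < Tn r" using O.T_pos N.T_pos r by auto
        have "(\<integral>\<^sup>+t. ennreal (cmod (F (of_real r * circ t)) * cmod (g (of_real r * circ t)) * ln (exp 1 / (1 - cmod (of_real r * circ t)))) \<partial>\<U>)
          \<le> (\<integral>\<^sup>+t. ennreal (X / W * L) * ennreal (cmod (g (of_real r * circ t))) \<partial>\<U>)"
        proof (rule nn_integral_mono)
          fix t
          have n: "cmod (of_real r * circ t) = r" using r by (simp add: norm_mult)
          have "cmod (F (of_real r * circ t)) * W \<le> X" using X[of "of_real r * circ t"] n r by (simp add: W_def)
          then have "cmod (F (of_real r * circ t)) \<le> X / W" using W by (simp add: field_simps)
          then have "cmod (F (of_real r * circ t)) * cmod (g (of_real r * circ t)) * L \<le> X / W * cmod (g (of_real r * circ t)) * L"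
            using L by (intro mult_right_mono) auto
          then have "ennreal (cmod (F (of_real r * circ t)) * cmod (g (of_real r * circ t)) * L) \<le> ennreal (X / W * L * cmod (g (of_real r * circ t)))"
            by (intro ennreal_leI) (simp add: mult_ac)
          also have "\<dots> = ennreal (X / W * L) * ennreal (cmod (g (of_real r * circ t)))"
            using X0 W L by (intro ennreal_mult) auto
          finally show "ennreal (cmod (F (of_real r * circ t)) * cmod (g (of_real r * circ t)) * ln (exp 1 / (1 - cmod (of_real r * circ t))))
            \<le> ennreal (X / W * L) * ennreal (cmod (g (of_real r * circ t)))" unfolding n L_def .
        qed
        also have "\<dots> = ennreal (X / W * L) * I r"
          unfolding I_def by (intro nn_integral_cmult measurable_compose[OF circle_measurable[OF gm r]]) measurable
        finally have i: "(\<integral>\<^sup>+t. ennreal (cmod (F (of_real r * circ t)) * cmod (g (of_real r * circ t)) * ln (exp 1 / (1 - cmod (of_real r * circ t)))) \<partial>\<U>)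
          \<le> ennreal (X / W * L) * I r" .
        have j: "tp r \<le> ennreal (2 ^ Suc m * (1 - r) ^ m * Tn r / r)"
          unfolding tp_def by (rule N.tail_profile_pow_bound) (use False r in auto)
        have "ennreal (2 * r) * tp r * (\<integral>\<^sup>+t. ennreal (cmod (F (of_real r * circ t)) * cmod (g (of_real r * circ t)) * ln (exp 1 / (1 - cmod (of_real r * circ t)))) \<partial>\<U>)
          \<le> ennreal (2 * r) * ennreal (2 ^ Suc m * (1 - r) ^ m * Tn r / r) * (ennreal (X / W * L) * I r)"
          by (intro mult_mono order_refl i j) auto
        also have "\<dots> = ennreal (2 * r) * ennreal (2 ^ Suc m * (1 - r) ^ m * Tn r / r) * ennreal (X / W * L) * I r"
          by (simp only: mult.assoc)
        also have "ennreal (2 * r) * ennreal (2 ^ Suc m * (1 - r) ^ m * Tn r / r) * ennreal (X / W * L) =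
          ennreal (2 * r * (2 ^ Suc m * (1 - r) ^ m * Tn r / r) * (X / W * L))"
          using r T X0 W L by (intro ennreal_mult3) auto
        also have "2 * r * (2 ^ Suc m * (1 - r) ^ m * Tn r / r) * (X / W * L) =
          2 * 2 ^ Suc m * X * ((To r * (1 - r)) powr (1 / p) / (1 - r)\<^sup>2)"
        proof -
          have "W = (1 - r) ^ m * (1 - r)\<^sup>2 * Tn r * L / (To r * (1 - r)) powr (1 / p)"
            unfolding W_def symbol_weight_def L_def[symmetric] by (simp add: power2_eq_square)
          moreover have "2 * r * (c * a * T / r) * (X / (a * b * T * L / q) * L) = 2 * c * X * (q / b)"
            if "a \<noteq> 0" "b \<noteq> 0" "q \<noteq> 0" "T \<noteq> 0" for a b c q T :: real
            using that L False by (simp add: field_simps)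
          moreover have "(1 - r) ^ m \<noteq> 0" "(1 - r)\<^sup>2 \<noteq> 0" "(To r * (1 - r)) powr (1 / p) \<noteq> 0" "Tn r \<noteq> 0"
            using r T by auto
          ultimately show ?thesis by (simp only:)
        qed
        also have "ennreal (2 * 2 ^ Suc m * X * ((To r * (1 - r)) powr (1 / p) / (1 - r)\<^sup>2)) = ennreal (2 * 2 ^ Suc m * X) * P r"
          unfolding P_def using X0 by (intro ennreal_mult) auto
        finally show ?thesis by (simp only: mult.assoc)
      qed
    qed
    also have "\<dots> = ennreal (2 * 2 ^ Suc m * X) * (\<integral>\<^sup>+r. P r * I r \<partial>\<U>)"
    proof (rule nn_integral_cmult)
      obtain T' where T': "T' \<in> borel_measurable borel" "\<And>s. 0 \<le> s \<Longrightarrow> s < 1 \<Longrightarrow> T' s = To s"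
        using O.T_borel by blast
      have "(\<lambda>r. ennreal ((T' r * (1 - r)) powr (1 / p) / (1 - r)\<^sup>2)) \<in> borel_measurable \<U>"
        by (rule borel_measurable_U) (use T'(1) in measurable)
      then have "P \<in> borel_measurable \<U>"
        by (rule measurable_cong[THEN iffD1, rotated]) (auto simp: P_def T'(2))
      moreover have "I \<in> borel_measurable \<U>"
        unfolding I_def[abs_def] by (rule circ_nn_measurable) (use gm in measurable)
      ultimately show "(\<lambda>r. P r * I r) \<in> borel_measurable \<U>" by measurable
    qed
    also have "\<dots> \<le> ennreal (2 * 2 ^ Suc m * X) * ennreal (C * bergman_norm g)"
      unfolding P_def I_def bergman_norm_def
      by (intro mult_left_mono C(2) H_infinityD(1)[OF g] bounded_p_integrable[OF g]) auto
    also have "\<dots> = ennreal (2 * 2 ^ Suc m * C * X * bergman_norm g)"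
      using X0 C(1) bergman_norm_nonneg[of g] by (subst ennreal_mult[symmetric]) (auto simp: mult_ac)
    finally show "(\<integral>\<^sup>+\<zeta>. ennreal (cmod (F \<zeta>) * cmod (g \<zeta>) * ln (exp 1 / (1 - cmod \<zeta>))) \<partial>disc_measure ((tail_profile ^^ Suc m) (\<lambda>s. ennreal (wn s))))
      \<le> ennreal (2 * 2 ^ Suc m * C * X * bergman_norm g)" unfolding tp_def .
  qed
qed

lemma hankel_upper_bound:
  assumes C: "C > 0" "\<And>r s. 0 \<le> s \<Longrightarrow> s \<le> r \<Longrightarrow> r < 1 \<Longrightarrow> symbol_weight (Suc m) r \<le> C * symbol_weight (Suc m) s"
  obtains K where "K > 0" "\<And>f S g. f holomorphic_on unit_disc \<Longrightarrow> integrable N.wmeasure f \<Longrightarrow>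
    (\<And>z. z \<in> unit_disc \<Longrightarrow> cmod ((deriv ^^ Suc m) f z) * symbol_weight (Suc m) (cmod z) \<le> S) \<Longrightarrow> g \<in> H_infinity \<Longrightarrow>
    (\<integral>\<^sup>+z. ennreal (cmod (N.hank f g z)) \<partial>N.wmeasure) \<le> ennreal (K * (S + (\<Sum>j<Suc m. cmod ((deriv ^^ j) f 0))) * bergman_norm g)"
proof -
  obtain K1 where K1: "K1 > 0" "\<And>f S z. f holomorphic_on unit_disc \<Longrightarrow>
    (\<And>z. z \<in> unit_disc \<Longrightarrow> cmod ((deriv ^^ Suc m) f z) * symbol_weight (Suc m) (cmod z) \<le> S) \<Longrightarrow> z \<in> unit_disc \<Longrightarrow>
    cmod ((euler_op ^^ Suc m) f z) * symbol_weight (Suc m) (cmod z) \<le> K1 * (S + (\<Sum>j<Suc m. cmod ((deriv ^^ j) f 0)))"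
    using euler_op_growth[OF C] by blast
  obtain K2 where K2: "K2 > 0" "\<And>F g X. F holomorphic_on unit_disc \<Longrightarrow> 0 \<le> X \<Longrightarrow>
    (\<And>z. z \<in> unit_disc \<Longrightarrow> cmod (F z) * symbol_weight (Suc m) (cmod z) \<le> X) \<Longrightarrow> g \<in> H_infinity \<Longrightarrow>
    (\<integral>\<^sup>+\<zeta>. ennreal (cmod (F \<zeta>) * cmod (g \<zeta>) * ln (exp 1 / (1 - cmod \<zeta>))) \<partial>disc_measure ((tail_profile ^^ Suc m) (\<lambda>s. ennreal (wn s))))
      \<le> ennreal (K2 * X * bergman_norm g)"
    using weighted_symbol_integral[of m] by blast
  obtain K3 where K3: "K3 > 0" "\<And>\<zeta>. \<zeta> \<in> unit_disc \<Longrightarrow>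
    (\<integral>\<^sup>+z. ennreal (cmod (N.kern 0 (cnj z * \<zeta>))) \<partial>N.wmeasure) \<le> ennreal (K3 * ln (exp 1 / (1 - cmod \<zeta>)))"
    using N.kern_log by blast
  show ?thesis
  proof (rule that[of "K3 * K2 * K1"])
    show "0 < K3 * K2 * K1" using K1(1) K2(1) K3(1) by simp
    fix f g :: "complex \<Rightarrow> complex" and S :: real
    assume f: "f holomorphic_on unit_disc" "integrable N.wmeasure f"
      and S: "\<And>z. z \<in> unit_disc \<Longrightarrow> cmod ((deriv ^^ Suc m) f z) * symbol_weight (Suc m) (cmod z) \<le> S"
      and g: "g \<in> H_infinity"
    define tp where "tp = (tail_profile ^^ Suc m) (\<lambda>s. ennreal (wn s))"
    define F where "F = (euler_op ^^ Suc m) f"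
    define X where "X = K1 * (S + (\<Sum>j<Suc m. cmod ((deriv ^^ j) f 0)))"
    have FX: "cmod (F z) * symbol_weight (Suc m) (cmod z) \<le> X" if "z \<in> unit_disc" for z
      unfolding F_def X_def by (rule K1(2)[OF f(1) S that])
    have X0: "0 \<le> X"
    proof -
      have "0 \<le> cmod (F 0) * symbol_weight (Suc m) (cmod 0)"
        using symbol_weight_pos[of 0 "Suc m"] by (simp add: zero_le_mult_iff)
      also have "\<dots> \<le> X" by (rule FX) simp
      finally show ?thesis .
    qed
    have Fh: "F holomorphic_on unit_disc" unfolding F_def by (rule euler_op_pow(1)[OF f(1)])
    have Fm: "F \<in> borel_measurable \<D>" by (rule holomorphic_measurable_D[OF Fh])
    have gm: "g \<in> borel_measurable \<D>" by (rule holomorphic_measurable_D[OF H_infinityD(1)[OF g]])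
    have main: "(\<integral>\<^sup>+\<zeta>. ennreal (cmod (F \<zeta>) * cmod (g \<zeta>) * ln (exp 1 / (1 - cmod \<zeta>))) \<partial>disc_measure tp)
      \<le> ennreal (K2 * X * bergman_norm g)" if "g \<in> H_infinity" for g
      unfolding tp_def by (rule K2(2)[OF Fh X0 FX that])
    \<comment> \<open>With the constant function 1 in place of \<open>g\<close> the main estimate
      shows that \<open>F\<close> is integrable against the tail measure, as
      \<open>pairing_euler_op\<close> requires.\<close>
    have one: "(\<lambda>_. 1) \<in> H_infinity" by (auto simp: H_infinity_def bounded_iff)
    have Fi: "integrable (disc_measure tp) F"
    proof (rule integrableI_bounded)
      show "F \<in> borel_measurable (disc_measure tp)" using Fm by simp
      have "(\<integral>\<^sup>+\<zeta>. ennreal (norm (F \<zeta>)) \<partial>disc_measure tp) \<le>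
        (\<integral>\<^sup>+\<zeta>. ennreal (cmod (F \<zeta>) * cmod 1 * ln (exp 1 / (1 - cmod \<zeta>))) \<partial>disc_measure tp)"
      proof (intro nn_integral_mono ennreal_leI)
        fix \<zeta> assume "\<zeta> \<in> space (disc_measure tp)"
        then have "1 \<le> ln (exp 1 / (1 - cmod \<zeta>))" by (intro log_factor_ge_1) auto
        then show "norm (F \<zeta>) \<le> cmod (F \<zeta>) * cmod 1 * ln (exp 1 / (1 - cmod \<zeta>))"
          using mult_left_mono[of 1 "ln (exp 1 / (1 - cmod \<zeta>))" "cmod (F \<zeta>)"] by simp
      qed
      also have "\<dots> \<le> ennreal (K2 * X * bergman_norm (\<lambda>_. 1))" by (rule main[OF one])
      finally show "(\<integral>\<^sup>+\<zeta>. ennreal (norm (F \<zeta>)) \<partial>disc_measure tp) < \<infinity>" by (rule le_less_trans) simp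
    qed
    \<comment> \<open>For fixed \<open>z\<close> the product of \<open>g\<close> with the kernel
      slice is bounded and holomorphic, so the pairing may be moved to the iterated tail before
      absolute values are taken.\<close>
    have pt: "ennreal (cmod (N.hank f g z)) \<le> (\<integral>\<^sup>+\<zeta>. ennreal (cmod (N.kern 0 (cnj z * \<zeta>))) * ennreal (cmod (F \<zeta>) * cmod (g \<zeta>)) \<partial>disc_measure tp)"
      if z: "z \<in> unit_disc" for z
    proof -
      obtain B where B: "B \<ge> 0" "\<And>z. z \<in> unit_disc \<Longrightarrow> cmod (g z) \<le> B" using H_infinityD(2)[OF g] by blast
      obtain B' where B': "\<And>\<zeta>. \<zeta> \<in> unit_disc \<Longrightarrow> cmod (N.kern 0 (cnj z * \<zeta>)) \<le> B'" using N.kern_bounded[OF z] by blast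
      define G where "G = (\<lambda>\<zeta>. g \<zeta> * N.kern 0 (cnj z * \<zeta>))"
      have G: "G holomorphic_on unit_disc" unfolding G_def
        by (intro holomorphic_on_mult H_infinityD(1)[OF g] N.kern_slice_holomorphic[OF z])
      have Gb: "cmod (G \<zeta>) \<le> B * B'" if "\<zeta> \<in> unit_disc" for \<zeta>
        unfolding G_def norm_mult by (intro mult_mono B B' that B(1)) simp
      have "N.hank f g z = (\<integral>\<zeta>. cnj (G \<zeta>) * F \<zeta> \<partial>disc_measure tp)"
        unfolding N.hank_def F_def tp_def G_def[symmetric]
        using pairing_euler_op[OF N.finite_profile_w f Fi[unfolded F_def tp_def] G Gb] unfolding G_def .
      also have "ennreal (cmod \<dots>) \<le> (\<integral>\<^sup>+\<zeta>. ennreal (norm (cnj (G \<zeta>) * F \<zeta>)) \<partial>disc_measure tp)"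
      proof (rule integral_norm_bound_ennreal)
        show "integrable (disc_measure tp) (\<lambda>\<zeta>. cnj (G \<zeta>) * F \<zeta>)"
        proof (rule Bochner_Integration.integrable_bound[of _ "\<lambda>\<zeta>. of_real (B * B') * F \<zeta>"])
          show "integrable (disc_measure tp) (\<lambda>\<zeta>. of_real (B * B') * F \<zeta>)" using Fi by (rule integrable_mult_right)
          have "G \<in> borel_measurable \<D>" by (rule holomorphic_measurable_D[OF G])
          then show "(\<lambda>\<zeta>. cnj (G \<zeta>) * F \<zeta>) \<in> borel_measurable (disc_measure tp)" using Fm by measurable
          show "AE \<zeta> in disc_measure tp. norm (cnj (G \<zeta>) * F \<zeta>) \<le> norm (of_real (B * B') * F \<zeta>)"
          proof (rule AE_I2)
            fix \<zeta> assume "\<zeta> \<in> space (disc_measure tp)"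
            then have "cmod (G \<zeta>) \<le> \<bar>B * B'\<bar>" using Gb[of \<zeta>] by simp
            then show "norm (cnj (G \<zeta>) * F \<zeta>) \<le> norm (of_real (B * B') * F \<zeta>)"
              unfolding norm_mult norm_of_real complex_mod_cnj by (rule mult_right_mono) simp
          qed
        qed
      qed
      also have "\<dots> = (\<integral>\<^sup>+\<zeta>. ennreal (cmod (N.kern 0 (cnj z * \<zeta>))) * ennreal (cmod (F \<zeta>) * cmod (g \<zeta>)) \<partial>disc_measure tp)"
        by (intro nn_integral_cong) (simp add: ennreal_mult[symmetric] norm_mult G_def mult_ac)
      finally show ?thesis .
    qed
    have tpf: "finite_profile tp" unfolding tp_def by (rule tail_profile_pow(1)[OF N.finite_profile_w])
    interpret M1: finite_measure N.wmeasure by (rule N.finite_measure_w)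
    interpret M2: finite_measure "disc_measure tp"
      using tpf by (intro finite_disc_measure) (auto simp: finite_profile_def)
    interpret PS: pair_sigma_finite N.wmeasure "disc_measure tp" ..
    have prodm: "(\<lambda>x. cnj (fst x) * snd x) \<in> \<D> \<Otimes>\<^sub>M \<D> \<rightarrow>\<^sub>M \<D>"
    proof (rule measurable_restrict_space2)
      show "(\<lambda>x::complex \<times> complex. cnj (fst x) * snd x) \<in> space (\<D> \<Otimes>\<^sub>M \<D>) \<rightarrow> unit_disc"
      proof
        fix x :: "complex \<times> complex" assume "x \<in> space (\<D> \<Otimes>\<^sub>M \<D>)"
        then have x: "fst x \<in> unit_disc" "snd x \<in> unit_disc" by (auto simp: space_pair_measure space_restrict_space)
        show "cnj (fst x) * snd x \<in> unit_disc" using test_arg_bounds(5)[OF x] by simp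
      qed
      have "fst \<in> \<D> \<Otimes>\<^sub>M \<D> \<rightarrow>\<^sub>M \<D>" "snd \<in> \<D> \<Otimes>\<^sub>M \<D> \<rightarrow>\<^sub>M \<D>" by measurable
      then have "fst \<in> borel_measurable (\<D> \<Otimes>\<^sub>M \<D>)" "snd \<in> borel_measurable (\<D> \<Otimes>\<^sub>M \<D>)"
        by (auto simp: measurable_restrict_space2_iff)
      then show "(\<lambda>x. cnj (fst x) * snd x) \<in> borel_measurable (\<D> \<Otimes>\<^sub>M \<D>)" by measurable
    qed
    have km: "N.kern 0 \<in> borel_measurable \<D>" by (rule holomorphic_measurable_D[OF N.kern_holomorphic])
    have km1: "(\<lambda>x. N.kern 0 (cnj (fst x) * snd x)) \<in> borel_measurable (\<D> \<Otimes>\<^sub>M \<D>)"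
      by (rule measurable_compose[OF prodm km])
    have joint: "(\<lambda>(z, \<zeta>). ennreal (cmod (N.kern 0 (cnj z * \<zeta>))) * ennreal (cmod (F \<zeta>) * cmod (g \<zeta>)))
      \<in> borel_measurable (N.wmeasure \<Otimes>\<^sub>M disc_measure tp)"
    proof -
      have "(\<lambda>x. F (snd x)) \<in> borel_measurable (\<D> \<Otimes>\<^sub>M \<D>)" "(\<lambda>x. g (snd x)) \<in> borel_measurable (\<D> \<Otimes>\<^sub>M \<D>)"
        by (rule measurable_compose[OF measurable_snd Fm], rule measurable_compose[OF measurable_snd gm])
      then have "(\<lambda>x. ennreal (cmod (N.kern 0 (cnj (fst x) * snd x))) * ennreal (cmod (F (snd x)) * cmod (g (snd x))))
        \<in> borel_measurable (\<D> \<Otimes>\<^sub>M \<D>)" using km1 by measurable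
      moreover have "sets (N.wmeasure \<Otimes>\<^sub>M disc_measure tp) = sets (\<D> \<Otimes>\<^sub>M \<D>)"
        by (intro sets_pair_measure_cong) auto
      ultimately show ?thesis by (simp add: case_prod_beta' cong: measurable_cong_sets)
    qed
    have "(\<integral>\<^sup>+z. ennreal (cmod (N.hank f g z)) \<partial>N.wmeasure) \<le>
      (\<integral>\<^sup>+z. (\<integral>\<^sup>+\<zeta>. ennreal (cmod (N.kern 0 (cnj z * \<zeta>))) * ennreal (cmod (F \<zeta>) * cmod (g \<zeta>)) \<partial>disc_measure tp) \<partial>N.wmeasure)"
      by (intro nn_integral_mono pt) simp
    also have "\<dots> = (\<integral>\<^sup>+\<zeta>. (\<integral>\<^sup>+z. ennreal (cmod (N.kern 0 (cnj z * \<zeta>))) * ennreal (cmod (F \<zeta>) * cmod (g \<zeta>)) \<partial>N.wmeasure) \<partial>disc_measure tp)"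
      using PS.Fubini'[OF joint] by simp
    also have "\<dots> \<le> (\<integral>\<^sup>+\<zeta>. ennreal K3 * ennreal (cmod (F \<zeta>) * cmod (g \<zeta>) * ln (exp 1 / (1 - cmod \<zeta>))) \<partial>disc_measure tp)"
    proof (rule nn_integral_mono)
      fix \<zeta> assume "\<zeta> \<in> space (disc_measure tp)"
      then have \<zeta>: "\<zeta> \<in> unit_disc" by simp
      have L: "1 \<le> ln (exp 1 / (1 - cmod \<zeta>))" using \<zeta> by (intro log_factor_ge_1) auto
      have "(\<lambda>z. (z, \<zeta>)) \<in> \<D> \<rightarrow>\<^sub>M \<D> \<Otimes>\<^sub>M \<D>" by (rule measurable_Pair2') (use \<zeta> in \<open>simp add: space_restrict_space\<close>)
      from measurable_compose[OF this km1]
      have kz: "(\<lambda>z. N.kern 0 (cnj z * \<zeta>)) \<in> borel_measurable N.wmeasure" by simp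
      have "(\<integral>\<^sup>+z. ennreal (cmod (N.kern 0 (cnj z * \<zeta>))) * ennreal (cmod (F \<zeta>) * cmod (g \<zeta>)) \<partial>N.wmeasure) =
        (\<integral>\<^sup>+z. ennreal (cmod (N.kern 0 (cnj z * \<zeta>))) \<partial>N.wmeasure) * ennreal (cmod (F \<zeta>) * cmod (g \<zeta>))"
        by (intro nn_integral_multc measurable_compose[OF kz]) measurable
      also have "\<dots> \<le> ennreal (K3 * ln (exp 1 / (1 - cmod \<zeta>))) * ennreal (cmod (F \<zeta>) * cmod (g \<zeta>))"
        by (intro mult_right_mono K3(2) \<zeta>) simp
      also have "\<dots> = ennreal K3 * ennreal (cmod (F \<zeta>) * cmod (g \<zeta>) * ln (exp 1 / (1 - cmod \<zeta>)))"
        using K3(1) L by (simp only: ennreal_mult[symmetric] mult_nonneg_nonneg norm_ge_zero less_imp_le order_trans[OF zero_le_one]) (simp only: mult_ac)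
      finally show "(\<integral>\<^sup>+z. ennreal (cmod (N.kern 0 (cnj z * \<zeta>))) * ennreal (cmod (F \<zeta>) * cmod (g \<zeta>)) \<partial>N.wmeasure)
        \<le> ennreal K3 * ennreal (cmod (F \<zeta>) * cmod (g \<zeta>) * ln (exp 1 / (1 - cmod \<zeta>)))" .
    qed
    also have "\<dots> = ennreal K3 * (\<integral>\<^sup>+\<zeta>. ennreal (cmod (F \<zeta>) * cmod (g \<zeta>) * ln (exp 1 / (1 - cmod \<zeta>))) \<partial>disc_measure tp)"
    proof (rule nn_integral_cmult)
      have "(\<lambda>\<zeta>::complex. ln (exp 1 / (1 - cmod \<zeta>))) \<in> borel_measurable \<D>"
        by (rule measurable_restrict_space1) measurable
      then show "(\<lambda>\<zeta>. ennreal (cmod (F \<zeta>) * cmod (g \<zeta>) * ln (exp 1 / (1 - cmod \<zeta>)))) \<in> borel_measurable (disc_measure tp)"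
        using Fm gm by measurable
    qed
    also have "\<dots> \<le> ennreal K3 * ennreal (K2 * X * bergman_norm g)" by (intro mult_left_mono main g) simp
    also have "\<dots> = ennreal (K3 * (K2 * X * bergman_norm g))"
      using K3(1) K2(1) X0 bergman_norm_nonneg[of g] by (subst ennreal_mult[symmetric]) auto
    also have "K3 * (K2 * X * bergman_norm g) = K3 * K2 * K1 * (S + (\<Sum>j<Suc m. cmod ((deriv ^^ j) f 0))) * bergman_norm g"
      by (simp only: X_def mult.assoc)
    finally show "(\<integral>\<^sup>+z. ennreal (cmod (N.hank f g z)) \<partial>N.wmeasure) \<le>
      ennreal (K3 * K2 * K1 * (S + (\<Sum>j<Suc m. cmod ((deriv ^^ j) f 0))) * bergman_norm g)" .
  qed
qed

end

subsection \<open>From the operator to the symbol\<close>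

lemma taylor_higher_deriv:
  "taylor ((deriv ^^ n) f) j = fact n * (of_nat ((j + n) choose n) * taylor f (j + n))"
proof -
  have "fact n * fact j * of_nat ((j + n) choose n) = (fact (j + n) :: complex)"
    using binomial_fact_lemma[of n "j + n"] by (metis add_diff_cancel_right' le_add2 of_nat_fact of_nat_mult)
  then have "fact n * of_nat ((j + n) choose n) / fact (j + n) = (1 / fact j :: complex)"
    by (simp add: field_simps)
  then have "(fact n * of_nat ((j + n) choose n) / fact (j + n)) * (deriv ^^ (j + n)) f 0 = 1 / fact j * (deriv ^^ (j + n)) f 0"
    by (simp only:)
  then show ?thesis by (simp add: taylor_def funpow_add mult.assoc)
qed

context hankel_setting begin

text \<open>As a function of \<open>a\<close> this is, up to \<open>fact n\<close>, the
  \<open>n\<close>-th derivative of \<open>f\<close> with each Taylor coefficient multiplied by a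
  moment.\<close>

definition kernel_coefficient :: "nat \<Rightarrow> (complex \<Rightarrow> complex) \<Rightarrow> complex \<Rightarrow> complex" where
  "kernel_coefficient n f a = (\<integral>\<zeta>. cnj (power_test n a \<zeta>) * f \<zeta> \<partial>N.wmeasure)"

lemma power_coeff_summable:
  assumes a: "a \<in> unit_disc"
  shows "summable (\<lambda>k. norm (if k < n then 0 else of_nat (k choose n) * a ^ (k - n) :: complex))"
proof -
  have "summable (\<lambda>j. norm (of_nat ((j + n) choose n) * a ^ j))"
    by (rule power_series_summable_norm[OF binomial_series_neg a])
  then have "summable (\<lambda>j. norm (if j + n < n then 0 else of_nat ((j + n) choose n) * a ^ (j + n - n) :: complex))"
    by simp
  then show ?thesis by (subst (asm) summable_iff_shift)
qed

lemma kernel_coefficient_sums: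
  assumes f: "f holomorphic_on unit_disc" "integrable N.wmeasure f" and a: "a \<in> unit_disc"
  shows "(\<lambda>j. of_nat ((j + n) choose n) * taylor f (j + n) * of_real (N.moment (j + n)) * a ^ j) sums kernel_coefficient n f a"
proof -
  define b where "b k = (if k < n then 0 else of_nat (k choose n) * a ^ (k - n))" for k
  have b: "summable (\<lambda>k. norm (b k))" unfolding b_def by (rule power_coeff_summable[OF a])
  have "(\<Sum>k. b k * cnj \<zeta> ^ k) = cnj (power_test n a \<zeta>)" if "\<zeta> \<in> unit_disc" for \<zeta>
  proof -
    have "(\<lambda>k. cnj ((if k < n then 0 else of_nat (k choose n) * cnj a ^ (k - n)) * \<zeta> ^ k)) sums cnj (power_test n a \<zeta>)"
      using power_test_sums[OF a that, of n] by (simp only: sums_cnj)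
    moreover have "cnj ((if k < n then 0 else of_nat (k choose n) * cnj a ^ (k - n)) * \<zeta> ^ k) = b k * cnj \<zeta> ^ k" for k
      by (simp add: b_def)
    ultimately show ?thesis by (simp only: sums_iff)
  qed
  then have "(\<integral>\<zeta>. (\<Sum>k. b k * cnj \<zeta> ^ k) * f \<zeta> \<partial>N.wmeasure) = kernel_coefficient n f a"
    unfolding kernel_coefficient_def by (intro Bochner_Integration.integral_cong) auto
  then have "(\<lambda>k. b k * (taylor f k * of_real (N.moment k))) sums kernel_coefficient n f a"
    using disc_pairing[OF N.finite_profile_w f b] by (simp add: N.profile_moment_w)
  then have "(\<lambda>j. b (j + n) * (taylor f (j + n) * of_real (N.moment (j + n)))) sums kernel_coefficient n f a"
    by (subst sums_iff_shift) (simp add: b_def)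
  then show ?thesis by (simp add: b_def mult_ac)
qed

text \<open>Applied to the test quotient, the operator yields an image whose Taylor coefficients
  times moments are pairings of \<open>f\<close> with the quotient times monomials. Summing them
  against the coefficients of \<open>log_test a\<close> cancels the logarithm in the quotient. These
  coefficients satisfy \<open>(k + 1) * cmod (b k) \<le> 2 * cmod a ^ k\<close>, so
  \<open>bloch_duality\<close> bounds the sum uniformly in \<open>a\<close> by the norm of the
  image.\<close>

lemma kernel_coefficient_bound:
  obtains n0 where "\<And>n. n \<ge> n0 \<Longrightarrow> \<exists>C>0. \<forall>f A a. f holomorphic_on unit_disc \<longrightarrow> integrable N.wmeasure f \<longrightarrow> 0 \<le> A \<longrightarrow>
    hankel_estimate f A \<longrightarrow> a \<in> unit_disc \<longrightarrow>
    cmod (kernel_coefficient n f a) \<le> C * A * ((To (cmod a) * (1 - cmod a)) powr (1 / p) / ((1 - cmod a) ^ Suc n * ln (exp 1 / (1 - cmod a))))"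
proof -
  obtain n0 where n0: "\<And>n. n \<ge> n0 \<Longrightarrow> \<exists>C>0. \<forall>a\<in>unit_disc.
    (\<integral>\<zeta>. cmod (power_test n a \<zeta> / log_test a \<zeta>) powr p \<partial>O.wmeasure) powr (1 / p) \<le>
      C * (To (cmod a) * (1 - cmod a)) powr (1 / p) / ((1 - cmod a) ^ Suc n * ln (exp 1 / (1 - cmod a)))"
    using O.test_quotient_norm[OF p(1)] by blast
  show ?thesis
  proof (rule N.bloch_duality)
    fix C2 assume C2: "C2 > 0" "\<And>h b q. h holomorphic_on unit_disc \<Longrightarrow> integrable N.wmeasure h \<Longrightarrow> 0 \<le> q \<Longrightarrow> q < 1 \<Longrightarrow>
      (\<And>k. (real k + 1) * cmod (b k) \<le> 2 * q ^ k) \<Longrightarrow>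
      \<exists>s. (\<lambda>k. b k * (taylor h k * of_real (N.moment k))) sums s \<and> cmod s \<le> C2 * (\<integral>\<zeta>. cmod (h \<zeta>) \<partial>N.wmeasure)"
    show ?thesis
    proof (rule that[of n0])
      fix n assume "n \<ge> n0"
      then obtain C where C: "C > 0" "\<And>a. a \<in> unit_disc \<Longrightarrow>
        (\<integral>\<zeta>. cmod (power_test n a \<zeta> / log_test a \<zeta>) powr p \<partial>O.wmeasure) powr (1 / p) \<le>
        C * (To (cmod a) * (1 - cmod a)) powr (1 / p) / ((1 - cmod a) ^ Suc n * ln (exp 1 / (1 - cmod a)))"
        using n0 by blast
      show "\<exists>C>0. \<forall>f A a. f holomorphic_on unit_disc \<longrightarrow> integrable N.wmeasure f \<longrightarrow> 0 \<le> A \<longrightarrow>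
        hankel_estimate f A \<longrightarrow> a \<in> unit_disc \<longrightarrow>
        cmod (kernel_coefficient n f a) \<le> C * A * ((To (cmod a) * (1 - cmod a)) powr (1 / p) / ((1 - cmod a) ^ Suc n * ln (exp 1 / (1 - cmod a))))"
      proof (intro exI[of _ "C2 * C"] conjI allI impI)
        show "0 < C2 * C" using C(1) C2(1) by simp
        fix f A a assume f: "f holomorphic_on unit_disc" "integrable N.wmeasure f" and A0: "0 \<le> A"
          and A: "hankel_estimate f A"
          and a: "a \<in> unit_disc"
        define g where "g = (\<lambda>\<zeta>. power_test n a \<zeta> / log_test a \<zeta>)"
        have g: "g \<in> H_infinity" unfolding g_def by (rule test_quotient_H_infinity[OF a])
        define h where "h = N.hank f g"
        have hh: "h holomorphic_on unit_disc" "taylor h = (\<lambda>k. N.hank_coeff f g k / of_real (N.moment k))"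
          unfolding h_def by (rule N.hank_holomorphic[OF f(2) g])+
        have hA: "(\<integral>\<^sup>+z. ennreal (cmod (h z)) \<partial>N.wmeasure) \<le> ennreal (A * bergman_norm g)"
          using A g unfolding h_def by blast
        have hm: "h \<in> borel_measurable N.wmeasure" using holomorphic_measurable_D[OF hh(1)] by simp
        have hi: "integrable N.wmeasure h"
          by (rule integrableI_bounded[OF hm]) (use le_less_trans[OF hA] in simp)
        have "ennreal (\<integral>\<zeta>. cmod (h \<zeta>) \<partial>N.wmeasure) \<le> ennreal (A * bergman_norm g)"
          using hA hi by (subst nn_integral_eq_integral[symmetric]) auto
        then have hI: "(\<integral>\<zeta>. cmod (h \<zeta>) \<partial>N.wmeasure) \<le> A * bergman_norm g"
          using A0 bergman_norm_nonneg[of g] by (subst (asm) ennreal_le_iff) auto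
        define b where "b k = cnj (log_coeff a k)" for k
        have b: "(real k + 1) * cmod (b k) \<le> 2 * cmod a ^ k" for k
        proof (cases "k = 0")
          case False
          then have "(real k + 1) * (cmod a ^ k / real k) \<le> 2 * real k * (cmod a ^ k / real k)"
            by (intro mult_right_mono) auto
          then show ?thesis using False by (simp add: b_def log_coeff_def norm_divide norm_power)
        qed (simp add: b_def log_coeff_def)
        obtain s where s: "(\<lambda>k. b k * (taylor h k * of_real (N.moment k))) sums s" "cmod s \<le> C2 * (\<integral>\<zeta>. cmod (h \<zeta>) \<partial>N.wmeasure)"
          using C2(2)[OF hh(1) hi _ _ b] a by auto
        have bs: "summable (\<lambda>k. norm (b k))"
        proof (rule summable_comparison_test')
          show "summable (\<lambda>k. 2 * cmod a ^ k)" using a by (intro summable_mult summable_geometric) simp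
          fix k :: nat
          have "norm (norm (b k)) = 1 * cmod (b k)" by simp
          also have "\<dots> \<le> (real k + 1) * cmod (b k)" by (intro mult_right_mono) auto
          also have "\<dots> \<le> 2 * cmod a ^ k" by (rule b)
          finally show "norm (norm (b k)) \<le> 2 * cmod a ^ k" .
        qed
        have "(\<lambda>k. b k * (\<integral>\<zeta>. cnj \<zeta> ^ k * (cnj (g \<zeta>) * f \<zeta>) \<partial>N.wmeasure)) sums
          (\<integral>\<zeta>. (\<Sum>k. b k * cnj \<zeta> ^ k) * (cnj (g \<zeta>) * f \<zeta>) \<partial>N.wmeasure)"
          by (rule integral_bounded_series(2)[OF bs N.hank_integrable[OF f(2) g] N.cnj_power_measurable])
            (auto simp: norm_power power_le_one)
        moreover have "(\<integral>\<zeta>. cnj \<zeta> ^ k * (cnj (g \<zeta>) * f \<zeta>) \<partial>N.wmeasure) = taylor h k * of_real (N.moment k)" for k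
          using N.moment_pos[of k] by (simp add: hh(2) N.hank_coeff_def)
        moreover have "(\<integral>\<zeta>. (\<Sum>k. b k * cnj \<zeta> ^ k) * (cnj (g \<zeta>) * f \<zeta>) \<partial>N.wmeasure) = kernel_coefficient n f a"
          unfolding kernel_coefficient_def
        proof (intro Bochner_Integration.integral_cong refl)
          fix \<zeta> assume "\<zeta> \<in> space N.wmeasure"
          then have \<zeta>: "\<zeta> \<in> unit_disc" by simp
          have "(\<lambda>k. cnj (log_coeff a k * \<zeta> ^ k)) sums cnj (log_test a \<zeta>)"
            using log_test_sums[OF a \<zeta>] by (simp only: sums_cnj)
          then have "(\<lambda>k. b k * cnj \<zeta> ^ k) sums cnj (log_test a \<zeta>)" by (simp add: b_def)
          then have e: "(\<Sum>k. b k * cnj \<zeta> ^ k) = cnj (log_test a \<zeta>)" by (simp add: sums_iff)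
          have "log_test a \<zeta> \<noteq> 0" using log_test_lower[OF a \<zeta>] by auto
          then show "(\<Sum>k. b k * cnj \<zeta> ^ k) * (cnj (g \<zeta>) * f \<zeta>) = cnj (power_test n a \<zeta>) * f \<zeta>"
            unfolding e g_def by simp
        qed
        ultimately have "(\<lambda>k. b k * (taylor h k * of_real (N.moment k))) sums kernel_coefficient n f a" by simp
        then have "kernel_coefficient n f a = s" using s(1) by (rule sums_unique2)
        then have "cmod (kernel_coefficient n f a) \<le> C2 * (\<integral>\<zeta>. cmod (h \<zeta>) \<partial>N.wmeasure)" using s(2) by simp
        also have "\<dots> \<le> C2 * (A * bergman_norm g)" using hI C2(1) by (intro mult_left_mono) auto
        also have "\<dots> \<le> C2 * (A * (C * (To (cmod a) * (1 - cmod a)) powr (1 / p) / ((1 - cmod a) ^ Suc n * ln (exp 1 / (1 - cmod a)))))"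
          unfolding bergman_norm_def g_def using C(2)[OF a] C2(1) A0 by (intro mult_left_mono) auto
        also have "\<dots> = C2 * C * A * ((To (cmod a) * (1 - cmod a)) powr (1 / p) / ((1 - cmod a) ^ Suc n * ln (exp 1 / (1 - cmod a))))"
          by (simp add: mult_ac)
        finally show "cmod (kernel_coefficient n f a) \<le> C2 * C * A * ((To (cmod a) * (1 - cmod a)) powr (1 / p) / ((1 - cmod a) ^ Suc n * ln (exp 1 / (1 - cmod a))))" .
      qed
    qed
  qed
qed

text \<open>Parseval multiplies coefficients termwise: \<open>kern n\<close> carries the reciprocal
  moments with the index shift \<open>n\<close> and cancels those in
  \<open>kernel_coefficient\<close>. Dilating by \<rho> and dividing \<open>z\<close> by \<rho>
  keeps both arguments inside the disc.\<close>

lemma higher_deriv_representation: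
  assumes f: "f holomorphic_on unit_disc" "integrable N.wmeasure f"
    and z: "cmod z < \<rho>" and \<rho>: "\<rho> < 1"
  shows "(deriv ^^ n) f z = fact n * (\<integral>t. kernel_coefficient n f (of_real \<rho> * circ t) * N.kern n (z / of_real \<rho> * cnj (circ t)) \<partial>\<U>)"
proof -
  have \<rho>0: "0 < \<rho>" using z norm_ge_zero[of z] by linarith
  have zd: "z \<in> unit_disc" using z \<rho> by simp
  define v where "v = z / of_real \<rho>"
  have v: "v \<in> unit_disc" using z \<rho>0 by (simp add: v_def norm_divide)
  define c where "c j = of_nat ((j + n) choose n) * taylor f (j + n) * of_real (N.moment (j + n))" for j
  define a where "a j = c j * of_real \<rho> ^ j" for j
  define b where "b j = 1 / of_real (N.moment (j + n)) * v ^ j" for j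
  have cs: "(\<lambda>j. c j * x ^ j) sums kernel_coefficient n f x" if "x \<in> unit_disc" for x
    unfolding c_def by (rule kernel_coefficient_sums[OF f that])
  have a: "summable (\<lambda>j. norm (a j))"
    unfolding a_def by (rule power_series_summable_norm[OF cs]) (use \<rho> \<rho>0 in auto)
  have b: "summable (\<lambda>j. norm (b j))"
    unfolding b_def by (rule power_series_summable_norm[OF N.kern_sums v])
  have 1: "(\<lambda>j. a j * b j) sums (\<integral>t. (\<Sum>j. a j * circ t ^ j) * (\<Sum>j. b j * cnj (circ t) ^ j) \<partial>\<U>)"
    by (rule circle_parseval[OF a b])
  have 2: "(\<Sum>j. a j * circ t ^ j) = kernel_coefficient n f (of_real \<rho> * circ t)" for t
    using cs[of "of_real \<rho> * circ t"] \<rho> \<rho>0 by (simp add: sums_iff a_def norm_mult power_mult_distrib mult.assoc)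
  have 3: "(\<Sum>j. b j * cnj (circ t) ^ j) = N.kern n (v * cnj (circ t))" for t
    using N.kern_sums[of "v * cnj (circ t)" n] v by (simp add: sums_iff b_def norm_mult power_mult_distrib mult.assoc)
  have 4: "fact n * (a j * b j) = taylor ((deriv ^^ n) f) j * z ^ j" for j
  proof -
    have "of_real \<rho> ^ j * v ^ j = z ^ j" using \<rho>0 by (simp add: v_def power_divide)
    then have "a j * b j = of_nat ((j + n) choose n) * taylor f (j + n) * z ^ j"
      using N.moment_pos[of "j + n"] by (simp add: a_def b_def c_def field_simps)
    then show ?thesis by (simp add: taylor_higher_deriv mult_ac)
  qed
  have "(\<lambda>j. taylor ((deriv ^^ n) f) j * z ^ j) sums (fact n * (\<integral>t. kernel_coefficient n f (of_real \<rho> * circ t) * N.kern n (v * cnj (circ t)) \<partial>\<U>))"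
    using sums_mult[OF 1, of "fact n"] unfolding 2 3 4 .
  moreover have "(\<lambda>j. taylor ((deriv ^^ n) f) j * z ^ j) sums (deriv ^^ n) f z"
    by (rule taylor_sums[OF holomorphic_higher_deriv[OF f(1) open_ball] zd])
  ultimately show ?thesis unfolding v_def by (rule sums_unique2[symmetric])
qed

text \<open>In the representation the kernel coefficient is bounded by its supremum on the circle of
  radius \<rho>, and the remaining mean of \<open>kern n\<close> costs a constant over the tail,
  which is the factor that \<open>symbol_weight\<close> multiplies back.\<close>

lemma symbol_lower_bound:
  obtains n0 where "\<And>n. n \<ge> n0 \<Longrightarrow> \<exists>C>0. \<forall>f A z. f holomorphic_on unit_disc \<longrightarrow> integrable N.wmeasure f \<longrightarrow> 0 \<le> A \<longrightarrow>
    hankel_estimate f A \<longrightarrow> z \<in> unit_disc \<longrightarrow>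
    cmod ((deriv ^^ n) f z) * symbol_weight n (cmod z) \<le> C * A"
proof -
  obtain n0 where n0: "\<And>n. n \<ge> n0 \<Longrightarrow> \<exists>C>0. \<forall>f A a. f holomorphic_on unit_disc \<longrightarrow> integrable N.wmeasure f \<longrightarrow> 0 \<le> A \<longrightarrow>
    hankel_estimate f A \<longrightarrow> a \<in> unit_disc \<longrightarrow>
    cmod (kernel_coefficient n f a) \<le> C * A * ((To (cmod a) * (1 - cmod a)) powr (1 / p) / ((1 - cmod a) ^ Suc n * ln (exp 1 / (1 - cmod a))))"
    using kernel_coefficient_bound by blast
  obtain D where D: "D \<ge> 1" "\<And>r. 0 \<le> r \<Longrightarrow> r < 1 \<Longrightarrow> Tn r \<le> D * Tn ((1 + r) / 2)"
    using N.upper_doubling by auto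
  show ?thesis
  proof (rule that[of n0])
    fix n assume "n \<ge> n0"
    obtain C where C: "C > 0" "\<And>f A a. f holomorphic_on unit_disc \<Longrightarrow> integrable N.wmeasure f \<Longrightarrow> 0 \<le> A \<Longrightarrow>
      hankel_estimate f A \<Longrightarrow> a \<in> unit_disc \<Longrightarrow>
      cmod (kernel_coefficient n f a) \<le> C * A * ((To (cmod a) * (1 - cmod a)) powr (1 / p) / ((1 - cmod a) ^ Suc n * ln (exp 1 / (1 - cmod a))))"
      using n0[OF \<open>n \<ge> n0\<close>] by blast
    obtain E where E: "E > 0" "\<And>s. 0 \<le> s \<Longrightarrow> s < 1 \<Longrightarrow> circ_mean (\<lambda>z. cmod (N.kern n z)) s \<le> E / Tn s"
      using N.kern_mean[of n] by blast
    show "\<exists>C>0. \<forall>f A z. f holomorphic_on unit_disc \<longrightarrow> integrable N.wmeasure f \<longrightarrow> 0 \<le> A \<longrightarrow>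
      hankel_estimate f A \<longrightarrow> z \<in> unit_disc \<longrightarrow>
      cmod ((deriv ^^ n) f z) * symbol_weight n (cmod z) \<le> C * A"
    proof (intro exI[of _ "fact n * C * 2 ^ Suc n * E * D"] conjI allI impI)
      show "0 < fact n * C * 2 ^ Suc n * E * D" using C(1) D(1) E(1) by (intro mult_pos_pos) auto
      fix f A and z :: complex assume f: "f holomorphic_on unit_disc" "integrable N.wmeasure f" and A0: "0 \<le> A"
        and A: "hankel_estimate f A"
        and z: "z \<in> unit_disc"
      \<comment> \<open>Halfway to the boundary \<open>1 - \<rho>\<close> is half of
        \<open>1 - r\<close>, and \<open>r / \<rho> \<le> \<rho>\<close> because
        \<open>(1 - r)^2 \<ge> 0\<close>. Hence both the circle of the coefficient and the radius of
        the kernel mean stay in the range where upper doubling compares tails with those at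
        \<open>r\<close>.\<close>
      define r \<rho> where "r = cmod z" and "\<rho> = (1 + r) / 2"
      have r: "0 \<le> r" "r < 1" using z by (auto simp: r_def)
      have \<rho>: "r < \<rho>" "\<rho> < 1" "0 < \<rho>" "1 - \<rho> = (1 - r) / 2" using r by (auto simp: \<rho>_def field_simps)
      have "0 \<le> (1 - r)\<^sup>2" by simp
      then have "r \<le> \<rho> * \<rho>" by (simp add: \<rho>_def power2_eq_square field_simps)
      then have r\<rho>: "r / \<rho> \<le> \<rho>" "0 \<le> r / \<rho>" using \<rho> r by (auto simp: field_simps)
      define W where "W = (To r * (1 - r)) powr (1 / p)"
      define L where "L = ln (exp 1 / (1 - r))"
      have T: "0 < To r" "0 < To \<rho>" "0 < Tn r" "0 < Tn \<rho>" "0 < Tn (r / \<rho>)"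
        using O.T_pos N.T_pos r \<rho> r\<rho> by auto
      have L: "1 \<le> L" unfolding L_def by (rule log_factor_ge_1[OF r])
      have W0: "0 < W" using T r by (simp add: W_def)
      define B where "B = C * A * (2 ^ Suc n * W / ((1 - r) ^ Suc n * L))"
      have B0: "0 \<le> B" unfolding B_def using C(1) A0 W0 r L by (intro mult_nonneg_nonneg divide_nonneg_nonneg) auto
      have Q: "cmod (kernel_coefficient n f (of_real \<rho> * circ t)) \<le> B" for t
      proof -
        have n\<rho>: "cmod (of_real \<rho> * circ t) = \<rho>" using \<rho> by (simp add: norm_mult)
        then have \<rho>d: "of_real \<rho> * circ t \<in> unit_disc" using \<rho>(2) by simp
        have "cmod (kernel_coefficient n f (of_real \<rho> * circ t)) \<le> C * A * ((To \<rho> * (1 - \<rho>)) powr (1 / p) / ((1 - \<rho>) ^ Suc n * ln (exp 1 / (1 - \<rho>))))"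
          using C(2)[OF f A0 A \<rho>d] unfolding n\<rho> .
        also have "\<dots> \<le> C * A * (W / ((1 - \<rho>) ^ Suc n * L))"
        proof (intro mult_left_mono frac_le mult_nonneg_nonneg mult_pos_pos)
          show "(To \<rho> * (1 - \<rho>)) powr (1 / p) \<le> W"
            unfolding W_def using p T r \<rho> O.T_antimono[of r \<rho>] by (intro powr_mono2 mult_mono) auto
          show "L \<le> ln (exp 1 / (1 - \<rho>))" unfolding L_def using r \<rho> by (simp add: log_factor)
        qed (use C(1) A0 W0 L \<rho> in auto)
        also have "(1 - \<rho>) ^ Suc n = (1 - r) ^ Suc n / 2 ^ Suc n" unfolding \<rho>(4) by (rule power_divide)
        finally show ?thesis by (simp add: B_def mult_ac)
      qed
      have K: "continuous_on unit_disc (\<lambda>z. cmod (N.kern n z))"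
        by (intro continuous_intros holomorphic_on_imp_continuous_on N.kern_holomorphic)
      have v: "cnj (z / of_real \<rho>) \<in> unit_disc" using \<rho> by (simp add: norm_divide r_def[symmetric])
      have kc: "cmod (N.kern n (z / of_real \<rho> * cnj (circ t))) = cmod (N.kern n (cnj (z / of_real \<rho>) * circ t))" for t
      proof -
        have "cnj (z / of_real \<rho>) * circ t \<in> unit_disc" using v by (simp only: mem_ball_0 norm_mult norm_circ mult_1_right)
        from N.kern_cnj[OF this, of n]
        have "cmod (N.kern n (cnj (cnj (z / of_real \<rho>) * circ t))) = cmod (N.kern n (cnj (z / of_real \<rho>) * circ t))"
          by (simp only: complex_mod_cnj)
        then show ?thesis by (simp only: complex_cnj_mult complex_cnj_cnj)
      qed
      have repr: "(deriv ^^ n) f z = fact n * (\<integral>t. kernel_coefficient n f (of_real \<rho> * circ t) * N.kern n (z / of_real \<rho> * cnj (circ t)) \<partial>\<U>)"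
        by (rule higher_deriv_representation[OF f]) (use \<rho> in \<open>simp_all add: r_def\<close>)
      have "cmod (\<integral>t. kernel_coefficient n f (of_real \<rho> * circ t) * N.kern n (z / of_real \<rho> * cnj (circ t)) \<partial>\<U>)
        \<le> (\<integral>t. B * cmod (N.kern n (cnj (z / of_real \<rho>) * circ t)) \<partial>\<U>)"
      proof (rule order_trans[OF integral_norm_bound integral_mono'])
        show "integrable \<U> (\<lambda>t. B * cmod (N.kern n (cnj (z / of_real \<rho>) * circ t)))"
          by (intro integrable_mult_right circ_mean_shift(2)[OF K _ v]) simp
        show "norm (kernel_coefficient n f (of_real \<rho> * circ t) * N.kern n (z / of_real \<rho> * cnj (circ t)))
          \<le> B * cmod (N.kern n (cnj (z / of_real \<rho>) * circ t))" for t
          unfolding norm_mult kc by (intro mult_right_mono Q) simp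
      qed (use B0 in simp)
      also have "\<dots> = B * circ_mean (\<lambda>z. cmod (N.kern n z)) (r / \<rho>)"
        using circ_mean_shift(1)[OF K _ v] \<rho>(3) by (simp add: norm_divide r_def)
      also have "\<dots> \<le> B * (E / Tn (r / \<rho>))" using B0 r\<rho> \<rho> by (intro mult_left_mono E) auto
      also have "\<dots> \<le> B * (E * D / Tn r)"
      proof -
        have "Tn r \<le> D * Tn \<rho>" using D(2)[OF r] by (simp add: \<rho>_def)
        also have "\<dots> \<le> D * Tn (r / \<rho>)" using D(1) r\<rho> \<rho> by (intro mult_left_mono N.T_antimono) auto
        finally have "1 / Tn (r / \<rho>) \<le> D / Tn r" using T by (simp add: field_simps)
        then have "E * (1 / Tn (r / \<rho>)) \<le> E * (D / Tn r)" using E(1) by (intro mult_left_mono) auto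
        then show ?thesis using B0 by (intro mult_left_mono) auto
      qed
      finally have "cmod ((deriv ^^ n) f z) \<le> fact n * (B * (E * D / Tn r))"
        unfolding repr norm_mult norm_fact by (rule mult_left_mono) simp
      then have "cmod ((deriv ^^ n) f z) * symbol_weight n r \<le> fact n * (B * (E * D / Tn r)) * symbol_weight n r"
        using symbol_weight_pos[OF r, of n] by (intro mult_right_mono) auto
      also have "fact n * (B * (E * D / Tn r)) * symbol_weight n r = fact n * C * 2 ^ Suc n * E * D * A"
      proof -
        have sw: "symbol_weight n r = (1 - r) ^ Suc n * Tn r * L / W"
          unfolding symbol_weight_def W_def[symmetric] L_def[symmetric] by simp
        have key: "x * (C * A * (y * W / (u * L)) * (E * D / v)) * (u * v * L / W) = x * C * y * E * D * A"
          if "u \<noteq> 0" "v \<noteq> 0" for u v x y :: real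
          using that L W0 by (simp add: field_simps)
        show ?thesis unfolding B_def sw by (rule key) (use T r in auto)
      qed
      finally show "cmod ((deriv ^^ n) f z) * symbol_weight n (cmod z) \<le> fact n * C * 2 ^ Suc n * E * D * A"
        by (simp add: r_def)
    qed
  qed
qed

text \<open>The operator is tested on \<open>\<zeta> ^ j\<close>. The integral of the image is its
  constant Taylor coefficient times a moment, and this equals the pairing of \<open>f\<close> with
  the monomial.\<close>

lemma derivative_at_0_bound:
  "\<exists>C>0. \<forall>f A. f holomorphic_on unit_disc \<longrightarrow> integrable N.wmeasure f \<longrightarrow> 0 \<le> A \<longrightarrow>
    hankel_estimate f A \<longrightarrow>
    cmod ((deriv ^^ j) f 0) \<le> C * A"
proof (intro exI[of _ "fact j * bergman_norm (\<lambda>\<zeta>. \<zeta> ^ j) / N.moment j + 1"] conjI allI impI)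
  \<comment> \<open>The summand 1 makes the constant positive without a proof that the monomial has
    positive norm.\<close>
  show "0 < fact j * bergman_norm (\<lambda>\<zeta>. \<zeta> ^ j) / N.moment j + 1"
    using bergman_norm_nonneg[of "\<lambda>\<zeta>. \<zeta> ^ j"] N.moment_pos[of j] by (intro add_nonneg_pos divide_nonneg_pos) auto
  fix f A assume f: "f holomorphic_on unit_disc" "integrable N.wmeasure f" and A0: "0 \<le> A"
    and A: "hankel_estimate f A"
  define g where "g = (\<lambda>\<zeta>::complex. \<zeta> ^ j)"
  have g: "g \<in> H_infinity"
    unfolding g_def H_infinity_def bounded_iff
    by (intro CollectI conjI exI[of _ 1] ballI holomorphic_intros) (auto simp: norm_power power_le_one)
  define h where "h = N.hank f g"
  have hh: "h holomorphic_on unit_disc" "taylor h = (\<lambda>k. N.hank_coeff f g k / of_real (N.moment k))"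
    unfolding h_def by (rule N.hank_holomorphic[OF f(2) g])+
  have hA: "(\<integral>\<^sup>+z. ennreal (cmod (h z)) \<partial>N.wmeasure) \<le> ennreal (A * bergman_norm g)"
    using A g unfolding h_def by blast
  have hm: "h \<in> borel_measurable N.wmeasure" using holomorphic_measurable_D[OF hh(1)] by simp
  have hi: "integrable N.wmeasure h"
    by (rule integrableI_bounded[OF hm]) (use le_less_trans[OF hA] in simp)
  have "taylor f j * of_real (N.moment j) = N.hank_coeff f g 0"
    using disc_coefficient[OF N.finite_profile_w f, of j] by (simp add: N.hank_coeff_def g_def N.profile_moment_w)
  also have "\<dots> = taylor h 0 * of_real (N.moment 0)" using N.moment_pos[of 0] by (simp add: hh(2))
  also have "\<dots> = (\<integral>\<zeta>. h \<zeta> \<partial>N.wmeasure)"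
    using disc_coefficient[OF N.finite_profile_w hh(1) hi, of 0] by (simp add: N.profile_moment_w)
  finally have "ennreal (cmod (taylor f j * of_real (N.moment j))) \<le> (\<integral>\<^sup>+\<zeta>. ennreal (norm (h \<zeta>)) \<partial>N.wmeasure)"
    using integral_norm_bound_ennreal[OF hi] by simp
  also have "\<dots> \<le> ennreal (A * bergman_norm g)" by (rule hA)
  finally have "cmod (taylor f j * of_real (N.moment j)) \<le> A * bergman_norm g"
    using A0 bergman_norm_nonneg[of g] by (subst (asm) ennreal_le_iff) auto
  then have "cmod ((deriv ^^ j) f 0) / fact j * N.moment j \<le> A * bergman_norm g"
    using N.moment_pos[of j] by (simp add: taylor_def norm_mult norm_divide)
  then have "cmod ((deriv ^^ j) f 0) \<le> fact j * bergman_norm g / N.moment j * A"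
    using N.moment_pos[of j] by (simp add: field_simps)
  then show "cmod ((deriv ^^ j) f 0) \<le> (fact j * bergman_norm (\<lambda>\<zeta>. \<zeta> ^ j) / N.moment j + 1) * A"
    using A0 unfolding g_def by (simp add: distrib_right)
qed

end

subsection \<open>The small Hankel operator\<close>

text \<open>Ties a weight on the disc to a Borel representative of its profile, so that the
  estimates for \<open>doubling_tail\<close> speak about the weight itself.\<close>

locale radial_profile = doubling_tail w "tail \<omega>" for \<omega> :: "complex \<Rightarrow> real" and w :: "real \<Rightarrow> real" +
  assumes weight: "radial_weight \<omega>"
    and weight_ae: "AE z in area. \<omega> z = w (cmod z)"
begin

lemmas transfer_integral = area_radial_integral[OF weight w_meas w_nonneg weight_ae]

lemma powr_integral:
  assumes f: "f \<in> borel_measurable \<D>"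
  shows "integrable area (\<lambda>z. cmod (f z) powr q * \<omega> z) \<longleftrightarrow> integrable wmeasure (\<lambda>z. cmod (f z) powr q)"
    and "(LINT z|area. cmod (f z) powr q * \<omega> z) = (\<integral>z. cmod (f z) powr q \<partial>wmeasure)"
proof -
  have m: "(\<lambda>z. cmod (f z) powr q) \<in> borel_measurable \<D>" using f by measurable
  show "integrable area (\<lambda>z. cmod (f z) powr q * \<omega> z) \<longleftrightarrow> integrable wmeasure (\<lambda>z. cmod (f z) powr q)"
    "(LINT z|area. cmod (f z) powr q * \<omega> z) = (\<integral>z. cmod (f z) powr q \<partial>wmeasure)"
    using transfer_integral(1,2)[OF m] by (simp_all add: mult.commute)
qed

lemma bergman_iff:
  "f \<in> bergman q \<omega> \<longleftrightarrow> f holomorphic_on unit_disc \<and> integrable wmeasure (\<lambda>z. cmod (f z) powr q)"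
  using powr_integral(1)[OF holomorphic_measurable_D] borel_measurable_area[OF holomorphic_measurable_D]
  by (auto simp: bergman_def Lp_def)

lemma pairing_transfer:
  assumes "\<phi> \<in> borel_measurable \<D>"
  shows "(LINT z|area. \<phi> z * complex_of_real (\<omega> z)) = (\<integral>z. \<phi> z \<partial>wmeasure)"
  using transfer_integral(2)[OF assms] by (simp add: scaleR_conv_of_real mult.commute)

lemma bounded_in_bergman_2:
  assumes g: "g holomorphic_on unit_disc" and B: "\<And>z. z \<in> unit_disc \<Longrightarrow> cmod (g z) \<le> B"
  shows "g \<in> bergman 2 \<omega>"
proof -
  have "integrable wmeasure (\<lambda>z. cmod (g z) powr 2)"
  proof (rule bounded_integrable_w)
    show "continuous_on unit_disc (\<lambda>z. cmod (g z) powr 2)"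
      by (rule continuous_on_norm_powr[OF holomorphic_on_imp_continuous_on[OF g]]) simp
    show "norm (cmod (g z) powr 2) \<le> B powr 2" if "z \<in> unit_disc" for z
      using powr_mono2[OF _ norm_ge_zero B[OF that], of 2] by (simp only: real_norm_def abs_of_nonneg powr_ge_zero)
  qed
  then show ?thesis using g by (simp add: bergman_iff)
qed

lemma bergman_2_integrable:
  assumes "f \<in> bergman 2 \<omega>"
  shows "integrable wmeasure f"
proof -
  interpret finite_measure wmeasure by (rule finite_measure_w)
  have f: "f holomorphic_on unit_disc" "integrable wmeasure (\<lambda>z. cmod (f z) powr 2)"
    using assms by (auto simp: bergman_iff)
  show ?thesis
  proof (rule Bochner_Integration.integrable_bound)
    show "integrable wmeasure (\<lambda>z. 1 + cmod (f z) powr 2)" using f(2) by (rule Bochner_Integration.integrable_add[OF integrable_const])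
    show "f \<in> borel_measurable wmeasure" using holomorphic_measurable_D[OF f(1)] by simp
    show "AE z in wmeasure. norm (f z) \<le> norm (1 + cmod (f z) powr 2)"
    proof (rule AE_I2)
      fix z
      have "0 \<le> (cmod (f z) - 1)\<^sup>2" by simp
      then have "2 * cmod (f z) \<le> 1 + (cmod (f z))\<^sup>2" by (simp add: power2_diff)
      then have "cmod (f z) \<le> 1 + (cmod (f z))\<^sup>2" using norm_ge_zero[of "f z"] by linarith
      then show "norm (f z) \<le> norm (1 + cmod (f z) powr 2)" by simp
    qed
  qed
qed

lemma cnj_kern_slice_sums:
  assumes "z \<in> unit_disc" "\<zeta> \<in> unit_disc"
  shows "(\<lambda>k. z ^ k / of_real (moment k) * cnj \<zeta> ^ k) sums cnj (kern 0 (cnj z * \<zeta>))"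
proof -
  have "(\<lambda>k. cnj ((1 / of_real (moment (k + 0))) * (cnj z * \<zeta>) ^ k)) sums cnj (kern 0 (cnj z * \<zeta>))"
    unfolding sums_cnj by (rule kern_sums) (use test_arg_bounds(5)[OF assms] in simp)
  then show ?thesis by (simp add: power_mult_distrib)
qed

text \<open>In the pairing of \<open>f\<close> with the kernel series the moments cancel, which
  leaves the Taylor series of \<open>f\<close> at \<open>z\<close>.\<close>

lemma kern_reproduces:
  assumes z: "z \<in> unit_disc"
  shows "reproduces_at \<omega> z (\<lambda>\<zeta>. kern 0 (cnj z * \<zeta>))"
  unfolding reproduces_at_def
proof (intro conjI ballI)
  have K: "(\<lambda>\<zeta>. kern 0 (cnj z * \<zeta>)) holomorphic_on unit_disc" by (rule kern_slice_holomorphic[OF z])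
  show "(\<lambda>\<zeta>. kern 0 (cnj z * \<zeta>)) \<in> bergman 2 \<omega>"
    using kern_bounded[OF z] bounded_in_bergman_2[OF K] by metis
  fix f assume f: "f \<in> bergman 2 \<omega>"
  have fh: "f holomorphic_on unit_disc" using f by (simp add: bergman_iff)
  have s: "summable (\<lambda>k. norm (z ^ k / complex_of_real (moment k)))" using kern_summable[OF z, of 0] by simp
  have p: "(\<lambda>k. z ^ k / of_real (moment k) * (taylor f k * of_real (moment k))) sums
    (\<integral>\<zeta>. (\<Sum>k. z ^ k / of_real (moment k) * cnj \<zeta> ^ k) * f \<zeta> \<partial>wmeasure)"
    using disc_pairing[OF finite_profile_w fh bergman_2_integrable[OF f] s] unfolding profile_moment_w .
  have c: "z ^ k / of_real (moment k) * (taylor f k * of_real (moment k)) = taylor f k * z ^ k" for k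
    using moment_pos[of k] by simp
  have i: "(\<integral>\<zeta>. (\<Sum>k. z ^ k / of_real (moment k) * cnj \<zeta> ^ k) * f \<zeta> \<partial>wmeasure) =
    (\<integral>\<zeta>. f \<zeta> * cnj (kern 0 (cnj z * \<zeta>)) \<partial>wmeasure)"
  proof (intro Bochner_Integration.integral_cong refl)
    fix \<zeta> assume "\<zeta> \<in> space wmeasure"
    then have "\<zeta> \<in> unit_disc" by simp
    from sums_unique[OF cnj_kern_slice_sums[OF z this]]
    show "(\<Sum>k. z ^ k / of_real (moment k) * cnj \<zeta> ^ k) * f \<zeta> = f \<zeta> * cnj (kern 0 (cnj z * \<zeta>))"
      by (simp only: mult.commute)
  qed
  have "f z = (\<integral>\<zeta>. f \<zeta> * cnj (kern 0 (cnj z * \<zeta>)) \<partial>wmeasure)"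
    using taylor_sums[OF fh z] p[unfolded c i] by (rule sums_unique2)
  also have "\<dots> = (LINT \<zeta>|area. f \<zeta> * cnj (kern 0 (cnj z * \<zeta>)) * of_real (\<omega> \<zeta>))"
    by (intro pairing_transfer[symmetric] borel_measurable_times borel_measurable_cnj holomorphic_measurable_D fh K)
  finally show "f z = (LINT \<zeta>|area. f \<zeta> * cnj (kern 0 (cnj z * \<zeta>)) * of_real (\<omega> \<zeta>))" .
qed

text \<open>Monomials belong to the space, and reproducing them fixes every Taylor coefficient of
  \<open>B\<close>.\<close>

lemma reproducing_unique:
  assumes z: "z \<in> unit_disc" and B: "reproduces_at \<omega> z B" and \<zeta>: "\<zeta> \<in> unit_disc"
  shows "B \<zeta> = kern 0 (cnj z * \<zeta>)"
proof -
  have Bb: "B \<in> bergman 2 \<omega>" using B by (simp add: reproduces_at_def)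
  have Bh: "B holomorphic_on unit_disc" using Bb by (simp add: bergman_iff)
  have t: "taylor B k = cnj z ^ k / of_real (moment k)" for k
  proof -
    have pk: "(\<lambda>\<zeta>. \<zeta> ^ k) \<in> bergman 2 \<omega>"
      by (rule bounded_in_bergman_2[of _ 1]) (auto intro!: holomorphic_intros simp: norm_power power_le_one)
    then have "z ^ k = (LINT \<zeta>|area. \<zeta> ^ k * cnj (B \<zeta>) * of_real (\<omega> \<zeta>))"
      using B by (simp add: reproduces_at_def)
    also have "\<dots> = (\<integral>\<zeta>. \<zeta> ^ k * cnj (B \<zeta>) \<partial>wmeasure)"
    proof (rule pairing_transfer)
      have "(\<lambda>\<zeta>::complex. \<zeta> ^ k) \<in> borel_measurable \<D>"
        by (rule holomorphic_measurable_D) (intro holomorphic_intros)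
      then show "(\<lambda>\<zeta>. \<zeta> ^ k * cnj (B \<zeta>)) \<in> borel_measurable \<D>"
        using holomorphic_measurable_D[OF Bh] by measurable
    qed
    also have "\<dots> = cnj (\<integral>\<zeta>. cnj \<zeta> ^ k * B \<zeta> \<partial>wmeasure)" by (subst Bochner_Integration.integral_cnj[symmetric]) simp
    also have "\<dots> = cnj (taylor B k * of_real (moment k))"
      using disc_coefficient[OF finite_profile_w Bh bergman_2_integrable[OF Bb], of k] by (simp add: profile_moment_w)
    finally have "cnj (z ^ k) = cnj (cnj (taylor B k * of_real (moment k)))" by (rule arg_cong)
    then have "cnj z ^ k = taylor B k * of_real (moment k)" by (simp only: complex_cnj_cnj complex_cnj_power)
    then show ?thesis using moment_pos[of k] by simp
  qed
  have "(\<lambda>k. taylor B k * \<zeta> ^ k) sums B \<zeta>" by (rule taylor_sums[OF Bh \<zeta>])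
  moreover have "(\<lambda>k. (1 / of_real (moment (k + 0))) * (cnj z * \<zeta>) ^ k) sums kern 0 (cnj z * \<zeta>)"
    by (rule kern_sums) (use test_arg_bounds(5)[OF z \<zeta>] in simp)
  ultimately show ?thesis by (simp add: t power_mult_distrib sums_iff)
qed

text \<open>Existence gives the choice operator a witness; uniqueness on the disc determines the
  values of whatever it picks.\<close>

lemma bergman_kernel_eq:
  assumes "z \<in> unit_disc" "\<zeta> \<in> unit_disc"
  shows "bergman_kernel \<omega> z \<zeta> = kern 0 (cnj z * \<zeta>)"
proof (rule reproducing_unique[OF assms(1) _ assms(2)])
  show "reproduces_at \<omega> z (bergman_kernel \<omega> z)"
    unfolding bergman_kernel_def using kern_reproduces[OF assms(1)] by (rule someI[where P = "reproduces_at \<omega> z"])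
qed

lemma small_hankel_eq:
  assumes f: "f holomorphic_on unit_disc" and g: "g holomorphic_on unit_disc" and z: "z \<in> unit_disc"
  shows "small_hankel \<omega> f g z = hank f g z"
proof -
  have "small_hankel \<omega> f g z = (LINT \<zeta>|area. cnj (g \<zeta> * kern 0 (cnj z * \<zeta>)) * f \<zeta> * of_real (\<omega> \<zeta>))"
    unfolding small_hankel_def using bergman_kernel_eq[OF z]
    by (intro Bochner_Integration.integral_cong) auto
  also have "\<dots> = hank f g z"
    unfolding hank_def using holomorphic_measurable_D[OF f] holomorphic_measurable_D[OF g] holomorphic_measurable_D[OF kern_slice_holomorphic[OF z]]
    by (intro pairing_transfer) measurable
  finally show ?thesis .
qed

lemma log_bergman_integrable:
  assumes "f \<in> bergman 1 (log_weight \<omega>)"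
  shows "f holomorphic_on unit_disc" "integrable wmeasure f"
proof -
  show f: "f holomorphic_on unit_disc" using assms by (simp add: bergman_def)
  have fm: "f \<in> borel_measurable \<D>" by (rule holomorphic_measurable_D[OF f])
  have "(\<lambda>z::complex. ln (exp 1 / (1 - cmod z))) \<in> borel_measurable \<D>"
    by (rule measurable_restrict_space1) measurable
  then have m: "(\<lambda>z. ln (exp 1 / (1 - cmod z)) * cmod (f z)) \<in> borel_measurable \<D>" using fm by measurable
  have "integrable area (\<lambda>z. \<omega> z *\<^sub>R (ln (exp 1 / (1 - cmod z)) * cmod (f z)))"
    using assms by (simp add: bergman_def Lp_def log_weight_def mult_ac)
  then have i: "integrable wmeasure (\<lambda>z. ln (exp 1 / (1 - cmod z)) * cmod (f z))"
    using transfer_integral(1)[OF m] by blast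
  show "integrable wmeasure f"
  proof (rule Bochner_Integration.integrable_bound[OF i])
    show "f \<in> borel_measurable wmeasure" using fm by simp
    show "AE z in wmeasure. norm (f z) \<le> norm (ln (exp 1 / (1 - cmod z)) * cmod (f z))"
    proof (rule AE_I2)
      fix z assume "z \<in> space wmeasure"
      then have "1 \<le> ln (exp 1 / (1 - cmod z))" by (intro log_factor_ge_1) auto
      then have "1 \<le> \<bar>ln (exp 1 / (1 - cmod z))\<bar>" by linarith
      from mult_right_mono[OF this norm_ge_zero[of "f z"]]
      show "norm (f z) \<le> norm (ln (exp 1 / (1 - cmod z)) * cmod (f z))" by (simp only: real_norm_def abs_mult abs_norm_cancel mult_1_left)
    qed
  qed
qed

end

lemma D_class_profile:
  assumes "\<omega> \<in> D_class"
  obtains w where "radial_profile \<omega> w"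
proof -
  have rw: "radial_weight \<omega>" using assms by (simp add: D_class_def D_hat_def)
  obtain w :: "real \<Rightarrow> real" where w: "w \<in> borel_measurable borel" "\<And>s. 0 \<le> w s" "AE z in area. \<omega> z = w (cmod z)"
    "\<And>r. 0 \<le> r \<Longrightarrow> r < 1 \<Longrightarrow> ennreal (tail \<omega> r) = (\<integral>\<^sup>+s. ennreal (w s) * indicator {r..} s \<partial>\<U>)"
    using radial_weight_borel[OF rw] by blast
  have "radial_profile \<omega> w"
  proof
    show "0 < tail \<omega> r" if "0 \<le> r" "r < 1" for r
      using radial_weightD(4)[OF rw, of "of_real r"] that by simp
    show "\<exists>C\<ge>1. \<forall>r\<in>{0..<1}. tail \<omega> r \<le> C * tail \<omega> ((1 + r) / 2)"
      "\<exists>K>1. \<exists>C>1. \<forall>r\<in>{0..<1}. C * tail \<omega> (1 - (1 - r) / K) \<le> tail \<omega> r"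
      using assms by (simp_all add: D_class_def D_hat_def D_check_def)
  qed (fact w rw)+
  then show ?thesis by (rule that)
qed

section \<open>Boundedness and norm of the small Hankel operator\<close>

locale hankel_weights = O: radial_profile \<omega> wo + N: radial_profile \<nu> wn
  for \<omega> \<nu> :: "complex \<Rightarrow> real" and wo wn :: "real \<Rightarrow> real" +
  fixes p :: real
  assumes p_range: "0 < p" "p \<le> 1"

sublocale hankel_weights \<subseteq> hankel_setting wo "tail \<omega>" wn "tail \<nu>" p
  by unfold_locales (fact p_range)+

context hankel_weights begin

lemma Lp_norm_eq: "g holomorphic_on unit_disc \<Longrightarrow> Lp_norm p \<omega> g = bergman_norm g"
  using O.powr_integral(2)[OF holomorphic_measurable_D] by (simp add: Lp_norm_def bergman_norm_def)

text \<open>Membership in \<open>Lp 1 \<nu>\<close> together with a bound for the real-valued norm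
  is one inequality for the non-negative integral. The sign of \<open>C\<close> matters, because
  \<open>ennreal\<close> sends negative bounds to 0.\<close>

lemma hankel_bound_iff:
  assumes f: "f \<in> bergman 1 (log_weight \<nu>)" and C: "0 \<le> C"
  shows "hankel_bound p \<omega> \<nu> f C \<longleftrightarrow>
    hankel_estimate f C"
  unfolding hankel_bound_def
proof (rule ball_cong[OF refl])
  note fh = N.log_bergman_integrable[OF f]
  fix g assume g: "g \<in> H_infinity"
  note gh = H_infinityD(1)[OF g]
  define h where "h = N.hank f g"
  have hh: "h holomorphic_on unit_disc" unfolding h_def by (rule N.hank_holomorphic(1)[OF fh(2) g])
  have hm: "h \<in> borel_measurable \<D>" by (rule holomorphic_measurable_D[OF hh])
  have eq: "small_hankel \<nu> f g z = h z" if "z \<in> space area" for z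
    unfolding h_def using that by (intro N.small_hankel_eq fh gh) simp
  have m: "small_hankel \<nu> f g \<in> borel_measurable area"
    using borel_measurable_area[OF hm] eq by (subst measurable_cong[of area _ h]) auto
  have i: "integrable area (\<lambda>z. cmod (small_hankel \<nu> f g z) powr 1 * \<nu> z) \<longleftrightarrow> integrable N.wmeasure (\<lambda>z. cmod (h z))"
  proof -
    have "integrable area (\<lambda>z. cmod (small_hankel \<nu> f g z) powr 1 * \<nu> z) \<longleftrightarrow> integrable area (\<lambda>z. cmod (h z) powr 1 * \<nu> z)"
      using eq by (intro Bochner_Integration.integrable_cong) auto
    then show ?thesis using N.powr_integral(1)[OF hm, of 1] by simp
  qed
  have n: "Lp_norm 1 \<nu> (small_hankel \<nu> f g) = (\<integral>z. cmod (h z) \<partial>N.wmeasure)"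
  proof -
    have "(LINT z|area. cmod (small_hankel \<nu> f g z) powr 1 * \<nu> z) = (LINT z|area. cmod (h z) powr 1 * \<nu> z)"
      using eq by (intro Bochner_Integration.integral_cong) auto
    also have "\<dots> = (\<integral>z. cmod (h z) \<partial>N.wmeasure)" using N.powr_integral(2)[OF hm, of 1] by simp
    finally have e: "(LINT z|area. cmod (small_hankel \<nu> f g z) powr 1 * \<nu> z) = (\<integral>z. cmod (h z) \<partial>N.wmeasure)" .
    have "0 \<le> (\<integral>z. cmod (h z) \<partial>N.wmeasure)" by simp
    then show ?thesis unfolding Lp_norm_def e by simp
  qed
  have c: "0 \<le> C * bergman_norm g" using C bergman_norm_nonneg by simp
  have "integrable N.wmeasure (\<lambda>z. cmod (h z)) \<and> (\<integral>z. cmod (h z) \<partial>N.wmeasure) \<le> C * bergman_norm g \<longleftrightarrow>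
    (\<integral>\<^sup>+z. ennreal (cmod (h z)) \<partial>N.wmeasure) \<le> ennreal (C * bergman_norm g)" (is "?L \<longleftrightarrow> ?R")
  proof
    assume ?L
    then show ?R by (subst nn_integral_eq_integral) (auto intro: ennreal_leI)
  next
    assume R: ?R
    have hi: "integrable N.wmeasure (\<lambda>z. cmod (h z))"
      by (rule integrableI_bounded) (use hm le_less_trans[OF R] in simp_all)
    moreover have "(\<integral>\<^sup>+z. ennreal (cmod (h z)) \<partial>N.wmeasure) = ennreal (\<integral>z. cmod (h z) \<partial>N.wmeasure)"
      by (rule nn_integral_eq_integral[OF hi]) simp
    ultimately show ?L using R c by (simp add: ennreal_le_iff)
  qed
  then show "small_hankel \<nu> f g \<in> Lp 1 \<nu> \<and> Lp_norm 1 \<nu> (small_hankel \<nu> f g) \<le> C * Lp_norm p \<omega> g \<longleftrightarrow>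
    (\<integral>\<^sup>+z. ennreal (cmod (N.hank f g z)) \<partial>N.wmeasure) \<le> ennreal (C * bergman_norm g)"
    using m i n Lp_norm_eq[OF gh] by (simp add: Lp_def h_def)
qed

lemma symbol_sup_le_iff:
  assumes "0 \<le> S"
  shows "symbol_sup p \<omega> \<nu> n f \<le> ennreal S \<longleftrightarrow>
    (\<forall>z\<in>unit_disc. cmod ((deriv ^^ n) f z) * symbol_weight n (cmod z) \<le> S)"
  unfolding symbol_sup_def SUP_le_iff ennreal_le_iff[OF assms] symbol_weight_def by (simp only: mult.assoc)

lemma sufficiency:
  obtains n1 where "\<And>n. n \<ge> n1 \<Longrightarrow> \<exists>K>0. \<forall>f\<in>bergman 1 (log_weight \<nu>). \<forall>S\<ge>0.
    symbol_sup p \<omega> \<nu> n f \<le> ennreal S \<longrightarrow> hankel_bound p \<omega> \<nu> f (K * (S + (\<Sum>j<n. cmod ((deriv ^^ j) f 0))))"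
proof -
  obtain n1 where n1: "\<And>n. n \<ge> n1 \<Longrightarrow> \<exists>C>0. \<forall>r\<in>{0..<1}. \<forall>s\<in>{0..r}. symbol_weight n r \<le> C * symbol_weight n s"
    using symbol_weight_almost_decreasing by blast
  show ?thesis
  proof (rule that[of "Suc n1"])
    \<comment> \<open>Order 0 is excluded: the iterated tail has the bound of
      \<open>tail_profile_pow_bound\<close> only after at least one application of the
      transform.\<close>
    fix n assume "Suc n1 \<le> n"
    then obtain m where m: "n = Suc m" "n \<ge> n1" by (cases n) auto
    obtain C where C: "C > 0" "\<And>r s. 0 \<le> s \<Longrightarrow> s \<le> r \<Longrightarrow> r < 1 \<Longrightarrow> symbol_weight (Suc m) r \<le> C * symbol_weight (Suc m) s"
      using n1[OF m(2)] unfolding m(1) by (metis atLeastAtMost_iff atLeastLessThan_iff order_trans)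
    obtain K where K: "K > 0" "\<And>f S g. f holomorphic_on unit_disc \<Longrightarrow> integrable N.wmeasure f \<Longrightarrow>
      (\<And>z. z \<in> unit_disc \<Longrightarrow> cmod ((deriv ^^ Suc m) f z) * symbol_weight (Suc m) (cmod z) \<le> S) \<Longrightarrow> g \<in> H_infinity \<Longrightarrow>
      (\<integral>\<^sup>+z. ennreal (cmod (N.hank f g z)) \<partial>N.wmeasure) \<le> ennreal (K * (S + (\<Sum>j<Suc m. cmod ((deriv ^^ j) f 0))) * bergman_norm g)"
      using hankel_upper_bound[OF C] by blast
    show "\<exists>K>0. \<forall>f\<in>bergman 1 (log_weight \<nu>). \<forall>S\<ge>0.
      symbol_sup p \<omega> \<nu> n f \<le> ennreal S \<longrightarrow> hankel_bound p \<omega> \<nu> f (K * (S + (\<Sum>j<n. cmod ((deriv ^^ j) f 0))))"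
    proof (intro exI[of _ K] conjI ballI allI impI)
      fix f S assume f: "f \<in> bergman 1 (log_weight \<nu>)" and S: "0 \<le> (S::real)" "symbol_sup p \<omega> \<nu> n f \<le> ennreal S"
      have s: "cmod ((deriv ^^ Suc m) f z) * symbol_weight (Suc m) (cmod z) \<le> S" if "z \<in> unit_disc" for z
        using S(2) that unfolding symbol_sup_le_iff[OF S(1)] m(1) by blast
      have "0 \<le> K * (S + (\<Sum>j<n. cmod ((deriv ^^ j) f 0)))"
        using K(1) S(1) by (intro mult_nonneg_nonneg add_nonneg_nonneg sum_nonneg) auto
      then show "hankel_bound p \<omega> \<nu> f (K * (S + (\<Sum>j<n. cmod ((deriv ^^ j) f 0))))"
        using K(2)[OF N.log_bergman_integrable[OF f] s] unfolding m(1) by (subst hankel_bound_iff[OF f]) auto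
    qed (fact K)
  qed
qed

lemma necessity:
  obtains n0 where "\<And>n. n \<ge> n0 \<Longrightarrow> \<exists>K>0. \<forall>f\<in>bergman 1 (log_weight \<nu>). \<forall>A\<ge>0.
    hankel_bound p \<omega> \<nu> f A \<longrightarrow> symbol_sup p \<omega> \<nu> n f + ennreal (\<Sum>j<n. cmod ((deriv ^^ j) f 0)) \<le> ennreal (K * A)"
proof -
  obtain n0 where n0: "\<And>n. n \<ge> n0 \<Longrightarrow> \<exists>C>0. \<forall>f A z. f holomorphic_on unit_disc \<longrightarrow> integrable N.wmeasure f \<longrightarrow> 0 \<le> A \<longrightarrow>
    hankel_estimate f A \<longrightarrow> z \<in> unit_disc \<longrightarrow>
    cmod ((deriv ^^ n) f z) * symbol_weight n (cmod z) \<le> C * A"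
    using symbol_lower_bound by blast
  obtain D where D: "\<And>j. 0 < D j" "\<And>j f A. f holomorphic_on unit_disc \<Longrightarrow> integrable N.wmeasure f \<Longrightarrow> 0 \<le> A \<Longrightarrow>
    hankel_estimate f A \<Longrightarrow>
    cmod ((deriv ^^ j) f 0) \<le> D j * A"
    using derivative_at_0_bound by metis
  show ?thesis
  proof (rule that[of n0])
    fix n assume "n \<ge> n0"
    then obtain C where C: "C > 0" "\<And>f A z. f holomorphic_on unit_disc \<Longrightarrow> integrable N.wmeasure f \<Longrightarrow> 0 \<le> A \<Longrightarrow>
      hankel_estimate f A \<Longrightarrow> z \<in> unit_disc \<Longrightarrow>
      cmod ((deriv ^^ n) f z) * symbol_weight n (cmod z) \<le> C * A"
      using n0 by blast
    show "\<exists>K>0. \<forall>f\<in>bergman 1 (log_weight \<nu>). \<forall>A\<ge>0.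
      hankel_bound p \<omega> \<nu> f A \<longrightarrow> symbol_sup p \<omega> \<nu> n f + ennreal (\<Sum>j<n. cmod ((deriv ^^ j) f 0)) \<le> ennreal (K * A)"
    proof (intro exI[of _ "C + (\<Sum>j<n. D j)"] conjI ballI allI impI)
      show "0 < C + (\<Sum>j<n. D j)" using C(1) D(1) by (intro add_pos_nonneg sum_nonneg) (auto intro: less_imp_le)
      fix f A assume f: "f \<in> bergman 1 (log_weight \<nu>)" and A: "0 \<le> (A::real)" "hankel_bound p \<omega> \<nu> f A"
      note fh = N.log_bergman_integrable[OF f]
      note b = A(2)[unfolded hankel_bound_iff[OF f A(1)]]
      have "symbol_sup p \<omega> \<nu> n f \<le> ennreal (C * A)"
        using C A(1) fh b by (subst symbol_sup_le_iff) auto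
      moreover have "(\<Sum>j<n. cmod ((deriv ^^ j) f 0)) \<le> (\<Sum>j<n. D j) * A"
        unfolding sum_distrib_right by (intro sum_mono D(2) fh A(1) b)
      ultimately have "symbol_sup p \<omega> \<nu> n f + ennreal (\<Sum>j<n. cmod ((deriv ^^ j) f 0)) \<le> ennreal (C * A) + ennreal ((\<Sum>j<n. D j) * A)"
        by (intro add_mono ennreal_leI)
      also have "\<dots> = ennreal ((C + (\<Sum>j<n. D j)) * A)"
      proof -
        have "0 \<le> C * A" "0 \<le> (\<Sum>j<n. D j) * A"
          using C(1) A(1) D(1) by (auto intro!: mult_nonneg_nonneg sum_nonneg intro: less_imp_le)
        then show ?thesis by (simp add: distrib_right)
      qed
      finally show "symbol_sup p \<omega> \<nu> n f + ennreal (\<Sum>j<n. cmod ((deriv ^^ j) f 0)) \<le> ennreal ((C + (\<Sum>j<n. D j)) * A)" .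
    qed
  qed
qed

end

theorem theorem5:
  fixes p :: real and \<omega> \<nu> :: "complex \<Rightarrow> real"
  assumes "0 < p" and "p \<le> 1"
    and "\<omega> \<in> D_class" and "\<nu> \<in> D_class"
  shows "\<exists>N::nat.
    (\<forall>f\<in>bergman 1 (log_weight \<nu>).
       (hankel_bounded p \<omega> \<nu> f \<longleftrightarrow> (\<exists>n\<ge>N. symbol_sup p \<omega> \<nu> n f < \<infinity>)) \<and>
       (hankel_bounded p \<omega> \<nu> f \<longleftrightarrow> (\<forall>n\<ge>N. symbol_sup p \<omega> \<nu> n f < \<infinity>))) \<and>
    (\<forall>n\<ge>N. comparable_on (bergman 1 (log_weight \<nu>))
       (hankel_norm p \<omega> \<nu>)
       (\<lambda>f. symbol_sup p \<omega> \<nu> n f + ennreal (\<Sum>j<n. cmod ((deriv ^^ j) f 0))))"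
proof -
  obtain wo where wo: "radial_profile \<omega> wo" using D_class_profile[OF assms(3)] by blast
  obtain wn where wn: "radial_profile \<nu> wn" using D_class_profile[OF assms(4)] by blast
  interpret hankel_weights \<omega> \<nu> wo wn p
    using wo wn assms(1,2) by (intro hankel_weights.intro hankel_weights_axioms.intro)
  define F where "F = bergman 1 (log_weight \<nu>)"
  define \<Sigma> where "\<Sigma> n f = (\<Sum>j<n. cmod ((deriv ^^ j) f 0))" for n f
  have \<Sigma>: "0 \<le> \<Sigma> n f" for n f by (simp add: \<Sigma>_def sum_nonneg)
  obtain n1 where n1: "\<And>n. n \<ge> n1 \<Longrightarrow> \<exists>K>0. \<forall>f\<in>F. \<forall>S\<ge>0.
    symbol_sup p \<omega> \<nu> n f \<le> ennreal S \<longrightarrow> hankel_bound p \<omega> \<nu> f (K * (S + \<Sigma> n f))"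
    using sufficiency unfolding F_def \<Sigma>_def by blast
  obtain n0 where n0: "\<And>n. n \<ge> n0 \<Longrightarrow> \<exists>K>0. \<forall>f\<in>F. \<forall>A\<ge>0.
    hankel_bound p \<omega> \<nu> f A \<longrightarrow> symbol_sup p \<omega> \<nu> n f + ennreal (\<Sigma> n f) \<le> ennreal (K * A)"
    using necessity unfolding F_def \<Sigma>_def by blast
  define N where "N = max n0 n1"
  have bounded: "hankel_bounded p \<omega> \<nu> f \<longleftrightarrow> symbol_sup p \<omega> \<nu> n f < \<infinity>" if n: "n \<ge> N" and f: "f \<in> F" for n f
  proof
    obtain K where K: "K > 0" "\<And>f A. f \<in> F \<Longrightarrow> 0 \<le> A \<Longrightarrow>
      hankel_bound p \<omega> \<nu> f A \<Longrightarrow> symbol_sup p \<omega> \<nu> n f + ennreal (\<Sigma> n f) \<le> ennreal (K * A)"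
      using n0[of n] n unfolding N_def by auto
    assume "hankel_bounded p \<omega> \<nu> f"
    then obtain C where "C > 0" "hankel_bound p \<omega> \<nu> f C" by (auto simp: hankel_bounded_def)
    then have "symbol_sup p \<omega> \<nu> n f + ennreal (\<Sigma> n f) \<le> ennreal (K * C)" by (intro K(2) f) auto
    then have "symbol_sup p \<omega> \<nu> n f \<le> ennreal (K * C)" by (rule order_trans[rotated]) simp
    then show "symbol_sup p \<omega> \<nu> n f < \<infinity>" by (rule le_less_trans) simp
  next
    obtain K where K: "K > 0" "\<And>f S. f \<in> F \<Longrightarrow> 0 \<le> S \<Longrightarrow>
      symbol_sup p \<omega> \<nu> n f \<le> ennreal S \<Longrightarrow> hankel_bound p \<omega> \<nu> f (K * (S + \<Sigma> n f))"
      using n1[of n] n unfolding N_def by auto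
    assume "symbol_sup p \<omega> \<nu> n f < \<infinity>"
    then obtain S where S: "0 \<le> S" "symbol_sup p \<omega> \<nu> n f = ennreal S" by (auto simp: less_top_ennreal)
    \<comment> \<open>\<open>S\<close> and the sum of derivatives may both be 0; the added 1 yields
      the strictly positive constant that \<open>hankel_bounded\<close> demands.\<close>
    then have "hankel_bound p \<omega> \<nu> f (K * (S + 1 + \<Sigma> n f))" by (intro K(2) f) (auto intro: ennreal_leI)
    moreover have "0 < K * (S + 1 + \<Sigma> n f)" using K(1) S(1) \<Sigma>[of n f] by (intro mult_pos_pos) auto
    ultimately show "hankel_bounded p \<omega> \<nu> f" unfolding hankel_bounded_def by blast
  qed
  have comparable: "comparable_on F (hankel_norm p \<omega> \<nu>) (\<lambda>f. symbol_sup p \<omega> \<nu> n f + ennreal (\<Sigma> n f))"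
    if n: "n \<ge> N" for n
  proof -
    obtain K1 where K1: "K1 > 0" "\<And>f S. f \<in> F \<Longrightarrow> 0 \<le> S \<Longrightarrow>
      symbol_sup p \<omega> \<nu> n f \<le> ennreal S \<Longrightarrow> hankel_bound p \<omega> \<nu> f (K1 * (S + \<Sigma> n f))"
      using n1[of n] n unfolding N_def by auto
    obtain K2 where K2: "K2 > 0" "\<And>f A. f \<in> F \<Longrightarrow> 0 \<le> A \<Longrightarrow>
      hankel_bound p \<omega> \<nu> f A \<Longrightarrow> symbol_sup p \<omega> \<nu> n f + ennreal (\<Sigma> n f) \<le> ennreal (K2 * A)"
      using n0[of n] n unfolding N_def by auto
    define C where "C = max K1 K2"
    have C: "0 < C" "K1 \<le> C" "K2 \<le> C" using K1(1) by (auto simp: C_def)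
    show ?thesis unfolding comparable_on_def
    proof (intro exI[of _ C] conjI ballI)
      show "0 < C" by (fact C)
      fix f assume f: "f \<in> F"
      define b where "b = symbol_sup p \<omega> \<nu> n f + ennreal (\<Sigma> n f)"
      have "ennreal (1 / K2) * b \<le> hankel_norm p \<omega> \<nu> f"
        unfolding hankel_norm_def
      proof (rule Inf_greatest)
        \<comment> \<open>Unbounded operators need no separate case: for them the set is empty and
          its infimum is infinite.\<close>
        fix x assume "x \<in> {ennreal C |C. 0 < C \<and> hankel_bound p \<omega> \<nu> f C}"
        then obtain A where A: "x = ennreal A" "0 < A" "hankel_bound p \<omega> \<nu> f A" by blast
        have "ennreal (1 / K2) * b \<le> ennreal (1 / K2) * ennreal (K2 * A)"
          unfolding b_def using A by (intro mult_left_mono K2(2) f) auto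
        also have "\<dots> = x" using A K2(1) by (simp add: ennreal_mult[symmetric])
        finally show "ennreal (1 / K2) * b \<le> x" .
      qed
      then have "ennreal K2 * (ennreal (1 / K2) * b) \<le> ennreal K2 * hankel_norm p \<omega> \<nu> f" by (intro mult_left_mono) auto
      also have "ennreal K2 * (ennreal (1 / K2) * b) = b"
        using K2(1) by (simp add: mult.assoc[symmetric] ennreal_mult[symmetric])
      also have "ennreal K2 * hankel_norm p \<omega> \<nu> f \<le> ennreal C * hankel_norm p \<omega> \<nu> f"
        using C by (intro mult_right_mono ennreal_leI) auto
      finally show "symbol_sup p \<omega> \<nu> n f + ennreal (\<Sigma> n f) \<le> ennreal C * hankel_norm p \<omega> \<nu> f" unfolding b_def .
      have up: "hankel_norm p \<omega> \<nu> f \<le> ennreal K1 * b"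
      proof (cases "symbol_sup p \<omega> \<nu> n f = \<infinity>")
        case True
        then show ?thesis using K1(1) by (simp add: b_def ennreal_mult_top)
      next
        case False
        then obtain S where S: "0 \<le> S" "symbol_sup p \<omega> \<nu> n f = ennreal S"
          by (cases "symbol_sup p \<omega> \<nu> n f") auto
        have "hankel_norm p \<omega> \<nu> f \<le> ennreal (K1 * (S + \<Sigma> n f))"
        proof (rule ennreal_le_epsilon)
          \<comment> \<open>The infimum ranges over positive constants, whereas
            \<open>K1 * (S + \<Sigma> n f)\<close> may be 0; room of size \<open>e\<close> keeps the
            constant positive.\<close>
          fix e :: real assume e: "0 < e"
          have "hankel_bound p \<omega> \<nu> f (K1 * (S + e / K1 + \<Sigma> n f))"
            using S e K1(1) by (intro K1(2) f) (auto intro!: ennreal_leI)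
          moreover have "0 < K1 * (S + e / K1 + \<Sigma> n f)"
            using S e K1(1) \<Sigma>[of n f] by (intro mult_pos_pos add_pos_nonneg add_nonneg_pos) auto
          ultimately have "hankel_norm p \<omega> \<nu> f \<le> ennreal (K1 * (S + e / K1 + \<Sigma> n f))"
            unfolding hankel_norm_def by (intro Inf_lower) blast
          also have "K1 * (S + e / K1 + \<Sigma> n f) = K1 * (S + \<Sigma> n f) + e" using K1(1) by (simp add: field_simps)
          also have "ennreal (K1 * (S + \<Sigma> n f) + e) = ennreal (K1 * (S + \<Sigma> n f)) + ennreal e"
            using K1(1) S(1) \<Sigma>[of n f] e by (intro ennreal_plus) auto
          finally show "hankel_norm p \<omega> \<nu> f \<le> ennreal (K1 * (S + \<Sigma> n f)) + ennreal e" .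
        qed
        also have "\<dots> = ennreal K1 * b"
          using K1(1) S \<Sigma>[of n f] by (simp add: b_def ennreal_mult ennreal_plus)
        finally show ?thesis .
      qed
      then have "ennreal (1 / C) * hankel_norm p \<omega> \<nu> f \<le> ennreal (1 / C) * (ennreal K1 * b)" by (intro mult_left_mono) auto
      also have "\<dots> = ennreal (K1 / C) * b"
        using C(1) K1(1) by (simp add: mult.assoc[symmetric] ennreal_mult[symmetric])
      also have "\<dots> \<le> ennreal 1 * b" using C by (intro mult_right_mono ennreal_leI) auto
      finally show "ennreal (1 / C) * hankel_norm p \<omega> \<nu> f \<le> symbol_sup p \<omega> \<nu> n f + ennreal (\<Sigma> n f)"
        by (simp add: b_def)
    qed
  qed
  show ?thesis
  proof (intro exI[of _ N] conjI ballI allI impI)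
    fix f assume f: "f \<in> bergman 1 (log_weight \<nu>)"
    then have b: "hankel_bounded p \<omega> \<nu> f \<longleftrightarrow> symbol_sup p \<omega> \<nu> n f < \<infinity>" if "n \<ge> N" for n
      using bounded[OF that] by (simp add: F_def)
    show "hankel_bounded p \<omega> \<nu> f \<longleftrightarrow> (\<exists>n\<ge>N. symbol_sup p \<omega> \<nu> n f < \<infinity>)"
      "hankel_bounded p \<omega> \<nu> f \<longleftrightarrow> (\<forall>n\<ge>N. symbol_sup p \<omega> \<nu> n f < \<infinity>)"
      using b by blast+
  next
    fix n assume "n \<ge> N"
    then show "comparable_on (bergman 1 (log_weight \<nu>)) (hankel_norm p \<omega> \<nu>)
      (\<lambda>f. symbol_sup p \<omega> \<nu> n f + ennreal (\<Sum>j<n. cmod ((deriv ^^ j) f 0)))"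
      using comparable unfolding F_def \<Sigma>_def by blast
  qed
qed

end
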